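(* For an irreducible complex representation $V_\gamma$ of $Spin(7)$, consider the twisted Dirac operator $(D^0_{A_\Sigma})_\gamma$ on $\mathrm{Hom}(V_\gamma,\Delta\otimes\mathfrak{spin}(7)_{\mathbb C})^{G_2}$ associated with $S^7=Spin(7)/G_2$. Its eigenvalues are: 1. $\frac12$, for $V_\gamma=V_{(0,0,0)}$; 2. $\frac16(-3+2\sqrt{105}),\ \frac16(-3-2\sqrt{105}),\ -\frac32$, for $V_\gamma=V_{(1,0,0)}$; 3. $\frac16(-3-8\sqrt6),\ \frac16(-3+8\sqrt6),\ -\frac52,\ \frac32$, for $V_\gamma=V_{(0,0,1)}$; 4. $\frac12(-1-2\sqrt{17}),\ \frac16(-3-2\sqrt{105}),\ \frac12(-1+2\sqrt{17}),\ -\frac72,\ \frac16(-3+2\sqrt{105})$, for $V_\gamma=V_{(0,1,0)}$; 5. $-\frac{25}{6},\ \frac{23}{6}$, for $V_\gamma=V_{(2,0,0)}$; 6. $\frac12(-1-4\sqrt5),\ \frac16(-3-4\sqrt{33}),\ \frac16(1+4\sqrt{37}),\ \frac12(-1+4\sqrt5),\ \frac16(1-4\sqrt{37}),\ \frac16(-3+4\sqrt{33}),\ -\frac{19}{6}$, for $V_\gamma=V_{(1,0,1)}$.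
   Context: $V_{(a,b,c)}$ is the irreducible complex representation of $Spin(7)$ with highest weight (Dynkin labels) $(a,b,c)$: $V_{(1,0,0)}$ is the 7-dimensional vector representation, $V_{(0,1,0)}=\mathfrak{spin}(7)_{\mathbb C}$, $V_{(0,0,1)}$ the 8-dimensional spin representation. Write $\mathfrak{spin}(7)=\mathfrak g_2\oplus\mathfrak m$, orthogonal for the Killing form $K$; use the inner product $-\frac3{40}K$ and let $\{I_a\}_{a=1}^7$ be an orthonormal basis of $\mathfrak m$. The $G_2$-invariant 3-form $\phi$ on $\mathfrak m$ is normalised by $[Y,Z]_{\mathfrak m}=-\frac23\phi(Y,Z,\cdot)$ (using the metric), i.e. $\phi(Y,Z,W)=-\frac32\langle[Y,Z]_{\mathfrak m},W\rangle$; it defines the nearly $G_2$-structure on $S^7=Spin(7)/G_2$ with $d\phi=4*\phi$. The complex spinor space is $\Delta=\mathbb{C}\oplus\mathfrak m^*_{\mathbb C}$ with Clifford multiplication by $u\in\mathfrak m\cong\mathfrak m^*$ $$u\cdot(f,v)=(\langle u,v\rangle,\,-fu-\phi(u,v,\cdot)),$$ under which $\phi$ acts as $7$ on $\mathbb{C}$ and as $-1$ on $\mathfrak m^*_{\mathbb C}$. $G_2$ acts on $\mathfrak{spin}(7)_{\mathbb C}$ by the restricted adjoint representation. For $t\in\mathbb{R}$ the operator $(D^t_{A_\Sigma})_\gamma$ on $\mathrm{Hom}(V_\gamma,\Delta\otimes\mathfrak{spin}(7)_{\mathbb C})^{G_2}$ is $$(D^t_{A_\Sigma})_\gamma\,\eta=-\sum_{a=1}^7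 I_a\cdot(\eta\circ\rho_{V_\gamma}(I_a))+\frac{t-1}{2}\,\phi\cdot\eta,$$ Clifford multiplication acting on the $\Delta$ factor. For $t=0$ this is the restriction of the Levi-Civita Dirac operator on $S^7$ twisted by the canonical connection $A_\Sigma$ (the $\mathfrak g_2$-part of the Maurer–Cartan form) on the bundle associated with $\mathfrak{spin}(7)_{\mathbb C}$, to the summand $\mathrm{Hom}(V_\gamma,\Delta\otimes\mathfrak{spin}(7)_{\mathbb C})^{G_2}\otimes V_\gamma$ in the Frobenius decomposition of $L^2(Spin(7),\Delta\otimes\mathfrak{spin}(7)_{\mathbb C})^{G_2}$. *)

theory Defs
  imports "HOL-Analysis.Analysis"
begin

section \<open>Matrix groups and their Lie algebras\<close>

text \<open>On the library's matrix type, \<open>*\<close> is the entrywise product, so powers and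
  exponentials have to be built from \<open>**\<close>.\<close>

definition matrix_exp :: "real^'n^'n \<Rightarrow> real^'n^'n" where
  "matrix_exp A = (\<Sum>k. (1 / fact k) *\<^sub>R ((\<lambda>B. A ** B) ^^ k) (mat 1))"

definition lie_algebra :: "(real^'n^'n) set \<Rightarrow> (real^'n^'n) set" where
  "lie_algebra G = {X. \<forall>t. matrix_exp (t *\<^sub>R X) \<in> G}"

definition bracket :: "'a::ring_1^'n^'n \<Rightarrow> 'a^'n^'n \<Rightarrow> 'a^'n^'n" where
  "bracket X Y = X ** Y - Y ** X"

definition Ad :: "'a::field^'n^'n \<Rightarrow> 'a^'n^'n \<Rightarrow> 'a^'n^'n" where
  "Ad g X = g ** X ** matrix_inv g"

definition mscale :: "'a::ring_1 \<Rightarrow> 'a^'n^'m \<Rightarrow> 'a^'n^'m" where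
  "mscale c A = map_matrix (\<lambda>z. c * z) A"

text \<open>The trace of an endomorphism of a subspace; it does not depend on the chosen basis.\<close>

definition trace_on :: "'v::real_vector set \<Rightarrow> ('v \<Rightarrow> 'v) \<Rightarrow> real" where
  "trace_on W f =
     (let B = (SOME B. independent B \<and> span B = W) in \<Sum>b\<in>B. representation B (f b) b)"


section \<open>The groups Spin(7) and G2\<close>

text \<open>
  \<open>7\<close> is the type of integers modulo 7. The structure constants of the octonions are
  \<open>e\<^sub>i e\<^bsub>i+1\<^esub> = e\<^bsub>i+3\<^esub>\<close> (indices modulo 7) together with all consequences
  under permutations of the three indices.

  \<open>\<gamma> u\<close> is the matrix of \<open>(f, v) \<mapsto> (\<langle>u, v\<rangle>, - f u - u \<times> v)\<close> on
  \<open>\<real> \<oplus> \<real>\<^sup>7\<close>, where \<open>\<times>\<close> is the octonionic cross product; the index \<open>None\<close> is the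
  summand \<open>\<real>\<close>. It satisfies the Clifford relation \<open>(\<gamma> u)\<^sup>2 = - \<bar>u\<bar>\<^sup>2\<close>. The induced map
  from the even Clifford algebra of \<open>\<real>\<^sup>7\<close> to the 8 by 8 matrices is an isomorphism, so
  Spin(7), the group of products of an even number of unit vectors in the Clifford
  algebra, is faithfully realised by these matrices.
\<close>

definition octonion_sign :: "7 \<Rightarrow> 7 \<Rightarrow> 7 \<Rightarrow> real" where
  "octonion_sign a b c =
     (if \<exists>i. (a, b, c) \<in> {(i, i+1, i+3), (i+1, i+3, i), (i+3, i, i+1)} then 1
      else if \<exists>i. (a, b, c) \<in> {(i+1, i, i+3), (i, i+3, i+1), (i+3, i+1, i)} then -1
      else 0)"

type_synonym real_mat8 = "real^(7 option)^(7 option)"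
type_synonym complex_mat8 = "complex^(7 option)^(7 option)"

definition gamma :: "real^7 \<Rightarrow> real_mat8" where
  "gamma u = (\<chi> i j.
     (case i of
        None \<Rightarrow> (case j of None \<Rightarrow> 0 | Some b \<Rightarrow> u $ b)
      | Some c \<Rightarrow> (case j of None \<Rightarrow> - (u $ c)
                          | Some b \<Rightarrow> - (\<Sum>a\<in>UNIV. octonion_sign a b c * u $ a))))"

inductive_set Spin7 :: "real_mat8 set" where
  one: "mat 1 \<in> Spin7"
| step: "g \<in> Spin7 \<Longrightarrow> norm u = 1 \<Longrightarrow> norm v = 1 \<Longrightarrow> gamma u ** gamma v ** g \<in> Spin7"

text \<open>Spin(7) acts transitively on the unit sphere of \<open>\<real> \<oplus> \<real>\<^sup>7\<close>; G2 is the
  stabiliser of the unit vector of the first summand.\<close>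

definition G2 :: "real_mat8 set" where
  "G2 = {g \<in> Spin7. g *v axis None 1 = axis None 1}"

definition spin7 :: "real_mat8 set" where
  "spin7 = lie_algebra Spin7"

definition g2 :: "real_mat8 set" where
  "g2 = lie_algebra G2"

definition spin7_complex :: "complex_mat8 set" where
  "spin7_complex = {A. map_matrix Re A \<in> spin7 \<and> map_matrix Im A \<in> spin7}"


section \<open>The reductive complement and the 3-form\<close>

definition killing :: "real_mat8 \<Rightarrow> real_mat8 \<Rightarrow> real" where
  "killing X Y = trace_on spin7 (\<lambda>Z. bracket X (bracket Y Z))"

definition spin7_inner :: "real_mat8 \<Rightarrow> real_mat8 \<Rightarrow> real" where
  "spin7_inner X Y = - (3 / 40) * killing X Y"

definition m7 :: "real_mat8 set" where
  "m7 = {X \<in> spin7. \<forall>Y\<in>g2. killing X Y = 0}"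

definition proj_m :: "real_mat8 \<Rightarrow> real_mat8" where
  "proj_m X = (THE Y. Y \<in> m7 \<and> X - Y \<in> g2)"

definition phi :: "real_mat8 \<Rightarrow> real_mat8 \<Rightarrow> real_mat8 \<Rightarrow> real" where
  "phi Y Z W = - (3 / 2) * spin7_inner (proj_m (bracket Y Z)) W"

definition orthonormal_basis_m :: "(7 \<Rightarrow> real_mat8) \<Rightarrow> bool" where
  "orthonormal_basis_m I \<longleftrightarrow>
     range I \<subseteq> m7 \<and> span (range I) = m7 \<and>
     (\<forall>a b. spin7_inner (I a) (I b) = (if a = b then 1 else 0))"


section \<open>Spinors\<close>

text \<open>
  The spinor space \<open>\<complex> \<oplus> \<mm>\<^sup>*\<^sub>\<complex>\<close> in coordinates: \<open>(f, v)\<close> has as second component the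
  element of \<open>\<mm>\<^sup>*\<^sub>\<complex>\<close> with value \<open>v $ a\<close> on the basis vector \<open>I a\<close>, which corresponds
  under the metric to \<open>\<Sum>a. v $ a * I a\<close>.
\<close>

type_synonym spinor = "complex \<times> (complex^7)"

definition clifford :: "(7 \<Rightarrow> real_mat8) \<Rightarrow> real_mat8 \<Rightarrow> spinor \<Rightarrow> spinor" where
  "clifford I u \<psi> = (case \<psi> of (f, v) \<Rightarrow>
     (\<Sum>a\<in>UNIV. of_real (spin7_inner u (I a)) * v $ a,
      \<chi> c. - f * of_real (spin7_inner u (I c))
          - (\<Sum>a\<in>UNIV. of_real (phi u (I a) (I c)) * v $ a)))"

text \<open>The 3-form acts as the sum over \<open>a < b < c\<close> of its components times
  \<open>I\<^sub>a \<cdot> I\<^sub>b \<cdot> I\<^sub>c\<close>; summing over all triples counts each term six times.\<close>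

definition clifford_phi :: "(7 \<Rightarrow> real_mat8) \<Rightarrow> spinor \<Rightarrow> spinor" where
  "clifford_phi I \<psi> = (1 / 6) *\<^sub>R
     (\<Sum>a\<in>UNIV. \<Sum>b\<in>UNIV. \<Sum>c\<in>UNIV.
        phi (I a) (I b) (I c) *\<^sub>R clifford I (I a) (clifford I (I b) (clifford I (I c) \<psi>)))"

definition spinor_act :: "(7 \<Rightarrow> real_mat8) \<Rightarrow> real_mat8 \<Rightarrow> spinor \<Rightarrow> spinor" where
  "spinor_act I g \<psi> = (case \<psi> of (f, v) \<Rightarrow>
     (f, \<chi> c. \<Sum>a\<in>UNIV. of_real (spin7_inner (Ad g (I a)) (I c)) * v $ a))"

text \<open>
  Spinors with values in a space of matrices: the tensor product of \<open>\<complex> \<oplus> \<complex>\<^sup>7\<close> with that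
  space is a direct sum of 1 + 7 copies of it. \<open>tensor_map F G\<close> is \<open>F \<otimes> G\<close> for
  complex linear \<open>F\<close> and \<open>G\<close>, written out on the standard basis of \<open>\<complex> \<oplus> \<complex>\<^sup>7\<close>.
\<close>

type_synonym twisted = "complex_mat8 \<times> (complex_mat8^7)"

definition tensor :: "spinor \<Rightarrow> complex_mat8 \<Rightarrow> twisted" where
  "tensor \<psi> s = (case \<psi> of (f, v) \<Rightarrow> (mscale f s, \<chi> a. mscale (v $ a) s))"

definition tensor_map ::
  "(spinor \<Rightarrow> spinor) \<Rightarrow> (complex_mat8 \<Rightarrow> complex_mat8) \<Rightarrow> twisted \<Rightarrow> twisted" where
  "tensor_map F G w = (case w of (s0, s) \<Rightarrow>
     tensor (F (1, 0)) (G s0) + (\<Sum>a\<in>UNIV. tensor (F (0, axis a 1)) (G (s $ a))))"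

definition tscale :: "complex \<Rightarrow> twisted \<Rightarrow> twisted" where
  "tscale c w = (case w of (s0, s) \<Rightarrow> (mscale c s0, \<chi> a. mscale c (s $ a)))"

definition twisted_spinors :: "twisted set" where
  "twisted_spinors = {(s0, s). s0 \<in> spin7_complex \<and> (\<forall>a. s $ a \<in> spin7_complex)}"

definition twisted_act :: "(7 \<Rightarrow> real_mat8) \<Rightarrow> real_mat8 \<Rightarrow> twisted \<Rightarrow> twisted" where
  "twisted_act I g = tensor_map (spinor_act I g) (Ad (map_matrix of_real g))"


section \<open>Complex representations of Spin(7)\<close>

definition spin7_rep :: "(real_mat8 \<Rightarrow> complex^'n^'n) \<Rightarrow> bool" where
  "spin7_rep \<rho> \<longleftrightarrow>
     continuous_on Spin7 \<rho> \<and> \<rho> (mat 1) = mat 1 \<and>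
     (\<forall>g\<in>Spin7. \<forall>h\<in>Spin7. \<rho> (g ** h) = \<rho> g ** \<rho> h)"

text \<open>The representation space \<open>complex^'n\<close> is never zero, as index types are nonempty.\<close>

definition irreducible_spin7_rep :: "(real_mat8 \<Rightarrow> complex^'n^'n) \<Rightarrow> bool" where
  "irreducible_spin7_rep \<rho> \<longleftrightarrow>
     spin7_rep \<rho> \<and>
     (\<forall>W. vec.subspace W \<and> (\<forall>g\<in>Spin7. \<forall>w\<in>W. \<rho> g *v w \<in> W) \<longrightarrow> W = {0} \<or> W = UNIV)"

definition drep :: "(real_mat8 \<Rightarrow> complex^'n^'n) \<Rightarrow> real_mat8 \<Rightarrow> complex^'n^'n" where
  "drep \<rho> X = vector_derivative (\<lambda>t. \<rho> (matrix_exp (t *\<^sub>R X))) (at 0)"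

definition drep_complex :: "(real_mat8 \<Rightarrow> complex^'n^'n) \<Rightarrow> complex_mat8 \<Rightarrow> complex^'n^'n" where
  "drep_complex \<rho> E = drep \<rho> (map_matrix Re E) + mscale \<i> (drep \<rho> (map_matrix Im E))"

text \<open>
  The Cartan subalgebra is spanned by the generators \<open>cartan k\<close> of the rotations of
  \<open>\<real>\<^sup>7\<close> in the planes \<open>(1,2)\<close>, \<open>(3,4)\<close>, \<open>(5,6)\<close>; the factor 1/2 comes from the double
  cover of SO(7). A weight is given by the vector \<open>w\<close> such that \<open>cartan k\<close> acts as
  \<open>\<i> * w $ k\<close>, so the roots are \<open>\<plusminus> \<epsilon>\<^sub>i \<plusminus> \<epsilon>\<^sub>j\<close> and \<open>\<plusminus> \<epsilon>\<^sub>i\<close>.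
\<close>

definition cartan :: "3 \<Rightarrow> real_mat8" where
  "cartan k = (1 / 2) *\<^sub>R
     (if k = 1 then gamma (axis 1 1) ** gamma (axis 2 1)
      else if k = 2 then gamma (axis 3 1) ** gamma (axis 4 1)
      else gamma (axis 5 1) ** gamma (axis 6 1))"

definition simple_root :: "3 \<Rightarrow> real^3" where
  "simple_root k =
     (if k = 1 then vector [1, -1, 0] else if k = 2 then vector [0, 1, -1] else vector [0, 0, 1])"

definition positive_roots :: "(real^3) set" where
  "positive_roots =
     {vector [1, -1, 0], vector [1, 0, -1], vector [0, 1, -1],
      vector [1, 1, 0], vector [1, 0, 1], vector [0, 1, 1],
      vector [1, 0, 0], vector [0, 1, 0], vector [0, 0, 1]}"

definition root_space :: "real^3 \<Rightarrow> complex_mat8 set" where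
  "root_space \<alpha> =
     {E \<in> spin7_complex. \<forall>k. bracket (map_matrix of_real (cartan k)) E = mscale (\<i> * of_real (\<alpha> $ k)) E}"

definition dynkin_label :: "real^3 \<Rightarrow> 3 \<Rightarrow> real" where
  "dynkin_label w k = 2 * (w \<bullet> simple_root k) / (simple_root k \<bullet> simple_root k)"

definition highest_weight_vector :: "(real_mat8 \<Rightarrow> complex^'n^'n) \<Rightarrow> real^3 \<Rightarrow> complex^'n \<Rightarrow> bool" where
  "highest_weight_vector \<rho> w x \<longleftrightarrow>
     x \<noteq> 0 \<and>
     (\<forall>k. drep \<rho> (cartan k) *v x = (\<i> * of_real (w $ k)) *s x) \<and>
     (\<forall>\<alpha>\<in>positive_roots. \<forall>E\<in>root_space \<alpha>. drep_complex \<rho> E *v x = 0)"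

definition has_highest_weight :: "(real_mat8 \<Rightarrow> complex^'n^'n) \<Rightarrow> nat \<times> nat \<times> nat \<Rightarrow> bool" where
  "has_highest_weight \<rho> l \<longleftrightarrow> (case l of (a, b, c) \<Rightarrow>
     \<exists>w x. highest_weight_vector \<rho> w x \<and>
       dynkin_label w 1 = of_nat a \<and> dynkin_label w 2 = of_nat b \<and> dynkin_label w 3 = of_nat c)"


section \<open>The twisted Dirac operator\<close>

definition hom_G2 ::
  "(7 \<Rightarrow> real_mat8) \<Rightarrow> (real_mat8 \<Rightarrow> complex^'n^'n) \<Rightarrow> (complex^'n \<Rightarrow> twisted) set" where
  "hom_G2 I \<rho> =
     {\<eta>. Vector_Spaces.linear (*s) tscale \<eta> \<and> range \<eta> \<subseteq> twisted_spinors \<and>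
         (\<forall>g\<in>G2. \<forall>x. \<eta> (\<rho> g *v x) = twisted_act I g (\<eta> x))}"

definition dirac ::
  "real \<Rightarrow> (7 \<Rightarrow> real_mat8) \<Rightarrow> (real_mat8 \<Rightarrow> complex^'n^'n) \<Rightarrow>
   (complex^'n \<Rightarrow> twisted) \<Rightarrow> (complex^'n \<Rightarrow> twisted)" where
  "dirac t I \<rho> \<eta> = (\<lambda>x.
     - (\<Sum>a\<in>UNIV. tensor_map (clifford I (I a)) id (\<eta> (drep \<rho> (I a) *v x)))
     + ((t - 1) / 2) *\<^sub>R tensor_map (clifford_phi I) id (\<eta> x))"

definition dirac_eigenvalues ::
  "real \<Rightarrow> (7 \<Rightarrow> real_mat8) \<Rightarrow> (real_mat8 \<Rightarrow> complex^'n^'n) \<Rightarrow> complex set" where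
  "dirac_eigenvalues t I \<rho> =
     {\<mu>. \<exists>\<eta>\<in>hom_G2 I \<rho>. (\<exists>x. \<eta> x \<noteq> 0) \<and> (\<forall>x. dirac t I \<rho> \<eta> x = tscale \<mu> (\<eta> x))}"

end

theory Submission
  imports Defs
begin

text \<open>
  An element \<open>\<eta>\<close> of the space of equivariant maps is determined by its value at a highest weight vector \<open>x\<close> of the representation. Indeed spin(7) is the
  sum of g2 and \<open>\<mm>\<close>, and modulo the positive root vectors, which kill \<open>x\<close>, every weight vector of \<open>\<mm>\<close> is congruent to an element \<open>Ymat p\<close> of g2, apart from a
  torus element acting by a scalar. Hence the words in g2 applied to \<open>x\<close> span the representation (\<open>g2_generates\<close>, \<open>hom_determined\<close>). The same
  congruence evaluates the Dirac operator: in \<open>D \<eta> x\<close> the vectors \<open>I\<^sub>a x\<close> are replaced by the action of g2 on \<open>x\<close>, which equivariance moves to the values of \<open>\<eta>\<close>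
  (\<open>dirac_c\<close>, \<open>equivariance\<close>, \<open>dirac_array\<close>).

  The value \<open>\<eta> x\<close> is a twisted spinor, that is an array of numbers with indices in the weight basis of \<open>\<complex>\<^sup>7\<close>. It satisfies linear conditions: it has the
  weight of \<open>x\<close> under the maximal torus of G2, the raising operators of su(3) kill it, and so does the first or second power of a lowering operator,
  since a simple root vector of negative root acts nilpotently on \<open>x\<close> with the order prescribed by the Dynkin label (\<open>weight_array\<close>, \<open>lowering_array\<close>). The
  solution spaces have dimensions 1, 3, 4, 5, 2 and 7, and on them \<open>D\<close> is an explicit rational matrix. For each highest weight its characteristic
  polynomial splits over the rationals into linear and quadratic factors; the lemmas \<open>blocks_...\<close> exhibit rational functionals realising these factors.

  Two facts depend on the representation being the one of the given highest weight: the nilpotency, and the existence of equivariant maps on which none of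
  the functionals vanishes, so that every root of the characteristic polynomial is an eigenvalue. Both follow by embedding the representation into an
  explicit model, a tensor product of vector, spin and trivial representations containing a vector of the same highest weight (\<open>embedding\<close>). The embedding
  is constructed as the span of all simultaneous words in negative root vectors; a unitary structure on the model shows that this span is a graph.
  A G2-equivariant map from the model to twisted spinors then supplies the required element (\<open>vector_hom\<close>, \<open>matrix_hom\<close>), and \<open>block_spectrum\<close> concludes.

  The first sections identify the groups and Lie algebras of the statement: skew 7 by 7 matrices parametrise spin(7), the contraction with the octonion structure
  constants cuts out g2, the Killing form is a multiple of the trace form, and \<open>\<mm>\<close> consists of the cross product matrices. Continuity of a
  representation is turned into differentiability by means of one-parameter groups.
\<close>

section \<open>Matrix exponentials and one-parameter groups\<close>

text \<open>
  A Banach algebra is needed in order to use the exponential of HOL. The entrywise product makes matrices an algebra for the wrong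
  multiplication, so the bounded endomorphisms of a Euclidean space are wrapped into a type of their own.
\<close>

typedef (overloaded) 'a endo = "UNIV :: ('a::euclidean_space \<Rightarrow>\<^sub>L 'a) set"
  morphisms blinfun_of_endo Endo ..

setup_lifting type_definition_endo

instantiation endo :: (euclidean_space) real_normed_algebra_1
begin
lift_definition zero_endo :: "'a endo" is 0 .
lift_definition one_endo :: "'a endo" is id_blinfun .
lift_definition plus_endo :: "'a endo \<Rightarrow> 'a endo \<Rightarrow> 'a endo" is "(+)" .
lift_definition minus_endo :: "'a endo \<Rightarrow> 'a endo \<Rightarrow> 'a endo" is "(-)" .
lift_definition uminus_endo :: "'a endo \<Rightarrow> 'a endo" is uminus .
lift_definition times_endo :: "'a endo \<Rightarrow> 'a endo \<Rightarrow> 'a endo" is "(o\<^sub>L)" .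
lift_definition scaleR_endo :: "real \<Rightarrow> 'a endo \<Rightarrow> 'a endo" is scaleR .
lift_definition norm_endo :: "'a endo \<Rightarrow> real" is norm .
definition dist_endo :: "'a endo \<Rightarrow> 'a endo \<Rightarrow> real" where "dist_endo x y = norm (x - y)"
definition sgn_endo :: "'a endo \<Rightarrow> 'a endo" where "sgn_endo x = scaleR (inverse (norm x)) x"
definition uniformity_endo :: "('a endo \<times> 'a endo) filter"
  where "uniformity_endo = (INF e\<in>{0 <..}. principal {(x, y). dist x y < e})"
definition open_endo :: "'a endo set \<Rightarrow> bool"
  where "open_endo S = (\<forall>x\<in>S. \<forall>\<^sub>F (x', y) in uniformity. x' = x \<longrightarrow> y \<in> S)"
instance
proof
  fix a b c :: "'a endo" and r s :: real
  show "a + b + c = a + (b + c)" "a + b = b + a" "0 + a = a" "- a + a = 0" "a - b = a + - b"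
    by (transfer, simp)+
  show "r *\<^sub>R (a + b) = r *\<^sub>R a + r *\<^sub>R b" "(r + s) *\<^sub>R a = r *\<^sub>R a + s *\<^sub>R a"
    "r *\<^sub>R s *\<^sub>R a = (r * s) *\<^sub>R a" "1 *\<^sub>R a = a"
    by (transfer, simp add: scaleR_left_distrib scaleR_right_distrib)+
  show "a * b * c = a * (b * c)" by (transfer, rule blinfun_eqI, simp)
  show "(a + b) * c = a * c + b * c" "a * (b + c) = a * b + a * c"
    by (transfer, rule blinfun_eqI, simp add: blinfun.bilinear_simps)+
  show "r *\<^sub>R a * b = r *\<^sub>R (a * b)" "a * r *\<^sub>R b = r *\<^sub>R (a * b)"
    by (transfer, rule blinfun_eqI, simp add: blinfun.bilinear_simps)+
  show "1 * a = a" "a * 1 = a" by (transfer, rule blinfun_eqI, simp)+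
  show "(0::'a endo) \<noteq> 1"
  proof (transfer, rule notI)
    assume "(0::'a \<Rightarrow>\<^sub>L 'a) = id_blinfun"
    hence "norm (id_blinfun :: 'a \<Rightarrow>\<^sub>L 'a) = 0" by (metis norm_zero)
    thus False by simp
  qed
  show "dist a b = norm (a - b)" by (rule dist_endo_def)
  show "sgn a = inverse (norm a) *\<^sub>R a" by (simp add: sgn_endo_def)
  show "norm (a + b) \<le> norm a + norm b" by transfer (rule norm_triangle_ineq)
  show "(norm a = 0) = (a = 0)" "norm (r *\<^sub>R a) = \<bar>r\<bar> * norm a" by (transfer, simp)+
  show "norm (a * b) \<le> norm a * norm b" by transfer (rule norm_blinfun_compose)
  show "norm (1::'a endo) = 1" by transfer simp
qed (rule uniformity_endo_def open_endo_def)+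
end

instance endo :: (euclidean_space) banach
proof
  fix X :: "nat \<Rightarrow> 'a endo" assume X: "Cauchy X"
  have "Cauchy (\<lambda>n. blinfun_of_endo (X n))"
    using X unfolding Cauchy_def dist_norm by (simp add: norm_endo.rep_eq minus_endo.rep_eq)
  then obtain l where l: "(\<lambda>n. blinfun_of_endo (X n)) \<longlonglongrightarrow> l"
    using Cauchy_convergent_iff convergentD by blast
  have "X \<longlonglongrightarrow> Endo l"
    using l unfolding lim_sequentially dist_norm
    by (simp add: norm_endo.rep_eq minus_endo.rep_eq Endo_inverse)
  thus "convergent X" by (rule convergentI)
qed

definition endo_of :: "'a::{real_normed_field,euclidean_space}^'n^'n \<Rightarrow> ('a^'n) endo" where
  "endo_of A = Endo (Blinfun ((*v) A))"

definition matrix_of_endo :: "('a::{real_normed_field,euclidean_space}^'n) endo \<Rightarrow> 'a^'n^'n" where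
  "matrix_of_endo e = (\<chi> i j. (blinfun_of_endo e (axis j 1)) $ i)"

lemma endo_of_apply: "blinfun_of_endo (endo_of A) x = A *v x"
  by (simp add: endo_of_def Endo_inverse bounded_linear_Blinfun_apply)

lemma endo_eqI: "(\<And>x. blinfun_of_endo a x = blinfun_of_endo b x) \<Longrightarrow> a = b"
  by (metis blinfun_eqI blinfun_of_endo_inject)

lemma endo_of_mult: "endo_of (A ** B) = endo_of A * endo_of B"
  by (rule endo_eqI) (simp add: endo_of_apply times_endo.rep_eq matrix_vector_mul_assoc)

lemma endo_of_one: "endo_of (mat 1) = 1"
  by (rule endo_eqI) (simp add: endo_of_apply one_endo.rep_eq)

lemma linear_endo_of: "linear endo_of"
  by (rule linearI; rule endo_eqI)
     (simp_all add: endo_of_apply plus_endo.rep_eq scaleR_endo.rep_eq blinfun.bilinear_simps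
       matrix_vector_mult_add_rdistrib, simp add: matrix_vector_mult_def vec_eq_iff scaleR_right.sum)

lemma matrix_of_endo_of [simp]: "matrix_of_endo (endo_of A) = A"
  by (simp add: matrix_of_endo_def endo_of_apply vec_eq_iff matrix_vector_mult_def axis_def if_distrib sum.delta cong: if_cong)

lemma norm_axis_eq: "norm (axis j x) = norm x"
  by (simp add: norm_vec_def L2_set_def axis_def if_distrib[of norm] if_distrib[of "\<lambda>x. x\<^sup>2"] cong: if_cong)

lemma bounded_linear_endo_of: "bounded_linear endo_of"
  using linear_endo_of by (simp add: linear_conv_bounded_linear)

lemma bounded_linear_matrix_of_endo: "bounded_linear (matrix_of_endo :: _ \<Rightarrow> 'a::{real_normed_field,euclidean_space}^'n^'n)"
proof (rule bounded_linear_intro[where K="of_nat (CARD('n) * CARD('n))"])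
  fix e f :: "('a^'n) endo" and r :: real
  show "matrix_of_endo (e + f) = matrix_of_endo e + matrix_of_endo f"
    by (simp add: matrix_of_endo_def vec_eq_iff plus_endo.rep_eq blinfun.bilinear_simps)
  show "matrix_of_endo (r *\<^sub>R e) = r *\<^sub>R matrix_of_endo e"
    by (simp add: matrix_of_endo_def vec_eq_iff scaleR_endo.rep_eq blinfun.bilinear_simps)
  have *: "norm (matrix_of_endo e $ i $ j) \<le> norm e" for i j
  proof -
    have "norm (matrix_of_endo e $ i $ j) \<le> norm (blinfun_of_endo e (axis j 1))"
      by (simp add: matrix_of_endo_def Finite_Cartesian_Product.norm_nth_le)
    also have "\<dots> \<le> norm (blinfun_of_endo e) * norm (axis j 1 :: 'a^'n)" by (rule norm_blinfun)
    also have "\<dots> = norm e" by (simp add: norm_endo.rep_eq norm_axis_eq)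
    finally show ?thesis .
  qed
  have "norm (matrix_of_endo e) \<le> (\<Sum>i\<in>UNIV. norm (matrix_of_endo e $ i))"
    by (simp add: norm_vec_def L2_set_le_sum)
  also have "\<dots> \<le> (\<Sum>i\<in>(UNIV::'n set). \<Sum>j\<in>(UNIV::'n set). norm (matrix_of_endo e $ i $ j))"
    by (intro sum_mono) (simp add: norm_vec_def L2_set_le_sum)
  also have "\<dots> \<le> (\<Sum>i\<in>(UNIV::'n set). \<Sum>j\<in>(UNIV::'n set). norm e)"
    by (intro sum_mono *)
  finally show "norm (matrix_of_endo e) \<le> norm e * of_nat (CARD('n) * CARD('n))"
    by (simp add: algebra_simps)
qed

lemma matrix_of_endo_pow: 
  "matrix_of_endo (endo_of A ^ k) = ((\<lambda>B. A ** B) ^^ k) (mat 1)"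
proof -
  have "endo_of A ^ k = endo_of (((\<lambda>B. A ** B) ^^ k) (mat 1))"
    by (induction k) (simp_all add: endo_of_mult endo_of_one)
  thus ?thesis by simp
qed

lemma matrix_exp_eq: "matrix_exp A = matrix_of_endo (exp (endo_of A))"
proof -
  have "(\<lambda>k. endo_of A ^ k /\<^sub>R fact k) sums exp (endo_of A)"
    by (rule exp_converges)
  from bounded_linear.sums[OF bounded_linear_matrix_of_endo this]
  have "(\<lambda>k. (1 / fact k) *\<^sub>R ((\<lambda>B. A ** B) ^^ k) (mat 1)) sums matrix_of_endo (exp (endo_of A))"
    by (simp add: linear_simps(5)[OF bounded_linear_matrix_of_endo] matrix_of_endo_pow divide_inverse)
  thus ?thesis unfolding matrix_exp_def by (simp add: sums_iff)
qed

text \<open>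
  A continuous one-parameter group is differentiable: averaging it over a short interval gives an invertible element \<open>a\<close> for which
  \<open>\<phi> t * a\<close> is an integral with variable limits. Its derivative satisfies the linear differential equation of the exponential.
  This is what makes the derivative of a merely continuous representation meaningful.
\<close>

lemma one_parameter_group_exp:
  fixes \<phi> :: "real \<Rightarrow> 'b::{real_normed_algebra_1,banach}"
  assumes cont: "continuous_on UNIV \<phi>" and zero: "\<phi> 0 = 1"
    and add: "\<And>s t. \<phi> (s + t) = \<phi> s * \<phi> t"
  obtains A where "\<And>t. \<phi> t = exp (t *\<^sub>R A)"
proof -
  have "continuous (at 0) \<phi>" using cont by (simp add: continuous_on_eq_continuous_at)
  then obtain d where d: "d > 0" "\<And>t. dist t 0 < d \<Longrightarrow> dist (\<phi> t) 1 < 1/2"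
    unfolding continuous_at_eps_delta zero using half_gt_zero[OF zero_less_one] by blast
  define h where "h = d/2"
  have h: "h > 0" "\<And>t. 0 \<le> t \<Longrightarrow> t \<le> h \<Longrightarrow> norm (\<phi> t - 1) \<le> 1/2"
    using d by (auto simp: h_def dist_norm intro!: less_imp_le)
  have int: "\<phi> integrable_on {a..b}" for a b
    by (rule integrable_continuous_real) (rule continuous_on_subset[OF cont], simp)
  (* Near 0 the values of \<phi> are close to 1, so the mean value L over {0..h} is invertible by a geometric series. *)
  define K where "K = integral {0..h} \<phi>"
  have "norm (K - h *\<^sub>R 1) \<le> 1/2 * measure lborel {0..h}"
  proof -
    have "((\<lambda>t. \<phi> t - 1) has_integral (K - measure lborel {0..h} *\<^sub>R 1)) {0..h}"
      unfolding K_def by (intro has_integral_diff integrable_integral int has_integral_const_real)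
    hence "norm (K - measure lborel {0..h} *\<^sub>R 1) \<le> 1/2 * measure lborel {0..h}"
      using h by (intro has_integral_bound_real[where f="\<lambda>t. \<phi> t - 1" and S="{}"]) auto
    thus ?thesis using h by simp
  qed
  hence K1: "norm (K - h *\<^sub>R 1) \<le> h / 2" using h by simp
  define L where "L = K /\<^sub>R h"
  have "norm (1 - L) = norm (K - h *\<^sub>R 1) / h"
  proof -
    have "1 - L = - ((K - h *\<^sub>R 1) /\<^sub>R h)" using h by (simp add: L_def scaleR_diff_right)
    hence "norm (1 - L) = norm ((K - h *\<^sub>R 1) /\<^sub>R h)" by (simp only: norm_minus_cancel)
    also have "\<dots> = norm (K - h *\<^sub>R 1) / h"
      using h by (simp only: norm_scaleR abs_inverse abs_of_pos divide_inverse_commute)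
    finally show ?thesis .
  qed
  hence "norm (1 - L) \<le> 1/2" using K1 h by (simp add: pos_divide_le_eq)
  hence L: "norm (1 - L) < 1" by simp
  define J where "J = (\<Sum>n. (1 - L) ^ n)"
  have sm: "summable (\<lambda>n. (1 - L) ^ n)" using L by (rule complete_algebra_summable_geometric)
  have LJ: "L * J = 1"
  proof -
    have "(1 - L) * J = (\<Sum>n. (1 - L) ^ Suc n)"
      unfolding J_def using suminf_mult[OF sm, of "1 - L"] by simp
    also have "\<dots> = J - 1" using suminf_split_head[OF sm] by (simp add: J_def)
    finally show ?thesis by (simp add: algebra_simps)
  qed
  have KJ: "K * (J /\<^sub>R h) = 1"
  proof -
    have "K = h *\<^sub>R L" using h by (simp add: L_def)
    thus ?thesis using LJ h by simp
  qed
  define A where "A = (\<phi> h - 1) * (J /\<^sub>R h)"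
  have key: "\<phi> t * K = integral {t..t+h} \<phi>" for t
  proof -
    have "\<phi> t * K = integral {0..h} (\<lambda>s. \<phi> t * \<phi> s)" unfolding K_def
      using integral_linear[OF int bounded_linear_mult_right] by (simp add: o_def)
    also have "\<dots> = integral {0..h} (\<lambda>s. \<phi> (s + t))" by (simp add: add[symmetric] add.commute)
    also have "\<dots> = integral {0+t..h+t} \<phi>"
      using integral_shift_Icc_real[of 0 h \<phi> t] by (simp add: o_def add.commute)
    finally show ?thesis by (simp add: add.commute)
  qed
  have der: "(\<phi> has_vector_derivative \<phi> t * A) (at t)" for t
  proof -
    define N where "N = \<bar>t\<bar> + h + 1"
    define P where "P = (\<lambda>x. integral {-N..x} \<phi>)"
    have P: "(P has_vector_derivative \<phi> x) (at x)" if "-N < x" "x < N" for x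
    proof -
      have "(P has_vector_derivative \<phi> x) (at x within {-N..N})" unfolding P_def
        by (rule integral_has_vector_derivative) (use that cont in \<open>auto intro: continuous_on_subset\<close>)
      thus ?thesis using that by (simp add: at_within_Icc_at)
    qed
    have Pd: "integral {x..x+h} \<phi> = P (x + h) - P x" if "-N < x" for x
      unfolding P_def using Henstock_Kurzweil_Integration.integral_combine[where a="-N" and c=x and b="x+h" and f=\<phi>] int that h
      by (simp add: algebra_simps)
    have a: "((\<lambda>x. P (x + h)) has_vector_derivative \<phi> (t + h)) (at t)"
    proof -
      have "((\<lambda>x. x + h) has_vector_derivative 1) (at t)" by (auto intro!: derivative_eq_intros)
      from vector_diff_chain_at[OF this, of P "\<phi> (t + h)"] P[of "t+h"] h
      show ?thesis by (simp add: o_def N_def)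
    qed
    have "((\<lambda>x. (P (x + h) - P x) * (J /\<^sub>R h)) has_vector_derivative (\<phi> (t+h) - \<phi> t) * (J /\<^sub>R h)) (at t)"
      by (rule bounded_linear.has_vector_derivative[OF bounded_linear_mult_left])
         (use a P[of t] h in \<open>auto intro!: has_vector_derivative_diff simp: N_def\<close>)
    hence "(\<phi> has_vector_derivative (\<phi> (t+h) - \<phi> t) * (J /\<^sub>R h)) (at t)"
    proof (rule has_vector_derivative_transform_within_open[of _ _ _ "{-N<..<N}"])
      show "t \<in> {-N<..<N}" using h by (auto simp: N_def)
      fix x assume "x \<in> {-N<..<N}"
      thus "(P (x + h) - P x) * (J /\<^sub>R h) = \<phi> x"
        using key[of x] Pd[of x] KJ mult.assoc[of "\<phi> x" K "J /\<^sub>R h"] by simp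
    qed auto
    moreover have "\<phi> (t + h) - \<phi> t = \<phi> t * (\<phi> h - 1)" by (simp add: add right_diff_distrib)
    ultimately show ?thesis by (simp only: A_def mult.assoc)
  qed
  have "\<phi> t = exp (t *\<^sub>R A)" for t
  proof -
    have "((\<lambda>t. \<phi> t * exp (t *\<^sub>R (- A))) has_vector_derivative 0) (at t)" for t
      using has_vector_derivative_mult[OF der[of t] exp_scaleR_has_vector_derivative_left[of "-A" t]]
      by (simp add: mult.assoc)
    then obtain c where "\<And>t. \<phi> t * exp (t *\<^sub>R (- A)) = c"
      using has_vector_derivative_zero_constant[of UNIV "\<lambda>t. \<phi> t * exp (t *\<^sub>R (- A))"] by auto
    from this[of 0] this[of t] have "\<phi> t * exp (- (t *\<^sub>R A)) = 1" by (simp add: zero)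
    hence "exp (t *\<^sub>R A) = (\<phi> t * exp (- (t *\<^sub>R A))) * exp (t *\<^sub>R A)" by simp
    also have "\<dots> = \<phi> t * (exp (- (t *\<^sub>R A)) * exp (t *\<^sub>R A))" by (rule mult.assoc)
    also have "exp (- (t *\<^sub>R A)) * exp (t *\<^sub>R A) = 1"
      using exp_minus_inverse[of "- (t *\<^sub>R A)"] by simp
    finally show ?thesis by simp
  qed
  thus ?thesis by (rule that)
qed

lemma norm_power_diff_le:
  fixes a b :: "'b::real_normed_algebra_1"
  assumes "norm a \<le> M" "norm b \<le> M" "1 \<le> M"
  shows "norm (a ^ n - b ^ n) \<le> of_nat n * norm (a - b) * M ^ n"
proof (induction n)
  case (Suc n)
  have M0: "0 \<le> M" using assms by simp
  have "a ^ Suc n - b ^ Suc n = a * (a ^ n - b ^ n) + (a - b) * b ^ n" by (simp add: algebra_simps)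
  also have "norm \<dots> \<le> norm a * norm (a ^ n - b ^ n) + norm (a - b) * norm (b ^ n)"
    by (intro order.trans[OF norm_triangle_ineq] add_mono norm_mult_ineq)
  also have "\<dots> \<le> M * (of_nat n * norm (a - b) * M ^ n) + norm (a - b) * M ^ Suc n"
  proof (intro add_mono mult_mono Suc assms(1) mult_left_mono)
    have "norm (b ^ n) \<le> norm b ^ n" by (rule norm_power_ineq)
    also have "\<dots> \<le> M ^ n" using assms by (simp add: power_mono)
    also have "\<dots> \<le> M ^ Suc n" using assms by (intro power_increasing) auto
    finally show "norm (b ^ n) \<le> M ^ Suc n" .
  qed (use M0 in auto)
  finally show ?case by (simp add: algebra_simps)
qed simp

lemma exp_of_nat_scaleR:
  "exp (of_nat n *\<^sub>R Z) = exp (Z :: 'b::{real_normed_algebra_1,banach}) ^ n"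
proof (induction n)
  case (Suc n)
  have "exp (of_nat (Suc n) *\<^sub>R Z) = exp (Z + of_nat n *\<^sub>R Z)" by (simp add: algebra_simps)
  also have "\<dots> = exp Z * exp (of_nat n *\<^sub>R Z)" by (rule exp_add_commuting) simp
  finally show ?case using Suc by simp
qed simp

text \<open>
  The two factors and \<open>exp ((X + Y) / n)\<close> differ by \<open>o(1 / n)\<close>, and telescoping the n-th powers costs one factor \<open>n\<close>.
  It yields the additivity of the derivative of a representation.
\<close>

lemma trotter_product:
  fixes X Y :: "'b::{real_normed_algebra_1,banach}"
  shows "(\<lambda>n. (exp (X /\<^sub>R real n) * exp (Y /\<^sub>R real n)) ^ n) \<longlonglongrightarrow> exp (X + Y)"
proof -
  (* The local error f vanishes to first order at 0. *)
  define f where "f t = exp (t *\<^sub>R X) * exp (t *\<^sub>R Y) - exp (t *\<^sub>R (X + Y))" for t :: real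
  have "(f has_vector_derivative 0) (at 0)"
  proof -
    have "(f has_vector_derivative (exp (0 *\<^sub>R X) * (exp (0 *\<^sub>R Y) * Y) + exp (0 *\<^sub>R X) * X * exp (0 *\<^sub>R Y)) 
       - exp (0 *\<^sub>R (X + Y)) * (X + Y)) (at 0)" unfolding f_def
      by (intro has_vector_derivative_diff has_vector_derivative_mult
          exp_scaleR_has_vector_derivative_right)
    thus ?thesis by simp
  qed
  hence "((\<lambda>h. norm (f h) / \<bar>h\<bar>) \<longlongrightarrow> 0) (at 0)"
    unfolding has_vector_derivative_def has_derivative_at by (simp add: f_def)
  moreover have "filterlim (\<lambda>n. 1 / real n) (at 0) sequentially"
    by (intro filterlim_atI lim_1_over_n eventually_sequentiallyI[of 1]) auto
  ultimately have l: "(\<lambda>n. norm (f (1 / real n)) / \<bar>1 / real n\<bar>) \<longlonglongrightarrow> 0"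
    by (rule filterlim_compose)
  define C where "C = exp (norm X + norm Y)"
  have bnd: "norm ((exp (X /\<^sub>R real n) * exp (Y /\<^sub>R real n)) ^ n - exp (X + Y)) 
      \<le> norm (f (1 / real n)) / \<bar>1 / real n\<bar> * C" if "n > 0" for n
  proof -
    define a where "a = exp (X /\<^sub>R real n) * exp (Y /\<^sub>R real n)"
    define b where "b = exp ((X + Y) /\<^sub>R real n)"
    define M where "M = exp ((norm X + norm Y) / real n)"
    have "norm a \<le> exp (norm (X /\<^sub>R real n)) * exp (norm (Y /\<^sub>R real n))"
      unfolding a_def by (intro order.trans[OF norm_mult_ineq] mult_mono norm_exp) auto
    also have "\<dots> = M" by (simp add: M_def divide_inverse_commute distrib_left flip: exp_add)
    finally have "norm a \<le> M" .
    moreover have "norm b \<le> M"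
    proof -
      have "norm b \<le> exp (norm ((X + Y) /\<^sub>R real n))" unfolding b_def by (rule norm_exp)
      also have "\<dots> \<le> M" using norm_triangle_ineq[of X Y]
        by (simp add: M_def divide_inverse_commute mult_left_mono)
      finally show ?thesis .
    qed
    moreover have "1 \<le> M" by (simp add: M_def)
    ultimately have "norm (a ^ n - b ^ n) \<le> of_nat n * norm (a - b) * M ^ n"
      by (rule norm_power_diff_le)
    also have "M ^ n = C" using that by (simp add: M_def C_def exp_of_nat_mult[symmetric])
    also have "b ^ n = exp (X + Y)"
      using that by (simp add: b_def flip: exp_of_nat_scaleR)
    also have "a - b = f (1 / real n)" by (simp add: a_def b_def f_def divide_inverse)
    finally show ?thesis using that by (simp add: a_def algebra_simps)
  qed
  have "(\<lambda>n. norm (f (1 / real n)) / \<bar>1 / real n\<bar> * C) \<longlonglongrightarrow> 0"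
    using tendsto_mult_right[OF l, of C] by (simp only: mult_zero_left)
  with eventually_sequentiallyI[of 1, OF bnd]
  have "(\<lambda>n. (exp (X /\<^sub>R real n) * exp (Y /\<^sub>R real n)) ^ n - exp (X + Y)) \<longlonglongrightarrow> 0"
    by (rule Lim_null_comparison) linarith
  thus ?thesis by (rule LIM_zero_cancel)
qed

definition mexp :: "'a::{real_normed_field,euclidean_space}^'n^'n \<Rightarrow> 'a^'n^'n" where
  "mexp A = matrix_of_endo (exp (endo_of A))"

lemma matrix_exp_mexp: "matrix_exp A = mexp A"
  by (simp add: matrix_exp_eq mexp_def)

lemma endo_of_mexp: "endo_of (mexp A) = exp (endo_of A)"
proof -
  have s: "(\<lambda>k. endo_of A ^ k /\<^sub>R fact k) sums exp (endo_of A)"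
    by (rule exp_converges)
  have "(\<lambda>k. endo_of (matrix_of_endo (endo_of A ^ k /\<^sub>R fact k))) sums endo_of (mexp A)"
    unfolding mexp_def
    by (rule bounded_linear.sums[OF bounded_linear_endo_of bounded_linear.sums[OF bounded_linear_matrix_of_endo s]])
  moreover have "endo_of (matrix_of_endo (endo_of A ^ k /\<^sub>R fact k)) = endo_of A ^ k /\<^sub>R fact k" for k
  proof -
    have "endo_of A ^ k = endo_of (((\<lambda>B. A ** B) ^^ k) (mat 1))"
      by (induction k) (simp_all add: endo_of_mult endo_of_one)
    thus ?thesis
      by (simp add: linear_simps(5)[OF bounded_linear_matrix_of_endo] linear_simps(5)[OF bounded_linear_endo_of])
  qed
  ultimately show ?thesis using s sums_unique2 by auto
qed

lemma endo_of_inject: "endo_of A = endo_of B \<longleftrightarrow> A = B"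
  by (metis matrix_of_endo_of)

lemma mexp_0 [simp]: "mexp 0 = mat 1"
  by (simp add: endo_of_mexp linear_0[OF linear_endo_of] endo_of_one flip: endo_of_inject)

lemma mexp_add_commuting: "A ** B = B ** A \<Longrightarrow> mexp (A + B) = mexp A ** mexp B"
  by (simp add: endo_of_mexp linear_add[OF linear_endo_of] endo_of_mult exp_add_commuting flip: endo_of_inject)

lemma matrix_scaleR_mult [simp]:
  "(r *\<^sub>R A) ** B = r *\<^sub>R (A ** B)" "A ** (r *\<^sub>R B) = r *\<^sub>R (A ** B :: 'a::real_algebra_1^'n^'m)"
  by (simp_all add: matrix_matrix_mult_def vec_eq_iff scaleR_right.sum)

lemma mexp_add_scaleR: "mexp ((s + t) *\<^sub>R A) = mexp (s *\<^sub>R A) ** mexp (t *\<^sub>R A)"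
  unfolding scaleR_left_distrib by (rule mexp_add_commuting) simp

lemma mexp_minus: "mexp A ** mexp (- A) = mat 1" "mexp (- A) ** mexp A = mat 1"
  using mexp_add_scaleR[of 1 "-1" A] mexp_add_scaleR[of "-1" 1 A] by simp_all

lemma mexp_has_vector_derivative:
  "((\<lambda>t. mexp (t *\<^sub>R A)) has_vector_derivative A ** mexp (t *\<^sub>R A)) (at t)"
proof -
  have "((\<lambda>t. matrix_of_endo (exp (t *\<^sub>R endo_of A))) has_vector_derivative
      matrix_of_endo (endo_of A * exp (t *\<^sub>R endo_of A))) (at t)"
    by (rule bounded_linear.has_vector_derivative[OF bounded_linear_matrix_of_endo
          exp_scaleR_has_vector_derivative_left])
  moreover have "exp (t *\<^sub>R endo_of A) = endo_of (mexp (t *\<^sub>R A))" for t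
    by (simp add: endo_of_mexp linear_scale[OF linear_endo_of])
  ultimately show ?thesis by (simp flip: endo_of_mult)
qed

lemma mexp_commute: "A ** mexp (t *\<^sub>R A) = mexp (t *\<^sub>R A) ** A"
proof -
  have "endo_of A * exp (t *\<^sub>R endo_of A) = exp (t *\<^sub>R endo_of A) * endo_of A"
    by (rule exp_times_scaleR_commute[symmetric])
  thus ?thesis by (simp add: endo_of_mult endo_of_mexp linear_scale[OF linear_endo_of] flip: endo_of_inject)
qed

lemma matrix_add_rdistrib: "(A + B) ** C = A ** C + B ** (C :: 'a::semiring_1^'n^'m)"
  by (simp add: matrix_matrix_mult_def vec_eq_iff distrib_right sum.distrib)

lemma bounded_bilinear_matrix_mult:
  "bounded_bilinear ((**) :: 'a::{real_normed_field,euclidean_space}^'n^'m \<Rightarrow> 'a^'k^'n \<Rightarrow> 'a^'k^'m)"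
proof -
  have "bilinear ((**) :: 'a^'n^'m \<Rightarrow> 'a^'k^'n \<Rightarrow> 'a^'k^'m)"
    unfolding bilinear_def by (auto intro!: linearI simp: matrix_add_ldistrib matrix_add_rdistrib
       vec_eq_iff matrix_matrix_mult_def sum.distrib scaleR_right.sum algebra_simps)
  thus ?thesis by (simp add: bilinear_conv_bounded_bilinear)
qed

lemma bounded_bilinear_matrix_vector_mult:
  "bounded_bilinear ((*v) :: 'a::{real_normed_field,euclidean_space}^'n^'m \<Rightarrow> 'a^'n \<Rightarrow> 'a^'m)"
proof -
  have "bilinear ((*v) :: 'a^'n^'m \<Rightarrow> 'a^'n \<Rightarrow> 'a^'m)"
    unfolding bilinear_def by (auto intro!: linearI simp: 
       vec_eq_iff matrix_vector_mult_def sum.distrib scaleR_right.sum algebra_simps)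
  thus ?thesis by (simp add: bilinear_conv_bounded_bilinear)
qed

lemma has_vector_derivative_matrix_mult:
  fixes f :: "real \<Rightarrow> 'a::{real_normed_field,euclidean_space}^'n^'m"
  assumes "(f has_vector_derivative f') (at x)" "(g has_vector_derivative g') (at x)"
  shows "((\<lambda>x. f x ** g x) has_vector_derivative f x ** g' + f' ** g x) (at x)"
  by (rule bounded_bilinear.has_vector_derivative[OF bounded_bilinear_matrix_mult assms])

text \<open>
  The product \<open>mexp (- t A) ** Y t\<close> has zero derivative.
\<close>

lemma linear_ode_unique:
  fixes Y :: "real \<Rightarrow> 'a::{real_normed_field,euclidean_space}^'k^'n"
  assumes d: "\<And>t. (Y has_vector_derivative A ** Y t) (at t)"
  shows "Y t = mexp (t *\<^sub>R A) ** Y 0"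
proof -
  have "((\<lambda>t. mexp (t *\<^sub>R (- A)) ** Y t) has_vector_derivative 0) (at t)" for t
  proof -
    have "((\<lambda>t. mexp (t *\<^sub>R (- A)) ** Y t) has_vector_derivative
       mexp (t *\<^sub>R (- A)) ** (A ** Y t) + (- A) ** mexp (t *\<^sub>R (- A)) ** Y t) (at t)"
      by (intro has_vector_derivative_matrix_mult d mexp_has_vector_derivative)
    also have "(- A) ** mexp (t *\<^sub>R (- A)) = mexp (t *\<^sub>R (- A)) ** (- A)" by (rule mexp_commute)
    also have "mexp (t *\<^sub>R (- A)) ** (A ** Y t) + mexp (t *\<^sub>R (- A)) ** (- A) ** Y t = 
      mexp (t *\<^sub>R (- A)) ** ((A + - A) ** Y t)"
      by (simp only: matrix_mul_assoc matrix_add_ldistrib matrix_add_rdistrib)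
    finally show ?thesis by simp
  qed
  then obtain c where c: "\<And>t. mexp (t *\<^sub>R (- A)) ** Y t = c"
    using has_vector_derivative_zero_constant[of UNIV "\<lambda>t. mexp (t *\<^sub>R (- A)) ** Y t"] by auto
  from c[of 0] have "c = Y 0" by simp
  with c[of t] have "mexp (t *\<^sub>R A) ** Y 0 = mexp (t *\<^sub>R A) ** (mexp (- (t *\<^sub>R A)) ** Y t)" by simp
  also have "\<dots> = Y t" by (simp add: matrix_mul_assoc mexp_minus)
  finally show ?thesis by simp
qed

section \<open>The octonionic cross product and the gamma matrices\<close>

lemma UNIV_7: "(UNIV :: 7 set) = {0,1,2,3,4,5,6}"
proof -
  have "card {0,1,2,3,4,5,6::7} = 7" by simp
  hence "{0,1,2,3,4,5,6::7} = UNIV" by (intro card_subset_eq) auto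
  thus ?thesis ..
qed

lemma all_7: "(\<forall>i::7. P i) \<longleftrightarrow> P 0 \<and> P 1 \<and> P 2 \<and> P 3 \<and> P 4 \<and> P 5 \<and> P 6"
  by (metis UNIV_7 UNIV_I insertE singletonD)

lemma ex_7: "(\<exists>i::7. P i) \<longleftrightarrow> P 0 \<or> P 1 \<or> P 2 \<or> P 3 \<or> P 4 \<or> P 5 \<or> P 6"
  by (metis UNIV_7 UNIV_I insertE singletonD)

lemma sum_7: "sum f (UNIV::7 set) = f 0 + f 1 + f 2 + f 3 + f 4 + f 5 + f 6"
  unfolding UNIV_7 by (simp add: add.assoc)

definition cross :: "'a::real_normed_field^7 \<Rightarrow> 'a^7 \<Rightarrow> 'a^7" where
  "cross u v = (\<chi> c. \<Sum>a\<in>UNIV. \<Sum>b\<in>UNIV. of_real (octonion_sign a b c) * u $ a * v $ b)"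

definition dot :: "'a::real_normed_field^7 \<Rightarrow> 'a^7 \<Rightarrow> 'a" where
  "dot u v = (\<Sum>a\<in>UNIV. u $ a * v $ a)"

text \<open>
  Spelling out the quantifier over the seven lines of the Fano plane lets the simplifier evaluate the structure constants.
\<close>

lemma octonion_sign_alt: "octonion_sign a b c =
  (if (a, b, c) \<in> {(0,1,3),(1,3,0),(3,0,1), (1,2,4),(2,4,1),(4,1,2), (2,3,5),(3,5,2),(5,2,3), (3,4,6),(4,6,3),(6,3,4),
     (4,5,0),(5,0,4),(0,4,5), (5,6,1),(6,1,5),(1,5,6), (6,0,2),(0,2,6),(2,6,0)} then 1
   else if (b, a, c) \<in> {(0,1,3),(1,3,0),(3,0,1), (1,2,4),(2,4,1),(4,1,2), (2,3,5),(3,5,2),(5,2,3), (3,4,6),(4,6,3),(6,3,4),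
     (4,5,0),(5,0,4),(0,4,5), (5,6,1),(6,1,5),(1,5,6), (6,0,2),(0,2,6),(2,6,0)} then -1 else 0)"
proof -
  have n: "(7::7) = 0" "(8::7) = 1" "(9::7) = 2" by simp_all
  have A: "(\<exists>i. (a, b, c) \<in> {(i, i+1, i+3), (i+1, i+3, i), (i+3, i, i+1)}) \<longleftrightarrow>
    (a, b, c) \<in> {(0,1,3),(1,3,0),(3,0,1), (1,2,4),(2,4,1),(4,1,2), (2,3,5),(3,5,2),(5,2,3), (3,4,6),(4,6,3),(6,3,4),
     (4,5,0),(5,0,4),(0,4,5), (5,6,1),(6,1,5),(1,5,6), (6,0,2),(0,2,6),(2,6,0)}" for a b c :: 7
    unfolding ex_7 by (simp add: n)
  have B: "(\<exists>i. (a, b, c) \<in> {(i+1, i, i+3), (i, i+3, i+1), (i+3, i+1, i)}) \<longleftrightarrow>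
     (\<exists>i. (b, a, c) \<in> {(i, i+1, i+3), (i+1, i+3, i), (i+3, i, i+1)})"
    by (rule arg_cong[where f=Ex], rule ext) auto
  show ?thesis unfolding octonion_sign_def B A ..
qed

lemma cross_nth:
  "cross u v $ 0 = u $ 1 * v $ 3 - u $ 3 * v $ 1 + u $ 4 * v $ 5 - u $ 5 * v $ 4 + u $ 2 * v $ 6 - u $ 6 * v $ 2"
  "cross u v $ 1 = u $ 2 * v $ 4 - u $ 4 * v $ 2 + u $ 5 * v $ 6 - u $ 6 * v $ 5 + u $ 3 * v $ 0 - u $ 0 * v $ 3"
  "cross u v $ 2 = u $ 3 * v $ 5 - u $ 5 * v $ 3 + u $ 6 * v $ 0 - u $ 0 * v $ 6 + u $ 4 * v $ 1 - u $ 1 * v $ 4"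
  "cross u v $ 3 = u $ 4 * v $ 6 - u $ 6 * v $ 4 + u $ 0 * v $ 1 - u $ 1 * v $ 0 + u $ 5 * v $ 2 - u $ 2 * v $ 5"
  "cross u v $ 4 = u $ 5 * v $ 0 - u $ 0 * v $ 5 + u $ 1 * v $ 2 - u $ 2 * v $ 1 + u $ 6 * v $ 3 - u $ 3 * v $ 6"
  "cross u v $ 5 = u $ 6 * v $ 1 - u $ 1 * v $ 6 + u $ 2 * v $ 3 - u $ 3 * v $ 2 + u $ 0 * v $ 4 - u $ 4 * v $ 0"
  "cross u v $ 6 = u $ 0 * v $ 2 - u $ 2 * v $ 0 + u $ 3 * v $ 4 - u $ 4 * v $ 3 + u $ 1 * v $ 5 - u $ 5 * v $ 1"
  by (simp_all add: cross_def sum_7 octonion_sign_alt)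

lemma vec_eq_7: "(u :: 'a^7) = v \<longleftrightarrow> u $ 0 = v $ 0 \<and> u $ 1 = v $ 1 \<and> u $ 2 = v $ 2 \<and> u $ 3 = v $ 3
    \<and> u $ 4 = v $ 4 \<and> u $ 5 = v $ 5 \<and> u $ 6 = v $ 6"
  by (simp add: vec_eq_iff all_7)

lemma dot_7: "dot u v = u $ 0 * v $ 0 + u $ 1 * v $ 1 + u $ 2 * v $ 2 + u $ 3 * v $ 3 + u $ 4 * v $ 4
    + u $ 5 * v $ 5 + u $ 6 * v $ 6"
  by (simp add: dot_def sum_7)

lemma cross_bilinear:
  "cross (u + u') v = cross u v + cross u' v" "cross u (v + v') = cross u v + cross u v'"
  "cross (c *s u) v = c *s cross u v" "cross u (c *s v) = c *s cross u v"
  "cross (- u) v = - cross u v" "cross u (- v) = - cross u v"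
  "cross (u - u') v = cross u v - cross u' v" "cross u (v - v') = cross u v - cross u v'"
  "cross 0 v = 0" "cross u 0 = 0"
  by (simp_all add: vec_eq_7 cross_nth algebra_simps)

lemma dot_bilinear:
  "dot (u + u') v = dot u v + dot u' v" "dot u (v + v') = dot u v + dot u v'"
  "dot (c *s u) v = c * dot u v" "dot u (c *s v) = c * dot u v"
  "dot (- u) v = - dot u v" "dot u (- v) = - dot u v"
  "dot (u - u') v = dot u v - dot u' v" "dot u (v - v') = dot u v - dot u v'"
  "dot 0 v = 0" "dot u 0 = 0"
  by (simp_all add: dot_7 algebra_simps)

lemma dot_commute: "dot u v = dot v u"
  by (simp add: dot_7 mult.commute)

lemma cross_skew: "cross u v = - cross v u"
  by (simp add: vec_eq_7 cross_nth)

lemma dot_cross_cyclic: "dot u (cross v w) = dot v (cross w u)"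
  unfolding dot_7 cross_nth by (simp add: algebra_simps)

text \<open>
  The polarised form of \<open>u \<times> (u \<times> w) = \<langle>u, w\<rangle> u - \<bar>u\<bar>\<^sup>2 w\<close>, which is equivalent to the Clifford relation.
\<close>

lemma cross_cross: "cross u (cross v w) + cross v (cross u w) = dot u w *s v + dot v w *s u - (2 * dot u v) *s w"
  unfolding vec_eq_7 vector_minus_component vector_add_component vector_smult_component cross_nth dot_7 
  by (intro conjI; simp add: algebra_simps)

lemma sum_option: "(\<Sum>i\<in>UNIV. f i) = f None + (\<Sum>c\<in>(UNIV::'a::finite set). f (Some c))"
  unfolding UNIV_option_conv by (simp add: sum.reindex)

definition pack :: "'a::zero \<Rightarrow> 'a^7 \<Rightarrow> 'a^(7 option)" where
  "pack f v = (\<chi> i. case i of None \<Rightarrow> f | Some c \<Rightarrow> v $ c)"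

lemma pack_nth [simp]: "pack f v $ None = f" "pack f v $ Some c = v $ c"
  by (simp_all add: pack_def)

lemma vec8_eq: "(x :: 'a^(7 option)) = y \<longleftrightarrow> x $ None = y $ None \<and> (\<forall>c. x $ Some c = y $ Some c)"
  by (auto simp: vec_eq_iff split_option_all)

lemma pack_eq_iff [simp]: "pack f v = pack f' v' \<longleftrightarrow> f = f' \<and> v = v'"
  by (auto simp: vec8_eq vec_eq_iff)

lemma pack_exhaust: obtains f v where "x = pack f v"
proof
  show "x = pack (x $ None) (\<chi> c. x $ Some c)" by (simp add: vec8_eq)
qed

lemma pack_add: "pack f v + pack f' v' = pack (f + f') (v + v')"
  and pack_diff: "pack f v - pack f' v' = pack (f - f') (v - v')"
  and pack_minus: "- pack f v = pack (- f) (- v)"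
  and pack_smult: "c *s pack f v = pack (c * f) (c *s v)"
  for f f' c :: "'a::ring_1"
  by (simp_all add: vec8_eq)

lemma pack_scaleR: "r *\<^sub>R pack f v = pack (r *\<^sub>R f) (r *\<^sub>R v)"
  for f :: "'a::real_normed_field"
  by (simp add: vec8_eq)

lemma mat8_eqI: 
  fixes A B :: "'a::real_normed_field^(7 option)^'n"
  assumes "\<And>f v. A *v pack f v = B *v pack f v" shows "A = B"
  unfolding matrix_eq by (metis assms pack_exhaust)

lemma gamma_pack: "gamma u *v pack f v = pack (dot u v) (- (f *s u) - cross u v)"
proof -
  have "(\<Sum>b\<in>UNIV. (\<Sum>a\<in>UNIV. octonion_sign a b c * u $ a) * v $ b) = cross u v $ c" for c
    unfolding cross_def by (simp add: sum_distrib_right) (rule sum.swap)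
  thus ?thesis
    by (simp add: vec8_eq matrix_vector_mult_def sum_option gamma_def dot_def sum_negf mult.commute)
qed

lemma gamma_add: "gamma (u + v) = gamma u + gamma v"
  and gamma_scaleR: "gamma (r *\<^sub>R u) = r *\<^sub>R gamma u"
  and gamma_minus: "gamma (- u) = - gamma u"
  and gamma_0: "gamma 0 = 0"
  and gamma_diff: "gamma (u - v) = gamma u - gamma v"
proof -
  show 1: "gamma (u + v) = gamma u + gamma v" for u v
    by (simp add: gamma_def vec_eq_iff distrib_left sum.distrib split: option.split)
  show 2: "gamma (r *\<^sub>R u) = r *\<^sub>R gamma u" for r u
    by (simp add: gamma_def vec_eq_iff sum_distrib_left mult.left_commute split: option.split)
  show 3: "gamma (- u) = - gamma u" for u using 2[of "-1" u] by simp
  show "gamma 0 = 0" using 2[of 0 0] by simp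
  show "gamma (u - v) = gamma u - gamma v" using 1[of u "-v"] by (simp add: 3)
qed

lemma linear_gamma: "linear gamma"
  by (rule linearI) (simp_all add: gamma_add gamma_scaleR)

lemma matrix_minus_mult [simp]:
  "(- A) ** B = - (A ** B)" "A ** (- B) = - (A ** B :: 'a::ring_1^'n^'m)"
  by (simp_all add: matrix_matrix_mult_def vec_eq_iff sum_negf)

lemma matrix_diff_distrib: 
  "(A - B) ** C = A ** C - B ** C" "C ** (A - B) = C ** A - C ** (B :: 'a::ring_1^'n^'m)"
  by (simp_all add: matrix_matrix_mult_def vec_eq_iff sum_subtractf algebra_simps)

lemma scaleR_matrix_vector: "(r *\<^sub>R A) *v x = r *\<^sub>R (A *v x)" for A :: "'a::real_normed_field^'n^'m"
  by (simp add: matrix_vector_mult_def vec_eq_iff scaleR_right.sum)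

lemma gamma_gamma_pack: "gamma u *v (gamma v *v pack f w) =
    pack (- (f * dot u v) - dot u (cross v w)) (f *s cross u v + cross u (cross v w) - dot v w *s u)"
  unfolding gamma_pack pack_eq_iff cross_skew[of v u] 
  by (simp add: dot_bilinear cross_bilinear)

lemma clifford_relation: "gamma u ** gamma v + gamma v ** gamma u = (- 2 * dot u v) *\<^sub>R mat 1"
proof (rule mat8_eqI)
  fix f :: real and w
  have 1: "dot v (cross u w) = - dot u (cross v w)"
    unfolding dot_7 cross_nth by (simp add: algebra_simps)
  have 2: "cross v (cross u w) = dot u w *s v + dot v w *s u - (2 * dot u v) *s w - cross u (cross v w)"
    using cross_cross[of u v w] by (metis add_diff_cancel_left')
  show "(gamma u ** gamma v + gamma v ** gamma u) *v pack f w = ((- 2 * dot u v) *\<^sub>R mat 1) *v pack f w"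
    unfolding matrix_vector_mult_add_rdistrib matrix_vector_mul_assoc[symmetric] gamma_gamma_pack
       scaleR_matrix_vector matrix_vector_mul_lid pack_add pack_scaleR pack_eq_iff 1 2 cross_skew[of v u]
    by (simp add: dot_commute[of v u] scalar_mult_eq_scaleR algebra_simps)
qed

lemma gamma_square: "gamma u ** gamma u = - (dot u u *\<^sub>R mat 1)"
proof -
  have "2 *\<^sub>R (gamma u ** gamma u) = 2 *\<^sub>R (- (dot u u *\<^sub>R mat 1))"
    unfolding scaleR_2 clifford_relation by (simp flip: scaleR_2)
  thus ?thesis unfolding scaleR_cancel_left by simp
qed

lemma dot_inner: "dot u v = u \<bullet> v" for u v :: "real^7"
  by (simp add: dot_def inner_vec_def)

lemma octonion_sign_cross: "octonion_sign a b c = cross (axis a 1) (axis b 1) $ c"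
  by (simp add: cross_def axis_def if_distrib[of "\<lambda>x. _ * x"] if_distrib[of "\<lambda>x. x * _"] cong: if_cong)

lemma dot_axis [simp]: "dot (axis c 1) v = v $ c" "dot v (axis c 1) = v $ c"
  by (simp_all add: dot_def axis_def if_distrib[of "\<lambda>x. _ * x"] if_distrib[of "\<lambda>x. x * _"] cong: if_cong)

lemma octonion_sign_cyclic: "octonion_sign a b c = octonion_sign b c a"
  using dot_cross_cyclic[of "axis c 1" "axis a 1" "axis b (1::real)"]
    dot_cross_cyclic[of "axis a 1" "axis b 1" "axis c (1::real)"]
  by (simp add: octonion_sign_cross)

lemma octonion_sign_skew: "octonion_sign b a c = - octonion_sign a b c" "octonion_sign a c b = - octonion_sign a b c"
proof -
  show *: "octonion_sign b a c = - octonion_sign a b c" for a b c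
    using cross_skew[of "axis b 1" "axis a (1::real)"] by (simp add: octonion_sign_cross)
  show "octonion_sign a c b = - octonion_sign a b c"
    by (metis * octonion_sign_cyclic)
qed

lemma transpose_gamma: "transpose (gamma u) = - gamma u"
proof -
  have "transpose (gamma u) $ i $ j = (- gamma u) $ i $ j" for i j
  proof (cases i; cases j)
    fix c b assume "i = Some c" "j = Some b"
    moreover have "(\<Sum>a\<in>UNIV. octonion_sign a c b * u $ a) = - (\<Sum>a\<in>UNIV. octonion_sign a b c * u $ a)"
      by (subst octonion_sign_skew(2)) (simp add: sum_negf)
    ultimately show ?thesis by (simp add: gamma_def transpose_def)
  qed (simp_all add: gamma_def transpose_def)
  thus ?thesis by (simp add: vec_eq_iff)
qed

lemmas matrix_mult_sum_left = bounded_bilinear.sum_left[OF bounded_bilinear_matrix_mult]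
lemmas matrix_mult_sum_right = bounded_bilinear.sum_right[OF bounded_bilinear_matrix_mult]

abbreviation gb :: "7 \<Rightarrow> real_mat8" where "gb a \<equiv> gamma (axis a 1)"

lemma gamma_expand: "gamma u = (\<Sum>a\<in>UNIV. u $ a *\<^sub>R gb a)"
proof -
  have "u = (\<Sum>a\<in>UNIV. u $ a *\<^sub>R axis a 1)" 
    using basis_expansion[of u] by (simp add: scalar_mult_eq_scaleR)
  hence "gamma u = gamma (\<Sum>a\<in>UNIV. u $ a *\<^sub>R axis a 1)" by simp
  thus ?thesis by (simp add: linear_sum[OF linear_gamma] gamma_scaleR)
qed

text \<open>
  Explicit vectors on which products of gamma matrices can be evaluated by rewriting.
\<close>

definition vec7 :: "'a \<Rightarrow> 'a \<Rightarrow> 'a \<Rightarrow> 'a \<Rightarrow> 'a \<Rightarrow> 'a \<Rightarrow> 'a \<Rightarrow> 'a^7" where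
  "vec7 x0 x1 x2 x3 x4 x5 x6 = (\<chi> i. if i = 0 then x0 else if i = 1 then x1 else if i = 2 then x2
     else if i = 3 then x3 else if i = 4 then x4 else if i = 5 then x5 else x6)"

lemma vec7_nth [simp]: "vec7 x0 x1 x2 x3 x4 x5 x6 $ 0 = x0" "vec7 x0 x1 x2 x3 x4 x5 x6 $ 1 = x1"
  "vec7 x0 x1 x2 x3 x4 x5 x6 $ 2 = x2" "vec7 x0 x1 x2 x3 x4 x5 x6 $ 3 = x3"
  "vec7 x0 x1 x2 x3 x4 x5 x6 $ 4 = x4" "vec7 x0 x1 x2 x3 x4 x5 x6 $ 5 = x5" "vec7 x0 x1 x2 x3 x4 x5 x6 $ 6 = x6"
  by (simp_all add: vec7_def)

lemma vec7_collect: "v = vec7 (v $ 0) (v $ 1) (v $ 2) (v $ 3) (v $ 4) (v $ 5) (v $ 6)"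
  by (simp add: vec_eq_7)

lemma axis7_nth: "axis a x $ b = (if a = b then x else 0)" for a b :: 7
  by (simp add: axis_def)

lemma gb_pack:
  "gb 0 *v pack f (vec7 x0 x1 x2 x3 x4 x5 x6) = pack x0 (vec7 (- f) (x3) (x6) (- x1) (x5) (- x4) (- x2))"
  "gb 1 *v pack f (vec7 x0 x1 x2 x3 x4 x5 x6) = pack x1 (vec7 (- x3) (- f) (x4) (x0) (- x2) (x6) (- x5))"
  "gb 2 *v pack f (vec7 x0 x1 x2 x3 x4 x5 x6) = pack x2 (vec7 (- x6) (- x4) (- f) (x5) (x1) (- x3) (x0))"
  "gb 3 *v pack f (vec7 x0 x1 x2 x3 x4 x5 x6) = pack x3 (vec7 (x1) (- x0) (- x5) (- f) (x6) (x2) (- x4))"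
  "gb 4 *v pack f (vec7 x0 x1 x2 x3 x4 x5 x6) = pack x4 (vec7 (- x5) (x2) (- x1) (- x6) (- f) (x0) (x3))"
  "gb 5 *v pack f (vec7 x0 x1 x2 x3 x4 x5 x6) = pack x5 (vec7 (x4) (- x6) (x3) (- x2) (- x0) (- f) (x1))"
  "gb 6 *v pack f (vec7 x0 x1 x2 x3 x4 x5 x6) = pack x6 (vec7 (x2) (x5) (- x0) (x4) (- x3) (- x1) (- f))"
  unfolding gamma_pack pack_eq_iff dot_axis vec_eq_7 vector_minus_component uminus_vec_def
  by (simp_all add: cross_nth axis7_nth)

text \<open>
  Along a line of the Fano plane the product of three gamma matrices is a diagonal involution; together these involutions separate the
  coordinates of \<open>\<real>\<^sup>8\<close>.
\<close>

lemma gamma_triple: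
  "gb 1 *v (gb 2 *v (gb 4 *v pack f (vec7 x0 x1 x2 x3 x4 x5 x6))) = pack f (vec7 (-x0) x1 x2 (-x3) x4 (-x5) (-x6))"
  "gb 2 *v (gb 3 *v (gb 5 *v pack f (vec7 x0 x1 x2 x3 x4 x5 x6))) = pack f (vec7 (-x0) (-x1) x2 x3 (-x4) x5 (-x6))"
  "gb 3 *v (gb 4 *v (gb 6 *v pack f (vec7 x0 x1 x2 x3 x4 x5 x6))) = pack f (vec7 (-x0) (-x1) (-x2) x3 x4 (-x5) x6)"
  "gb 6 *v (gb 0 *v (gb 2 *v pack f (vec7 x0 x1 x2 x3 x4 x5 x6))) = pack f (vec7 x0 (-x1) x2 (-x3) (-x4) (-x5) x6)"
  by (simp_all add: gb_pack)

text \<open>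
  The involutions of the previous lemma fix the unit spinor \<open>pack 1 0\<close>, so they multiply its image under \<open>g\<close> by \<open>s\<close>. Their common
  fixed space is the line of the unit spinor, and there is no common eigenvector for -1. The gamma matrices carry the unit spinor to all others,
  which determines \<open>g\<close>.
\<close>

lemma gamma_commutant:
  fixes g :: real_mat8
  assumes s: "s \<in> {1, -1}" and g: "\<And>a. g ** gb a = s *\<^sub>R (gb a ** g)"
  shows "s = 1 \<Longrightarrow> \<exists>c. g = c *\<^sub>R mat 1" and "s = -1 \<Longrightarrow> g = 0"
proof -
  obtain f v where fv: "g *v pack 1 0 = pack f v" by (rule pack_exhaust)
  have move: "g *v (gb a *v x) = s *\<^sub>R (gb a *v (g *v x))" for a x
    using arg_cong[OF g[of a], of "\<lambda>M. M *v x"]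
    by (simp add: matrix_vector_mul_assoc[symmetric] scaleR_matrix_vector_assoc[symmetric])
  have three: "g *v (gb a *v (gb b *v (gb c *v x))) = s *\<^sub>R (gb a *v (gb b *v (gb c *v (g *v x))))" for a b c x
    unfolding move matrix_vector_mult_scaleR using s by auto
  have e0: "pack 1 0 = pack (1::real) (vec7 0 0 0 0 0 0 0)" by (simp add: vec_eq_7)
  have line: "gb a *v (gb b *v (gb c *v pack 1 0)) = pack 1 0 \<Longrightarrow> 
    pack f v = s *\<^sub>R (gb a *v (gb b *v (gb c *v pack f v)))" for a b c
    using three[of a b c "pack 1 0"] fv by simp
  obtain x0 x1 x2 x3 x4 x5 x6 where x: "v = vec7 x0 x1 x2 x3 x4 x5 x6" using vec7_collect by blast
  note l = line[of 1 2 4] line[of 2 3 5] line[of 3 4 6] line[of 6 0 2]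
  have fs: "f = s * f" using l(1) unfolding e0 x gamma_triple pack_scaleR pack_eq_iff by simp
  have v0: "v = 0"
  proof (cases "s = 1")
    case True
    show ?thesis
      using l unfolding e0 x gamma_triple pack_scaleR pack_eq_iff True vec_eq_7 by simp
  next
    case False
    hence s1: "s = -1" using s by simp
    show ?thesis
      using l unfolding e0 x gamma_triple pack_scaleR pack_eq_iff s1 vec_eq_7 by simp
  qed
  have all: "g *v pack x w = f *\<^sub>R pack x (s *\<^sub>R w)" for x w
  proof -
    have 1: "pack x w = x *\<^sub>R pack 1 0 - gamma w *v pack 1 0"
      by (simp add: gamma_pack pack_scaleR pack_diff dot_bilinear cross_bilinear)
    have "g *v (gamma w *v pack 1 0) = s *\<^sub>R (gamma w *v (g *v pack 1 0))"
    proof -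
      have "g ** gamma w = s *\<^sub>R (gamma w ** g)"
        unfolding gamma_expand[of w] matrix_mult_sum_left matrix_mult_sum_right matrix_scaleR_mult g scaleR_right.sum
        by (simp add: mult.commute)
      from arg_cong[OF this, of "\<lambda>M. M *v pack 1 0"] show ?thesis 
        by (simp only: matrix_vector_mul_assoc scaleR_matrix_vector)
    qed
    hence 2: "g *v (gamma w *v pack 1 0) = s *\<^sub>R pack 0 (- (f *s w))"
      by (simp add: fv v0 gamma_pack dot_bilinear cross_bilinear)
    have "g *v pack x w = x *\<^sub>R (g *v pack 1 0) - g *v (gamma w *v pack 1 0)"
      unfolding 1 matrix_vector_mult_diff_distrib by (simp only: matrix_vector_mult_scaleR)
    thus ?thesis unfolding 2 fv v0 pack_scaleR pack_diff pack_eq_iff 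
      by (simp add: scalar_mult_eq_scaleR mult.commute)
  qed
  show "s = 1 \<Longrightarrow> \<exists>c. g = c *\<^sub>R mat 1"
    by (intro exI[of _ f] mat8_eqI) (simp add: all scaleR_matrix_vector_assoc[symmetric])
  show "s = -1 \<Longrightarrow> g = 0"
    using fs by (intro mat8_eqI) (simp add: all)
qed

section \<open>The double cover of SO(7)\<close>

lemma dot_scaleR: "dot (r *\<^sub>R u) v = r * dot u v" "dot u (r *\<^sub>R v) = r * dot u v" for u v :: "real^7"
  by (simp_all add: dot_7 algebra_simps)

lemma axis_nth_real [simp]: "axis i (1::'a::zero_neq_one) $ j = (if i = j then 1 else 0)"
  by (simp add: axis_def)

definition skew :: "'a::ring_1^'n^'n \<Rightarrow> bool" where "skew A \<longleftrightarrow> transpose A = - A"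

lemma skew_nth: "skew A \<longleftrightarrow> (\<forall>i j. A $ i $ j = - A $ j $ i)"
  by (auto simp: skew_def transpose_def vec_eq_iff)

lemma skewD: "skew A \<Longrightarrow> A $ i $ j = - A $ j $ i"
  unfolding skew_nth by blast

lemma transpose_add: "transpose (A + B) = transpose A + transpose B"
  and transpose_minus: "transpose (- A) = - transpose A"
  and transpose_diff: "transpose (A - B) = transpose A - transpose B" for A B :: "'a::ring_1^'n^'m"
  by (simp_all add: transpose_def vec_eq_iff)

lemma transpose_scaleR: "transpose (r *\<^sub>R A) = r *\<^sub>R transpose A" for A :: "'a::real_vector^'n^'m"
  by (simp add: transpose_def vec_eq_iff)

lemma transpose_sum: "transpose (\<Sum>i\<in>I. f i) = (\<Sum>i\<in>I. transpose (f i :: 'a::comm_monoid_add^'n^'m))"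
  by (induction I rule: infinite_finite_induct) (auto simp: transpose_def vec_eq_iff)

lemma linear_transpose: "linear (transpose :: 'a::real_normed_field^'n^'m \<Rightarrow> _)"
  by (rule linearI) (simp_all add: transpose_def vec_eq_iff)

lemma skew_add: "skew A \<Longrightarrow> skew B \<Longrightarrow> skew (A + B)"
  and skew_scaleR: "skew C \<Longrightarrow> skew (r *\<^sub>R C)"
  and skew_bracket: "skew D \<Longrightarrow> skew E \<Longrightarrow> skew (bracket D E)"
  for A B :: "'a::ring_1^'n^'n" and C :: "'c::real_algebra_1^'n^'n" and D E :: "'b::comm_ring_1^'n^'n"
  by (simp_all add: skew_def transpose_add transpose_scaleR bracket_def transpose_diff matrix_transpose_mul
      matrix_mul_assoc matrix_minus_mult)

text \<open>
  The isomorphism from skew 7 by 7 matrices onto spin(7) that inverts the adjoint action on the gamma matrices.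
\<close>

definition spin :: "real^7^7 \<Rightarrow> real_mat8" where
  "spin A = (- (1/4)) *\<^sub>R (\<Sum>a\<in>UNIV. \<Sum>b\<in>UNIV. A $ a $ b *\<^sub>R (gb a ** gb b))"

lemma spin_add: "spin (A + B) = spin A + spin B"
  and spin_scaleR: "spin (r *\<^sub>R A) = r *\<^sub>R spin A"
  by (simp_all add: spin_def scaleR_left_distrib sum.distrib scaleR_right_distrib scaleR_right.sum mult.commute)

lemma linear_spin: "linear spin"
  by (rule linearI) (simp_all add: spin_add spin_scaleR)

lemmas spin_minus = linear_neg[OF linear_spin]
lemmas spin_diff = linear_diff[OF linear_spin]
lemmas spin_0 = linear_0[OF linear_spin]

lemma gamma_swap: "gamma u ** gamma v = (- 2 * dot u v) *\<^sub>R mat 1 - gamma v ** gamma u"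
  using clifford_relation[of u v] by (simp add: eq_diff_eq)

lemma bracket_gamma_gamma: 
  "bracket (gamma u ** gamma v) (gamma w) = gamma ((2 * dot u w) *\<^sub>R v - (2 * dot v w) *\<^sub>R u)"
proof -
  have "gamma u ** gamma v ** gamma w = gamma u ** (gamma v ** gamma w)" by (simp add: matrix_mul_assoc)
  also have "\<dots> = (- 2 * dot v w) *\<^sub>R gamma u - gamma u ** gamma w ** gamma v"
    by (subst gamma_swap[of v w]) (simp add: matrix_diff_distrib matrix_mul_assoc)
  also have "gamma u ** gamma w ** gamma v = (- 2 * dot u w) *\<^sub>R gamma v - gamma w ** gamma u ** gamma v"
    by (subst gamma_swap[of u w]) (simp add: matrix_diff_distrib matrix_mul_assoc)
  finally show ?thesis
    by (simp add: bracket_def gamma_diff gamma_scaleR matrix_mul_assoc)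
qed

lemma bracket_add_left: "bracket (A + B) C = bracket A C + bracket B C"
  and bracket_add_right: "bracket C (A + B) = bracket C A + bracket C B"
  and bracket_diff_left: "bracket (A - B) C = bracket A C - bracket B C"
  for A B C :: "'a::comm_ring_1^'n^'n"
  by (simp_all add: bracket_def matrix_add_ldistrib matrix_add_rdistrib matrix_diff_distrib)

lemma bracket_scaleR: "bracket (r *\<^sub>R A) C = r *\<^sub>R bracket A C" "bracket C (r *\<^sub>R A) = r *\<^sub>R bracket C A"
  for A C :: "'a::real_algebra_1^'n^'n"
  by (simp_all add: bracket_def scaleR_diff_right)

lemma linear_bracket: "linear (\<lambda>A. bracket A C)" "linear (bracket C)" for C :: "'a::real_normed_field^'n^'n"
  by (auto intro!: linearI simp: bracket_add_left bracket_add_right bracket_scaleR)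

lemma spin_gamma:
  assumes "skew A" shows "bracket (spin A) (gamma u) = gamma (A *v u)"
proof -
  have "bracket (spin A) (gamma u) = (- (1/4)) *\<^sub>R (\<Sum>a\<in>UNIV. \<Sum>b\<in>UNIV. A $ a $ b *\<^sub>R bracket (gb a ** gb b) (gamma u))"
    unfolding spin_def by (simp only: linear_sum[OF linear_bracket(1)] bracket_scaleR)
  also have "\<dots> = (- (1/4)) *\<^sub>R ((\<Sum>a\<in>UNIV. \<Sum>b\<in>UNIV. (2 * A $ a $ b * u $ a) *\<^sub>R gb b) - 
      (\<Sum>a\<in>UNIV. \<Sum>b\<in>UNIV. (2 * A $ a $ b * u $ b) *\<^sub>R gb a))"
    by (simp add: bracket_gamma_gamma gamma_diff gamma_scaleR scaleR_diff_right sum_subtractf algebra_simps)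
  also have "(\<Sum>a\<in>UNIV. \<Sum>b\<in>UNIV. (2 * A $ a $ b * u $ a) *\<^sub>R gb b) = (\<Sum>b\<in>UNIV. \<Sum>a\<in>UNIV. (2 * A $ a $ b * u $ a) *\<^sub>R gb b)"
    by (rule sum.swap)
  also have "\<dots> = (\<Sum>b\<in>UNIV. \<Sum>a\<in>UNIV. - ((2 * A $ b $ a * u $ a) *\<^sub>R gb b))"
    by (intro sum.cong refl) (subst skewD[OF assms], simp)
  also have "(- (1/4)) *\<^sub>R (\<dots> - (\<Sum>a\<in>UNIV. \<Sum>b\<in>UNIV. (2 * A $ a $ b * u $ b) *\<^sub>R gb a))
     = (\<Sum>a\<in>UNIV. \<Sum>b\<in>UNIV. (A $ a $ b * u $ b) *\<^sub>R gb a)"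
    by (simp add: sum_negf scaleR_right.sum flip: scaleR_2)
  also have "\<dots> = gamma (A *v u)"
    by (subst gamma_expand) (simp add: matrix_vector_mult_def scaleR_left.sum)
  finally show ?thesis .
qed

lemma bracket_mult: "bracket X (Y ** Z) = bracket X Y ** Z + Y ** bracket X Z" for X :: "'a::comm_ring_1^'n^'n"
  by (simp add: bracket_def matrix_diff_distrib matrix_mul_assoc)

lemma spin_double: "(\<Sum>a\<in>UNIV. \<Sum>b\<in>UNIV. A $ a $ b *\<^sub>R (gb a ** gb b)) = - 4 *\<^sub>R spin A"
  by (simp add: spin_def)

lemma gamma_mult_expand:
  fixes S T :: "real^7^7"
  shows "(\<Sum>a\<in>UNIV. \<Sum>b\<in>UNIV. B $ a $ b *\<^sub>R (gamma (S *v axis a 1) ** gamma (T *v axis b 1))) = - 4 *\<^sub>R spin (S ** B ** transpose T)"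
proof -
  have g: "gamma (S *v axis a 1) = (\<Sum>c\<in>UNIV. S $ c $ a *\<^sub>R gb c)" for S :: "real^7^7" and a
    by (subst gamma_expand) (simp add: matrix_vector_mult_def axis_def if_distrib cong: if_cong)
  have "(\<Sum>a\<in>UNIV. \<Sum>b\<in>UNIV. B $ a $ b *\<^sub>R (gamma (S *v axis a 1) ** gamma (T *v axis b 1))) = 
     (\<Sum>a\<in>UNIV. \<Sum>b\<in>UNIV. \<Sum>c\<in>UNIV. \<Sum>d\<in>UNIV. (S $ c $ a * B $ a $ b * T $ d $ b) *\<^sub>R (gb c ** gb d))"
  proof (intro sum.cong refl)
    fix a b
    have "B $ a $ b *\<^sub>R (gamma (S *v axis a 1) ** gamma (T *v axis b 1)) = 
      (\<Sum>c\<in>UNIV. B $ a $ b *\<^sub>R (S $ c $ a *\<^sub>R (gb c ** (\<Sum>d\<in>UNIV. T $ d $ b *\<^sub>R gb d))))"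
      unfolding g[of S a] g[of T b] by (simp only: matrix_mult_sum_left scaleR_right.sum matrix_scaleR_mult)
    also have "\<dots> = (\<Sum>c\<in>UNIV. \<Sum>d\<in>UNIV. (S $ c $ a * B $ a $ b * T $ d $ b) *\<^sub>R (gb c ** gb d))"
      by (simp add: matrix_mult_sum_right scaleR_right.sum mult_ac)
    finally show "B $ a $ b *\<^sub>R (gamma (S *v axis a 1) ** gamma (T *v axis b 1)) = \<dots>" .
  qed
  also have "\<dots> = (\<Sum>a\<in>UNIV. \<Sum>c\<in>UNIV. \<Sum>b\<in>UNIV. \<Sum>d\<in>UNIV. (S $ c $ a * B $ a $ b * T $ d $ b) *\<^sub>R (gb c ** gb d))"
    by (rule sum.cong[OF refl], rule sum.swap)
  also have "\<dots> = (\<Sum>c\<in>UNIV. \<Sum>a\<in>UNIV. \<Sum>b\<in>UNIV. \<Sum>d\<in>UNIV. (S $ c $ a * B $ a $ b * T $ d $ b) *\<^sub>R (gb c ** gb d))"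
    by (rule sum.swap)
  also have "\<dots> = (\<Sum>c\<in>UNIV. \<Sum>a\<in>UNIV. \<Sum>d\<in>UNIV. \<Sum>b\<in>UNIV. (S $ c $ a * B $ a $ b * T $ d $ b) *\<^sub>R (gb c ** gb d))"
    by (rule sum.cong[OF refl], rule sum.cong[OF refl], rule sum.swap)
  also have "\<dots> = (\<Sum>c\<in>UNIV. \<Sum>d\<in>UNIV. \<Sum>a\<in>UNIV. \<Sum>b\<in>UNIV. (S $ c $ a * B $ a $ b * T $ d $ b) *\<^sub>R (gb c ** gb d))"
    by (rule sum.cong[OF refl], rule sum.swap)
  also have "\<dots> = (\<Sum>c\<in>UNIV. \<Sum>d\<in>UNIV. (S ** B ** transpose T) $ c $ d *\<^sub>R (gb c ** gb d))"
    by (intro sum.cong refl, subst sum.swap)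
       (simp add: matrix_matrix_mult_def transpose_def sum_distrib_right flip: scaleR_left.sum)
  finally show ?thesis by (simp only: spin_double)
qed

text \<open>
  Bracketing with \<open>spin A\<close> is a derivation that sends \<open>gamma u\<close> to \<open>gamma (A *v u)\<close>, so it acts on \<open>spin B\<close> through both indices of \<open>B\<close>.
\<close>

lemma spin_bracket:
  assumes A: "skew A" and B: "skew B"
  shows "bracket (spin A) (spin B) = spin (bracket A B)"
proof -
  have "bracket (spin A) (spin B) = (- (1/4)) *\<^sub>R (\<Sum>a\<in>UNIV. \<Sum>b\<in>UNIV. B $ a $ b *\<^sub>R bracket (spin A) (gb a ** gb b))"
    unfolding spin_def[of B] by (simp only: linear_sum[OF linear_bracket(2)] bracket_scaleR)
  also have "\<dots> = (- (1/4)) *\<^sub>R ((\<Sum>a\<in>UNIV. \<Sum>b\<in>UNIV. B $ a $ b *\<^sub>R (gamma (A *v axis a 1) ** gamma (mat 1 *v axis b 1))) +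
      (\<Sum>a\<in>UNIV. \<Sum>b\<in>UNIV. B $ a $ b *\<^sub>R (gamma (mat 1 *v axis a 1) ** gamma (A *v axis b 1))))"
    by (simp add: bracket_mult spin_gamma[OF A] scaleR_right_distrib sum.distrib)
  also have "\<dots> = spin (A ** B + B ** transpose A)"
    unfolding gamma_mult_expand scaleR_right_distrib by (simp add: spin_add transpose_mat)
  finally show ?thesis using A by (simp add: skew_def bracket_def)
qed

lemma gamma_column: "gamma w $ Some a $ None = - (w $ a)"
  by (simp add: gamma_def)

lemma transpose_spin: "transpose (spin A) = spin (transpose A)"
proof -
  have "transpose (spin A) = (- (1/4)) *\<^sub>R (\<Sum>a\<in>UNIV. \<Sum>b\<in>UNIV. A $ a $ b *\<^sub>R (gb b ** gb a))"
    unfolding spin_def by (simp only: transpose_scaleR transpose_sum matrix_transpose_mul transpose_gamma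
        matrix_minus_mult minus_minus)
  also have "(\<Sum>a\<in>UNIV. \<Sum>b\<in>UNIV. A $ a $ b *\<^sub>R (gb b ** gb a)) = (\<Sum>b\<in>UNIV. \<Sum>a\<in>UNIV. A $ a $ b *\<^sub>R (gb b ** gb a))"
    by (rule sum.swap)
  finally show ?thesis by (simp add: spin_def transpose_def)
qed

definition covers :: "real_mat8 \<Rightarrow> real^7^7 \<Rightarrow> bool" where
  "covers g T \<longleftrightarrow> g ** transpose g = mat 1 \<and> (\<forall>u. g ** gamma u = gamma (T *v u) ** g)"

lemma covers_conj_gamma: "covers g T \<Longrightarrow> g ** gamma u ** transpose g = gamma (T *v u)"
  by (simp add: covers_def matrix_mul_assoc[symmetric])

lemma covers_conj_spin:
  assumes "covers g T"
  shows "g ** spin A ** transpose g = spin (T ** A ** transpose T)"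
proof -
  have gg: "transpose g ** g = mat 1" using assms by (simp add: covers_def matrix_left_right_inverse)
  have "g ** (gb a ** gb b) ** transpose g = (g ** gb a ** transpose g) ** (g ** gb b ** transpose g)" for a b
  proof -
    have "(g ** gb a ** transpose g) ** (g ** gb b ** transpose g) = g ** gb a ** (transpose g ** g) ** gb b ** transpose g"
      by (simp only: matrix_mul_assoc)
    thus ?thesis unfolding gg by (simp add: matrix_mul_assoc)
  qed
  hence c: "g ** (gb a ** gb b) ** transpose g = gamma (T *v axis a 1) ** gamma (T *v axis b 1)" for a b
    by (simp add: covers_conj_gamma[OF assms])
  have "g ** spin A ** transpose g = (- (1/4)) *\<^sub>R (\<Sum>a\<in>UNIV. \<Sum>b\<in>UNIV. A $ a $ b *\<^sub>R (g ** (gb a ** gb b) ** transpose g))"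
    unfolding spin_def by (simp add: matrix_mult_sum_left matrix_mult_sum_right)
  thus ?thesis unfolding c gamma_mult_expand by simp
qed

text \<open>
  Intertwining preserves anticommutators, which are scalars by the Clifford relation.
\<close>

lemma inner_preserved:
  fixes G :: real_mat8
  assumes "G \<noteq> 0" "G ** gamma u = gamma u' ** G" "G ** gamma v = gamma v' ** G"
  shows "dot u v = dot u' v'"
proof -
  have "G ** (gamma u ** gamma v + gamma v ** gamma u) = (gamma u' ** gamma v' + gamma v' ** gamma u') ** G"
    by (simp add: matrix_add_ldistrib matrix_add_rdistrib matrix_mul_assoc assms(2,3))
       (simp add: assms(2,3) flip: matrix_mul_assoc)
  thus ?thesis unfolding clifford_relation using assms(1) by simp
qed

text \<open>
  Conjugation by a unit vector is, up to sign, the reflection in its orthogonal hyperplane.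
\<close>

lemma reflection_gamma:
  assumes "norm u = 1"
  shows "gamma u ** gamma w = gamma ((2 * dot u w) *\<^sub>R u - w) ** gamma u"
proof -
  have "dot u u = 1" using assms by (simp add: dot_inner dot_square_norm)
  thus ?thesis
    by (subst gamma_swap) (simp add: gamma_diff gamma_scaleR matrix_diff_distrib gamma_square)
qed

text \<open>
  Products of \<open>k\<close> unit vectors; the count \<open>k\<close> carries the parity that distinguishes Spin(7) inside the pin group.
\<close>

inductive pin :: "nat \<Rightarrow> real_mat8 \<Rightarrow> bool" where
  pin_0: "pin 0 (mat 1)"
| pin_Suc: "pin k h \<Longrightarrow> norm u = 1 \<Longrightarrow> pin (Suc k) (gamma u ** h)"

lemma pin_parity: 
  "pin k h \<Longrightarrow> (even k \<longrightarrow> h \<in> Spin7) \<and> (odd k \<longrightarrow> (\<exists>u h'. norm u = 1 \<and> h' \<in> Spin7 \<and> h = gamma u ** h'))"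
proof (induction rule: pin.induct)
  case (pin_Suc k h u)
  thus ?case by (auto simp: matrix_mul_assoc intro: Spin7.step)
qed (auto intro: Spin7.one)

lemma Spin7_mult: "g \<in> Spin7 \<Longrightarrow> h \<in> Spin7 \<Longrightarrow> g ** h \<in> Spin7"
proof (induction rule: Spin7.induct)
  case (step g u v)
  hence "gamma u ** gamma v ** (g ** h) \<in> Spin7" using Spin7.step by blast
  thus ?case by (simp only: matrix_mul_assoc)
qed simp

lemma pin_orthogonal: "pin k h \<Longrightarrow> h ** transpose h = mat 1"
proof (induction rule: pin.induct)
  case (pin_Suc k h u)
  have "gamma u ** h ** transpose (gamma u ** h) = gamma u ** (h ** transpose h) ** transpose (gamma u)"
    by (simp add: matrix_transpose_mul matrix_mul_assoc)
  thus ?case using pin_Suc by (simp add: transpose_gamma gamma_square dot_inner dot_square_norm)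
qed simp

lemma pin_covers: "pin k h \<Longrightarrow> \<exists>w. h ** gamma u = gamma w ** h"
proof (induction arbitrary: u rule: pin.induct)
  case (pin_Suc k h v)
  then obtain w where "h ** gamma u = gamma w ** h" by blast
  hence "gamma v ** h ** gamma u = gamma v ** gamma w ** h" by (simp flip: matrix_mul_assoc)
  also have "\<dots> = gamma ((2 * dot v w) *\<^sub>R v - w) ** (gamma v ** h)"
    by (simp add: reflection_gamma[OF pin_Suc(2), of w] matrix_mul_assoc)
  finally show ?case by blast
qed auto

lemma Spin7_pin: "g \<in> Spin7 \<Longrightarrow> \<exists>k. pin k g"
proof (induction rule: Spin7.induct)
  case (step g u v)
  then obtain k where "pin k g" by blast
  hence "pin (Suc (Suc k)) (gamma u ** (gamma v ** g))" using step by (intro pin_Suc)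
  thus ?case by (auto simp: matrix_mul_assoc)
qed (auto intro: pin_0)

definition vecrep :: "real_mat8 \<Rightarrow> real^7^7" where
  "vecrep g = (\<chi> a b. - (g ** gb b ** transpose g) $ Some a $ None)"

lemma Spin7_orthogonal: "g \<in> Spin7 \<Longrightarrow> g ** transpose g = mat 1"
  using Spin7_pin pin_orthogonal by blast

lemma Spin7_orthogonal': "g \<in> Spin7 \<Longrightarrow> transpose g ** g = mat 1"
  using Spin7_orthogonal matrix_left_right_inverse by blast

lemma Spin7_covers: assumes "g \<in> Spin7" shows "covers g (vecrep g)"
proof -
  obtain k where k: "pin k g" using Spin7_pin assms by blast
  have o: "g ** transpose g = mat 1" by (rule Spin7_orthogonal[OF assms])
  have o': "transpose g ** g = mat 1" by (rule Spin7_orthogonal'[OF assms])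
  have b: "g ** gb b ** transpose g = gamma (vecrep g *v axis b 1)" for b
  proof -
    obtain w where w: "g ** gb b = gamma w ** g" using pin_covers[OF k] by blast
    hence "g ** gb b ** transpose g = gamma w ** (g ** transpose g)" by (simp only: matrix_mul_assoc)
    hence "g ** gb b ** transpose g = gamma w" by (simp add: o)
    moreover from this have "vecrep g *v axis b 1 = w"
      by (simp add: vec_eq_iff matrix_vector_mult_basis column_def vecrep_def gamma_column)
    ultimately show ?thesis by simp
  qed
  have "g ** gamma u ** transpose g = gamma (vecrep g *v u)" for u
  proof -
    have "g ** gamma u ** transpose g = (\<Sum>a\<in>UNIV. u $ a *\<^sub>R gamma (vecrep g *v axis a 1))"
      by (subst gamma_expand) (simp add: matrix_mult_sum_left matrix_mult_sum_right b)
    also have "\<dots> = gamma (vecrep g *v (\<Sum>a\<in>UNIV. u $ a *\<^sub>R axis a 1))"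
      by (simp add: linear_sum[OF linear_gamma] gamma_scaleR matrix_vector_mult_scaleR 
          linear_sum[OF matrix_vector_mul_linear])
    also have "(\<Sum>a\<in>UNIV. u $ a *\<^sub>R axis a 1) = u"
      using basis_expansion[of u] by (simp add: scalar_mult_eq_scaleR)
    finally show ?thesis .
  qed
  hence "gamma (vecrep g *v u) ** g = g ** gamma u ** (transpose g ** g)" for u
    by (simp only: matrix_mul_assoc)
  hence "g ** gamma u = gamma (vecrep g *v u) ** g" for u
    by (simp add: o')
  thus ?thesis using o by (simp add: covers_def)
qed

lemma Spin7_transpose: "g \<in> Spin7 \<Longrightarrow> transpose g \<in> Spin7"
proof (induction rule: Spin7.induct)
  case (step g u v)
  have "gamma v ** gamma u ** mat 1 \<in> Spin7" using step by (intro Spin7.step Spin7.one)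
  hence "transpose g ** (gamma v ** gamma u ** mat 1) \<in> Spin7" using step Spin7_mult by blast
  moreover have "transpose (gamma u ** gamma v ** g) = transpose g ** (gamma v ** gamma u ** mat 1)"
    by (simp add: matrix_transpose_mul transpose_gamma)
  ultimately show ?case by simp
qed (simp add: Spin7.one)

lemma Spin7_neg: "g \<in> Spin7 \<Longrightarrow> - g \<in> Spin7"
proof -
  assume g: "g \<in> Spin7"
  have n: "norm (axis 0 1 :: real^7) = 1" by simp
  have "gb 0 ** gb 0 ** g \<in> Spin7" by (rule Spin7.step[OF g n n])
  thus ?thesis by (simp add: gamma_square axis7_nth)
qed

lemma orthogonal_nonzero: "(G :: real_mat8) ** transpose G = mat 1 \<Longrightarrow> G \<noteq> 0"
proof
  assume "G ** transpose G = mat 1" "G = 0"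
  hence "mat 1 = (0 :: real_mat8)" by (simp add: matrix_matrix_mult_def vec_eq_iff)
  hence "(mat 1 :: real_mat8) $ None $ None = 0" by simp
  thus False by (simp add: mat_def)
qed

text \<open>
  The Cartan-Dieudonne argument: one reflection for each basis vector moves the image of that vector back to the vector
  without disturbing those already fixed.
\<close>

lemma pin_straighten:
  fixes g :: real_mat8
  assumes o: "g ** transpose g = mat 1" and c: "\<And>u. \<exists>w. g ** gamma u = gamma w ** g"
  shows "finite S \<Longrightarrow> \<exists>k h. pin k h \<and> (\<forall>a\<in>S. (h ** g) ** gb a = (-1)^k *\<^sub>R (gb a ** (h ** g)))"
proof (induction rule: finite_induct)
  case empty show ?case by (auto intro: pin_0)
next
  case (insert j S)
  then obtain k h where h: "pin k h" and S: "\<And>a. a \<in> S \<Longrightarrow> (h ** g) ** gb a = (-1)^k *\<^sub>R (gb a ** (h ** g))"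
    by blast
  define G where "G = h ** g"
  define s :: real where "s = (-1)^k"
  have s: "s * s = 1" by (simp add: s_def flip: power_add)
  have "G ** transpose G = h ** (g ** transpose g) ** transpose h"
    by (simp add: G_def matrix_transpose_mul matrix_mul_assoc)
  hence G0: "G \<noteq> 0" using o pin_orthogonal[OF h] orthogonal_nonzero by simp
  obtain w' where "g ** gb j = gamma w' ** g" using c by blast
  moreover obtain w where "h ** gamma w' = gamma w ** h" using pin_covers[OF h] by blast
  ultimately have w: "G ** gb j = gamma w ** G" unfolding G_def matrix_mul_assoc[symmetric, of h g]
    by (simp only: matrix_mul_assoc)
  define f where "f = s *\<^sub>R w"
  have wf: "w = s *\<^sub>R f" using s by (simp add: f_def)
  have S': "G ** gb a = gamma (s *\<^sub>R axis a 1) ** G" if "a \<in> S" for a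
    using S[OF that] by (simp add: G_def s_def gamma_scaleR)
  have ff: "dot f f = 1"
    using inner_preserved[OF G0 w w] s by (simp add: f_def dot_scaleR)
  have fS: "f $ a = 0" if "a \<in> S" for a
  proof -
    have "dot (axis j 1) (axis a 1) = dot w (s *\<^sub>R axis a (1::real))" by (rule inner_preserved[OF G0 w S'[OF that]])
    moreover have "j \<noteq> a" using that insert by auto
    ultimately show ?thesis by (auto simp: f_def dot_scaleR s_def)
  qed
  show ?case
  proof (cases "f = axis j 1")
    case True
    hence "G ** gb j = s *\<^sub>R (gb j ** G)" using w wf by (simp add: gamma_scaleR)
    thus ?thesis using h S by (intro exI[of _ k] exI[of _ h]) (auto simp: G_def s_def)
  next
    case False
    (* The reflection along f - e_j exchanges f and e_j; its sign is absorbed into the parity of k. *)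
    define u where "u = (f - axis j 1) /\<^sub>R norm (f - axis j 1)"
    have u: "norm u = 1" using False by (simp add: u_def)
    have n2: "(norm (f - axis j 1))\<^sup>2 = 2 * (1 - f $ j)"
      using ff unfolding power2_norm_eq_inner dot_inner[symmetric] by (simp add: dot_bilinear)
    have n0: "norm (f - axis j 1) \<noteq> 0" using False by simp
    have refl_f: "(2 * dot u f) *\<^sub>R u - f = - axis j 1"
    proof -
      have "dot u f = (1 - f $ j) / norm (f - axis j 1)"
        using ff by (simp add: u_def dot_scaleR dot_bilinear divide_inverse)
      hence "2 * dot u f * inverse (norm (f - axis j 1)) = (2 * (1 - f $ j)) * (inverse (norm (f - axis j 1)))\<^sup>2"
        by (simp only: divide_inverse power2_eq_square mult.assoc)
      also have "\<dots> = 1" unfolding n2[symmetric] using n0 by (simp flip: power_mult_distrib)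
      finally have "2 * dot u f * inverse (norm (f - axis j 1)) = 1" .
      hence "(2 * dot u f) *\<^sub>R u = 1 *\<^sub>R (f - axis j 1)" using n0 by (simp add: u_def)
      thus ?thesis by simp
    qed
    have "(gamma u ** h ** g) ** gb a = (-1)^Suc k *\<^sub>R (gb a ** (gamma u ** h ** g))" if "a \<in> insert j S" for a
    proof (cases "a = j")
      case True
      have "gamma u ** h ** g ** gb a = gamma u ** (G ** gb j)" by (simp add: True G_def matrix_mul_assoc)
      also have "\<dots> = s *\<^sub>R (gamma u ** gamma f ** G)" by (simp add: w wf gamma_scaleR matrix_mul_assoc)
      also have "gamma u ** gamma f = - (gb j ** gamma u)" 
        using reflection_gamma[OF u, of f] by (simp add: refl_f gamma_minus)
      finally show ?thesis by (simp add: True G_def s_def matrix_mul_assoc)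
    next
      case False
      hence aS: "a \<in> S" using that by simp
      have "gamma u ** h ** g ** gb a = gamma u ** (G ** gb a)" by (simp add: G_def matrix_mul_assoc)
      also have "\<dots> = s *\<^sub>R (gamma u ** gb a ** G)" by (simp add: S'[OF aS] gamma_scaleR matrix_mul_assoc)
      also have "dot u (axis a 1) = 0" using fS[OF aS] False by (auto simp: u_def dot_scaleR)
      hence "gamma u ** gb a = - (gb a ** gamma u)" 
        using reflection_gamma[OF u, of "axis a 1"] by (simp add: gamma_minus)
      finally show ?thesis by (simp add: G_def s_def matrix_mul_assoc)
    qed
    thus ?thesis using pin_Suc[OF h u] by blast
  qed
qed

text \<open>
  After straightening, the matrix commutes or anticommutes with all gamma matrices. An anticommuting one would be zero, so it commutes and is a
  scalar, and orthogonality makes the scalar \<open>\<plusminus>1\<close>. This recognises exponentials as elements of Spin(7).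
\<close>

lemma normalizer_Spin7:
  fixes g :: real_mat8
  assumes o: "g ** transpose g = mat 1" and c: "\<And>u. \<exists>w. g ** gamma u = gamma w ** g"
  shows "g \<in> Spin7"
proof -
  obtain k h where h: "pin k h" and a: "\<And>a. (h ** g) ** gb a = (-1)^k *\<^sub>R (gb a ** (h ** g))"
    using pin_straighten[OF o c, of UNIV] by auto
  define G where "G = h ** g"
  have GG: "G ** transpose G = mat 1"
  proof -
    have "G ** transpose G = h ** (g ** transpose g) ** transpose h"
      by (simp add: G_def matrix_transpose_mul matrix_mul_assoc)
    thus ?thesis using o pin_orthogonal[OF h] by simp
  qed
  have ev: "even k"
  proof (rule ccontr)
    assume "odd k"
    hence "G = 0" using gamma_commutant(2)[of "-1" G] a by (simp add: G_def)
    thus False using orthogonal_nonzero[OF GG] by simp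
  qed
  then obtain r where r: "G = r *\<^sub>R mat 1" using gamma_commutant(1)[of 1 G] a by (auto simp: G_def)
  have "r * r = 1" 
  proof -
    have "(r * r) *\<^sub>R (mat 1 :: real_mat8) = mat 1" using GG unfolding r by (simp add: transpose_scaleR transpose_mat)
    hence "((r * r) *\<^sub>R (mat 1 :: real_mat8)) $ None $ None = (mat 1 :: real_mat8) $ None $ None" by (rule arg_cong)
    thus ?thesis by (simp add: mat_def)
  qed
  hence "r = 1 \<or> r = -1" by (simp add: square_eq_1_iff)
  have hS: "transpose h \<in> Spin7" using pin_parity[OF h] ev Spin7_transpose by blast
  have "transpose h ** h = mat 1" using pin_orthogonal[OF h] matrix_left_right_inverse by blast
  hence "g = transpose h ** G" by (simp add: G_def matrix_mul_assoc)
  hence "g = r *\<^sub>R transpose h" by (simp add: r)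
  thus ?thesis using \<open>r = 1 \<or> r = -1\<close> hS Spin7_neg by auto
qed

section \<open>The Lie algebras spin(7) and g2 and the Killing form\<close>

lemma has_derivative_mexp_0: "((\<lambda>t. mexp (t *\<^sub>R A)) has_vector_derivative A) (at 0)"
  using mexp_has_vector_derivative[of A 0] by simp

lemma transpose_mexp_skew:
  assumes "skew (X :: real^'n^'n)"
  shows "transpose (mexp (t *\<^sub>R X)) = mexp (t *\<^sub>R (- X))"
proof -
  have bl: "bounded_linear (transpose :: real^'n^'n \<Rightarrow> _)"
    using linear_transpose linear_conv_bounded_linear by blast
  have "((\<lambda>t. transpose (mexp (t *\<^sub>R X))) has_vector_derivative (- X) ** transpose (mexp (t *\<^sub>R X))) (at t)" for t
  proof -
    have "((\<lambda>t. transpose (mexp (t *\<^sub>R X))) has_vector_derivative transpose (X ** mexp (t *\<^sub>R X))) (at t)"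
      by (rule bounded_linear.has_vector_derivative[OF bl mexp_has_vector_derivative])
    moreover have "transpose (X ** mexp (t *\<^sub>R X)) = (- X) ** transpose (mexp (t *\<^sub>R X))"
      using assms unfolding mexp_commute matrix_transpose_mul skew_def by simp
    ultimately show ?thesis by simp
  qed
  from linear_ode_unique[OF this, of t] show ?thesis by (simp add: transpose_mat)
qed

text \<open>
  Both sides of the intertwining relation solve the same linear differential equation.
\<close>

lemma mexp_spin_covers:
  assumes "skew A" shows "covers (mexp (t *\<^sub>R spin A)) (mexp (t *\<^sub>R A))"
proof -
  have sk: "skew (spin A)" using assms by (simp add: skew_def transpose_spin spin_minus)
  have "mexp (t *\<^sub>R spin A) ** transpose (mexp (t *\<^sub>R spin A)) = mat 1"
    unfolding transpose_mexp_skew[OF sk] using mexp_minus(1)[of "t *\<^sub>R spin A"] by simp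
  moreover have "mexp (t *\<^sub>R spin A) ** gamma u = gamma (mexp (t *\<^sub>R A) *v u) ** mexp (t *\<^sub>R spin A)" for u
  proof -
    define Y where "Y t = gamma (mexp (t *\<^sub>R A) *v u) ** mexp (t *\<^sub>R spin A)" for t
    have "(Y has_vector_derivative spin A ** Y t) (at t)" for t
    proof -
      have v: "((\<lambda>t. mexp (t *\<^sub>R A) *v u) has_vector_derivative A ** mexp (t *\<^sub>R A) *v u) (at t)"
        by (rule bounded_linear.has_vector_derivative[OF bounded_bilinear.bounded_linear_left[OF
            bounded_bilinear_matrix_vector_mult] mexp_has_vector_derivative])
      have bl: "bounded_linear gamma" using linear_gamma linear_conv_bounded_linear by blast
      have "(Y has_vector_derivative gamma (mexp (t *\<^sub>R A) *v u) ** (spin A ** mexp (t *\<^sub>R spin A)) +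
         gamma (A ** mexp (t *\<^sub>R A) *v u) ** mexp (t *\<^sub>R spin A)) (at t)"
        unfolding Y_def
        by (intro has_vector_derivative_matrix_mult bounded_linear.has_vector_derivative[OF bl v]
            mexp_has_vector_derivative)
      moreover have "gamma (A ** mexp (t *\<^sub>R A) *v u) = 
         spin A ** gamma (mexp (t *\<^sub>R A) *v u) - gamma (mexp (t *\<^sub>R A) *v u) ** spin A"
        using spin_gamma[OF assms, of "mexp (t *\<^sub>R A) *v u"] 
        by (simp add: bracket_def matrix_vector_mul_assoc)
      ultimately show ?thesis by (simp add: Y_def matrix_diff_distrib matrix_mul_assoc)
    qed
    from linear_ode_unique[OF this, of t] show ?thesis by (simp add: Y_def)
  qed
  ultimately show ?thesis by (simp add: covers_def)
qed

lemma covers_Spin7: "covers g T \<Longrightarrow> g \<in> Spin7"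
  using normalizer_Spin7[of g] unfolding covers_def by blast

lemma spin_in_spin7: "skew A \<Longrightarrow> spin A \<in> spin7"
  unfolding spin7_def lie_algebra_def matrix_exp_mexp
  using mexp_spin_covers covers_Spin7 by blast

text \<open>
  Differentiating the orthogonality and covering relations of \<open>mexp (t X)\<close> at \<open>t = 0\<close> gives a skew \<open>A\<close> such that \<open>X - spin A\<close> commutes with
  every gamma matrix. It is then scalar, and it is skew, so it vanishes.
\<close>

lemma spin7_is_spin:
  assumes X: "X \<in> spin7" obtains A where "skew A" "X = spin A"
proof -
  have E: "mexp (t *\<^sub>R X) \<in> Spin7" for t
    using X by (simp add: spin7_def lie_algebra_def matrix_exp_mexp)
  have bl: "bounded_linear (transpose :: real_mat8 \<Rightarrow> _)"
    using linear_transpose linear_conv_bounded_linear by blast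
  have dE: "((\<lambda>t. mexp (t *\<^sub>R X)) has_vector_derivative X) (at 0)" by (rule has_derivative_mexp_0)
  have dT: "((\<lambda>t. transpose (mexp (t *\<^sub>R X))) has_vector_derivative transpose X) (at 0)"
    by (rule bounded_linear.has_vector_derivative[OF bl dE])
  have "((\<lambda>t. mexp (t *\<^sub>R X) ** transpose (mexp (t *\<^sub>R X))) has_vector_derivative
      mexp (0 *\<^sub>R X) ** transpose X + X ** transpose (mexp (0 *\<^sub>R X))) (at 0)"
    by (rule has_vector_derivative_matrix_mult[OF dE dT])
  moreover have "mexp (t *\<^sub>R X) ** transpose (mexp (t *\<^sub>R X)) = mat 1" for t
    by (rule Spin7_orthogonal[OF E])
  ultimately have "((\<lambda>t. mat 1) has_vector_derivative transpose X + X) (at (0::real))" 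
    by (simp add: transpose_mat)
  hence "transpose X + X = 0"
    by (rule vector_derivative_unique_at) (rule has_vector_derivative_const)
  hence tX: "transpose X = - X" by (simp add: add_eq_0_iff2)
  (* P is linear and vanishes on all matrices gamma w, so the derivative of a path of such matrices is again of this form. *)
  define P where "P M = M + gamma (\<chi> a. M $ Some a $ None)" for M :: real_mat8
  have linP: "linear P" 
    by (rule linearI) (simp_all add: P_def vec_eq_iff gamma_def algebra_simps sum.distrib sum_distrib_left
        split: option.split)
  have Pg: "P (gamma w) = 0" for w
  proof -
    have "(\<chi> a. gamma w $ Some a $ None) = - w" by (simp add: gamma_column vec_eq_iff)
    thus ?thesis by (simp add: P_def gamma_minus)
  qed
  define A where "A = (\<chi> c b. - (bracket X (gb b)) $ Some c $ None)"
  have br: "bracket X (gb b) = gamma (A *v axis b 1)" for b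
  proof -
    have "((\<lambda>t. mexp (t *\<^sub>R X) ** gb b ** transpose (mexp (t *\<^sub>R X))) has_vector_derivative
      mexp (0 *\<^sub>R X) ** gb b ** transpose X + (mexp (0 *\<^sub>R X) ** 0 + X ** gb b) ** transpose (mexp (0 *\<^sub>R X))) (at 0)"
      by (intro has_vector_derivative_matrix_mult dE dT has_vector_derivative_const)
    hence "((\<lambda>t. mexp (t *\<^sub>R X) ** gb b ** transpose (mexp (t *\<^sub>R X))) has_vector_derivative
        bracket X (gb b)) (at 0)" by (simp add: transpose_mat tX bracket_def)
    from bounded_linear.has_vector_derivative[OF linP[unfolded linear_conv_bounded_linear] this]
    have "((\<lambda>t. 0) has_vector_derivative P (bracket X (gb b))) (at (0::real))"
      by (simp add: covers_conj_gamma[OF Spin7_covers[OF E]] Pg)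
    hence "P (bracket X (gb b)) = 0"
      by (rule vector_derivative_unique_at) (rule has_vector_derivative_const)
    hence "bracket X (gb b) = gamma (- (\<chi> a. bracket X (gb b) $ Some a $ None))"
      unfolding P_def gamma_minus by (simp add: eq_neg_iff_add_eq_0)
    also have "- (\<chi> a. bracket X (gb b) $ Some a $ None) = A *v axis b 1"
      by (simp add: vec_eq_iff matrix_vector_mult_basis column_def A_def)
    finally show ?thesis .
  qed
  have sk: "skew A"
  proof -
    have "A $ a $ b = - A $ b $ a" for a b
    proof -
      have "bracket X (gb a ** gb b + gb b ** gb a) = 0"
        unfolding clifford_relation by (simp add: bracket_def)
      hence "(gamma (A *v axis a 1) ** gb b + gb b ** gamma (A *v axis a 1)) + 
          (gb a ** gamma (A *v axis b 1) + gamma (A *v axis b 1) ** gb a) = 0"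
        by (simp add: bracket_add_right bracket_mult br algebra_simps)
      hence "(- 2 * (dot (A *v axis a 1) (axis b 1) + dot (axis a 1) (A *v axis b 1))) *\<^sub>R (mat 1 :: real_mat8) = 0"
        by (simp only: clifford_relation scaleR_left_distrib distrib_left)
      moreover have "(mat 1 :: real_mat8) \<noteq> 0" by (auto simp: vec_eq_iff mat_def)
      ultimately show ?thesis by (simp add: matrix_vector_mult_basis column_def)
    qed
    thus ?thesis unfolding skew_nth by blast
  qed
  have "(X - spin A) ** gb a = 1 *\<^sub>R (gb a ** (X - spin A))" for a
    using br[of a] spin_gamma[OF sk, of "axis a 1"] 
    by (simp add: bracket_def matrix_diff_distrib) (simp add: algebra_simps)
  then obtain c where c: "X - spin A = c *\<^sub>R mat 1" using gamma_commutant(1)[of 1 "X - spin A"] by auto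
  have "transpose (X - spin A) = - (X - spin A)" 
    using sk by (simp add: transpose_diff tX transpose_spin skew_def spin_minus)
  hence "c *\<^sub>R (mat 1 :: real_mat8) = - (c *\<^sub>R mat 1)" unfolding c by (simp add: transpose_scaleR transpose_mat)
  hence "c *\<^sub>R (mat 1 :: real_mat8) + c *\<^sub>R mat 1 = 0" by (simp add: eq_neg_iff_add_eq_0)
  hence "(c + c) *\<^sub>R (mat 1 :: real_mat8) = 0" by (simp only: scaleR_left_distrib)
  moreover have "(mat 1 :: real_mat8) \<noteq> 0" by (rule orthogonal_nonzero) (simp add: transpose_mat)
  ultimately have "c = 0" by simp
  hence "X = spin A" using c by simp
  thus ?thesis using sk that by blast
qed

lemma spin7_eq: "spin7 = spin ` {A. skew A}"
  by (auto simp: spin_in_spin7 elim!: spin7_is_spin)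

text \<open>
  The equivariant projection of a bivector to \<open>\<real>\<^sup>7\<close>; its kernel on skew matrices is g2.
\<close>

definition contract :: "'a::real_normed_field^7^7 \<Rightarrow> 'a^7" where
  "contract L = (\<chi> c. \<Sum>a\<in>UNIV. \<Sum>b\<in>UNIV. of_real (octonion_sign a b c) * L $ a $ b)"

lemma gamma_gamma_unit: "gb a *v (gb b *v pack 1 0) = pack (- (if a = b then 1 else 0)) (cross (axis a 1) (axis b 1))"
  unfolding gamma_gamma_pack by (simp add: dot_bilinear cross_bilinear)

lemma sum_pack: "(\<Sum>i\<in>I. pack (f i) (v i)) = pack (sum f I) (sum v I)" for f :: "_ \<Rightarrow> 'a::ring_1"
  by (induction I rule: infinite_finite_induct) (simp_all add: pack_add vec8_eq)

lemma sum_matrix_vector: "(\<Sum>i\<in>I. f i) *v x = (\<Sum>i\<in>I. f i *v x)" for f :: "_ \<Rightarrow> 'a::{real_normed_field,euclidean_space}^'n^'m"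
  by (rule bounded_bilinear.sum_left[OF bounded_bilinear_matrix_vector_mult])

lemma spin_unit:
  assumes "skew L" shows "spin L *v pack 1 0 = pack 0 (- (1/4) *\<^sub>R contract L)"
proof -
  have "spin L *v pack 1 0 = (- (1/4)) *\<^sub>R (\<Sum>a\<in>UNIV. \<Sum>b\<in>UNIV. L $ a $ b *\<^sub>R pack (- (if a = b then 1 else 0)) (cross (axis a 1) (axis b 1)))"
    unfolding spin_def scaleR_matrix_vector sum_matrix_vector 
    by (simp only: matrix_vector_mul_assoc[symmetric] gamma_gamma_unit)
  also have "\<dots> = pack ((1/4) * (\<Sum>a\<in>UNIV. L $ a $ a)) (- (1/4) *\<^sub>R (\<Sum>a\<in>UNIV. \<Sum>b\<in>UNIV. L $ a $ b *\<^sub>R cross (axis a 1) (axis b 1)))"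
    unfolding pack_scaleR sum_pack pack_eq_iff by (simp add: sum_negf if_distrib cong: if_cong)
  also have "(\<Sum>a\<in>UNIV. L $ a $ a) = 0" using assms by (intro sum.neutral) (metis skewD equal_neg_zero)
  also have "(\<Sum>a\<in>UNIV. \<Sum>b\<in>UNIV. L $ a $ b *\<^sub>R cross (axis a 1) (axis b 1)) = contract L"
    by (simp add: contract_def vec_eq_iff octonion_sign_cross mult.commute)
  finally show ?thesis by simp
qed

lemma unit_axis: "axis None 1 = (pack 1 0 :: 'a::zero_neq_one^(7 option))"
  by (auto simp: vec8_eq axis_def)

text \<open>
  The spinor \<open>pack 1 0\<close> is fixed by the one-parameter group of \<open>spin L\<close> if and only if \<open>spin L\<close> annihilates it.
\<close>

lemma g2_eq: "g2 = spin ` {L. skew L \<and> contract L = 0}"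
proof -
  have "X \<in> g2 \<longleftrightarrow> X \<in> spin7 \<and> X *v pack 1 0 = 0" for X
  proof -
    have "(\<forall>t. mexp (t *\<^sub>R X) *v pack 1 0 = pack 1 0) \<longleftrightarrow> X *v pack 1 0 = 0"
    proof
      assume f: "\<forall>t. mexp (t *\<^sub>R X) *v pack 1 0 = pack 1 0"
      have "((\<lambda>t. mexp (t *\<^sub>R X) *v pack 1 0) has_vector_derivative X *v pack 1 0) (at 0)"
        by (rule bounded_linear.has_vector_derivative[OF bounded_bilinear.bounded_linear_left[OF
            bounded_bilinear_matrix_vector_mult] has_derivative_mexp_0])
      hence "((\<lambda>t. pack 1 0) has_vector_derivative X *v pack 1 0) (at (0::real))" using f by simp
      thus "X *v pack 1 0 = 0" by (rule vector_derivative_unique_at) (rule has_vector_derivative_const)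
    next
      assume z: "X *v pack 1 0 = 0"
      have "((\<lambda>t. mexp (t *\<^sub>R X) *v pack 1 0) has_vector_derivative 0) (at t)" for t
      proof -
        have "((\<lambda>t. mexp (t *\<^sub>R X) *v pack 1 0) has_vector_derivative (X ** mexp (t *\<^sub>R X)) *v pack 1 0) (at t)"
          by (rule bounded_linear.has_vector_derivative[OF bounded_bilinear.bounded_linear_left[OF
              bounded_bilinear_matrix_vector_mult] mexp_has_vector_derivative])
        thus ?thesis unfolding mexp_commute by (simp add: z flip: matrix_vector_mul_assoc)
      qed
      then obtain c where c: "\<And>t. mexp (t *\<^sub>R X) *v pack 1 0 = c"
        using has_vector_derivative_zero_constant[of UNIV "\<lambda>t. mexp (t *\<^sub>R X) *v pack 1 0"] by auto
      from c[of 0] have "c = pack 1 0" by simp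
      with c show "\<forall>t. mexp (t *\<^sub>R X) *v pack 1 0 = pack 1 0" by simp
    qed
    thus ?thesis by (auto simp: g2_def spin7_def lie_algebra_def G2_def matrix_exp_mexp unit_axis)
  qed
  moreover have "spin L *v pack 1 0 = 0 \<longleftrightarrow> contract L = 0" if "skew L" for L
    unfolding spin_unit[OF that] by (auto simp: vec8_eq vec_eq_iff)
  ultimately have "X \<in> g2 \<longleftrightarrow> (\<exists>L. skew L \<and> X = spin L \<and> contract L = 0)" for X
    unfolding spin7_eq image_iff mem_Collect_eq Bex_def by metis
  thus ?thesis by (simp add: set_eq_iff image_iff) metis
qed

text \<open>
  Traces over a subspace are defined with an arbitrary basis; a frame with a dual family of functionals computes them without choosing one.
\<close>

lemma trace_on_frame:
  fixes f :: "'v::euclidean_space \<Rightarrow> 'v" and d :: "'i \<Rightarrow> 'v \<Rightarrow> real"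
  assumes W: "subspace W" and f: "linear f" "\<And>w. w \<in> W \<Longrightarrow> f w \<in> W" and fin: "finite I"
    and b: "\<And>i. i \<in> I \<Longrightarrow> b i \<in> W" and d: "\<And>i. i \<in> I \<Longrightarrow> linear (d i)"
    and frame: "\<And>w. w \<in> W \<Longrightarrow> (\<Sum>i\<in>I. d i w *\<^sub>R b i) = w"
  shows "trace_on W f = (\<Sum>i\<in>I. d i (f (b i)))"
proof -
  define B where "B = (SOME B. independent B \<and> span B = W)"
  have "\<exists>B. independent B \<and> span B = W"
    using basis_exists[of W] W by (metis span_eq_iff span_mono subset_antisym)
  hence B: "independent B" "span B = W" unfolding B_def by (metis (mono_tags, lifting) someI_ex)+
  have finB: "finite B" using B(1) by (rule independent_imp_finite)
  have BW: "c \<in> B \<Longrightarrow> c \<in> W" for c using B(2) span_superset by blast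
  have "trace_on W f = (\<Sum>c\<in>B. representation B (f c) c)"
    unfolding trace_on_def B_def Let_def ..
  also have "\<dots> = (\<Sum>c\<in>B. \<Sum>i\<in>I. d i (f c) * representation B (b i) c)"
  proof (intro sum.cong refl)
    fix c assume c: "c \<in> B"
    have "representation B (f c) = representation B (\<Sum>i\<in>I. d i (f c) *\<^sub>R b i)"
      using frame[OF f(2)[OF BW[OF c]]] by simp
    also have "\<dots> = (\<lambda>x. \<Sum>i\<in>I. representation B (d i (f c) *\<^sub>R b i) x)"
      using B b W by (intro representation_sum) (auto intro: subspace_scale)
    also have "\<dots> = (\<lambda>x. \<Sum>i\<in>I. d i (f c) * representation B (b i) x)"
      using B b by (intro ext sum.cong refl) (simp add: representation_scale)
    finally show "representation B (f c) c = (\<Sum>i\<in>I. d i (f c) * representation B (b i) c)" by simp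
  qed
  also have "\<dots> = (\<Sum>i\<in>I. \<Sum>c\<in>B. d i (f c) * representation B (b i) c)" by (rule sum.swap)
  also have "\<dots> = (\<Sum>i\<in>I. d i (f (b i)))"
  proof (intro sum.cong refl)
    fix i assume i: "i \<in> I"
    have "b i = (\<Sum>c\<in>B. representation B (b i) c *\<^sub>R c)"
      using sum_representation_eq[OF B(1) _ finB subset_refl] b[OF i] B(2) by simp
    hence "d i (f (b i)) = d i (f (\<Sum>c\<in>B. representation B (b i) c *\<^sub>R c))" by simp
    also have "\<dots> = (\<Sum>c\<in>B. representation B (b i) c *\<^sub>R d i (f c))"
      by (simp add: linear_sum[OF f(1)] linear_scale[OF f(1)] linear_sum[OF d[OF i]] linear_scale[OF d[OF i]])
    finally show "(\<Sum>c\<in>B. d i (f c) * representation B (b i) c) = d i (f (b i))" by (simp add: mult.commute)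
  qed
  finally show ?thesis .
qed

text \<open>
  A linear extension to all matrices of the inverse of \<open>spin\<close>.
\<close>

definition vecmat :: "real_mat8 \<Rightarrow> real^7^7" where
  "vecmat X = (\<chi> c b. - (bracket X (gb b)) $ Some c $ None)"

lemma linear_vecmat: "linear vecmat"
  by (rule linearI) (simp_all add: vecmat_def vec_eq_iff bracket_add_left bracket_scaleR)

lemma vecmat_spin [simp]: "skew A \<Longrightarrow> vecmat (spin A) = A"
  by (simp add: vecmat_def spin_gamma gamma_column vec_eq_iff matrix_vector_mult_basis column_def)

definition elem :: "7 \<Rightarrow> 7 \<Rightarrow> 'a::ring_1^7^7" where
  "elem a b = (\<chi> i j. (if i = a \<and> j = b then 1 else 0) - (if i = b \<and> j = a then 1 else 0))"

lemma skew_elem: "skew (elem a b)"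
  unfolding skew_nth
proof (intro allI)
  fix i j show "elem a b $ i $ j = - elem a b $ j $ i"
    unfolding elem_def vec_lambda_beta minus_diff_eq by (simp only: conj_commute)
qed

lemma subspace_spin7: "subspace spin7"
  unfolding spin7_eq by (rule linear_subspace_image[OF linear_spin])
    (auto simp: subspace_def skew_add skew_scaleR, simp add: skew_def transpose_def vec_eq_iff)

lemma sum_sum_delta:
  fixes g :: "'i::finite \<Rightarrow> 'j::finite \<Rightarrow> 'a::comm_monoid_add"
  shows "(\<Sum>a\<in>UNIV. \<Sum>b\<in>UNIV. if a = i then if b = j then g a b else 0 else 0) = g i j"
proof -
  have "(\<Sum>b\<in>UNIV. if a = i then if b = j then g a b else 0 else 0) = (if a = i then g a j else 0)" for a
    by (cases "a = i") simp_all
  thus ?thesis by simp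
qed

lemma skew_frame:
  fixes A :: "real^7^7"
  assumes "skew A" shows "(\<Sum>a\<in>UNIV. \<Sum>b\<in>UNIV. (A $ a $ b / 2) *\<^sub>R elem a b) = A"
proof -
  have "(\<Sum>a\<in>UNIV. \<Sum>b\<in>UNIV. (A $ a $ b / 2) * elem a b $ i $ j) = A $ i $ j" for i j
  proof -
    have "(\<Sum>a\<in>UNIV. \<Sum>b\<in>UNIV. (A $ a $ b / 2) * elem a b $ i $ j) = 
      (\<Sum>a\<in>UNIV. \<Sum>b\<in>UNIV. (A $ a $ b / 2) * (if a = i then if b = j then 1 else 0 else 0)) - 
      (\<Sum>a\<in>UNIV. \<Sum>b\<in>UNIV. (A $ a $ b / 2) * (if a = j then if b = i then 1 else 0 else 0))"
      unfolding sum_subtractf[symmetric] by (intro sum.cong refl) (simp add: elem_def right_diff_distrib)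
    also have "\<dots> = A $ i $ j / 2 - A $ j $ i / 2"
      by (simp add: if_distrib[of "\<lambda>x. _ * x"] sum_sum_delta cong: if_cong)
    finally show ?thesis using skewD[OF assms, of j i] by simp
  qed
  thus ?thesis by (simp add: vec_eq_iff)
qed

text \<open>
  The trace is computed over the redundant frame of elementary bivectors. The constant is \<open>2 - 7 = -5\<close>, from the Killing form \<open>(n - 2) tr (A B)\<close> of so(n).
\<close>

lemma killing_spin:
  assumes A: "skew A" and B: "skew B"
  shows "killing (spin A) (spin B) = - 5 * (\<Sum>a\<in>UNIV. \<Sum>b\<in>UNIV. A $ a $ b * B $ a $ b)"
proof -
  define d where "d = (\<lambda>(a, b) X. vecmat X $ a $ b / 2)"
  define e where "e = (\<lambda>(a, b). spin (elem a b))"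
  have "killing (spin A) (spin B) = (\<Sum>i\<in>UNIV. d i (bracket (spin A) (bracket (spin B) (e i))))"
    unfolding killing_def
  proof (rule trace_on_frame[OF subspace_spin7])
    show "linear (\<lambda>Z. bracket (spin A) (bracket (spin B) Z))"
      using linear_compose[OF linear_bracket(2) linear_bracket(2)] by (simp add: o_def)
    show "bracket (spin A) (bracket (spin B) w) \<in> spin7" if "w \<in> spin7" for w
      using that A B by (auto simp: spin7_eq spin_bracket skew_bracket intro!: imageI)
    show "e i \<in> spin7" for i by (auto simp: e_def spin7_eq skew_elem split: prod.split)
    show "linear (d i)" for i
    proof -
      obtain a b where i: "i = (a, b)" by force
      show ?thesis
        by (rule linearI) (simp_all add: i d_def linear_add[OF linear_vecmat] linear_scale[OF linear_vecmat] add_divide_distrib)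
    qed
    fix w assume "w \<in> spin7"
    then obtain C where C: "skew C" "w = spin C" by (auto simp: spin7_eq)
    have "(\<Sum>i\<in>UNIV. d i w *\<^sub>R e i) = (\<Sum>a\<in>UNIV. \<Sum>b\<in>UNIV. (C $ a $ b / 2) *\<^sub>R spin (elem a b))"
      unfolding sum.cartesian_product using C by (simp add: d_def e_def case_prod_unfold)
    also have "\<dots> = spin (\<Sum>a\<in>UNIV. \<Sum>b\<in>UNIV. (C $ a $ b / 2) *\<^sub>R elem a b)"
      by (simp add: linear_sum[OF linear_spin] spin_scaleR)
    finally show "(\<Sum>i\<in>UNIV. d i w *\<^sub>R e i) = w" by (simp add: skew_frame[OF C(1)] C(2))
  qed simp
  also have "\<dots> = (\<Sum>a\<in>UNIV. \<Sum>b\<in>UNIV. d (a, b) (bracket (spin A) (bracket (spin B) (e (a, b)))))"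
    unfolding sum.cartesian_product by simp
  also have "\<dots> = (\<Sum>a\<in>UNIV. \<Sum>b\<in>UNIV. bracket A (bracket B (elem a b)) $ a $ b / 2)"
    by (intro sum.cong refl) (simp add: d_def e_def spin_bracket A B skew_elem skew_bracket)
  also have "\<dots> = (\<Sum>a\<in>UNIV. \<Sum>b\<in>UNIV. ((A ** B) $ a $ a - (A ** B) $ a $ b * (if a = b then 1 else 0)
      - (A $ a $ a * B $ b $ b - A $ a $ b * B $ a $ b) - (B $ a $ a * A $ b $ b - B $ a $ b * A $ a $ b)
      + (B ** A) $ b $ b - (if a = b then 1 else 0) * (B ** A) $ a $ b) / 2)"
  proof -
    have 0: "(M ** elem a b) $ i $ k = (if k = b then M $ i $ a else 0) - (if k = a then M $ i $ b else 0)"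
      for M :: "real^7^7" and a b i k
    proof -
      have "(M ** elem a b) $ i $ k = (\<Sum>l\<in>UNIV. (if l = a then (if k = b then M $ i $ a else 0) else 0) -
          (if l = b then (if k = a then M $ i $ b else 0) else 0))"
        unfolding matrix_matrix_mult_def vec_lambda_beta elem_def by (intro sum.cong refl) (auto simp: right_diff_distrib)
      thus ?thesis by (simp add: sum_subtractf)
    qed
    have 1: "(M ** elem a b) $ a $ b = M $ a $ a - M $ a $ b * (if a = b then 1 else 0)" for M :: "real^7^7" and a b
      unfolding 0 by auto
    have 2: "(M ** elem a b ** N) $ a $ b = M $ a $ a * N $ b $ b - M $ a $ b * N $ a $ b" for M N :: "real^7^7" and a b
    proof -
      have "(M ** elem a b ** N) $ a $ b = (\<Sum>k\<in>UNIV. (M ** elem a b) $ a $ k * N $ k $ b)"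
        by (simp add: matrix_matrix_mult_def)
      thus ?thesis unfolding 0 by (simp add: left_diff_distrib sum_subtractf if_distrib[of "\<lambda>x. x * _"] cong: if_cong)
    qed
    have 3: "(elem a b ** M) $ a $ b = M $ b $ b - (if a = b then 1 else 0) * M $ a $ b" for M :: "real^7^7" and a b
      using 2[of "mat 1" a b M] unfolding matrix_mul_lid by (auto simp: mat_def)
    note 1 = 1 2 3
    have eq: "bracket A (bracket B (elem a b)) = (A ** B) ** elem a b - A ** elem a b ** B - B ** elem a b ** A + elem a b ** (B ** A)" for a b
      by (simp add: bracket_def matrix_diff_distrib matrix_mul_assoc)
    show ?thesis unfolding eq vector_minus_component vector_add_component 1
      by (intro sum.cong refl) (simp add: algebra_simps)
  qed
  also have "\<dots> = - 5 * (\<Sum>a\<in>UNIV. \<Sum>b\<in>UNIV. A $ a $ b * B $ a $ b)"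
  proof -
    have z: "A $ a $ a = 0" "B $ a $ a = 0" for a
      using skewD[OF A, of a a] skewD[OF B, of a a] by simp_all
    have AB: "(A ** B) $ a $ a = - (\<Sum>b\<in>UNIV. A $ a $ b * B $ a $ b)" 
      "(B ** A) $ a $ a = - (\<Sum>b\<in>UNIV. A $ a $ b * B $ a $ b)" for a
      unfolding matrix_matrix_mult_def using skewD[OF B, of _ a] skewD[OF A, of _ a]
      by (simp_all add: mult.commute flip: sum_negf)
    have dl: "(if a = b then (1::real) else 0) * (B ** A) $ a $ b = (if a = b then 1 else 0) * (B ** A) $ a $ a"
      "(A ** B) $ a $ b * (if a = b then (1::real) else 0) = (A ** B) $ a $ a * (if a = b then 1 else 0)" for a b by auto
    show ?thesis unfolding dl z AB
      by (simp add: sum.distrib sum_subtractf sum_divide_distrib[symmetric] sum_negf add_divide_distrib diff_divide_distrib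
        if_distrib[of "\<lambda>x. _ * x"] if_distrib[of "\<lambda>x. x * _"] cong: if_cong flip: sum_distrib_left)
  qed
  finally show ?thesis .
qed

section \<open>The complement of g2, its 3-form and the action of G2\<close>

definition crossmat :: "'a::real_normed_field^7 \<Rightarrow> 'a^7^7" where
  "crossmat u = (\<chi> c b. cross u (axis b 1) $ c)"

lemma crossmat_vector: "crossmat u *v v = cross u v"
  by (simp add: vec_eq_7 matrix_vector_mult_def crossmat_def sum_7 cross_nth algebra_simps)

lemma skew_crossmat: "skew (crossmat u)"
proof -
  have "crossmat u $ i $ j = - crossmat u $ j $ i" for i j
    using dot_cross_cyclic[of "axis i 1" u "axis j 1"] dot_cross_cyclic[of u "axis j 1" "axis i 1"]
      cross_skew[of "axis i 1" u] by (simp add: crossmat_def)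
  thus ?thesis unfolding skew_nth by blast
qed

lemma crossmat_add: "crossmat (u + v) = crossmat u + crossmat v"
  and crossmat_smult: "crossmat (c *s u) $ i $ j = c * crossmat u $ i $ j"
  by (simp_all add: crossmat_def vec_eq_iff cross_bilinear)

lemma crossmat_scaleR: "crossmat (r *\<^sub>R u) = r *\<^sub>R crossmat u" for u :: "real^7"
  using crossmat_smult[of r u] by (simp add: vec_eq_iff scalar_mult_eq_scaleR)

lemma crossmat_nth:
  fixes u :: "'a::real_normed_field^7"
  shows
    "crossmat u $ 0 $ 0 = 0" "crossmat u $ 0 $ 1 = - u $ 3" "crossmat u $ 0 $ 2 = - u $ 6" "crossmat u $ 0 $ 3 = u $ 1" "crossmat u $ 0 $ 4 = - u $ 5" "crossmat u $ 0 $ 5 = u $ 4" "crossmat u $ 0 $ 6 = u $ 2"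
    "crossmat u $ 1 $ 0 = u $ 3" "crossmat u $ 1 $ 1 = 0" "crossmat u $ 1 $ 2 = - u $ 4" "crossmat u $ 1 $ 3 = - u $ 0" "crossmat u $ 1 $ 4 = u $ 2" "crossmat u $ 1 $ 5 = - u $ 6" "crossmat u $ 1 $ 6 = u $ 5"
    "crossmat u $ 2 $ 0 = u $ 6" "crossmat u $ 2 $ 1 = u $ 4" "crossmat u $ 2 $ 2 = 0" "crossmat u $ 2 $ 3 = - u $ 5" "crossmat u $ 2 $ 4 = - u $ 1" "crossmat u $ 2 $ 5 = u $ 3" "crossmat u $ 2 $ 6 = - u $ 0"
    "crossmat u $ 3 $ 0 = - u $ 1" "crossmat u $ 3 $ 1 = u $ 0" "crossmat u $ 3 $ 2 = u $ 5" "crossmat u $ 3 $ 3 = 0" "crossmat u $ 3 $ 4 = - u $ 6" "crossmat u $ 3 $ 5 = - u $ 2" "crossmat u $ 3 $ 6 = u $ 4"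
    "crossmat u $ 4 $ 0 = u $ 5" "crossmat u $ 4 $ 1 = - u $ 2" "crossmat u $ 4 $ 2 = u $ 1" "crossmat u $ 4 $ 3 = u $ 6" "crossmat u $ 4 $ 4 = 0" "crossmat u $ 4 $ 5 = - u $ 0" "crossmat u $ 4 $ 6 = - u $ 3"
    "crossmat u $ 5 $ 0 = - u $ 4" "crossmat u $ 5 $ 1 = u $ 6" "crossmat u $ 5 $ 2 = - u $ 3" "crossmat u $ 5 $ 3 = u $ 2" "crossmat u $ 5 $ 4 = u $ 0" "crossmat u $ 5 $ 5 = 0" "crossmat u $ 5 $ 6 = - u $ 1"
    "crossmat u $ 6 $ 0 = - u $ 2" "crossmat u $ 6 $ 1 = - u $ 5" "crossmat u $ 6 $ 2 = u $ 0" "crossmat u $ 6 $ 3 = - u $ 4" "crossmat u $ 6 $ 4 = u $ 3" "crossmat u $ 6 $ 5 = u $ 1" "crossmat u $ 6 $ 6 = 0"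
  by (simp_all add: crossmat_def cross_nth axis7_nth)

lemma contract_cross: "contract L $ c = (\<Sum>b\<in>UNIV. cross (L *v axis b 1) (axis b 1) $ c)"
  unfolding contract_def cross_def
  by (simp add: matrix_vector_mult_def if_distrib[of "\<lambda>x. _ * x"] cong: if_cong) (rule sum.swap)

lemma contract_nth:
  "contract L $ 0 = L $ 1 $ 3 - L $ 3 $ 1 + L $ 4 $ 5 - L $ 5 $ 4 + L $ 2 $ 6 - L $ 6 $ 2"
  "contract L $ 1 = L $ 2 $ 4 - L $ 4 $ 2 + L $ 5 $ 6 - L $ 6 $ 5 + L $ 3 $ 0 - L $ 0 $ 3"
  "contract L $ 2 = L $ 3 $ 5 - L $ 5 $ 3 + L $ 6 $ 0 - L $ 0 $ 6 + L $ 4 $ 1 - L $ 1 $ 4"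
  "contract L $ 3 = L $ 4 $ 6 - L $ 6 $ 4 + L $ 0 $ 1 - L $ 1 $ 0 + L $ 5 $ 2 - L $ 2 $ 5"
  "contract L $ 4 = L $ 5 $ 0 - L $ 0 $ 5 + L $ 1 $ 2 - L $ 2 $ 1 + L $ 6 $ 3 - L $ 3 $ 6"
  "contract L $ 5 = L $ 6 $ 1 - L $ 1 $ 6 + L $ 2 $ 3 - L $ 3 $ 2 + L $ 0 $ 4 - L $ 4 $ 0"
  "contract L $ 6 = L $ 0 $ 2 - L $ 2 $ 0 + L $ 3 $ 4 - L $ 4 $ 3 + L $ 1 $ 5 - L $ 5 $ 1"
  unfolding contract_cross by (simp_all add: sum_7 cross_nth axis7_nth matrix_vector_mult_def)

lemma contract_linear: 
  "contract (A + B) = contract A + contract B" "contract (A - B) = contract A - contract B"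
  "contract (r *\<^sub>R A) = r *\<^sub>R contract A" "contract 0 = 0"
  by (simp_all add: vec_eq_7 contract_nth algebra_simps)

lemma contract_crossmat: "contract (crossmat u) = - 6 *s u"
  unfolding vec_eq_7 contract_nth crossmat_nth by simp

text \<open>
  The cross product matrices do not close under brackets: the bracket has a component along g2, which \<open>contract\<close> removes.
\<close>

lemma contract_bracket_crossmat: "contract (bracket (crossmat u) (crossmat v)) = 6 *s cross u v"
proof -
  have "contract (bracket (crossmat u) (crossmat v)) $ c = 6 * cross u v $ c" if "c \<in> {0,1,2,3,4,5,6}" for c
    using that unfolding insert_iff empty_iff
    by (elim disjE; simp add: contract_nth bracket_def matrix_matrix_mult_def sum_7 crossmat_nth cross_nth)
      (simp_all add: algebra_simps)?
  thus ?thesis by (simp add: vec_eq_7)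
qed

definition frob :: "'a::real_normed_field^7^7 \<Rightarrow> 'a^7^7 \<Rightarrow> 'a" where
  "frob A B = (\<Sum>a\<in>UNIV. \<Sum>b\<in>UNIV. A $ a $ b * B $ a $ b)"

lemma frob_crossmat: "frob (crossmat u) L = - dot u (contract L)"
  unfolding frob_def dot_7 sum_7 contract_nth crossmat_nth by (simp add: algebra_simps)

lemma frob_scaleR: "frob (r *\<^sub>R A) B = r *\<^sub>R frob A B" "frob A (r *\<^sub>R B) = r *\<^sub>R frob A B"
  by (simp_all add: frob_def scaleR_right.sum)

lemma frob_diff: "frob (A - C) B = frob A B - frob C B"
  by (simp add: frob_def sum_subtractf left_diff_distrib)

lemma frob_self_eq_0: "frob A A = 0 \<Longrightarrow> A = 0" for A :: "real^7^7"
proof -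
  assume "frob A A = 0"
  hence "(\<Sum>b\<in>UNIV. A $ a $ b * A $ a $ b) = 0" for a
    unfolding frob_def by (subst (asm) sum_nonneg_eq_0_iff) (auto intro: sum_nonneg)
  hence "A $ a $ b * A $ a $ b = 0" for a b
    by (subst (asm) sum_nonneg_eq_0_iff) auto
  thus ?thesis by (simp add: vec_eq_iff)
qed

lemma spin7_inner_spin: "skew A \<Longrightarrow> skew B \<Longrightarrow> spin7_inner (spin A) (spin B) = 3/8 * frob A B"
  by (simp add: spin7_inner_def killing_spin frob_def)

text \<open>
  The factor 2/3 makes this parametrisation of \<open>\<mm>\<close> by \<open>\<real>\<^sup>7\<close> an isometry, and it turns the 3-form into the octonionic one.
\<close>

definition Jm :: "real^7 \<Rightarrow> real_mat8" where
  "Jm u = spin ((2/3) *\<^sub>R crossmat u)"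

lemma Jm_add: "Jm (u + v) = Jm u + Jm v"
  and Jm_scaleR: "Jm (r *\<^sub>R u) = r *\<^sub>R Jm u"
  by (simp_all add: Jm_def crossmat_add crossmat_scaleR spin_add spin_scaleR scaleR_right_distrib)

text \<open>
  Since \<open>frob (crossmat u) (crossmat v) = 6 \<langle>u, v\<rangle>\<close>, the constant is \<open>3/8 * (2/3)\<^sup>2 * 6 = 1\<close>.
\<close>

lemma Jm_inner: "spin7_inner (Jm u) (Jm v) = dot u v"
  unfolding Jm_def by (simp add: spin7_inner_spin skew_scaleR skew_crossmat frob_scaleR frob_crossmat contract_crossmat dot_bilinear)

lemma killing_spin_frob: "skew A \<Longrightarrow> skew B \<Longrightarrow> killing (spin A) (spin B) = - 5 * frob A B"
  by (simp add: killing_spin frob_def)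

lemma real_smult: "r *s (v :: real^'n) = r *\<^sub>R v" by (simp add: scalar_mult_eq_scaleR)

lemma skew_diff: "skew A \<Longrightarrow> skew B \<Longrightarrow> skew (A - B)" for A :: "'a::ring_1^'n^'n"
  by (simp add: skew_def transpose_diff)

text \<open>
  The cross product matrices are the orthogonal complement of the kernel of \<open>contract\<close>, because \<open>frob (crossmat u) L\<close> is a multiple of
  \<open>\<langle>u, contract L\<rangle>\<close>.
\<close>

lemma m7_eq: "m7 = range Jm"
proof
  show "range Jm \<subseteq> m7"
    by (auto simp: m7_def g2_eq Jm_def spin7_eq killing_spin_frob skew_scaleR skew_crossmat frob_scaleR frob_crossmat dot_bilinear)
  show "m7 \<subseteq> range Jm"
  proof
    fix X assume X: "X \<in> m7"
    then obtain A where A: "skew A" "X = spin A" by (auto simp: m7_def spin7_eq)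
    define w where "w = - (1/6) *\<^sub>R contract A"
    define L where "L = A - crossmat w"
    have sL: "skew L" by (simp add: L_def skew_diff A skew_crossmat)
    have cL: "contract L = 0" by (simp add: L_def contract_linear contract_crossmat w_def real_smult)
    have "spin L \<in> g2" using sL cL by (auto simp: g2_eq)
    hence "killing (spin A) (spin L) = 0" using X A(2) by (auto simp: m7_def)
    hence "frob A L = 0" by (simp add: killing_spin_frob A(1) sL)
    hence "frob L L = 0" using frob_diff[of A "crossmat w" L] 
      by (simp add: L_def[symmetric] frob_crossmat cL dot_bilinear)
    hence "L = 0" by (rule frob_self_eq_0)
    hence "A = crossmat w" by (simp add: L_def)
    hence "X = Jm ((3/2) *\<^sub>R w)" using A by (simp add: Jm_def crossmat_scaleR)
    thus "X \<in> range Jm" by blast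
  qed
qed

lemma proj_m_spin:
  assumes A: "skew A" shows "proj_m (spin A) = spin (crossmat (- (1/6) *\<^sub>R contract A))"
  unfolding proj_m_def
proof (rule the_equality)
  define w where "w = - (1/6) *\<^sub>R contract A"
  have "spin (crossmat w) = Jm ((3/2) *\<^sub>R w)" by (simp add: Jm_def crossmat_scaleR)
  moreover have "spin A - spin (crossmat w) = spin (A - crossmat w)" by (simp add: spin_diff)
  moreover have "spin (A - crossmat w) \<in> g2"
    unfolding g2_eq using A
    by (intro imageI) (simp add: skew_diff skew_crossmat contract_linear contract_crossmat w_def real_smult)
  ultimately show "spin (crossmat w) \<in> m7 \<and> spin A - spin (crossmat w) \<in> g2"
    by (simp add: m7_eq)
  fix Y assume Y: "Y \<in> m7 \<and> spin A - Y \<in> g2"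
  then obtain u where u: "Y = Jm u" by (auto simp: m7_eq)
  define B where "B = A - (2/3) *\<^sub>R crossmat u"
  have sB: "skew B" by (simp add: B_def skew_diff A skew_scaleR skew_crossmat)
  have "spin B \<in> g2" using Y by (simp add: u Jm_def B_def spin_diff)
  then obtain L where "spin B = spin L" "L \<in> {L. skew L \<and> contract L = 0}" unfolding g2_eq by (rule imageE)
  hence L: "skew L" "contract L = 0" "spin B = spin L" by simp_all
  have "B = vecmat (spin B)" by (rule vecmat_spin[OF sB, symmetric])
  also have "\<dots> = L" unfolding L(3) by (rule vecmat_spin[OF L(1)])
  finally have "B = L" .
  hence "contract B = 0" using L by simp
  hence "contract A = - (4 *\<^sub>R u)"
    by (simp add: B_def contract_linear contract_crossmat real_smult eq_neg_iff_add_eq_0)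
  hence "w = (2/3) *\<^sub>R u" by (simp add: w_def)
  thus "Y = spin (crossmat w)" by (simp add: u Jm_def crossmat_scaleR)
qed

lemma phi_Jm: "phi (Jm u) (Jm v) (Jm w) = dot (cross u v) w"
proof -
  have "bracket (Jm u) (Jm v) = spin ((4/9) *\<^sub>R bracket (crossmat u) (crossmat v))"
    unfolding Jm_def by (simp add: spin_bracket skew_scaleR skew_crossmat bracket_scaleR)
  hence "proj_m (bracket (Jm u) (Jm v)) = spin (crossmat (- (4/9) *\<^sub>R cross u v))"
    by (simp add: proj_m_spin skew_scaleR skew_bracket skew_crossmat contract_linear contract_bracket_crossmat real_smult)
  also have "\<dots> = Jm (- (2/3) *\<^sub>R cross u v)" by (simp add: Jm_def flip: crossmat_scaleR)
  finally show ?thesis by (simp add: phi_def Jm_inner dot_scaleR dot_bilinear)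
qed

lemma orthonormal_basis_m_vectors:
  assumes "orthonormal_basis_m I"
  obtains i where "\<And>a. I a = Jm (i a)" "\<And>a b. dot (i a) (i b) = (if a = b then 1 else 0)"
proof -
  have "\<forall>a. \<exists>u. I a = Jm u" using assms unfolding orthonormal_basis_m_def m7_eq by blast
  then obtain i where i: "\<And>a. I a = Jm (i a)" by metis
  moreover have "dot (i a) (i b) = (if a = b then 1 else 0)" for a b
    using assms by (simp add: orthonormal_basis_m_def i Jm_inner)
  ultimately show ?thesis by (rule that)
qed

lemma Ad_Spin7: "g \<in> Spin7 \<Longrightarrow> Ad g X = g ** X ** transpose g"
proof -
  assume g: "g \<in> Spin7"
  have "\<exists>h. g ** h = mat 1 \<and> h ** g = mat 1" using Spin7_orthogonal[OF g] Spin7_orthogonal'[OF g] by blast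
  hence "g ** matrix_inv g = mat 1 \<and> matrix_inv g ** g = mat 1" unfolding matrix_inv_def by (rule someI_ex)
  hence "matrix_inv g ** (g ** transpose g) = transpose g"
    by (simp add: matrix_mul_assoc)
  hence "matrix_inv g = transpose g" by (simp add: Spin7_orthogonal[OF g])
  thus ?thesis by (simp add: Ad_def)
qed

lemma Ad_spin: "g \<in> Spin7 \<Longrightarrow> Ad g (spin A) = spin (vecrep g ** A ** transpose (vecrep g))"
  by (simp add: Ad_Spin7 covers_conj_spin Spin7_covers)

lemma vecrep_mult:
  assumes "g \<in> Spin7" "h \<in> Spin7" shows "vecrep (g ** h) = vecrep g ** vecrep h"
proof -
  have "gamma (vecrep (g ** h) *v u) = gamma ((vecrep g ** vecrep h) *v u)" for u
  proof -
    have "gamma (vecrep (g ** h) *v u) = (g ** h) ** gamma u ** transpose (g ** h)"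
      by (rule covers_conj_gamma[OF Spin7_covers[OF Spin7_mult[OF assms]], symmetric])
    also have "\<dots> = g ** (h ** gamma u ** transpose h) ** transpose g"
      by (simp add: matrix_transpose_mul matrix_mul_assoc)
    also have "\<dots> = gamma ((vecrep g ** vecrep h) *v u)"
      by (simp only: covers_conj_gamma[OF Spin7_covers[OF assms(1)]] covers_conj_gamma[OF Spin7_covers[OF assms(2)]]
          matrix_vector_mul_assoc)
    finally show ?thesis .
  qed
  hence "vecrep (g ** h) *v u = (vecrep g ** vecrep h) *v u" for u
    using gamma_column by (metis neg_equal_iff_equal vec_eq_iff)
  thus ?thesis by (simp add: matrix_eq)
qed

lemma vecrep_one: "vecrep (mat 1) = mat 1"
proof -
  have "vecrep (mat 1) $ a $ b = axis b 1 $ a" for a b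
    by (simp only: vecrep_def vec_lambda_beta transpose_mat matrix_mul_lid matrix_mul_rid gamma_column minus_minus)
  thus ?thesis by (simp add: vec_eq_iff mat_def)
qed

lemma vecrep_orthogonal:
  assumes "g \<in> Spin7" shows "transpose (vecrep g) ** vecrep g = mat 1" "vecrep g ** transpose (vecrep g) = mat 1"
proof -
  have g0: "g \<noteq> 0" using Spin7_orthogonal[OF assms] by (rule orthogonal_nonzero)
  have "dot (vecrep g *v axis a 1) (vecrep g *v axis b 1) = dot (axis a 1) (axis b (1::real))" for a b
    using Spin7_covers[OF assms] by (intro inner_preserved[OF g0, symmetric]) (auto simp: covers_def)
  hence "dot (vecrep g *v axis a 1) (vecrep g *v axis b 1) = (if a = b then 1 else 0)" for a b by simp
  hence "(transpose (vecrep g) ** vecrep g) $ a $ b = (if a = b then 1 else 0)" for a b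
    by (simp add: dot_def matrix_matrix_mult_def transpose_def matrix_vector_mult_basis column_def)
  thus 1: "transpose (vecrep g) ** vecrep g = mat 1" by (simp add: vec_eq_iff mat_def)
  thus "vecrep g ** transpose (vecrep g) = mat 1" by (simp add: matrix_left_right_inverse)
qed

text \<open>
  An element fixing the first spinor \<open>e\<close> satisfies \<open>g (gamma u e) = gamma (g u) e\<close>, so it acts on \<open>\<real> \<oplus> \<real>\<^sup>7\<close> by the identity and its vector
  representation; comparing products of two gamma matrices gives compatibility with the cross product.
\<close>

lemma vecrep_G2_cross:
  assumes "g \<in> G2" shows "cross (vecrep g *v u) (vecrep g *v v) = vecrep g *v cross u v"
    "g *v pack f v = pack f (vecrep g *v v)"
proof -
  have g: "g \<in> Spin7" "g *v pack 1 0 = pack 1 0" using assms by (auto simp: G2_def unit_axis)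
  have c: "g *v (gamma w *v x) = gamma (vecrep g *v w) *v (g *v x)" for w x
    using Spin7_covers[OF g(1)] by (simp add: covers_def matrix_vector_mul_assoc)
  have e: "pack 0 w = - (gamma w *v pack 1 0)" for w
    by (simp add: gamma_pack pack_minus dot_bilinear cross_bilinear)
  have gv: "g *v pack 0 w = pack 0 (vecrep g *v w)" for w
  proof -
    have "g *v pack 0 w = - (g *v (gamma w *v pack 1 0))"
      unfolding e by (simp add: matrix_vector_mult_def vec_eq_iff sum_negf)
    thus ?thesis unfolding c g(2) e[symmetric] .
  qed
  have pk: "g *v pack f v = pack f (vecrep g *v v)" for f v
  proof -
    have "pack f v = f *\<^sub>R pack 1 0 + pack 0 v" by (simp add: pack_scaleR pack_add)
    hence "g *v pack f v = f *\<^sub>R (g *v pack 1 0) + g *v pack 0 v"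
      by (simp only: matrix_vector_right_distrib matrix_vector_mult_scaleR)
    thus ?thesis by (simp add: g gv pack_scaleR pack_add)
  qed
  show "g *v pack f v = pack f (vecrep g *v v)" by (rule pk)
  have "g *v (gamma u *v pack 0 v) = gamma (vecrep g *v u) *v pack 0 (vecrep g *v v)" by (simp add: c gv)
  hence "g *v pack (dot u v) (- cross u v) = pack (dot (vecrep g *v u) (vecrep g *v v)) (- cross (vecrep g *v u) (vecrep g *v v))"
    by (simp add: gamma_pack)
  hence "vecrep g *v (- cross u v) = - cross (vecrep g *v u) (vecrep g *v v)"
    by (simp add: pk)
  thus "cross (vecrep g *v u) (vecrep g *v v) = vecrep g *v cross u v"
    by (simp add: matrix_vector_mult_def vec_eq_iff sum_negf)
qed

section \<open>Derivatives of representations\<close>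

lemma mexp_conj:
  assumes assms: "Q ** P = mat 1" and PQ: "P ** Q = mat 1" shows "mexp (P ** A ** Q) = P ** mexp A ** Q"
proof -
  have "((\<lambda>t. P ** mexp (t *\<^sub>R A) ** Q) has_vector_derivative (P ** A ** Q) ** (P ** mexp (t *\<^sub>R A) ** Q)) (at t)" for t
  proof -
    have "((\<lambda>t. P ** mexp (t *\<^sub>R A) ** Q) has_vector_derivative
       P ** mexp (t *\<^sub>R A) ** 0 + (P ** (A ** mexp (t *\<^sub>R A)) + 0 ** mexp (t *\<^sub>R A)) ** Q) (at t)"
      by (intro has_vector_derivative_matrix_mult mexp_has_vector_derivative has_vector_derivative_const)
    moreover have "(P ** A ** Q) ** (P ** mexp (t *\<^sub>R A) ** Q) = P ** A ** (Q ** P) ** mexp (t *\<^sub>R A) ** Q"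
      by (simp only: matrix_mul_assoc)
    ultimately show ?thesis by (simp add: assms matrix_mul_assoc)
  qed
  from linear_ode_unique[OF this, of 1] show ?thesis by (simp add: PQ)
qed

lemma subspace_skew: "skew (0::'a::ring_1^'n^'n)"
  by (simp add: skew_def transpose_def vec_eq_iff)

lemma spin7_scaleR: "X \<in> spin7 \<Longrightarrow> r *\<^sub>R X \<in> spin7"
  and spin7_add: "X \<in> spin7 \<Longrightarrow> Y \<in> spin7 \<Longrightarrow> X + Y \<in> spin7"
  using subspace_spin7 by (auto intro: subspace_scale subspace_add)

lemma mexp_spin7: "X \<in> spin7 \<Longrightarrow> mexp (t *\<^sub>R X) \<in> Spin7"
  by (simp add: spin7_def lie_algebra_def matrix_exp_mexp)

lemma mexp_spin7': "X \<in> spin7 \<Longrightarrow> mexp X \<in> Spin7"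
  using mexp_spin7[of X 1] by simp

context
  fixes \<rho> :: "real_mat8 \<Rightarrow> complex^'n^'n"
  assumes rep: "spin7_rep \<rho>"
begin

lemma rep_one: "\<rho> (mat 1) = mat 1"
  and rep_mult: "g \<in> Spin7 \<Longrightarrow> h \<in> Spin7 \<Longrightarrow> \<rho> (g ** h) = \<rho> g ** \<rho> h"
  and rep_cont: "continuous_on Spin7 \<rho>"
  using rep by (auto simp: spin7_rep_def)

lemma rep_transpose: "g \<in> Spin7 \<Longrightarrow> \<rho> (transpose g) ** \<rho> g = mat 1" "g \<in> Spin7 \<Longrightarrow> \<rho> g ** \<rho> (transpose g) = mat 1"
  by (simp_all add: rep_mult[symmetric] Spin7_transpose Spin7_orthogonal Spin7_orthogonal' rep_one)

text \<open>
  The map \<open>t \<mapsto> \<rho> (mexp (t X))\<close> is a continuous one-parameter group, hence an exponential, and its generator is the derivative.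
\<close>

lemma drep_exp:
  assumes X: "X \<in> spin7"
  shows "\<rho> (mexp (t *\<^sub>R X)) = mexp (t *\<^sub>R drep \<rho> X)"
    "((\<lambda>t. \<rho> (mexp (t *\<^sub>R X))) has_vector_derivative drep \<rho> X) (at 0)"
proof -
  define \<phi> where "\<phi> t = endo_of (\<rho> (mexp (t *\<^sub>R X)))" for t
  have E: "mexp (t *\<^sub>R X) \<in> Spin7" for t by (rule mexp_spin7[OF X])
  have cE: "continuous_on UNIV (\<lambda>t. mexp (t *\<^sub>R X))"
    by (intro continuous_at_imp_continuous_on ballI)
       (rule has_vector_derivative_continuous[OF mexp_has_vector_derivative])
  have "continuous_on UNIV (\<lambda>t. \<rho> (mexp (t *\<^sub>R X)))"
    by (rule continuous_on_compose2[OF rep_cont cE]) (use E in auto)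
  hence c: "continuous_on UNIV \<phi>" unfolding \<phi>_def
    by (rule bounded_linear.continuous_on[OF bounded_linear_endo_of])
  have z: "\<phi> 0 = 1" by (simp add: \<phi>_def rep_one endo_of_one)
  have a: "\<phi> (s + t) = \<phi> s * \<phi> t" for s t
    by (simp add: \<phi>_def mexp_add_scaleR rep_mult E endo_of_mult)
  obtain B where B: "\<And>t. \<phi> t = exp (t *\<^sub>R B)"
    using one_parameter_group_exp[OF c z a] by blast
  define C where "C = matrix_of_endo B"
  have d: "((\<lambda>t. \<rho> (mexp (t *\<^sub>R X))) has_vector_derivative C) (at 0)"
  proof -
    have "((\<lambda>t. matrix_of_endo (exp (t *\<^sub>R B))) has_vector_derivative matrix_of_endo (B * exp (0 *\<^sub>R B))) (at 0)"
      by (rule bounded_linear.has_vector_derivative[OF bounded_linear_matrix_of_endo exp_scaleR_has_vector_derivative_left])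
    moreover have "matrix_of_endo (exp (t *\<^sub>R B)) = \<rho> (mexp (t *\<^sub>R X))" for t
      using B[of t] by (simp add: \<phi>_def flip: B)
    ultimately show ?thesis by (simp add: C_def)
  qed
  have D: "drep \<rho> X = C" unfolding drep_def matrix_exp_mexp
    using d by (rule vector_derivative_at)
  show "((\<lambda>t. \<rho> (mexp (t *\<^sub>R X))) has_vector_derivative drep \<rho> X) (at 0)" using d D by simp
  have "endo_of C = B"
  proof -
    have "(\<phi> has_vector_derivative endo_of C) (at 0)" unfolding \<phi>_def
      by (rule bounded_linear.has_vector_derivative[OF bounded_linear_endo_of d])
    moreover have "(\<phi> has_vector_derivative B * exp (0 *\<^sub>R B)) (at 0)"
    proof -
      have "\<phi> = (\<lambda>t. exp (t *\<^sub>R B))" using B by (rule ext)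
      thus ?thesis using exp_scaleR_has_vector_derivative_left[of B 0] by simp
    qed
    ultimately show ?thesis using vector_derivative_unique_at by fastforce
  qed
  thus "\<rho> (mexp (t *\<^sub>R X)) = mexp (t *\<^sub>R drep \<rho> X)"
    using B[of t] by (simp add: D \<phi>_def endo_of_mexp linear_scale[OF linear_endo_of] flip: endo_of_inject)
qed

lemma drep_unique:
  assumes "X \<in> spin7" "\<And>t. \<rho> (mexp (t *\<^sub>R X)) = mexp (t *\<^sub>R C)" shows "drep \<rho> X = C"
proof -
  have "((\<lambda>t. \<rho> (mexp (t *\<^sub>R X))) has_vector_derivative C) (at 0)"
    unfolding assms(2) by (rule has_derivative_mexp_0)
  thus ?thesis using drep_exp(2)[OF assms(1)] vector_derivative_unique_at by blast
qed

lemma drep_scaleR: assumes "X \<in> spin7" shows "drep \<rho> (r *\<^sub>R X) = r *\<^sub>R drep \<rho> X"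
  using drep_exp(1)[OF assms, of "_ * r"] by (intro drep_unique) (auto simp: spin7_scaleR assms)

text \<open>
  The Trotter formula on both sides of \<open>\<rho>\<close>, which is continuous at the limit \<open>mexp (X + Y)\<close> in Spin(7).
\<close>

lemma rep_exp_add:
  assumes X: "X \<in> spin7" and Y: "Y \<in> spin7"
  shows "\<rho> (mexp (X + Y)) = mexp (drep \<rho> X + drep \<rho> Y)"
proof -
  define P where "P n = mexp (inverse (real n) *\<^sub>R X) ** mexp (inverse (real n) *\<^sub>R Y)" for n :: nat
  define Pn where "Pn n = ((\<lambda>B. P n ** B) ^^ n) (mat 1)" for n
  have PS: "P n \<in> Spin7" for n unfolding P_def by (intro Spin7_mult mexp_spin7 X Y)
  have "((\<lambda>B. P n ** B) ^^ k) (mat 1) \<in> Spin7" for n k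
    by (induction k) (auto intro: Spin7.one Spin7_mult PS)
  hence PnS: "Pn n \<in> Spin7" for n by (simp add: Pn_def)
  have pow: "endo_of (((\<lambda>B. M ** B) ^^ k) (mat 1)) = endo_of M ^ k" for M :: "'a::{real_normed_field,euclidean_space}^'m^'m" and k
    by (induction k) (simp_all add: endo_of_one endo_of_mult)
  have e: "endo_of (Pn n) = (exp (endo_of X /\<^sub>R real n) * exp (endo_of Y /\<^sub>R real n)) ^ n" for n
    by (simp add: Pn_def pow P_def endo_of_mult endo_of_mexp linear_scale[OF linear_endo_of])
  have "(\<lambda>n. matrix_of_endo (endo_of (Pn n))) \<longlonglongrightarrow> matrix_of_endo (exp (endo_of X + endo_of Y))"
    unfolding e by (rule bounded_linear.tendsto[OF bounded_linear_matrix_of_endo trotter_product])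
  moreover have "matrix_of_endo (exp (endo_of X + endo_of Y)) = mexp (X + Y)"
    by (simp add: mexp_def linear_add[OF linear_endo_of])
  ultimately have "Pn \<longlonglongrightarrow> mexp (X + Y)" by simp
  moreover have "mexp (X + Y) \<in> Spin7" using mexp_spin7'[OF spin7_add[OF X Y]] .
  ultimately have 1: "(\<lambda>n. \<rho> (Pn n)) \<longlonglongrightarrow> \<rho> (mexp (X + Y))"
    using continuous_on_tendsto_compose[OF rep_cont] PnS by (auto intro: always_eventually)
  have r: "\<rho> (((\<lambda>B. P n ** B) ^^ k) (mat 1)) = ((\<lambda>B. \<rho> (P n) ** B) ^^ k) (mat 1)" for n k
    by (induction k) (simp_all add: rep_one rep_mult PS \<open>\<And>n k. ((\<lambda>B. P n ** B) ^^ k) (mat 1) \<in> Spin7\<close>)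
  have "endo_of (\<rho> (Pn n)) = (exp (endo_of (drep \<rho> X) /\<^sub>R real n) * exp (endo_of (drep \<rho> Y) /\<^sub>R real n)) ^ n" for n
    unfolding Pn_def r pow
    by (simp add: P_def rep_mult mexp_spin7 X Y drep_exp(1) endo_of_mult endo_of_mexp linear_scale[OF linear_endo_of])
  hence "(\<lambda>n. matrix_of_endo (endo_of (\<rho> (Pn n)))) \<longlonglongrightarrow> matrix_of_endo (exp (endo_of (drep \<rho> X) + endo_of (drep \<rho> Y)))"
    using bounded_linear.tendsto[OF bounded_linear_matrix_of_endo trotter_product[of "endo_of (drep \<rho> X)" "endo_of (drep \<rho> Y)"]] by simp
  moreover have "matrix_of_endo (exp (endo_of (drep \<rho> X) + endo_of (drep \<rho> Y))) = mexp (drep \<rho> X + drep \<rho> Y)"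
    by (simp add: mexp_def linear_add[OF linear_endo_of])
  ultimately have "(\<lambda>n. \<rho> (Pn n)) \<longlonglongrightarrow> mexp (drep \<rho> X + drep \<rho> Y)" by simp
  with 1 show ?thesis by (rule LIMSEQ_unique)
qed

lemma drep_add:
  assumes X: "X \<in> spin7" and Y: "Y \<in> spin7" shows "drep \<rho> (X + Y) = drep \<rho> X + drep \<rho> Y"
proof (rule drep_unique[OF spin7_add[OF X Y]])
  fix t
  show "\<rho> (mexp (t *\<^sub>R (X + Y))) = mexp (t *\<^sub>R (drep \<rho> X + drep \<rho> Y))"
    unfolding scaleR_right_distrib using rep_exp_add[OF spin7_scaleR[OF X] spin7_scaleR[OF Y]]
    by (simp add: drep_scaleR X Y)
qed

lemma drep_conj:
  assumes g: "g \<in> Spin7" and X: "X \<in> spin7"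
  shows "drep \<rho> (g ** X ** transpose g) = \<rho> g ** drep \<rho> X ** \<rho> (transpose g)"
proof (rule drep_unique)
  obtain A where A: "skew A" "X = spin A" using X by (auto simp: spin7_eq)
  have "skew (vecrep g ** A ** transpose (vecrep g))"
    using A(1) by (simp add: skew_def matrix_transpose_mul matrix_mul_assoc)
  thus "g ** X ** transpose g \<in> spin7"
    unfolding A(2) covers_conj_spin[OF Spin7_covers[OF g]] spin7_eq by blast
  fix t
  have "mexp (t *\<^sub>R (g ** X ** transpose g)) = g ** mexp (t *\<^sub>R X) ** transpose g"
    using mexp_conj[OF Spin7_orthogonal'[OF g] Spin7_orthogonal[OF g], of "t *\<^sub>R X"] by simp
  thus "\<rho> (mexp (t *\<^sub>R (g ** X ** transpose g))) = mexp (t *\<^sub>R (\<rho> g ** drep \<rho> X ** \<rho> (transpose g)))"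
    using mexp_conj[OF rep_transpose(1)[OF g] rep_transpose(2)[OF g], of "t *\<^sub>R drep \<rho> X"]
    by (simp add: rep_mult Spin7_mult g mexp_spin7 X Spin7_transpose drep_exp(1))
qed

lemma linear_drep_spin: "linear (\<lambda>A. drep \<rho> (spin ((1/2) *\<^sub>R (A - transpose A))))"
proof -
  have s: "spin ((1/2) *\<^sub>R (A - transpose A)) \<in> spin7" for A
    by (intro spin_in_spin7) (simp add: skew_def transpose_diff transpose_scaleR flip: scaleR_minus_right)
  show ?thesis
  proof (rule linearI)
    fix A B :: "real^7^7" and r :: real
    have "spin ((1/2) *\<^sub>R (A + B - transpose (A + B))) = spin ((1/2) *\<^sub>R (A - transpose A)) + spin ((1/2) *\<^sub>R (B - transpose B))"
      by (simp add: transpose_add algebra_simps flip: spin_add)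
    thus "drep \<rho> (spin ((1/2) *\<^sub>R (A + B - transpose (A + B)))) = drep \<rho> (spin ((1/2) *\<^sub>R (A - transpose A))) + drep \<rho> (spin ((1/2) *\<^sub>R (B - transpose B)))"
      by (simp add: drep_add s)
    have "spin ((1/2) *\<^sub>R (r *\<^sub>R A - transpose (r *\<^sub>R A))) = r *\<^sub>R spin ((1/2) *\<^sub>R (A - transpose A))"
      by (simp add: transpose_scaleR scaleR_diff_right mult.commute flip: spin_scaleR)
    thus "drep \<rho> (spin ((1/2) *\<^sub>R (r *\<^sub>R A - transpose (r *\<^sub>R A)))) = r *\<^sub>R drep \<rho> (spin ((1/2) *\<^sub>R (A - transpose A)))"
      by (simp add: drep_scaleR s)
  qed
qed

text \<open>
  Differentiate \<open>\<rho> (g X g\<^sup>T) = \<rho> g (drep X) \<rho> g\<^sup>T\<close> along the exponential of \<open>Y\<close>.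
\<close>

lemma drep_bracket:
  assumes Y: "Y \<in> spin7" and X: "X \<in> spin7"
  shows "drep \<rho> (bracket Y X) = bracket (drep \<rho> Y) (drep \<rho> X)"
proof -
  define F where "F Z = drep \<rho> (spin ((1/2) *\<^sub>R (vecmat Z - transpose (vecmat Z))))" for Z
  have F: "F Z = drep \<rho> Z" if "Z \<in> spin7" for Z
  proof -
    obtain A where A: "skew A" "Z = spin A" using spin7_is_spin[OF \<open>Z \<in> spin7\<close>] by blast
    have "(1/2) *\<^sub>R (A - transpose A) = A" using A(1) by (simp add: skew_def flip: scaleR_2)
    thus ?thesis using A by (simp add: F_def)
  qed
  have "linear F" unfolding F_def using linear_compose[OF linear_vecmat linear_drep_spin] by (simp add: o_def)
  hence bF: "bounded_linear F" by (simp add: linear_conv_bounded_linear)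
  have skY: "transpose (mexp (t *\<^sub>R Y)) = mexp (t *\<^sub>R (- Y))" for t
    using Y by (intro transpose_mexp_skew) (auto simp: spin7_eq skew_def transpose_spin spin_minus)
  have conj: "mexp (t *\<^sub>R Y) ** X ** mexp (t *\<^sub>R (- Y)) \<in> spin7" for t
  proof -
    obtain A where A: "skew A" "X = spin A" using X by (auto simp: spin7_eq)
    have "skew (vecrep (mexp (t *\<^sub>R Y)) ** A ** transpose (vecrep (mexp (t *\<^sub>R Y))))"
      using A(1) by (simp add: skew_def matrix_transpose_mul matrix_mul_assoc)
    thus ?thesis
      unfolding A(2) skY[symmetric] covers_conj_spin[OF Spin7_covers[OF mexp_spin7[OF Y]]] spin7_eq by blast
  qed
  have d: "((\<lambda>t. mexp (t *\<^sub>R Z) ** W ** mexp (t *\<^sub>R (- Z))) has_vector_derivative bracket Z W) (at 0)"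
    for Z W :: "'a::{real_normed_field,euclidean_space}^'m^'m"
  proof -
    have "((\<lambda>t. mexp (t *\<^sub>R Z) ** W ** mexp (t *\<^sub>R (- Z))) has_vector_derivative
      mexp (0 *\<^sub>R Z) ** W ** (- Z) + (mexp (0 *\<^sub>R Z) ** 0 + Z ** W) ** mexp (0 *\<^sub>R (- Z))) (at 0)"
      by (intro has_vector_derivative_matrix_mult has_derivative_mexp_0 has_vector_derivative_const)
    thus ?thesis by (simp add: bracket_def)
  qed
  have "((\<lambda>t. F (mexp (t *\<^sub>R Y) ** X ** mexp (t *\<^sub>R (- Y)))) has_vector_derivative F (bracket Y X)) (at 0)"
    by (rule bounded_linear.has_vector_derivative[OF bF d])
  moreover have "F (mexp (t *\<^sub>R Y) ** X ** mexp (t *\<^sub>R (- Y))) = 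
      mexp (t *\<^sub>R drep \<rho> Y) ** drep \<rho> X ** mexp (t *\<^sub>R (- drep \<rho> Y))" for t
  proof -
    have "- Y \<in> spin7" using spin7_scaleR[OF Y, of "-1"] by simp
    moreover have "drep \<rho> (- Y) = - drep \<rho> Y" using drep_scaleR[OF Y, of "-1"] by simp
    moreover have "F (mexp (t *\<^sub>R Y) ** X ** mexp (t *\<^sub>R (- Y))) = drep \<rho> (mexp (t *\<^sub>R Y) ** X ** transpose (mexp (t *\<^sub>R Y)))"
      using F[OF conj] by (simp only: skY)
    ultimately show ?thesis
      unfolding drep_conj[OF mexp_spin7[OF Y] X] using Y by (simp only: drep_exp(1) skY)
  qed
  ultimately have "((\<lambda>t. mexp (t *\<^sub>R drep \<rho> Y) ** drep \<rho> X ** mexp (t *\<^sub>R (- drep \<rho> Y))) has_vector_derivative F (bracket Y X)) (at 0)"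
    by simp
  hence "F (bracket Y X) = bracket (drep \<rho> Y) (drep \<rho> X)" using d vector_derivative_unique_at by blast
  moreover have "bracket Y X \<in> spin7" using X Y by (auto simp: spin7_eq spin_bracket skew_bracket intro!: imageI)
  ultimately show ?thesis using F by simp
qed

end

section \<open>Complexification and an adapted weight basis\<close>

abbreviation cmat :: "real^'n^'m \<Rightarrow> complex^'n^'m" where "cmat \<equiv> map_matrix complex_of_real"
abbreviation Rem :: "complex^'n^'m \<Rightarrow> real^'n^'m" where "Rem \<equiv> map_matrix Re"
abbreviation Imm :: "complex^'n^'m \<Rightarrow> real^'n^'m" where "Imm \<equiv> map_matrix Im"

lemma mscale_nth [simp]: "mscale c A $ i $ j = c * A $ i $ j"
  by (simp add: mscale_def map_matrix_def)

lemma map_matrix_nth [simp]: "map_matrix f A $ i $ j = f (A $ i $ j)"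
  by (simp add: map_matrix_def)

lemma mscale_simps:
  "mscale c (A + B) = mscale c A + mscale c B" "mscale c (A - B) = mscale c A - mscale c B"
  "mscale (c + d) A = mscale c A + mscale d A" "mscale c (mscale d A) = mscale (c * d) A"
  "mscale c 0 = 0" "mscale 0 A = 0" "mscale 1 A = A" "mscale c (- A) = - mscale c A" "mscale (- c) A = - mscale c A"
  for A B :: "'a::comm_ring_1^'n^'m"
  by (simp_all add: vec_eq_iff algebra_simps)

lemma mscale_mult: "mscale c A ** B = mscale c (A ** B)" "A ** mscale c B = mscale c (A ** B)"
  for A :: "'a::comm_ring_1^'n^'m"
  by (simp_all add: vec_eq_iff matrix_matrix_mult_def sum_distrib_left mult_ac)

lemma mscale_vector: "mscale c A *v x = c *s (A *v x)"
  for A :: "'a::comm_ring_1^'n^'m"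
  by (simp add: vec_eq_iff matrix_vector_mult_def sum_distrib_left mult_ac)

lemma mscale_real: "mscale (complex_of_real r) A = r *\<^sub>R A" for A :: "complex^'n^'m"
  by (simp add: vec_eq_iff complex_eq_iff)

lemma bracket_mscale: "bracket (mscale c A) B = mscale c (bracket A B)" "bracket A (mscale c B) = mscale c (bracket A B)"
  for A B :: "'a::comm_ring_1^'n^'n"
  by (simp_all add: bracket_def mscale_mult mscale_simps)

lemma skew_mscale: "skew A \<Longrightarrow> skew (mscale c A)" for A :: "'a::comm_ring_1^'n^'n"
  unfolding skew_nth by (metis mscale_nth mult_minus_right)

lemma complex_matrix_split: "A = cmat (Rem A) + mscale \<i> (cmat (Imm A))"
  by (simp add: vec_eq_iff complex_eq_iff)

lemma skew_Re_Im: "skew A \<Longrightarrow> skew (Rem A)" "skew A \<Longrightarrow> skew (Imm A)"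
proof -
  assume "skew A" hence *: "A $ i $ j = - A $ j $ i" for i j by (rule skewD)
  have "Re (A $ i $ j) = - Re (A $ j $ i)" for i j by (subst *) (simp only: uminus_complex.sel)
  thus "skew (Rem A)" unfolding skew_nth map_matrix_nth by blast
  have "Im (A $ i $ j) = - Im (A $ j $ i)" for i j by (subst *) (simp only: uminus_complex.sel)
  thus "skew (Imm A)" unfolding skew_nth map_matrix_nth by blast
qed

lemma skew_cmat: "skew A \<Longrightarrow> skew (cmat A)"
  unfolding skew_nth map_matrix_nth by (metis of_real_minus)

lemma Re_Im_mat: 
  "Rem (A + B) = Rem A + Rem B" "Imm (A + B) = Imm A + Imm B"
  "Rem (A - B) = Rem A - Rem B" "Imm (A - B) = Imm A - Imm B"
  "Rem (mscale c A) = Re c *\<^sub>R Rem A - Im c *\<^sub>R Imm A" "Imm (mscale c A) = Re c *\<^sub>R Imm A + Im c *\<^sub>R Rem A"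
  "Rem (cmat M) = M" "Imm (cmat M) = 0"
  by (simp_all add: vec_eq_iff)

lemma Re_Im_mult: 
  "Rem (P ** Q) = Rem P ** Rem Q - Imm P ** Imm Q" "Imm (P ** Q) = Rem P ** Imm Q + Imm P ** Rem Q"
  by (simp_all add: vec_eq_iff matrix_matrix_mult_def sum_subtractf sum.distrib)

lemma Re_Im_bracket: 
  "Rem (bracket P Q) = bracket (Rem P) (Rem Q) - bracket (Imm P) (Imm Q)" 
  "Imm (bracket P Q) = bracket (Rem P) (Imm Q) + bracket (Imm P) (Rem Q)"
  by (simp_all add: bracket_def Re_Im_mat Re_Im_mult)

lemma cmat_simps: "cmat (A + B) = cmat A + cmat B" "cmat (A - B) = cmat A - cmat B" "cmat (r *\<^sub>R A) = mscale (of_real r) (cmat A)"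
   "cmat 0 = 0" "cmat (- A) = - cmat A" "cmat (mat 1) = mat 1" "cmat (transpose A) = transpose (cmat A)"
  by (simp_all add: vec_eq_iff mat_def transpose_def)

lemma cmat_mult: "cmat (P ** Q) = cmat P ** cmat Q"
  by (simp add: vec_eq_iff matrix_matrix_mult_def)

definition spinC :: "complex^7^7 \<Rightarrow> complex_mat8" where
  "spinC A = cmat (spin (Rem A)) + mscale \<i> (cmat (spin (Imm A)))"

lemma Re_Im_spinC: "Rem (spinC A) = spin (Rem A)" "Imm (spinC A) = spin (Imm A)"
  by (simp_all add: spinC_def Re_Im_mat)

lemma complex_mat_eqI: "Rem A = Rem B \<Longrightarrow> Imm A = Imm B \<Longrightarrow> A = B"
  by (metis complex_matrix_split)

lemma spinC_add: "spinC (A + B) = spinC A + spinC B"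
  and spinC_mscale: "spinC (mscale c A) = mscale c (spinC A)"
  by (rule complex_mat_eqI; simp add: Re_Im_spinC Re_Im_mat spin_add spin_diff spin_scaleR)+

lemma spinC_cmat: "spinC (cmat A) = cmat (spin A)"
  by (rule complex_mat_eqI; simp add: Re_Im_spinC Re_Im_mat spin_0)

lemma spinC_bracket: "skew A \<Longrightarrow> skew B \<Longrightarrow> bracket (spinC A) (spinC B) = spinC (bracket A B)"
  by (rule complex_mat_eqI) (simp_all add: Re_Im_spinC Re_Im_bracket spin_bracket skew_Re_Im spin_diff spin_add)

lemma spin7_complex_eq: "spin7_complex = spinC ` {A. skew A}"
proof
  show "spinC ` {A. skew A} \<subseteq> spin7_complex"
    by (auto simp: spin7_complex_def Re_Im_spinC spin7_eq skew_Re_Im)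
  show "spin7_complex \<subseteq> spinC ` {A. skew A}"
  proof
    fix X assume "X \<in> spin7_complex"
    hence "Rem X \<in> spin7" "Imm X \<in> spin7" by (auto simp: spin7_complex_def)
    then obtain A B where AB: "skew A" "Rem X = spin A" "skew B" "Imm X = spin B"
      using spin7_is_spin by metis
    have "X = spinC (cmat A + mscale \<i> (cmat B))"
      by (rule complex_mat_eqI) (simp_all add: Re_Im_spinC Re_Im_mat AB)
    moreover have "skew (cmat A + mscale \<i> (cmat B))" using AB by (intro skew_add skew_mscale skew_cmat)
    ultimately show "X \<in> spinC ` {A. skew A}" by blast
  qed
qed

text \<open>
  The complexified derivative, as a function of a complex skew 7 by 7 matrix; this identifies the complexification of spin(7) with so(7, \<open>\<complex>\<close>).
\<close>

definition crep :: "(real_mat8 \<Rightarrow> complex^'n^'n) \<Rightarrow> complex^7^7 \<Rightarrow> complex^'n^'n" where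
  "crep \<rho> A = drep_complex \<rho> (spinC A)"

lemma crep_alt: "crep \<rho> A = drep \<rho> (spin (Rem A)) + mscale \<i> (drep \<rho> (spin (Imm A)))"
  by (simp add: crep_def drep_complex_def Re_Im_spinC)

context
  fixes \<rho> :: "real_mat8 \<Rightarrow> complex^'n^'n"
  assumes rep: "spin7_rep \<rho>"
begin

lemmas drep_facts = drep_add[OF rep] drep_scaleR[OF rep] spin_in_spin7 skew_Re_Im skew_add skew_scaleR skew_diff

lemma drep_diff: "X \<in> spin7 \<Longrightarrow> Y \<in> spin7 \<Longrightarrow> drep \<rho> (X - Y) = drep \<rho> X - drep \<rho> Y"
  using drep_add[OF rep, of "X - Y" Y] subspace_diff[OF subspace_spin7, of X Y] by simp

lemma drep_zero: "drep \<rho> 0 = 0"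
  using drep_scaleR[OF rep, of "spin 0" 0] spin_in_spin7[OF subspace_skew] by (simp add: spin_0)

lemma crep_add: "skew A \<Longrightarrow> skew B \<Longrightarrow> crep \<rho> (A + B) = crep \<rho> A + crep \<rho> B"
  by (simp add: crep_alt Re_Im_mat spin_add drep_facts mscale_simps)

lemma crep_mscale: "skew A \<Longrightarrow> crep \<rho> (mscale c A) = mscale c (crep \<rho> A)"
proof -
  assume A: "skew A"
  have "crep \<rho> (mscale c A) = Re c *\<^sub>R drep \<rho> (spin (Rem A)) - Im c *\<^sub>R drep \<rho> (spin (Imm A)) +
     mscale \<i> (Re c *\<^sub>R drep \<rho> (spin (Imm A)) + Im c *\<^sub>R drep \<rho> (spin (Rem A)))"
    using A by (simp add: crep_alt Re_Im_mat spin_add spin_diff spin_scaleR drep_facts drep_diff spin7_scaleR)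
  also have "\<dots> = mscale c (crep \<rho> A)"
    by (simp add: crep_alt vec_eq_iff complex_eq_iff algebra_simps)
  finally show ?thesis .
qed

lemma crep_zero: "crep \<rho> 0 = 0"
  using crep_mscale[OF subspace_skew, of 0] by (simp add: mscale_simps)

lemma crep_minus: "skew A \<Longrightarrow> crep \<rho> (- A) = - crep \<rho> A"
  using crep_mscale[of A "-1"] by (simp add: mscale_simps)

lemma crep_diff: "skew A \<Longrightarrow> skew B \<Longrightarrow> crep \<rho> (A - B) = crep \<rho> A - crep \<rho> B"
  using crep_add[of A "- B"] crep_minus[of B] by (simp add: skew_def transpose_minus)

lemma crep_bracket: "skew A \<Longrightarrow> skew B \<Longrightarrow> crep \<rho> (bracket A B) = bracket (crep \<rho> A) (crep \<rho> B)"
proof -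
  assume A: "skew A" and B: "skew B"
  define a where "a = drep \<rho> (spin (Rem A))" define a' where "a' = drep \<rho> (spin (Imm A))"
  define b where "b = drep \<rho> (spin (Rem B))" define b' where "b' = drep \<rho> (spin (Imm B))"
  have "crep \<rho> (bracket A B) = (bracket a b - bracket a' b') + mscale \<i> (bracket a b' + bracket a' b)"
    unfolding a_def a'_def b_def b'_def crep_alt Re_Im_bracket
    by (simp add: spin_add spin_diff drep_facts drep_diff skew_bracket A B drep_bracket[OF rep, symmetric] spin_bracket)
  also have "\<dots> = bracket (a + mscale \<i> a') (b + mscale \<i> b')"
    by (simp add: bracket_add_left bracket_add_right bracket_mscale mscale_simps)
  finally show ?thesis by (simp add: crep_alt a_def a'_def b_def b'_def)
qed

lemma crep_cmat: "crep \<rho> (cmat A) = drep \<rho> (spin A)"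
  by (simp add: crep_alt Re_Im_mat spin_0 drep_zero mscale_simps)

lemma crep_conj:
  assumes g: "g \<in> Spin7" and A: "skew A"
  shows "crep \<rho> (cmat (vecrep g) ** A ** transpose (cmat (vecrep g))) = \<rho> g ** crep \<rho> A ** \<rho> (transpose g)"
proof -
  have d: "drep \<rho> (spin (vecrep g ** B ** transpose (vecrep g))) = \<rho> g ** drep \<rho> (spin B) ** \<rho> (transpose g)" if "skew B" for B
    using drep_conj[OF rep g spin_in_spin7[OF that]] covers_conj_spin[OF Spin7_covers[OF g]] by simp
  have "Rem (cmat (vecrep g) ** A ** transpose (cmat (vecrep g))) = vecrep g ** Rem A ** transpose (vecrep g)"
    "Imm (cmat (vecrep g) ** A ** transpose (cmat (vecrep g))) = vecrep g ** Imm A ** transpose (vecrep g)"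
    by (simp_all add: Re_Im_mult Re_Im_mat flip: cmat_simps)
  thus ?thesis
    by (simp add: crep_alt d skew_Re_Im A matrix_add_ldistrib matrix_add_rdistrib mscale_mult)
qed

end

definition wedge :: "complex^7 \<Rightarrow> complex^7 \<Rightarrow> complex^7^7" where
  "wedge u v = (\<chi> a b. u $ a * v $ b - v $ a * u $ b)"

lemma skew_wedge: "skew (wedge u v)"
  unfolding skew_nth wedge_def by (simp add: mult.commute)

lemma wedge_bilinear: "wedge (u + u') v = wedge u v + wedge u' v" "wedge u (v + v') = wedge u v + wedge u v'"
  "wedge (c *s u) v = mscale c (wedge u v)" "wedge u (c *s v) = mscale c (wedge u v)"
  "wedge u 0 = 0" "wedge 0 u = 0" "wedge u (- v) = - wedge u v" "wedge (- u) v = - wedge u v"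
  by (simp_all add: wedge_def vec_eq_iff algebra_simps)

lemma wedge_self: "wedge u u = 0" and wedge_swap: "wedge v u = - wedge u v"
  by (simp_all add: wedge_def vec_eq_iff)

lemma wedge_vector: "wedge u v *v w = dot v w *s u - dot u w *s v"
  by (simp add: wedge_def vec_eq_iff matrix_vector_mult_def dot_def sum_subtractf sum_distrib_left algebra_simps)

lemma mult_wedge: "(L ** wedge u v) $ a $ b = (L *v u) $ a * v $ b - (L *v v) $ a * u $ b"
  by (simp add: wedge_def matrix_matrix_mult_def matrix_vector_mult_def sum_subtractf sum_distrib_left algebra_simps)

lemma wedge_mult: "(wedge u v ** transpose L) $ a $ b = u $ a * (L *v v) $ b - v $ a * (L *v u) $ b"
  by (simp add: wedge_def matrix_matrix_mult_def matrix_vector_mult_def transpose_def sum_subtractf sum_distrib_left algebra_simps)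

lemma bracket_wedge:
  assumes "skew L" shows "bracket L (wedge u v) = wedge (L *v u) v + wedge u (L *v v)"
proof -
  have "wedge u v ** L = - (wedge u v ** transpose L)" using assms by (simp add: skew_def)
  hence "bracket L (wedge u v) = L ** wedge u v + wedge u v ** transpose L" by (simp add: bracket_def)
  thus ?thesis by (simp add: vec_eq_iff mult_wedge wedge_mult) (simp add: wedge_def algebra_simps)
qed

lemma wedge_conj: "M ** wedge u v ** transpose M = wedge (M *v u) (M *v v)"
proof -
  have "(M ** wedge u v ** transpose M) $ a $ b = (M *v u) $ a * (M *v v) $ b - (M *v v) $ a * (M *v u) $ b" for a b
    unfolding matrix_matrix_mult_def[of "M ** wedge u v"] vec_lambda_beta mult_wedge
    by (simp add: transpose_def matrix_vector_mult_def[of M v] matrix_vector_mult_def[of M u] sum_distrib_left 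
        sum_subtractf algebra_simps) (rule sum.swap)
  thus ?thesis by (simp add: vec_eq_iff wedge_def)
qed

text \<open>
  Labels of the seven weights of the vector representation: \<open>P\<close> and \<open>M\<close> for the positive and negative ones, \<open>N0\<close> for zero.
\<close>

datatype wt = N0 | P1 | P2 | P3 | M1 | M2 | M3

lemma UNIV_wt: "UNIV = {N0, P1, P2, P3, M1, M2, M3}"
  by (auto intro: wt.exhaust)

instance wt :: finite by standard (simp add: UNIV_wt)

lemma sum_wt: "sum f (UNIV :: wt set) = f N0 + f P1 + f P2 + f P3 + f M1 + f M2 + f M3"
  unfolding UNIV_wt by (simp add: add.assoc)

fun neg :: "wt \<Rightarrow> wt" where
  "neg N0 = N0" | "neg P1 = M1" | "neg P2 = M2" | "neg P3 = M3" | "neg M1 = P1" | "neg M2 = P2" | "neg M3 = P3"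

text \<open>
  A sum of two heights is the height of the corresponding root, so its sign tells positive roots from negative ones.
\<close>

fun height :: "wt \<Rightarrow> int" where
  "height N0 = 0" | "height P1 = 3" | "height P2 = 2" | "height P3 = 1" | "height M1 = -3" | "height M2 = -2" | "height M3 = -1"

text \<open>
  The value of \<open>\<langle>n\<^sub>p, n\<^bsub>-p\<^esub>\<rangle>\<close>. It is -1 for the zero weight because the vector there is \<open>\<i>\<close> times a unit vector.
\<close>

fun nrm :: "wt \<Rightarrow> complex" where
  "nrm N0 = -1" | "nrm P1 = 2" | "nrm P2 = 2" | "nrm P3 = 2" | "nrm M1 = 2" | "nrm M2 = 2" | "nrm M3 = 2"

text \<open>
  Isotropic weight vectors for the torus of rotations in the planes (1,3), (2,6), (4,5). These are the three octonion lines through \<open>e\<^sub>0\<close>, so that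
  the torus contains a maximal torus of G2 and all structure constants become rational.
\<close>

fun nvec :: "wt \<Rightarrow> complex^7" where
  "nvec N0 = vec7 \<i> 0 0 0 0 0 0"
| "nvec P1 = vec7 0 1 0 (-\<i>) 0 0 0" | "nvec M1 = vec7 0 1 0 \<i> 0 0 0"
| "nvec P2 = vec7 0 0 1 0 0 0 (-\<i>)" | "nvec M2 = vec7 0 0 1 0 0 0 \<i>"
| "nvec P3 = vec7 0 0 0 0 1 (-\<i>) 0" | "nvec M3 = vec7 0 0 0 0 1 \<i> 0"

fun wvec :: "real^3 \<Rightarrow> wt \<Rightarrow> complex" where
  "wvec l N0 = 0" | "wvec l P1 = l $ 1" | "wvec l P2 = l $ 2" | "wvec l P3 = l $ 3"
| "wvec l M1 = - l $ 1" | "wvec l M2 = - l $ 2" | "wvec l M3 = - l $ 3"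

text \<open>
  A highest weight vector with respect to the torus of the vectors \<open>nvec\<close>: root vectors of so(7) are the bivectors of two weight vectors.
\<close>

definition hwv :: "(complex^7^7 \<Rightarrow> complex^'n^'n) \<Rightarrow> real^3 \<Rightarrow> complex^'n \<Rightarrow> bool" where
  "hwv R l x \<longleftrightarrow> x \<noteq> 0 \<and>
     (\<forall>p q. height p + height q > 0 \<longrightarrow> R (wedge (nvec p) (nvec q)) *v x = 0) \<and>
     (\<forall>p. R (wedge (nvec p) (nvec (neg p))) *v x = (nrm p * wvec l p) *s x)"

text \<open>
  Weight vectors for the rotations in the planes (1,2), (3,4), (5,6), which define the Cartan subalgebra of the statement.
\<close>

fun ovec :: "wt \<Rightarrow> complex^7" where
  "ovec N0 = vec7 (-\<i>) 0 0 0 0 0 0"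
| "ovec P1 = vec7 0 1 (-\<i>) 0 0 0 0" | "ovec M1 = vec7 0 1 \<i> 0 0 0 0"
| "ovec P2 = vec7 0 0 0 1 (-\<i>) 0 0" | "ovec M2 = vec7 0 0 0 1 \<i> 0 0"
| "ovec P3 = vec7 0 0 0 0 0 1 (-\<i>)" | "ovec M3 = vec7 0 0 0 0 0 1 \<i>"

fun wtvec :: "wt \<Rightarrow> real^3" where
  "wtvec N0 = vector [0,0,0]" | "wtvec P1 = vector [1,0,0]" | "wtvec P2 = vector [0,1,0]" | "wtvec P3 = vector [0,0,1]"
| "wtvec M1 = vector [-1,0,0]" | "wtvec M2 = vector [0,-1,0]" | "wtvec M3 = vector [0,0,-1]"

definition rot :: "3 \<Rightarrow> real^7^7" where
  "rot k = (if k = 1 then elem 2 1 else if k = 2 then elem 4 3 else elem 6 5)"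

lemma skew_rot: "skew (rot k)" by (simp add: rot_def skew_elem)

lemma spin_elem: assumes "a \<noteq> b" shows "spin (elem b a) = (1/2) *\<^sub>R (gb a ** gb b)"
proof -
  have "spin (elem b a) = (- (1/4)) *\<^sub>R ((\<Sum>i\<in>UNIV. \<Sum>j\<in>UNIV. if i = b then if j = a then gb i ** gb j else 0 else 0)
     - (\<Sum>i\<in>UNIV. \<Sum>j\<in>UNIV. if i = a then if j = b then gb i ** gb j else 0 else 0))"
    unfolding spin_def sum_subtractf[symmetric] by (intro arg_cong[where f="scaleR _"] sum.cong refl) (auto simp: elem_def)
  also have "\<dots> = (- (1/4)) *\<^sub>R (gb b ** gb a - gb a ** gb b)" by (simp only: sum_sum_delta)
  also have "gb b ** gb a = - (gb a ** gb b)" using gamma_swap[of "axis b 1" "axis a 1"] assms by simp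
  finally show ?thesis by (simp add: scaleR_right_diff_distrib)
qed

lemma cartan_rot: "cartan k = spin (rot k)"
  by (simp add: cartan_def rot_def spin_elem)

lemma rot_ovec: "cmat (rot k) *v ovec p = (\<i> * of_real (wtvec p $ k)) *s ovec p"
proof -
  have "k = 1 \<or> k = 2 \<or> k = 3" using UNIV_3 by auto
  thus ?thesis
    by (elim disjE; cases p; simp add: rot_def vec_eq_7 matrix_vector_mult_def sum_7 elem_def vector_3)
qed

text \<open>
  An element of Spin(7) conjugating the Cartan subalgebra of the statement to the one adapted to G2; it permutes the coordinate axes and reverses \<open>e\<^sub>0\<close>.
\<close>

definition align :: real_mat8 where
  "align = gamma ((1 / sqrt 2) *\<^sub>R (axis 5 1 - axis 6 1)) ** gamma ((1 / sqrt 2) *\<^sub>R (axis 4 1 - axis 5 1)) **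
     (gamma ((1 / sqrt 2) *\<^sub>R (axis 2 1 - axis 3 1)) ** gamma (axis 0 1) ** mat 1)"

lemma align_Spin7: "align \<in> Spin7"
proof -
  have n: "norm ((1 / sqrt 2) *\<^sub>R (axis a 1 - axis b 1) :: real^7) = 1" if "a \<noteq> b" for a b
    using that by (simp add: norm_eq_sqrt_inner dot_scaleR dot_bilinear flip: dot_inner)
  show ?thesis unfolding align_def by (intro Spin7.step Spin7.one n) simp_all
qed

lemma vecrep_eqI: assumes "g \<in> Spin7" "g ** gamma u = gamma w ** g" shows "vecrep g *v u = w"
proof -
  have "gamma (vecrep g *v u) ** g ** transpose g = gamma w ** g ** transpose g"
    using Spin7_covers[OF assms(1)] assms(2) by (simp add: covers_def)
  hence "gamma (vecrep g *v u) = gamma w" by (simp add: Spin7_orthogonal[OF assms(1)] flip: matrix_mul_assoc)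
  thus ?thesis using gamma_column[of "vecrep g *v u"] gamma_column[of w] by (simp add: vec_eq_iff)
qed

lemma swap_gamma:
  assumes "a \<noteq> b"
  shows "gamma ((1 / sqrt 2) *\<^sub>R (axis a 1 - axis b 1)) ** gamma w = 
    gamma ((dot (axis a 1 - axis b 1) w) *\<^sub>R (axis a 1 - axis b 1) - w) ** gamma ((1 / sqrt 2) *\<^sub>R (axis a 1 - axis b 1))"
proof -
  have n: "norm ((1 / sqrt 2) *\<^sub>R (axis a 1 - axis b 1) :: real^7) = 1"
    using assms by (simp add: norm_eq_sqrt_inner dot_scaleR dot_bilinear flip: dot_inner)
  show ?thesis using reflection_gamma[OF n, of w] by (simp add: dot_scaleR)
qed

lemma gamma_conj_mult:
  assumes "\<And>w. U ** gamma w = gamma (f w) ** U" "\<And>w. V ** gamma w = gamma (h w) ** V"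
  shows "(U ** V) ** gamma w = gamma (f (h w)) ** (U ** V)"
proof -
  have "(U ** V) ** gamma w = U ** (V ** gamma w)" by (simp only: matrix_mul_assoc)
  also have "\<dots> = (U ** gamma (h w)) ** V" by (simp only: assms(2) matrix_mul_assoc)
  finally show ?thesis by (simp only: assms(1) matrix_mul_assoc)
qed

lemma align_axis: "vecrep align *v axis 0 1 = - axis 0 1" "vecrep align *v axis 1 1 = axis 1 1"
  "vecrep align *v axis 2 1 = axis 3 1" "vecrep align *v axis 3 1 = axis 2 1" "vecrep align *v axis 4 1 = axis 6 1"
  "vecrep align *v axis 5 1 = axis 4 1" "vecrep align *v axis 6 1 = axis 5 1"
proof -
  have r0: "gamma (axis 0 1) ** gamma w = gamma ((2 * dot (axis 0 1) w) *\<^sub>R axis 0 1 - w) ** gamma (axis 0 1)" for w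
    by (rule reflection_gamma) simp
  have "align ** gamma w = gamma (let w1 = (2 * dot (axis 0 1) w) *\<^sub>R axis 0 1 - w; 
     w2 = dot (axis 2 1 - axis 3 1) w1 *\<^sub>R (axis 2 1 - axis 3 1) - w1;
     w3 = dot (axis 4 1 - axis 5 1) w2 *\<^sub>R (axis 4 1 - axis 5 1) - w2 in
     dot (axis 5 1 - axis 6 1) w3 *\<^sub>R (axis 5 1 - axis 6 1) - w3) ** align" (is "_ = gamma (?f w) ** _") for w
  proof -
    have a: "align = gamma ((1 / sqrt 2) *\<^sub>R (axis 5 1 - axis 6 1)) ** (gamma ((1 / sqrt 2) *\<^sub>R (axis 4 1 - axis 5 1)) **
     (gamma ((1 / sqrt 2) *\<^sub>R (axis 2 1 - axis 3 1)) ** gamma (axis 0 1)))"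
      by (simp add: align_def matrix_mul_assoc)
    have n: "(5::7) \<noteq> 6" "(4::7) \<noteq> 5" "(2::7) \<noteq> 3" by simp_all
    show ?thesis unfolding a Let_def
      by (rule gamma_conj_mult[OF swap_gamma[OF n(1)] gamma_conj_mult[OF swap_gamma[OF n(2)] gamma_conj_mult[OF swap_gamma[OF n(3)] r0]]])
  qed
  hence "vecrep align *v w = ?f w" for w by (intro vecrep_eqI align_Spin7)
  thus "vecrep align *v axis 0 1 = - axis 0 1" "vecrep align *v axis 1 1 = axis 1 1"
  "vecrep align *v axis 2 1 = axis 3 1" "vecrep align *v axis 3 1 = axis 2 1" "vecrep align *v axis 4 1 = axis 6 1"
  "vecrep align *v axis 5 1 = axis 4 1" "vecrep align *v axis 6 1 = axis 5 1"
    by (simp_all add: Let_def dot_bilinear dot_scaleR vec_eq_7)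
qed

lemma align_ovec: "cmat (vecrep align) *v ovec p = nvec p"
proof -
  have e: "vecrep align $ a $ b = (vecrep align *v axis b 1) $ a" for a b
    by (simp add: matrix_vector_mult_basis column_def)
  show ?thesis
    by (cases p) (simp_all add: vec_eq_7 matrix_vector_mult_def[of "cmat _"] sum_7 e align_axis)
qed

text \<open>
  Transport of the given highest weight vector by \<open>\<rho> align\<close>. Every bivector of two weight vectors of positive total height is a positive root vector.
\<close>

lemma highest_weight_aligned:
  fixes \<rho> :: "real_mat8 \<Rightarrow> complex^'n^'n"
  assumes rep: "spin7_rep \<rho>" and hw: "has_highest_weight \<rho> (a, b, c)"
  shows "\<exists>x. hwv (crep \<rho>) (vector [real a + real b + real c / 2, real b + real c / 2, real c / 2]) x"
proof -
  obtain w x where x: "highest_weight_vector \<rho> w x" and d: "dynkin_label w 1 = a" "dynkin_label w 2 = b" "dynkin_label w 3 = c"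
    using hw by (auto simp: has_highest_weight_def)
  have w3: "w $ 3 = c / 2" and w2: "w $ 2 = real b + real c / 2" and w1: "w $ 1 = real a + real b + real c / 2"
    using d by (simp_all add: dynkin_label_def simple_root_def inner_vec_def sum_3 vector_3)
  have w: "w = vector [real a + real b + real c / 2, real b + real c / 2, real c / 2]"
    by (simp add: vec_eq_iff forall_3 vector_3 w1 w2 w3)
  have x0: "x \<noteq> 0" and xc: "\<And>k. drep \<rho> (cartan k) *v x = (\<i> * of_real (w $ k)) *s x"
    and xr: "\<And>\<alpha> E. \<alpha> \<in> positive_roots \<Longrightarrow> E \<in> root_space \<alpha> \<Longrightarrow> drep_complex \<rho> E *v x = 0"
    using x by (auto simp: highest_weight_vector_def)
  have pos: "crep \<rho> (wedge (ovec p) (ovec q)) *v x = 0" if h: "height p + height q > 0" for p q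
  proof (cases "p = q")
    case True thus ?thesis by (simp add: wedge_self crep_zero[OF rep])
  next
    case False
    have "spinC (wedge (ovec p) (ovec q)) \<in> root_space (wtvec p + wtvec q)"
    proof -
      have "bracket (cmat (cartan k)) (spinC (wedge (ovec p) (ovec q))) =
         mscale (\<i> * of_real ((wtvec p + wtvec q) $ k)) (spinC (wedge (ovec p) (ovec q)))" for k
      proof -
        have "bracket (cmat (cartan k)) (spinC (wedge (ovec p) (ovec q))) = spinC (bracket (cmat (rot k)) (wedge (ovec p) (ovec q)))"
          unfolding cartan_rot spinC_cmat[symmetric] by (intro spinC_bracket skew_cmat skew_rot skew_wedge)
        thus ?thesis
          by (simp add: bracket_wedge skew_cmat skew_rot rot_ovec wedge_bilinear distrib_left spinC_mscale flip: mscale_simps(3))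
      qed
      moreover have "spinC (wedge (ovec p) (ovec q)) \<in> spin7_complex"
        unfolding spin7_complex_eq using skew_wedge by blast
      ultimately show ?thesis by (simp add: root_space_def)
    qed
    moreover have "wtvec p + wtvec q \<in> positive_roots"
      using h False unfolding positive_roots_def
      by (cases p; cases q) (simp_all add: vec_eq_iff forall_3 vector_3)
    ultimately show ?thesis using xr by (simp add: crep_def)
  qed
  have crot: "crep \<rho> (cmat (rot k)) *v x = (\<i> * of_real (w $ k)) *s x" for k
    using xc[of k] by (simp add: crep_cmat[OF rep] cartan_rot)
  have e: "cmat (elem i j) = - wedge (axis j 1) (axis i 1)" for i j
    by (auto simp: vec_eq_iff elem_def wedge_def)
  have car: "crep \<rho> (wedge (ovec p) (ovec (neg p))) *v x = (nrm p * wvec w p) *s x" for p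
  proof -
    have P: "crep \<rho> (wedge (ovec p) (ovec (neg p))) *v x = (nrm p * wvec w p) *s x" 
      if "wedge (ovec p) (ovec (neg p)) = mscale (- 2 * \<i> * s) (cmat (rot k))" "s * w $ k = wvec w p" "nrm p = 2" for p k s
    proof -
      have "crep \<rho> (wedge (ovec p) (ovec (neg p))) *v x = (- 2 * \<i> * s * (\<i> * of_real (w $ k))) *s x"
        unfolding that(1) crep_mscale[OF rep skew_cmat[OF skew_rot]] mscale_vector crot by simp
      also have "- 2 * \<i> * s * (\<i> * of_real (w $ k)) = nrm p * wvec w p"
        using that(2,3) by (simp add: algebra_simps)
      finally show ?thesis .
    qed
    show ?thesis
    proof (cases p)
      case N0 thus ?thesis by (simp add: wedge_self crep_zero[OF rep])
    next
      case P1 show ?thesis by (rule P[of p 1 1]) (simp_all add: P1 rot_def vec_eq_7 wedge_def elem_def)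
    next
      case P2 show ?thesis by (rule P[of p 1 2]) (simp_all add: P2 rot_def vec_eq_7 wedge_def elem_def)
    next
      case P3 show ?thesis by (rule P[of p 1 3]) (simp_all add: P3 rot_def vec_eq_7 wedge_def elem_def)
    next
      case M1 show ?thesis by (rule P[of p "-1" 1]) (simp_all add: M1 rot_def vec_eq_7 wedge_def elem_def)
    next
      case M2 show ?thesis by (rule P[of p "-1" 2]) (simp_all add: M2 rot_def vec_eq_7 wedge_def elem_def)
    next
      case M3 show ?thesis by (rule P[of p "-1" 3]) (simp_all add: M3 rot_def vec_eq_7 wedge_def elem_def)
    qed
  qed
  define y where "y = \<rho> align *v x"
  have mv: "crep \<rho> (wedge (nvec p) (nvec q)) *v y = \<rho> align *v (crep \<rho> (wedge (ovec p) (ovec q)) *v x)" for p q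
  proof -
    have "wedge (nvec p) (nvec q) = cmat (vecrep align) ** wedge (ovec p) (ovec q) ** transpose (cmat (vecrep align))"
      by (simp add: wedge_conj align_ovec)
    hence "crep \<rho> (wedge (nvec p) (nvec q)) *v y = (\<rho> align ** crep \<rho> (wedge (ovec p) (ovec q)) ** (\<rho> (transpose align) ** \<rho> align)) *v x"
      by (simp add: crep_conj[OF rep align_Spin7 skew_wedge] y_def matrix_vector_mul_assoc matrix_mul_assoc)
    thus ?thesis by (simp add: rep_transpose[OF rep align_Spin7] matrix_vector_mul_assoc)
  qed
  have "y \<noteq> 0"
  proof
    assume "y = 0"
    hence "\<rho> (transpose align) *v (\<rho> align *v x) = 0" by (simp add: y_def)
    thus False using x0 by (simp add: rep_transpose[OF rep align_Spin7] matrix_vector_mul_assoc)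
  qed
  moreover have "\<rho> align *v (c *s x) = c *s y" for c
    by (simp add: y_def vec_eq_iff matrix_vector_mult_def sum_distrib_left mult_ac)
  ultimately have "hwv (crep \<rho>) w y"
    using pos car by (simp add: hwv_def mv)
  thus ?thesis unfolding w by blast
qed

section \<open>Twisted spinors in coordinates\<close>

definition cv :: "real^7 \<Rightarrow> complex^7" where "cv u = (\<chi> a. of_real (u $ a))"

lemma cv_simps: "cv (u + v) = cv u + cv v" "cv (r *\<^sub>R u) = of_real r *s cv u" "dot (cv u) (cv v) = of_real (dot u v)"
  "cross (cv u) (cv v) = cv (cross u v)" "cv (axis a 1) = axis a 1" "cmat L *v cv u = cv (L *v u)"
  by (simp_all add: cv_def vec_eq_iff dot_def cross_def axis_def matrix_vector_mult_def)

lemma crossmat_cv: "crossmat (cv u) = cmat (crossmat u)"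
proof -
  have "cross (cv u) (axis b 1) $ c = of_real (cross u (axis b 1) $ c)" for b c
  proof -
    have "cross (cv u) (axis b 1) $ c = cv (cross u (axis b 1)) $ c"
      unfolding cv_simps(4)[symmetric] cv_simps(5) ..
    thus ?thesis by (simp add: cv_def)
  qed
  thus ?thesis by (simp add: vec_eq_iff crossmat_def)
qed

lemma dot_sum: "dot (\<Sum>i\<in>I. f i) v = (\<Sum>i\<in>I. dot (f i) v)" "dot v (\<Sum>i\<in>I. f i) = (\<Sum>i\<in>I. dot v (f i))"
  by (induction I rule: infinite_finite_induct) (simp_all add: dot_bilinear)

lemma expand_axis: "u = (\<Sum>c\<in>UNIV. u $ c *s axis c 1)" for u :: "'a::real_normed_field^7"
  using basis_expansion[of u] by simp

text \<open>
  Sums \<open>\<Sum>\<^sub>a B (e\<^sub>a, e\<^sub>a)\<close> over an orthonormal basis do not depend on the basis and may also be computed with the weight vectors. This replaces the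
  arbitrary basis of \<open>\<mm>\<close> by one in which all coefficients are rational.
\<close>

locale bilinear_form =
  fixes B :: "complex^7 \<Rightarrow> complex^7 \<Rightarrow> complex"
  assumes addl: "B (u + u') v = B u v + B u' v" and addr: "B u (v + v') = B u v + B u v'"
    and scl: "B (c *s u) v = c * B u v" and scr: "B u (c *s v) = c * B u v"
begin

lemma zero: "B 0 v = 0" "B u 0 = 0" using scl[of 0 0 v] scr[of u 0 0] by simp_all

lemma sum: "B (\<Sum>i\<in>I. f i) v = (\<Sum>i\<in>I. B (f i) v)" "B v (\<Sum>i\<in>I. f i) = (\<Sum>i\<in>I. B v (f i))"
  by (induction I rule: infinite_finite_induct) (simp_all add: zero addl addr)

lemma frame_sum:
  assumes "finite I" "\<And>c d. (\<Sum>i\<in>I. k i * u i $ c * v i $ d) = (if c = d then 1 else 0)"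
  shows "(\<Sum>i\<in>I. k i * B (u i) (v i)) = (\<Sum>c\<in>UNIV. B (axis c 1) (axis c 1))"
proof -
  have "B (u i) (v i) = (\<Sum>c\<in>UNIV. \<Sum>d\<in>UNIV. u i $ c * v i $ d * B (axis c 1) (axis d 1))" for i
  proof -
    have "B (u i) (v i) = B (\<Sum>c\<in>UNIV. u i $ c *s axis c 1) (\<Sum>d\<in>UNIV. v i $ d *s axis d 1)"
      using expand_axis[of "u i"] expand_axis[of "v i"] by simp
    also have "\<dots> = (\<Sum>d\<in>UNIV. \<Sum>c\<in>UNIV. u i $ c * v i $ d * B (axis c 1) (axis d 1))"
      by (simp add: sum scl scr sum_distrib_left mult_ac)
    finally show ?thesis by (subst sum.swap)
  qed
  hence "(\<Sum>i\<in>I. k i * B (u i) (v i)) = (\<Sum>i\<in>I. \<Sum>c\<in>UNIV. \<Sum>d\<in>UNIV. (k i * u i $ c * v i $ d) * B (axis c 1) (axis d 1))"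
    by (simp add: sum_distrib_left mult.assoc)
  also have "\<dots> = (\<Sum>c\<in>UNIV. \<Sum>i\<in>I. \<Sum>d\<in>UNIV. (k i * u i $ c * v i $ d) * B (axis c 1) (axis d 1))"
    by (rule sum.swap)
  also have "\<dots> = (\<Sum>c\<in>UNIV. \<Sum>d\<in>UNIV. \<Sum>i\<in>I. (k i * u i $ c * v i $ d) * B (axis c 1) (axis d 1))"
    by (rule sum.cong[OF refl], rule sum.swap)
  also have "\<dots> = (\<Sum>c\<in>UNIV. \<Sum>d\<in>UNIV. (if c = d then 1 else 0) * B (axis c 1) (axis d 1))"
    unfolding sum_distrib_right[symmetric] assms(2) ..
  also have "\<dots> = (\<Sum>c\<in>UNIV. B (axis c 1) (axis c 1))"
    by (simp add: if_distrib[of "\<lambda>x. x * _"] cong: if_cong)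
  finally show ?thesis .
qed

lemma weight_sum: "(\<Sum>p\<in>UNIV. inverse (nrm p) * B (nvec p) (nvec (neg p))) = (\<Sum>c\<in>UNIV. B (axis c 1) (axis c 1))"
proof (rule frame_sum)
  have "\<forall>c d. (\<Sum>p\<in>UNIV. inverse (nrm p) * nvec p $ c * nvec (neg p) $ d) = (if c = d then 1 else 0)"
    unfolding all_7 by (simp add: sum_wt)
  thus "(\<Sum>p\<in>UNIV. inverse (nrm p) * nvec p $ c * nvec (neg p) $ d) = (if c = d then 1 else 0)" for c d by blast
qed simp

end

lemma orthonormal_complete:
  fixes i :: "7 \<Rightarrow> real^7"
  assumes "\<And>a b. dot (i a) (i b) = (if a = b then 1 else 0)"
  shows "(\<Sum>a\<in>UNIV. i a $ c * i a $ d) = (if c = d then 1 else 0)"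
proof -
  define M :: "real^7^7" where "M = (\<chi> a c. i a $ c)"
  have "M ** transpose M = mat 1"
    using assms by (simp add: M_def vec_eq_iff matrix_matrix_mult_def transpose_def mat_def dot_def)
  hence "transpose M ** M = mat 1" by (simp add: matrix_left_right_inverse)
  hence "(transpose M ** M) $ c $ d = (mat 1 :: real^7^7) $ c $ d" by (rule arg_cong)
  thus ?thesis by (simp add: M_def matrix_matrix_mult_def transpose_def mat_def)
qed

lemma (in bilinear_form) orthonormal_sum:
  fixes i :: "7 \<Rightarrow> real^7"
  assumes "\<And>a b. dot (i a) (i b) = (if a = b then 1 else 0)"
  shows "(\<Sum>a\<in>UNIV. B (cv (i a)) (cv (i a))) = (\<Sum>c\<in>UNIV. B (axis c 1) (axis c 1))"
proof -
  have "(\<Sum>a\<in>UNIV. 1 * B (cv (i a)) (cv (i a))) = (\<Sum>c\<in>UNIV. B (axis c 1) (axis c 1))"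
  proof (rule frame_sum)
    show "(\<Sum>a\<in>UNIV. 1 * cv (i a) $ c * cv (i a) $ d) = (if c = d then 1 else 0)" for c d
      using orthonormal_complete[OF assms, of c d] unfolding cv_def
      by (simp flip: of_real_mult of_real_sum)
  qed simp
  thus ?thesis by simp
qed

text \<open>
  The complex linear extension of \<open>vecmat\<close>; it turns a value in the complexification of spin(7) into a skew 7 by 7 matrix.
\<close>

definition vecC :: "complex_mat8 \<Rightarrow> complex^7^7" where
  "vecC s = cmat (vecmat (Rem s)) + mscale \<i> (cmat (vecmat (Imm s)))"

lemma vecC_spinC: "skew A \<Longrightarrow> vecC (spinC A) = A"
  using complex_matrix_split[of A] by (simp add: vecC_def Re_Im_spinC skew_Re_Im)

lemma vecmat_linear: "vecmat (X + Y) = vecmat X + vecmat Y" "vecmat (X - Y) = vecmat X - vecmat Y" "vecmat (r *\<^sub>R X) = r *\<^sub>R vecmat X"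
  by (simp_all add: linear_add[OF linear_vecmat] linear_diff[OF linear_vecmat] linear_scale[OF linear_vecmat])

lemma vecC_add: "vecC (s + t) = vecC s + vecC t"
  by (simp add: vecC_def Re_Im_mat vecmat_linear cmat_simps mscale_simps)

lemma vecC_mscale: "vecC (mscale c s) = mscale c (vecC s)"
  by (simp add: vecC_def Re_Im_mat vecmat_linear vec_eq_iff complex_eq_iff algebra_simps)

lemma vecC_scaleR: "vecC (r *\<^sub>R s) = mscale (of_real r) (vecC s)"
  using vecC_mscale[of "of_real r" s] by (simp add: mscale_real)

lemma vecC_0: "vecC 0 = 0" using vecC_mscale[of 0 0] by (simp add: mscale_simps)

lemma vecC_minus: "vecC (- s) = - vecC s" using vecC_mscale[of "-1" s] by (simp add: mscale_simps)

lemma vecC_sum: "vecC (\<Sum>i\<in>I. f i) = (\<Sum>i\<in>I. vecC (f i))"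
  by (induction I rule: infinite_finite_induct) (simp_all add: vecC_0 vecC_add)

text \<open>
  The function component of a twisted spinor, as a bilinear form. Lowering all indices makes the G2-action a substitution in the arguments.
\<close>

definition c0 :: "twisted \<Rightarrow> complex^7 \<Rightarrow> complex^7 \<Rightarrow> complex" where
  "c0 w y z = dot y (vecC (fst w) *v z)"

text \<open>
  The vector component of a twisted spinor as a trilinear form, independent of the orthonormal basis used for its coordinates.
\<close>

definition c1 :: "(7 \<Rightarrow> real^7) \<Rightarrow> twisted \<Rightarrow> complex^7 \<Rightarrow> complex^7 \<Rightarrow> complex^7 \<Rightarrow> complex" where
  "c1 i w u y z = (\<Sum>a\<in>UNIV. dot u (cv (i a)) * dot y (vecC (snd w $ a) *v z))"

lemma cmatrix_vector: "(A + B) *v z = A *v z + B *v z" "(mscale c A) *v z = c *s (A *v z)" "(- A) *v z = - (A *v z)" "0 *v z = 0"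
   "A *v (z + z') = A *v z + A *v z'" "A *v (c *s z) = c *s (A *v z)" "A *v (- z) = - (A *v z)"
   for A B :: "complex^'n^'m"
  by (simp_all add: vec_eq_iff matrix_vector_mult_def sum.distrib sum_distrib_left sum_negf algebra_simps)

lemma c0_linear: "c0 (w + w') y z = c0 w y z + c0 w' y z" "c0 (tscale k w) y z = k * c0 w y z"
   "c0 w (y + y') z = c0 w y z + c0 w y' z" "c0 w (k *s y) z = k * c0 w y z"
   "c0 w y (z + z') = c0 w y z + c0 w y z'" "c0 w y (k *s z) = k * c0 w y z"
  by (simp_all add: c0_def vecC_add cmatrix_vector dot_bilinear tscale_def vecC_mscale split: prod.split)

lemma c1_linear: "c1 i (w + w') u y z = c1 i w u y z + c1 i w' u y z" "c1 i (tscale k w) u y z = k * c1 i w u y z"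
   "c1 i w (u + u') y z = c1 i w u y z + c1 i w u' y z" "c1 i w (k *s u) y z = k * c1 i w u y z"
   "c1 i w u (y + y') z = c1 i w u y z + c1 i w u y' z" "c1 i w u (k *s y) z = k * c1 i w u y z"
   "c1 i w u y (z + z') = c1 i w u y z + c1 i w u y z'" "c1 i w u y (k *s z) = k * c1 i w u y z"
  by (simp_all add: c1_def vecC_add cmatrix_vector dot_bilinear tscale_def vecC_mscale sum.distrib sum_distrib_left algebra_simps split: prod.split)

lemma vecC_skew: "s \<in> spin7_complex \<Longrightarrow> skew (vecC s)"
  by (auto simp: spin7_complex_eq vecC_spinC)

lemma vecC_inj: "s \<in> spin7_complex \<Longrightarrow> vecC s = 0 \<Longrightarrow> s = 0"
proof -
  assume "s \<in> spin7_complex" "vecC s = 0"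
  then obtain A where "s = spinC A" "skew A" by (auto simp: spin7_complex_eq)
  moreover from this \<open>vecC s = 0\<close> have "A = 0" by (simp add: vecC_spinC)
  moreover have "spinC 0 = 0" using spinC_mscale[of 0 0] by (simp add: mscale_simps)
  ultimately show "s = 0" by simp
qed

lemma skew_dot: "skew A \<Longrightarrow> dot y (A *v z) = - dot z (A *v y)" for A :: "complex^7^7"
proof -
  assume A: "skew A"
  have "dot y (A *v z) = (\<Sum>a\<in>UNIV. \<Sum>b\<in>UNIV. y $ a * (A $ a $ b * z $ b))"
    by (simp add: dot_def matrix_vector_mult_def sum_distrib_left)
  also have "\<dots> = (\<Sum>b\<in>UNIV. \<Sum>a\<in>UNIV. y $ a * (A $ a $ b * z $ b))" by (rule sum.swap)
  also have "\<dots> = (\<Sum>b\<in>UNIV. \<Sum>a\<in>UNIV. - (z $ b * (A $ b $ a * y $ a)))"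
    by (intro sum.cong refl) (subst skewD[OF A], simp)
  also have "\<dots> = - dot z (A *v y)"
    by (simp add: dot_def matrix_vector_mult_def sum_distrib_left sum_negf)
  finally show ?thesis .
qed

lemma c_skew: "w \<in> twisted_spinors \<Longrightarrow> c0 w y z = - c0 w z y" "w \<in> twisted_spinors \<Longrightarrow> c1 i w u y z = - c1 i w u z y"
proof -
  assume w: "w \<in> twisted_spinors"
  hence "skew (vecC (fst w))" "skew (vecC (snd w $ a))" for a by (auto simp: twisted_spinors_def vecC_skew)
  thus "c0 w y z = - c0 w z y" "c1 i w u y z = - c1 i w u z y"
    using skew_dot[of "vecC (fst w)" y z] skew_dot[of "vecC (snd w $ _)" y z]
    unfolding c0_def c1_def by (simp_all add: sum_negf)
qed

lemma tensor_map_pair: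
  "tensor_map F G w = (mscale (fst (F (1, 0))) (G (fst w)) + (\<Sum>a\<in>UNIV. mscale (fst (F (0, axis a 1))) (G (snd w $ a))),
     \<chi> c. mscale (snd (F (1, 0)) $ c) (G (fst w)) + (\<Sum>a\<in>UNIV. mscale (snd (F (0, axis a 1)) $ c) (G (snd w $ a))))"
  by (simp add: tensor_map_def tensor_def case_prod_unfold prod_eq_iff fst_sum snd_sum vec_eq_iff)

text \<open>
  An orthonormal basis of \<open>\<mm>\<close> is the image under the isometry \<open>Jm\<close> of an orthonormal basis \<open>i\<close> of \<open>\<real>\<^sup>7\<close>.
\<close>

locale dirac_setting =
  fixes \<rho> :: "real_mat8 \<Rightarrow> complex^'n^'n" and I :: "7 \<Rightarrow> real_mat8" and i :: "7 \<Rightarrow> real^7"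
  assumes rep: "spin7_rep \<rho>" and I: "\<And>a. I a = Jm (i a)" and on: "\<And>a b. dot (i a) (i b) = (if a = b then 1 else 0)"
begin

lemma clifford_I: "clifford I (Jm u) (f, v) = (\<Sum>a\<in>UNIV. of_real (dot u (i a)) * v $ a,
   \<chi> c. - f * of_real (dot u (i c)) - (\<Sum>a\<in>UNIV. of_real (dot (cross u (i a)) (i c)) * v $ a))"
  by (simp add: clifford_def I Jm_inner phi_Jm)

text \<open>
  Spinors with the vector part written in the standard basis instead of the basis \<open>i\<close>.
\<close>

definition emb :: "spinor \<Rightarrow> spinor" where "emb \<psi> = (fst \<psi>, \<Sum>a\<in>UNIV. snd \<psi> $ a *s cv (i a))"

text \<open>
  Clifford multiplication extended to complex vectors.
\<close>

definition cl :: "complex^7 \<Rightarrow> spinor \<Rightarrow> spinor" where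
  "cl u \<psi> = (dot u (snd \<psi>), - (fst \<psi> *s u) - cross u (snd \<psi>))"

lemma complete: "(\<Sum>a\<in>UNIV. dot u (cv (i a)) *s cv (i a)) = u"
proof -
  have "(\<Sum>a\<in>UNIV. dot u (cv (i a)) * cv (i a) $ c) = u $ c" for c
  proof -
    interpret bilinear_form "\<lambda>x y. dot u x * y $ c" by unfold_locales (simp_all add: dot_bilinear algebra_simps)
    have "(\<Sum>a\<in>UNIV. dot u (cv (i a)) * cv (i a) $ c) = (\<Sum>d\<in>UNIV. u $ d * (if d = c then 1 else 0))"
      using orthonormal_sum[OF on] by simp
    thus ?thesis by (simp add: if_distrib[of "\<lambda>x. _ * x"] cong: if_cong)
  qed
  thus ?thesis by (simp add: vec_eq_iff)
qed

lemma emb_inj: "emb \<psi> = emb \<psi>' \<Longrightarrow> \<psi> = \<psi>'"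
proof -
  have d: "dot (snd (emb \<psi>)) (cv (i b)) = snd \<psi> $ b" for \<psi> b
    by (simp add: emb_def dot_sum dot_bilinear cv_simps on if_distrib[of of_real] if_distrib[of "\<lambda>x. _ * x"] cong: if_cong)
  assume "emb \<psi> = emb \<psi>'"
  hence "fst \<psi> = fst \<psi>'" "snd \<psi> $ b = snd \<psi>' $ b" for b using d[of \<psi> b] d[of \<psi>' b] by (simp_all add: emb_def)
  thus ?thesis by (simp add: prod_eq_iff vec_eq_iff)
qed

lemma cross_sum: "cross u (\<Sum>i\<in>S. f i) = (\<Sum>i\<in>S. cross u (f i))" "cross (\<Sum>i\<in>S. f i) u = (\<Sum>i\<in>S. cross (f i) u)"
  by (induction S rule: infinite_finite_induct) (simp_all add: cross_bilinear)

lemma emb_clifford: "emb (clifford I (Jm u) \<psi>) = cl (cv u) (emb \<psi>)"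
proof -
  obtain f v where p: "\<psi> = (f, v)" by force
  have 1: "(\<Sum>c\<in>UNIV. of_real (dot u (i c)) *s cv (i c)) = cv u"
    using complete[of "cv u"] by (simp add: cv_simps)
  have 2: "(\<Sum>c\<in>UNIV. of_real (dot (cross u (i a)) (i c)) *s cv (i c)) = cross (cv u) (cv (i a))" for a
    using complete[of "cross (cv u) (cv (i a))"] by (simp add: cv_simps)
  have "(\<Sum>c\<in>UNIV. (- f * of_real (dot u (i c)) - (\<Sum>a\<in>UNIV. of_real (dot (cross u (i a)) (i c)) * v $ a)) *s cv (i c))
     = - (f *s (\<Sum>c\<in>UNIV. of_real (dot u (i c)) *s cv (i c))) - (\<Sum>a\<in>UNIV. v $ a *s (\<Sum>c\<in>UNIV. of_real (dot (cross u (i a)) (i c)) *s cv (i c)))"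
    by (simp add: vec_eq_iff sum_distrib_left sum_subtractf sum_distrib_right algebra_simps sum_negf) (subst sum.swap, simp add: algebra_simps)
  thus ?thesis unfolding 1 2
    by (simp add: p clifford_I emb_def cl_def dot_sum dot_bilinear cv_simps cross_sum cross_bilinear mult.commute)
qed

end

section \<open>The Dirac operator in coordinates\<close>

lemma cross_axis:
  "cross (axis (0::7) 1) (axis 0 1) = 0"
  "cross (axis (0::7) 1) (axis 1 1) = axis 3 1"
  "cross (axis (0::7) 1) (axis 2 1) = axis 6 1"
  "cross (axis (0::7) 1) (axis 3 1) = - axis 1 1"
  "cross (axis (0::7) 1) (axis 4 1) = axis 5 1"
  "cross (axis (0::7) 1) (axis 5 1) = - axis 4 1"
  "cross (axis (0::7) 1) (axis 6 1) = - axis 2 1"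
  "cross (axis (1::7) 1) (axis 0 1) = - axis 3 1"
  "cross (axis (1::7) 1) (axis 1 1) = 0"
  "cross (axis (1::7) 1) (axis 2 1) = axis 4 1"
  "cross (axis (1::7) 1) (axis 3 1) = axis 0 1"
  "cross (axis (1::7) 1) (axis 4 1) = - axis 2 1"
  "cross (axis (1::7) 1) (axis 5 1) = axis 6 1"
  "cross (axis (1::7) 1) (axis 6 1) = - axis 5 1"
  "cross (axis (2::7) 1) (axis 0 1) = - axis 6 1"
  "cross (axis (2::7) 1) (axis 1 1) = - axis 4 1"
  "cross (axis (2::7) 1) (axis 2 1) = 0"
  "cross (axis (2::7) 1) (axis 3 1) = axis 5 1"
  "cross (axis (2::7) 1) (axis 4 1) = axis 1 1"
  "cross (axis (2::7) 1) (axis 5 1) = - axis 3 1"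
  "cross (axis (2::7) 1) (axis 6 1) = axis 0 1"
  "cross (axis (3::7) 1) (axis 0 1) = axis 1 1"
  "cross (axis (3::7) 1) (axis 1 1) = - axis 0 1"
  "cross (axis (3::7) 1) (axis 2 1) = - axis 5 1"
  "cross (axis (3::7) 1) (axis 3 1) = 0"
  "cross (axis (3::7) 1) (axis 4 1) = axis 6 1"
  "cross (axis (3::7) 1) (axis 5 1) = axis 2 1"
  "cross (axis (3::7) 1) (axis 6 1) = - axis 4 1"
  "cross (axis (4::7) 1) (axis 0 1) = - axis 5 1"
  "cross (axis (4::7) 1) (axis 1 1) = axis 2 1"
  "cross (axis (4::7) 1) (axis 2 1) = - axis 1 1"
  "cross (axis (4::7) 1) (axis 3 1) = - axis 6 1"
  "cross (axis (4::7) 1) (axis 4 1) = 0"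
  "cross (axis (4::7) 1) (axis 5 1) = axis 0 1"
  "cross (axis (4::7) 1) (axis 6 1) = axis 3 1"
  "cross (axis (5::7) 1) (axis 0 1) = axis 4 1"
  "cross (axis (5::7) 1) (axis 1 1) = - axis 6 1"
  "cross (axis (5::7) 1) (axis 2 1) = axis 3 1"
  "cross (axis (5::7) 1) (axis 3 1) = - axis 2 1"
  "cross (axis (5::7) 1) (axis 4 1) = - axis 0 1"
  "cross (axis (5::7) 1) (axis 5 1) = 0"
  "cross (axis (5::7) 1) (axis 6 1) = axis 1 1"
  "cross (axis (6::7) 1) (axis 0 1) = axis 2 1"
  "cross (axis (6::7) 1) (axis 1 1) = axis 5 1"
  "cross (axis (6::7) 1) (axis 2 1) = - axis 0 1"
  "cross (axis (6::7) 1) (axis 3 1) = axis 4 1"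
  "cross (axis (6::7) 1) (axis 4 1) = - axis 3 1"
  "cross (axis (6::7) 1) (axis 5 1) = - axis 1 1"
  "cross (axis (6::7) 1) (axis 6 1) = 0"
  by (simp_all add: vec_eq_7 cross_nth axis7_nth)

lemma gamma_gamma_spin:
  assumes "dot u w = 0" shows "gamma u ** gamma w \<in> spin7"
proof -
  define M :: "real^7^7" where "M = (\<chi> a b. u $ a * w $ b - w $ a * u $ b)"
  have e: "gamma u ** gamma w = (\<Sum>a\<in>UNIV. \<Sum>b\<in>UNIV. (u $ a * w $ b) *\<^sub>R (gb a ** gb b))" for u w
    by (subst gamma_expand, subst gamma_expand[of w])
       (simp add: matrix_mult_sum_left matrix_mult_sum_right scaleR_right.sum, subst sum.swap, simp add: mult.commute)
  have "spin M = (- (1/4)) *\<^sub>R (gamma u ** gamma w - gamma w ** gamma u)"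
    unfolding spin_def M_def e[of u w] e[of w u]
    by (simp add: scaleR_left_diff_distrib sum_subtractf)
  also have "gamma w ** gamma u = - (gamma u ** gamma w)"
    using gamma_swap[of w u] assms by (simp add: dot_commute)
  finally have "spin M = (- (1/2)) *\<^sub>R (gamma u ** gamma w)" by (simp flip: scaleR_2)
  hence "spin ((- 2) *\<^sub>R M) = gamma u ** gamma w" by (simp only: spin_scaleR) simp
  moreover have "skew M" unfolding skew_nth M_def by simp
  hence "skew ((- 2) *\<^sub>R M)" by (rule skew_scaleR)
  ultimately show ?thesis using spin_in_spin7 by metis
qed

lemma mexp_rotation:
  fixes E :: "real^'n^'n"
  assumes "E ** E = - mat 1" shows "mexp (t *\<^sub>R E) = cos t *\<^sub>R mat 1 + sin t *\<^sub>R E"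
proof -
  define Y :: "real \<Rightarrow> real^'n^'n" where "Y t = cos t *\<^sub>R mat 1 + sin t *\<^sub>R E" for t
  have "(Y has_vector_derivative E ** Y t) (at t)" for t
  proof -
    have "(Y has_vector_derivative (- sin t) *\<^sub>R mat 1 + cos t *\<^sub>R E) (at t)"
      unfolding Y_def by (auto intro!: derivative_eq_intros simp: has_real_derivative_iff_has_vector_derivative[symmetric])
    moreover have "E ** Y t = (- sin t) *\<^sub>R mat 1 + cos t *\<^sub>R E"
      by (simp add: Y_def matrix_add_ldistrib assms)
    ultimately show ?thesis by simp
  qed
  from linear_ode_unique[OF this, of t] show ?thesis by (simp add: Y_def)
qed

text \<open>
  Let \<open>w\<close> be a unit vector orthogonal to \<open>u\<close> in the plane of \<open>u\<close> and \<open>v\<close>, or any one if they are parallel. Then \<open>E = gamma u ** gamma w\<close> has square -1 and the product is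
  \<open>cos a + sin a E\<close> for an angle \<open>a\<close>.
\<close>

lemma gamma_gamma_exp:
  assumes u: "norm u = 1" and v: "norm v = 1"
  shows "\<exists>X\<in>spin7. gamma u ** gamma v = mexp X"
proof -
  have uu: "dot u u = 1" and vv: "dot v v = 1" using u v by (simp_all add: dot_inner dot_square_norm)
  define c where "c = - dot u v"
  define w' where "w' = v + c *\<^sub>R u"
  have ow': "dot u w' = 0" by (simp add: w'_def dot_bilinear dot_scaleR uu c_def)
  have nw': "dot w' w' = 1 - c\<^sup>2"
    by (simp add: w'_def dot_bilinear dot_scaleR uu vv c_def dot_commute[of v u] power2_eq_square algebra_simps)
  have "\<exists>w. dot u w = 0 \<and> dot w w = 1 \<and> w' = sqrt (1 - c\<^sup>2) *\<^sub>R w"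
  proof (cases "w' = 0")
    case True
    obtain y :: "real^7" where y: "y \<noteq> 0" "orthogonal u y"
      using orthogonal_to_vector_exists[of u] by auto
    have "dot (y /\<^sub>R norm y) (y /\<^sub>R norm y) = 1" using y by (simp add: dot_inner)  (simp add: dot_square_norm power2_eq_square field_simps)?
    thus ?thesis using True nw' y
      by (intro exI[of _ "y /\<^sub>R norm y"]) (simp add: dot_scaleR dot_bilinear orthogonal_def dot_inner)
  next
    case False
    have p: "1 - c\<^sup>2 > 0" using False by (simp add: nw'[symmetric] dot_inner)
    thus ?thesis using nw' ow'
      by (intro exI[of _ "w' /\<^sub>R sqrt (1 - c\<^sup>2)"]) (simp add: dot_scaleR dot_bilinear flip: power2_eq_square, simp add: field_simps)?
  qed
  then obtain w where w: "dot u w = 0" "dot w w = 1" "w' = sqrt (1 - c\<^sup>2) *\<^sub>R w" by blast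
  have c1: "c\<^sup>2 \<le> 1" using nw' inner_ge_zero[of w'] by (simp add: dot_inner)
  hence cc: "-1 \<le> c" "c \<le> 1" by (simp_all add: abs_le_square_iff[of c 1, simplified, symmetric] abs_le_iff power2_le_iff_abs_le[of 1 c, simplified])
  define E where "E = gamma u ** gamma w"
  have EE: "E ** E = - mat 1"
  proof -
    have "E ** E = gamma u ** (gamma w ** gamma u) ** gamma w" by (simp add: E_def matrix_mul_assoc)
    also have "gamma w ** gamma u = - (gamma u ** gamma w)" using gamma_swap[of w u] w(1) by (simp add: dot_commute)
    also have "gamma u ** - (gamma u ** gamma w) ** gamma w = - ((gamma u ** gamma u) ** (gamma w ** gamma w))"
      by (simp add: matrix_mul_assoc)
    finally show ?thesis by (simp add: gamma_square uu w(2))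
  qed
  have vw: "v = sqrt (1 - c\<^sup>2) *\<^sub>R w - c *\<^sub>R u" using w(3) by (simp add: w'_def algebra_simps)
  have "gamma u ** gamma v = c *\<^sub>R mat 1 + sqrt (1 - c\<^sup>2) *\<^sub>R E"
    unfolding vw by (simp add: gamma_diff gamma_scaleR matrix_diff_distrib gamma_square uu E_def)
  also have "\<dots> = mexp (arccos c *\<^sub>R E)"
    using cc by (simp add: mexp_rotation[OF EE] sin_arccos)
  finally show ?thesis using spin7_scaleR[OF gamma_gamma_spin[OF w(1)], of "arccos c"] unfolding E_def by blast
qed

text \<open>
  Spin(7) is generated by exponentials; in this form connectedness enters all later arguments.
\<close>

lemma Spin7_exp_induct:
  assumes g: "g \<in> Spin7" and "P (mat 1)" and "\<And>X g. X \<in> spin7 \<Longrightarrow> g \<in> Spin7 \<Longrightarrow> P g \<Longrightarrow> P (mexp X ** g)"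
  shows "P g"
  using g
proof (induction rule: Spin7.induct)
  case (step g u v)
  obtain X where "X \<in> spin7" "gamma u ** gamma v = mexp X" using gamma_gamma_exp[OF step(2,3)] by blast
  thus ?case using step assms(3) by simp
qed (rule assms(2))

text \<open>
  A subspace of a finite-dimensional space is closed, and the exponential is a limit of polynomials in the generator.
\<close>

lemma mexp_invariant_subspace:
  fixes A :: "complex^'n^'n"
  assumes N: "vec.subspace N" and A: "\<And>y. y \<in> N \<Longrightarrow> A *v y \<in> N" and y: "y \<in> N"
  shows "mexp A *v y \<in> N"
proof -
  have rN: "subspace N"
    using N by (auto simp: subspace_def vec.subspace_def) 
      (metis (no_types, lifting) scaleR_conv_of_real vec_eq_iff vector_scaleR_component vector_smult_component)
  have p: "matrix_of_endo (endo_of A ^ k) *v y \<in> N" for k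
    unfolding matrix_of_endo_pow by (induction k) (simp_all add: y A flip: matrix_vector_mul_assoc)
  have bl: "bounded_linear (\<lambda>e. matrix_of_endo e *v y)"
    using bounded_linear_compose[OF bounded_bilinear.bounded_linear_left[OF bounded_bilinear_matrix_vector_mult, of y]
       bounded_linear_matrix_of_endo] by (simp add: o_def)
  have "(\<lambda>k. matrix_of_endo (endo_of A ^ k /\<^sub>R fact k) *v y) sums (mexp A *v y)"
    unfolding mexp_def by (rule bounded_linear.sums[OF bl exp_converges])
  hence lim: "(\<lambda>n. \<Sum>k<n. matrix_of_endo (endo_of A ^ k /\<^sub>R fact k) *v y) \<longlonglongrightarrow> mexp A *v y"
    unfolding sums_def .
  have t: "matrix_of_endo (endo_of A ^ k /\<^sub>R fact k) *v y \<in> N" for k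
    using subspace_scale[OF rN p[of k]]
    by (simp add: linear_simps(5)[OF bounded_linear_matrix_of_endo] scaleR_matrix_vector)
  show ?thesis
    by (rule closed_sequentially[OF closed_subspace[OF rN] _ lim]) (rule subspace_sum[OF rN t])
qed

lemma Spin7_invariant_subspace:
  fixes \<rho> :: "real_mat8 \<Rightarrow> complex^'n^'n"
  assumes rep: "spin7_rep \<rho>" and N: "vec.subspace N" and A: "\<And>X y. X \<in> spin7 \<Longrightarrow> y \<in> N \<Longrightarrow> drep \<rho> X *v y \<in> N"
    and g: "g \<in> Spin7" and y: "y \<in> N"
  shows "\<rho> g *v y \<in> N"
proof -
  have "\<forall>y\<in>N. \<rho> g *v y \<in> N"
  proof (rule Spin7_exp_induct[OF g])
    show "\<forall>y\<in>N. \<rho> (mat 1) *v y \<in> N" by (simp add: rep_one[OF rep])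
    fix X g assume X: "X \<in> spin7" and g: "g \<in> Spin7" and IH: "\<forall>y\<in>N. \<rho> g *v y \<in> N"
    show "\<forall>y\<in>N. \<rho> (mexp X ** g) *v y \<in> N"
    proof
      fix y assume "y \<in> N"
      have "\<rho> (mexp X ** g) *v y = mexp (drep \<rho> X) *v (\<rho> g *v y)"
        using drep_exp(1)[OF rep X, of 1] rep_mult[OF rep mexp_spin7'[OF X] g]
        by (simp add: matrix_vector_mul_assoc)
      thus "\<rho> (mexp X ** g) *v y \<in> N" using mexp_invariant_subspace[OF N A[OF X]] IH \<open>y \<in> N\<close> by simp
    qed
  qed
  thus ?thesis using y by blast
qed

context dirac_setting begin

lemma cl_axis:
  "cl (axis 0 1) (f, vec7 x0 x1 x2 x3 x4 x5 x6) = (x0, vec7 (- f) x3 x6 (- x1) x5 (- x4) (- x2))"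
  "cl (axis 1 1) (f, vec7 x0 x1 x2 x3 x4 x5 x6) = (x1, vec7 (- x3) (- f) x4 x0 (- x2) x6 (- x5))"
  "cl (axis 2 1) (f, vec7 x0 x1 x2 x3 x4 x5 x6) = (x2, vec7 (- x6) (- x4) (- f) x5 x1 (- x3) x0)"
  "cl (axis 3 1) (f, vec7 x0 x1 x2 x3 x4 x5 x6) = (x3, vec7 x1 (- x0) (- x5) (- f) x6 x2 (- x4))"
  "cl (axis 4 1) (f, vec7 x0 x1 x2 x3 x4 x5 x6) = (x4, vec7 (- x5) x2 (- x1) (- x6) (- f) x0 x3)"
  "cl (axis 5 1) (f, vec7 x0 x1 x2 x3 x4 x5 x6) = (x5, vec7 x4 (- x6) x3 (- x2) (- x0) (- f) x1)"
  "cl (axis 6 1) (f, vec7 x0 x1 x2 x3 x4 x5 x6) = (x6, vec7 x2 x5 (- x0) x4 (- x3) (- x1) (- f))"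
  unfolding cl_def fst_conv snd_conv prod.inject dot_axis vec_eq_7 vector_minus_component uminus_vec_def
  by (simp_all add: cross_nth axis7_nth)

lemma cl_minus: "cl (- u) \<psi> = - cl u \<psi>" and cl_zero: "cl 0 \<psi> = 0" and cl_neg: "cl u (- \<psi>) = - cl u \<psi>"
  by (simp_all add: cl_def dot_bilinear cross_bilinear prod_eq_iff vec_eq_iff)

lemma trilinear_sum:
  fixes F :: "complex^7 \<Rightarrow> complex^7 \<Rightarrow> complex^7 \<Rightarrow> complex"
  assumes F1: "\<And>v w. bilinear_form (\<lambda>u x. F u v (cross x w))" and F2: "\<And>u. bilinear_form (\<lambda>v w. F u v w)"
    and F3: "\<And>u u' v w. F (u + u') v w = F u v w + F u' v w" "\<And>c u v w. F (c *s u) v w = c * F u v w"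
  shows "(\<Sum>a\<in>UNIV. \<Sum>b\<in>UNIV. \<Sum>c\<in>UNIV. of_real (dot (cross (i a) (i b)) (i c)) * F (cv (i a)) (cv (i b)) (cv (i c)))
    = (\<Sum>a\<in>UNIV. \<Sum>b\<in>UNIV. F (axis a 1) (axis b 1) (cross (axis a 1) (axis b 1)))"
proof -
  have a: "(\<Sum>c\<in>UNIV. of_real (dot (cross (i a) (i b)) (i c)) * F (cv (i a)) (cv (i b)) (cv (i c)))
     = F (cv (i a)) (cv (i b)) (cross (cv (i a)) (cv (i b)))" for a b
  proof -
    interpret bilinear_form "F (cv (i a))" by (rule F2)
    have "F (cv (i a)) (cv (i b)) (\<Sum>c\<in>UNIV. dot (cross (cv (i a)) (cv (i b))) (cv (i c)) *s cv (i c)) 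
      = (\<Sum>c\<in>UNIV. of_real (dot (cross (i a) (i b)) (i c)) * F (cv (i a)) (cv (i b)) (cv (i c)))"
      by (simp add: sum scr cv_simps)
    thus ?thesis unfolding complete by simp
  qed
  have b: "(\<Sum>b\<in>UNIV. F u (cv (i b)) (cross x (cv (i b)))) = (\<Sum>b\<in>UNIV. F u (axis b 1) (cross x (axis b 1)))" for u x
  proof -
    interpret F: bilinear_form "F u" by (rule F2)
    interpret bilinear_form "\<lambda>v w. F u v (cross x w)"
      by unfold_locales (simp_all add: F.addl F.addr F.scl F.scr cross_bilinear)
    show ?thesis by (rule orthonormal_sum[OF on])
  qed
  have c: "(\<Sum>a\<in>UNIV. \<Sum>b\<in>UNIV. F (cv (i a)) (axis b 1) (cross (cv (i a)) (axis b 1))) = (\<Sum>a\<in>UNIV. \<Sum>b\<in>UNIV. F (axis a 1) (axis b 1) (cross (axis a 1) (axis b 1)))"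
  proof -
    interpret F: bilinear_form "F u" for u by (rule F2)
    interpret bilinear_form "\<lambda>u x. \<Sum>b\<in>UNIV. F u (axis b 1) (cross x (axis b 1))"
      by unfold_locales (simp_all add: F.addl F.addr F.scl F.scr F3 cross_bilinear sum.distrib sum_distrib_left)
    show ?thesis by (rule orthonormal_sum[OF on])
  qed
  show ?thesis unfolding a b c ..
qed

lemma emb_linear: "emb (\<psi> + \<psi>') = emb \<psi> + emb \<psi>'" "emb (r *\<^sub>R \<psi>) = r *\<^sub>R emb \<psi>" "emb 0 = 0"
proof -
  show "emb (\<psi> + \<psi>') = emb \<psi> + emb \<psi>'" for \<psi> \<psi>'
    by (simp add: emb_def prod_eq_iff vec_eq_iff sum.distrib algebra_simps)
  show 2: "emb (r *\<^sub>R \<psi>) = r *\<^sub>R emb \<psi>" for r \<psi>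
    by (simp add: emb_def prod_eq_iff vec_eq_iff scaleR_right.sum)
  show "emb 0 = 0" using 2[of 0 0] by simp
qed

lemma emb_sum: "emb (\<Sum>a\<in>S. f a) = (\<Sum>a\<in>S. emb (f a))"
  by (induction S rule: infinite_finite_induct) (simp_all add: emb_linear)

text \<open>
  The triple sum is evaluated in the standard basis, where it is a finite computation with octonion structure constants.
\<close>

lemma clifford_phi_eq: "clifford_phi I (f, v) = (7 * f, - v)"
proof (rule emb_inj)
  obtain V where V: "emb (f, v) = (f, V)" by (simp add: emb_def)
  define T where "T u v w = cl u (cl v (cl w (f, V)))" for u v w
  have e: "emb (clifford_phi I (f, v)) = (1/6) *\<^sub>R (\<Sum>a\<in>UNIV. \<Sum>b\<in>UNIV. \<Sum>c\<in>UNIV. 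
      dot (cross (i a) (i b)) (i c) *\<^sub>R T (cv (i a)) (cv (i b)) (cv (i c)))"
    unfolding clifford_phi_def by (simp add: emb_linear emb_sum I phi_Jm emb_clifford V T_def)
  have T1: "fst (T u v w) = - (dot w V * dot u v) + f * dot u (cross v w) + dot u (cross v (cross w V))" for u v w
    by (simp add: T_def cl_def dot_bilinear cross_bilinear algebra_simps)
  have T2: "snd (T u v w) $ k = (f * dot v w + dot v (cross w V)) * u $ k + dot w V * cross u v $ k - f * cross u (cross v w) $ k - cross u (cross v (cross w V)) $ k" for u v w k
    by (simp add: T_def cl_def dot_bilinear cross_bilinear algebra_simps)
  have sr: "r *\<^sub>R z = of_real r * z" for r and z :: complex by (rule scaleR_conv_of_real)
  have s1: "(\<Sum>a\<in>UNIV. \<Sum>b\<in>UNIV. \<Sum>c\<in>UNIV. of_real (dot (cross (i a) (i b)) (i c)) * fst (T (cv (i a)) (cv (i b)) (cv (i c))))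
    = (\<Sum>a\<in>UNIV. \<Sum>b\<in>UNIV. fst (T (axis a 1) (axis b 1) (cross (axis a 1) (axis b 1))))"
    unfolding T1 by (rule trilinear_sum; (unfold_locales)?; simp add: dot_bilinear cross_bilinear algebra_simps)
  have s2: "(\<Sum>a\<in>UNIV. \<Sum>b\<in>UNIV. \<Sum>c\<in>UNIV. of_real (dot (cross (i a) (i b)) (i c)) * snd (T (cv (i a)) (cv (i b)) (cv (i c))) $ k)
    = (\<Sum>a\<in>UNIV. \<Sum>b\<in>UNIV. snd (T (axis a 1) (axis b 1) (cross (axis a 1) (axis b 1))) $ k)" for k
    unfolding T2 by (rule trilinear_sum; (unfold_locales)?; simp add: dot_bilinear cross_bilinear algebra_simps)
  obtain x0 x1 x2 x3 x4 x5 x6 where x: "V = vec7 x0 x1 x2 x3 x4 x5 x6" using vec7_collect by blast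
  have S: "(\<Sum>a\<in>UNIV. \<Sum>b\<in>UNIV. T (axis a 1) (axis b 1) (cross (axis a 1) (axis b 1))) = (42 * f, - 6 *s V)"
    unfolding T_def x sum_7 cross_axis cl_minus cl_neg cl_axis cl_zero
    by (simp add: vec_eq_7 cl_def dot_bilinear cross_bilinear)
  have "emb (clifford_phi I (f, v)) = (1/6) *\<^sub>R (42 * f, - 6 *s V)"
    unfolding e S[symmetric]
    using s1 s2 by (simp add: prod_eq_iff vec_eq_iff fst_sum snd_sum sr)
  also have "\<dots> = emb (7 * f, - v)"
    using V by (auto simp: emb_def vec_eq_iff sum_negf sr)
  finally show "emb (clifford_phi I (f, v)) = emb (7 * f, - v)" .
qed

text \<open>
  The action on the representation of the element of the complexified \<open>\<mm>\<close> corresponding to a complex vector.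
\<close>

definition RJ :: "complex^7 \<Rightarrow> complex^'n^'n" where "RJ u = crep \<rho> (mscale (2/3) (crossmat u))"

lemma skew_crossmatC: "skew (mscale c (crossmat u))" by (intro skew_mscale skew_crossmat)

lemma RJ_linear: "RJ (u + v) = RJ u + RJ v" "RJ (c *s u) = mscale c (RJ u)"
proof -
  show "RJ (u + v) = RJ u + RJ v"
    by (simp add: RJ_def crossmat_add mscale_simps crep_add[OF rep] skew_crossmatC)
  have "mscale (2/3) (crossmat (c *s u)) = mscale c (mscale (2/3) (crossmat u))"
    by (simp add: vec_eq_iff crossmat_smult)
  thus "RJ (c *s u) = mscale c (RJ u)" by (simp add: RJ_def crep_mscale[OF rep] skew_crossmatC)
qed

lemma drep_I: "drep \<rho> (I a) = RJ (cv (i a))"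
proof -
  have "mscale (2/3) (crossmat (cv (i a))) = cmat ((2/3) *\<^sub>R crossmat (i a))"
    by (simp add: crossmat_cv vec_eq_iff)
  thus ?thesis by (simp add: RJ_def crep_cmat[OF rep] I Jm_def)
qed

lemma hom_linear:
  assumes "\<eta> \<in> hom_G2 I \<rho>"
  shows "\<eta> (x + y) = \<eta> x + \<eta> y" "\<eta> (c *s x) = tscale c (\<eta> x)" "\<eta> x \<in> twisted_spinors"
    "g \<in> G2 \<Longrightarrow> \<eta> (\<rho> g *v x) = twisted_act I g (\<eta> x)"
  using assms unfolding hom_G2_def Vector_Spaces.linear_def module_hom_def module_hom_axioms_def by auto

text \<open>
  A twisted spinor is determined by its two lowered components.
\<close>

lemma tw_eqI:
  assumes w: "w \<in> twisted_spinors" "w' \<in> twisted_spinors" and "\<And>y z. c0 w y z = c0 w' y z" "\<And>u y z. c1 i w u y z = c1 i w' u y z"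
  shows "w = w'"
proof -
  have sub: "s - s' \<in> spin7_complex" if "s \<in> spin7_complex" "s' \<in> spin7_complex" for s s'
    using that subspace_diff[OF subspace_spin7] by (auto simp: spin7_complex_def Re_Im_mat)
  have ext: "A = B" if "\<And>y z. dot y (A *v z) = dot y (B *v z)" for A B :: "complex^7^7"
  proof -
    have "A $ a $ b = B $ a $ b" for a b using that[of "axis a 1" "axis b 1"] 
      by (simp add: matrix_vector_mult_def if_distrib[of "\<lambda>x. _ * x"] cong: if_cong)
    thus ?thesis by (simp add: vec_eq_iff)
  qed
  have vd: "vecC (s - s') = vecC s - vecC s'" for s s' using vecC_add[of s "- s'"] by (simp add: vecC_minus)
  have eq: "s = s'" if "s \<in> spin7_complex" "s' \<in> spin7_complex" "vecC s = vecC s'" for s s'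
    using vecC_inj[OF sub[OF that(1,2)]] that(3) by (simp add: vd)
  have "vecC (fst w) = vecC (fst w')" by (rule ext) (use assms(3) in \<open>simp add: c0_def\<close>)
  hence 1: "fst w = fst w'" using w by (intro eq) (auto simp: twisted_spinors_def)
  have c1e: "c1 i w (cv (i b)) y z = dot y (vecC (snd w $ b) *v z)" for w b y z
    by (simp add: c1_def cv_simps on if_distrib[of of_real] if_distrib[of "\<lambda>x. x * _"] cong: if_cong)
  have "vecC (snd w $ b) = vecC (snd w' $ b)" for b by (rule ext) (use assms(4)[of "cv (i b)"] in \<open>simp add: c1e\<close>)
  hence "snd w $ b = snd w' $ b" for b using w by (intro eq) (auto simp: twisted_spinors_def)
  thus ?thesis using 1 by (simp add: prod_eq_iff vec_eq_iff)
qed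

lemma c0_zero: "c0 0 y z = 0" and c1_zero: "c1 i 0 u y z = 0"
  by (simp_all add: c0_def c1_def vecC_0 cmatrix_vector dot_bilinear)

text \<open>
  The Dirac operator for \<open>t = 0\<close>. The constants -7/2 and 1/2 are \<open>-1/2\<close> times the eigenvalues 7 and -1 of the 3-form, and the sum over the basis of
  \<open>\<mm>\<close> has become a sum over weight vectors.
\<close>

lemma dirac_c:
  assumes \<eta>: "\<eta> \<in> hom_G2 I \<rho>"
  shows "c0 (dirac 0 I \<rho> \<eta> x) y z = - (\<Sum>p\<in>UNIV. inverse (nrm p) * c1 i (\<eta> (RJ (nvec p) *v x)) (nvec (neg p)) y z) - 7/2 * c0 (\<eta> x) y z"
    "c1 i (dirac 0 I \<rho> \<eta> x) u y z = c0 (\<eta> (RJ u *v x)) y z 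
      + (\<Sum>p\<in>UNIV. inverse (nrm p) * c1 i (\<eta> (RJ (nvec p) *v x)) (cross u (nvec (neg p))) y z) + 1/2 * c1 i (\<eta> x) u y z"
proof -
  note lin = hom_linear[OF \<eta>]
  define s where "s a = \<eta> (RJ (cv (i a)) *v x)" for a
  have R: "RJ (u + v) *v x = RJ u *v x + RJ v *v x" "RJ (c *s u) *v x = c *s (RJ u *v x)" for u v c
    by (simp_all add: RJ_linear cmatrix_vector)
  have d0: "fst (dirac 0 I \<rho> \<eta> x) = - (\<Sum>a\<in>UNIV. snd (s a) $ a) - (7/2) *\<^sub>R fst (\<eta> x)"
    by (simp add: dirac_def tensor_map_pair clifford_I[of "i _", folded I] clifford_phi_eq fst_sum drep_I s_def on mscale_simps
       if_distrib[of "\<lambda>x. mscale x _"] if_distrib[of of_real] mscale_real[of 7, simplified]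
       axis_def if_distrib[of "\<lambda>x. _ * x"] cong: if_cong)
  have d1: "snd (dirac 0 I \<rho> \<eta> x) $ c = fst (s c) + (\<Sum>a\<in>UNIV. \<Sum>b\<in>UNIV. dot (cross (i a) (i b)) (i c) *\<^sub>R snd (s a) $ b) + (1/2) *\<^sub>R snd (\<eta> x) $ c" for c
    by (simp add: dirac_def tensor_map_pair clifford_I[of "i _", folded I] clifford_phi_eq snd_sum drep_I s_def on mscale_simps
       if_distrib[of "\<lambda>x. mscale x _"] if_distrib[of of_real] if_distrib[of uminus] sum_negf mscale_real sum_subtractf sum.distrib
       axis_def if_distrib[of "\<lambda>x. _ * x"] if_distrib[of "\<lambda>x. x * _"] cong: if_cong)
  have c1e: "c1 i w (cv (i b)) y z = dot y (vecC (snd w $ b) *v z)" for w b y z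
    by (simp add: c1_def cv_simps on if_distrib[of of_real] if_distrib[of "\<lambda>x. x * _"] cong: if_cong)
  interpret B0: bilinear_form "\<lambda>u v. c1 i (\<eta> (RJ u *v x)) v y z"
    by unfold_locales (simp_all add: R lin c1_linear)
  have "c0 (dirac 0 I \<rho> \<eta> x) y z = - (\<Sum>a\<in>UNIV. c1 i (s a) (cv (i a)) y z) - 7/2 * c0 (\<eta> x) y z"
    unfolding c0_def d0 c1e 
    by (simp add: vecC_add[of _ "- _", simplified] vecC_minus vecC_sum vecC_scaleR cmatrix_vector matrix_vector_mult_diff_rdistrib dot_bilinear sum_matrix_vector dot_sum)
  also have "(\<Sum>a\<in>UNIV. c1 i (s a) (cv (i a)) y z) = (\<Sum>p\<in>UNIV. inverse (nrm p) * c1 i (\<eta> (RJ (nvec p) *v x)) (nvec (neg p)) y z)"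
    unfolding s_def B0.orthonormal_sum[OF on] B0.weight_sum ..
  finally show "c0 (dirac 0 I \<rho> \<eta> x) y z = - (\<Sum>p\<in>UNIV. inverse (nrm p) * c1 i (\<eta> (RJ (nvec p) *v x)) (nvec (neg p)) y z) - 7/2 * c0 (\<eta> x) y z" .
  interpret B1: bilinear_form "\<lambda>v v'. c1 i (\<eta> (RJ v *v x)) (cross u v') y z"
    by unfold_locales (simp_all add: R lin c1_linear cross_bilinear)
  have "c1 i (dirac 0 I \<rho> \<eta> x) u y z = (\<Sum>c\<in>UNIV. dot u (cv (i c)) * (c0 (s c) y z + 
      (\<Sum>a\<in>UNIV. \<Sum>b\<in>UNIV. of_real (dot (cross (i a) (i b)) (i c)) * c1 i (s a) (cv (i b)) y z) + 1/2 * c1 i (\<eta> x) (cv (i c)) y z))"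
    unfolding c1_def[of i "dirac 0 I \<rho> \<eta> x"] d1 c1e c0_def
    by (simp add: vecC_add vecC_sum vecC_scaleR cmatrix_vector dot_bilinear sum_matrix_vector dot_sum)
  also have "\<dots> = (\<Sum>c\<in>UNIV. dot u (cv (i c)) * c0 (s c) y z) + 
      (\<Sum>c\<in>UNIV. \<Sum>a\<in>UNIV. \<Sum>b\<in>UNIV. dot u (cv (i c)) * of_real (dot (cross (i a) (i b)) (i c)) * c1 i (s a) (cv (i b)) y z)
      + 1/2 * (\<Sum>c\<in>UNIV. dot u (cv (i c)) * c1 i (\<eta> x) (cv (i c)) y z)"
    by (simp add: sum.distrib sum_distrib_left algebra_simps)
  also have "(\<Sum>c\<in>UNIV. dot u (cv (i c)) * c0 (s c) y z) = c0 (\<eta> (RJ u *v x)) y z"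
  proof -
    interpret L: bilinear_form "\<lambda>v v'. dot u v * c0 (\<eta> (RJ v' *v x)) y z"
      by unfold_locales (simp_all add: R lin c0_linear dot_bilinear algebra_simps)
    have "(\<Sum>c\<in>UNIV. u $ c * c0 (\<eta> (RJ (axis c 1) *v x)) y z) = c0 (\<eta> (RJ (\<Sum>c\<in>UNIV. u $ c *s axis c 1) *v x)) y z"
    proof -
      interpret M: bilinear_form "\<lambda>v v'. dot (axis 0 1) v * c0 (\<eta> (RJ v' *v x)) y z"
        by unfold_locales (simp_all add: R lin c0_linear dot_bilinear algebra_simps)
      show ?thesis using M.sum(2)[of "axis 0 1" "\<lambda>c. u $ c *s axis c 1" UNIV]
        by (simp add: M.scr R lin c0_linear)
    qed
    thus ?thesis unfolding s_def L.orthonormal_sum[OF on] using expand_axis[of u] by simp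
  qed
  also have "(\<Sum>c\<in>UNIV. dot u (cv (i c)) * c1 i (\<eta> x) (cv (i c)) y z) = c1 i (\<eta> x) u y z"
    unfolding c1e by (simp add: c1_def)
  also have "(\<Sum>c\<in>UNIV. \<Sum>a\<in>UNIV. \<Sum>b\<in>UNIV. dot u (cv (i c)) * of_real (dot (cross (i a) (i b)) (i c)) * c1 i (s a) (cv (i b)) y z)
    = (\<Sum>a\<in>UNIV. c1 i (s a) (cross u (cv (i a))) y z)"
  proof -
    have "(\<Sum>c\<in>UNIV. dot u (cv (i c)) * of_real (dot (cross (i a) (i b)) (i c))) = dot (cross u (cv (i a))) (cv (i b))" for a b
    proof -
      have "dot u (\<Sum>c\<in>UNIV. dot (cross (cv (i a)) (cv (i b))) (cv (i c)) *s cv (i c)) = dot u (cross (cv (i a)) (cv (i b)))"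
        unfolding complete ..
      hence "(\<Sum>c\<in>UNIV. dot u (cv (i c)) * of_real (dot (cross (i a) (i b)) (i c))) = dot u (cross (cv (i a)) (cv (i b)))"
        by (simp add: dot_sum dot_bilinear cv_simps mult.commute)
      also have "\<dots> = dot (cross u (cv (i a))) (cv (i b))"
        using dot_cross_cyclic[of "cv (i b)" u "cv (i a)"] dot_cross_cyclic[of u "cv (i a)" "cv (i b)"] dot_cross_cyclic[of "cv (i a)" "cv (i b)" u] 
        by (simp add: dot_commute)
      finally show ?thesis .
    qed
    note k = this
    have "(\<Sum>c\<in>UNIV. \<Sum>a\<in>UNIV. \<Sum>b\<in>UNIV. dot u (cv (i c)) * of_real (dot (cross (i a) (i b)) (i c)) * c1 i (s a) (cv (i b)) y z)
      = (\<Sum>a\<in>UNIV. \<Sum>c\<in>UNIV. \<Sum>b\<in>UNIV. dot u (cv (i c)) * of_real (dot (cross (i a) (i b)) (i c)) * c1 i (s a) (cv (i b)) y z)"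
      by (rule sum.swap)
    also have "\<dots> = (\<Sum>a\<in>UNIV. \<Sum>b\<in>UNIV. \<Sum>c\<in>UNIV. dot u (cv (i c)) * of_real (dot (cross (i a) (i b)) (i c)) * c1 i (s a) (cv (i b)) y z)"
      by (rule sum.cong[OF refl], rule sum.swap)
    also have "\<dots> = (\<Sum>a\<in>UNIV. \<Sum>b\<in>UNIV. dot (cross u (cv (i a))) (cv (i b)) * c1 i (s a) (cv (i b)) y z)"
      unfolding sum_distrib_right[symmetric] k ..
    also have "\<dots> = (\<Sum>a\<in>UNIV. c1 i (s a) (cross u (cv (i a))) y z)"
      unfolding c1e by (simp add: c1_def)
    finally show ?thesis .
  qed
  also have "(\<Sum>a\<in>UNIV. c1 i (s a) (cross u (cv (i a))) y z) = (\<Sum>p\<in>UNIV. inverse (nrm p) * c1 i (\<eta> (RJ (nvec p) *v x)) (cross u (nvec (neg p))) y z)"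
    unfolding s_def B1.orthonormal_sum[OF on] B1.weight_sum ..
  finally show "c1 i (dirac 0 I \<rho> \<eta> x) u y z = c0 (\<eta> (RJ u *v x)) y z 
      + (\<Sum>p\<in>UNIV. inverse (nrm p) * c1 i (\<eta> (RJ (nvec p) *v x)) (cross u (nvec (neg p))) y z) + 1/2 * c1 i (\<eta> x) u y z" .
qed

end

section \<open>Equivariance under G2\<close>

text \<open>
  Structure constants \<open>n\<^sub>p \<times> n\<^sub>q = crc p q n\<^bsub>crt p q\<^esub>\<close> of the cross product in the weight basis.
\<close>

fun crc :: "wt \<Rightarrow> wt \<Rightarrow> complex" where
  "crc N0 P1 = - 1"
| "crc N0 P2 = - 1"
| "crc N0 P3 = - 1"
| "crc N0 M1 = 1"
| "crc N0 M2 = 1"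
| "crc N0 M3 = 1"
| "crc P1 N0 = 1"
| "crc P1 P2 = 2"
| "crc P1 P3 = - 2"
| "crc P1 M1 = 2"
| "crc P2 N0 = 1"
| "crc P2 P1 = - 2"
| "crc P2 P3 = 2"
| "crc P2 M2 = 2"
| "crc P3 N0 = 1"
| "crc P3 P1 = 2"
| "crc P3 P2 = - 2"
| "crc P3 M3 = 2"
| "crc M1 N0 = - 1"
| "crc M1 P1 = - 2"
| "crc M1 M2 = 2"
| "crc M1 M3 = - 2"
| "crc M2 N0 = - 1"
| "crc M2 P2 = - 2"
| "crc M2 M1 = - 2"
| "crc M2 M3 = 2"
| "crc M3 N0 = - 1"
| "crc M3 P3 = - 2"
| "crc M3 M1 = 2"
| "crc M3 M2 = - 2"
| "crc _ _ = 0"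

fun crt :: "wt \<Rightarrow> wt \<Rightarrow> wt" where
  "crt N0 P1 = P1"
| "crt N0 P2 = P2"
| "crt N0 P3 = P3"
| "crt N0 M1 = M1"
| "crt N0 M2 = M2"
| "crt N0 M3 = M3"
| "crt P1 N0 = P1"
| "crt P1 P2 = M3"
| "crt P1 P3 = M2"
| "crt P1 M1 = N0"
| "crt P2 N0 = P2"
| "crt P2 P1 = M3"
| "crt P2 P3 = M1"
| "crt P2 M2 = N0"
| "crt P3 N0 = P3"
| "crt P3 P1 = M2"
| "crt P3 P2 = M1"
| "crt P3 M3 = N0"
| "crt M1 N0 = M1"
| "crt M1 P1 = N0"
| "crt M1 M2 = P3"
| "crt M1 M3 = P2"
| "crt M2 N0 = M2"
| "crt M2 P2 = N0"
| "crt M2 M1 = P3"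
| "crt M2 M3 = P1"
| "crt M3 N0 = M3"
| "crt M3 P3 = N0"
| "crt M3 M1 = P2"
| "crt M3 M2 = P1"
| "crt _ _ = N0"

text \<open>
  The action \<open>Y\<^sub>p n\<^sub>r = ymc p r n\<^bsub>ymt p r\<^esub>\<close> of the elements \<open>Ymat p\<close> of g2.
\<close>

fun ymc :: "wt \<Rightarrow> wt \<Rightarrow> complex" where
  "ymc P1 N0 = - 2"
| "ymc P1 P2 = 2"
| "ymc P1 P3 = - 2"
| "ymc P1 M1 = - 4"
| "ymc P2 N0 = - 2"
| "ymc P2 P1 = - 2"
| "ymc P2 P3 = 2"
| "ymc P2 M2 = - 4"
| "ymc P3 N0 = - 2"
| "ymc P3 P1 = 2"
| "ymc P3 P2 = - 2"
| "ymc P3 M3 = - 4"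
| "ymc M1 N0 = - 1"
| "ymc M1 P1 = - 2"
| "ymc M1 M2 = - 1"
| "ymc M1 M3 = 1"
| "ymc M2 N0 = - 1"
| "ymc M2 P2 = - 2"
| "ymc M2 M1 = 1"
| "ymc M2 M3 = - 1"
| "ymc M3 N0 = - 1"
| "ymc M3 P3 = - 2"
| "ymc M3 M1 = - 1"
| "ymc M3 M2 = 1"
| "ymc _ _ = 0"

fun ymt :: "wt \<Rightarrow> wt \<Rightarrow> wt" where
  "ymt P1 N0 = P1"
| "ymt P1 P2 = M3"
| "ymt P1 P3 = M2"
| "ymt P1 M1 = N0"
| "ymt P2 N0 = P2"
| "ymt P2 P1 = M3"
| "ymt P2 P3 = M1"
| "ymt P2 M2 = N0"
| "ymt P3 N0 = P3"
| "ymt P3 P1 = M2"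
| "ymt P3 P2 = M1"
| "ymt P3 M3 = N0"
| "ymt M1 N0 = M1"
| "ymt M1 P1 = N0"
| "ymt M1 M2 = P3"
| "ymt M1 M3 = P2"
| "ymt M2 N0 = M2"
| "ymt M2 P2 = N0"
| "ymt M2 M1 = P3"
| "ymt M2 M3 = P1"
| "ymt M3 N0 = M3"
| "ymt M3 P3 = N0"
| "ymt M3 M1 = P2"
| "ymt M3 M2 = P1"
| "ymt _ _ = N0"

text \<open>
  An element of g2 that differs from \<open>crossmat (nvec p)\<close> by a multiple of a positive root vector for every nonzero weight \<open>p\<close>. On a highest weight
  vector the action of \<open>\<mm>\<close> can therefore be replaced by that of g2, which an equivariant map converts into an action on its values.
\<close>

fun Ymat :: "wt \<Rightarrow> complex^7^7" where
  "Ymat N0 = 0"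
| "Ymat P1 = mscale (1) (wedge (nvec M3) (nvec M2)) + mscale (2) (wedge (nvec P1) (nvec N0))"
| "Ymat P2 = mscale (- 1) (wedge (nvec M3) (nvec M1)) + mscale (2) (wedge (nvec P2) (nvec N0))"
| "Ymat P3 = mscale (1) (wedge (nvec M2) (nvec M1)) + mscale (2) (wedge (nvec P3) (nvec N0))"
| "Ymat M1 = mscale (1) (wedge (nvec M1) (nvec N0)) + mscale (- 1/2) (wedge (nvec P3) (nvec P2))"
| "Ymat M2 = mscale (1) (wedge (nvec M2) (nvec N0)) + mscale (- 1/2) (wedge (nvec P1) (nvec P3))"
| "Ymat M3 = mscale (1) (wedge (nvec M3) (nvec N0)) + mscale (- 1/2) (wedge (nvec P2) (nvec P1))"

lemma crossmat_nvec:
  "crossmat (nvec N0) = mscale (- 1/2) (wedge (nvec P1) (nvec M1)) + mscale (- 1/2) (wedge (nvec P2) (nvec M2)) + mscale (- 1/2) (wedge (nvec P3) (nvec M3))"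
  "crossmat (nvec P1) = mscale (- 1) (wedge (nvec P1) (nvec N0)) + mscale (1) (wedge (nvec M3) (nvec M2))"
  "crossmat (nvec P2) = mscale (- 1) (wedge (nvec P2) (nvec N0)) + mscale (- 1) (wedge (nvec M3) (nvec M1))"
  "crossmat (nvec P3) = mscale (- 1) (wedge (nvec P3) (nvec N0)) + mscale (1) (wedge (nvec M2) (nvec M1))"
  "crossmat (nvec M1) = mscale (1) (wedge (nvec M1) (nvec N0)) + mscale (1) (wedge (nvec P3) (nvec P2))"
  "crossmat (nvec M2) = mscale (1) (wedge (nvec M2) (nvec N0)) + mscale (- 1) (wedge (nvec P3) (nvec P1))"
  "crossmat (nvec M3) = mscale (1) (wedge (nvec M3) (nvec N0)) + mscale (1) (wedge (nvec P2) (nvec P1))"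
  by (simp_all add: vec_eq_7 crossmat_nth wedge_def)
lemma cross_nvec: "cross (nvec p) (nvec q) = crc p q *s nvec (crt p q)"
  by (cases p; cases q; simp add: vec_eq_7 cross_nth)

lemma dot_nvec: "dot (nvec p) (nvec q) = (if q = neg p then nrm p else 0)"
  by (cases p; cases q; simp add: dot_7)

lemma Ymat_nvec: "Ymat p *v nvec r = ymc p r *s nvec (ymt p r)"
  by (cases p; cases r; simp add: cmatrix_vector wedge_vector dot_nvec vector_smult_assoc del: nvec.simps)

lemma contract_mscale: "contract (mscale c A) = c *s contract A"
  by (simp add: vec_eq_7 contract_nth algebra_simps)

lemma contract_wedge: "contract (wedge u v) = 2 *s cross u v"
  unfolding vec_eq_7 by (simp add: contract_nth wedge_def cross_nth)

lemma skew_Ymat: "skew (Ymat p)"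
  by (cases p) (simp_all add: subspace_skew skew_add skew_mscale skew_wedge)

lemma contract_Ymat: "contract (Ymat p) = 0"
  by (cases p) (simp_all add: contract_linear contract_mscale contract_wedge cross_nvec vector_smult_assoc del: nvec.simps)

text \<open>
  The elements \<open>gE12\<close>, \<open>gE23\<close>, \<open>gH12\<close>, \<open>gH23\<close> lie in the subalgebra su(3) of g2; the first two are raising operators, the last two span a Cartan subalgebra.
\<close>

definition gE12 :: "complex^7^7" where "gE12 = wedge (nvec P1) (nvec M2)"
definition gE23 :: "complex^7^7" where "gE23 = wedge (nvec P2) (nvec M3)"
definition gH12 :: "complex^7^7" where "gH12 = mscale (1/2) (wedge (nvec P1) (nvec M1)) - mscale (1/2) (wedge (nvec P2) (nvec M2))"
definition gH23 :: "complex^7^7" where "gH23 = mscale (1/2) (wedge (nvec P2) (nvec M2)) - mscale (1/2) (wedge (nvec P3) (nvec M3))"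

lemma skew_g: "skew gE12" "skew gE23" "skew gH12" "skew gH23"
  by (simp_all add: gE12_def gE23_def gH12_def gH23_def skew_wedge skew_diff skew_mscale)

lemma contract_g: "contract gE12 = 0" "contract gE23 = 0" "contract gH12 = 0" "contract gH23 = 0"
  by (simp_all add: gE12_def gE23_def gH12_def gH23_def contract_linear contract_mscale contract_wedge cross_nvec vector_smult_assoc del: nvec.simps)

text \<open>
  Coefficients and target labels of the four su(3) elements in the weight basis.
\<close>

fun e12c where "e12c P2 = (2::complex)" | "e12c M1 = -2" | "e12c _ = 0"
fun e12t where "e12t P2 = P1" | "e12t M1 = M2" | "e12t _ = N0"
fun e23c where "e23c P3 = (2::complex)" | "e23c M2 = -2" | "e23c _ = 0"
fun e23t where "e23t P3 = P2" | "e23t M2 = M3" | "e23t _ = N0"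
fun h12 where "h12 P1 = (1::complex)" | "h12 P2 = -1" | "h12 M1 = -1" | "h12 M2 = 1" | "h12 _ = 0"
fun h23 where "h23 P2 = (1::complex)" | "h23 P3 = -1" | "h23 M2 = -1" | "h23 M3 = 1" | "h23 _ = 0"

lemma g_nvec: "gE12 *v nvec r = e12c r *s nvec (e12t r)" "gE23 *v nvec r = e23c r *s nvec (e23t r)"
  "gH12 *v nvec r = h12 r *s nvec r" "gH23 *v nvec r = h23 r *s nvec r"
  unfolding gE12_def gE23_def gH12_def gH23_def matrix_vector_mult_diff_rdistrib cmatrix_vector wedge_vector dot_nvec
  by (cases r; simp add: vector_smult_assoc del: nvec.simps)+

lemma cv_split: "u = cv (\<chi> a. Re (u $ a)) + \<i> *s cv (\<chi> a. Im (u $ a))"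
  by (simp add: vec_eq_iff cv_def complex_eq_iff)

lemma G2_cross_complex:
  assumes g: "g \<in> G2"
  shows "cross (cmat (vecrep g) *v u) (cmat (vecrep g) *v v) = cmat (vecrep g) *v cross u v"
proof -
  obtain a b where u: "u = cv a + \<i> *s cv b" using cv_split by blast
  obtain c d where v: "v = cv c + \<i> *s cv d" using cv_split by blast
  show ?thesis unfolding u v
    by (simp add: cmatrix_vector matrix_vector_mult_diff_distrib cross_bilinear cv_simps vecrep_G2_cross(1)[OF g])
qed

lemma mv_axis: "(M *v axis a 1) $ c = M $ c $ a" for M :: "complex^'n^'m"
  by (simp add: matrix_vector_mult_def if_distrib[of "\<lambda>x. _ * x"] cong: if_cong)

lemma dot_transpose: "dot (M *v u) v = dot u (transpose M *v v)" for M :: "complex^7^7"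
proof -
  have "dot (M *v u) v = (\<Sum>a\<in>UNIV. \<Sum>b\<in>UNIV. M $ a $ b * u $ b * v $ a)"
    by (simp add: dot_def matrix_vector_mult_def sum_distrib_right)
  also have "\<dots> = (\<Sum>b\<in>UNIV. \<Sum>a\<in>UNIV. M $ a $ b * u $ b * v $ a)" by (rule sum.swap)
  also have "\<dots> = dot u (transpose M *v v)"
    by (simp add: dot_def matrix_vector_mult_def transpose_def sum_distrib_left mult_ac)
  finally show ?thesis .
qed

lemma cmat_vecrep_orthogonal:
  assumes "g \<in> Spin7"
  shows "transpose (cmat (vecrep g)) ** cmat (vecrep g) = mat 1" "cmat (vecrep g) ** transpose (cmat (vecrep g)) = mat 1"
  using vecrep_orthogonal[OF assms] by (metis cmat_mult cmat_simps(6,7))+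

lemma G2_transpose: "g \<in> G2 \<Longrightarrow> transpose g \<in> G2"
proof -
  assume g: "g \<in> G2"
  hence s: "g \<in> Spin7" and e: "g *v axis None 1 = axis None 1" by (auto simp: G2_def)
  have "transpose g *v axis None 1 = transpose g *v (g *v axis None 1)" by (simp add: e)
  thus ?thesis using s by (simp add: G2_def Spin7_transpose Spin7_orthogonal' matrix_vector_mul_assoc)
qed

lemma vecrep_transpose: assumes "g \<in> Spin7" shows "vecrep (transpose g) = transpose (vecrep g)"
proof -
  have "vecrep (transpose g) ** vecrep g = mat 1"
    by (simp add: vecrep_one Spin7_transpose Spin7_orthogonal' assms flip: vecrep_mult)
  hence "vecrep (transpose g) ** vecrep g ** transpose (vecrep g) = transpose (vecrep g)" by simp
  thus ?thesis by (simp add: vecrep_orthogonal[OF assms] flip: matrix_mul_assoc)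
qed

lemma crossmat_G2:
  assumes g: "g \<in> G2"
  shows "crossmat (cmat (vecrep g) *v u) = cmat (vecrep g) ** crossmat u ** transpose (cmat (vecrep g))"
proof -
  have s: "g \<in> Spin7" using g by (simp add: G2_def)
  have "crossmat (cmat (vecrep g) *v u) *v z = (cmat (vecrep g) ** crossmat u ** transpose (cmat (vecrep g))) *v z" for z
  proof -
    have "z = cmat (vecrep g) *v (transpose (cmat (vecrep g)) *v z)"
      by (simp only: matrix_vector_mul_assoc cmat_vecrep_orthogonal[OF s] matrix_vector_mul_lid)
    hence "crossmat (cmat (vecrep g) *v u) *v z = cross (cmat (vecrep g) *v u) (cmat (vecrep g) *v (transpose (cmat (vecrep g)) *v z))"
      by (simp add: crossmat_vector)
    also have "\<dots> = cmat (vecrep g) *v (crossmat u *v (transpose (cmat (vecrep g)) *v z))"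
      unfolding G2_cross_complex[OF g] crossmat_vector ..
    finally show ?thesis by (simp only: matrix_vector_mul_assoc matrix_mul_assoc)
  qed
  thus ?thesis unfolding matrix_eq by blast
qed

lemma spin7_complex_closed: 
  "s \<in> spin7_complex \<Longrightarrow> t \<in> spin7_complex \<Longrightarrow> s + t \<in> spin7_complex"
  "s \<in> spin7_complex \<Longrightarrow> mscale c s \<in> spin7_complex" "0 \<in> spin7_complex"
proof -
  have z: "spinC 0 = 0" using spinC_mscale[of 0 0] by (simp add: mscale_simps)
  show "0 \<in> spin7_complex" unfolding spin7_complex_eq using z subspace_skew by (metis (mono_tags, lifting) imageI mem_Collect_eq)
  have I: "skew A \<Longrightarrow> spinC A \<in> spin7_complex" for A unfolding spin7_complex_eq by (rule imageI) simp
  have E: "\<exists>A. s = spinC A \<and> skew A" if "s \<in> spin7_complex" for s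
    using that unfolding spin7_complex_eq by (elim imageE) auto
  show "s + t \<in> spin7_complex" if "s \<in> spin7_complex" "t \<in> spin7_complex"
    using E[OF that(1)] E[OF that(2)] I by (metis skew_add spinC_add)
  show "mscale c s \<in> spin7_complex" if "s \<in> spin7_complex"
    using E[OF that] I by (metis skew_mscale spinC_mscale)
qed

lemma spin7_complex_sum: "(\<And>i. i \<in> S \<Longrightarrow> f i \<in> spin7_complex) \<Longrightarrow> (\<Sum>i\<in>S. f i) \<in> spin7_complex"
  by (induction S rule: infinite_finite_induct) (auto intro: spin7_complex_closed)

lemma twisted_spinors_iff: "w \<in> twisted_spinors \<longleftrightarrow> fst w \<in> spin7_complex \<and> (\<forall>a. snd w $ a \<in> spin7_complex)"
  by (cases w) (auto simp: twisted_spinors_def)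

lemma twisted_spinors_closed:
  "w \<in> twisted_spinors \<Longrightarrow> w' \<in> twisted_spinors \<Longrightarrow> w + w' \<in> twisted_spinors"
  "w \<in> twisted_spinors \<Longrightarrow> tscale c w \<in> twisted_spinors" "0 \<in> twisted_spinors"
  by (auto simp: twisted_spinors_iff tscale_def spin7_complex_closed split: prod.splits)

lemma tscale_simps: "tscale c (w + w') = tscale c w + tscale c w'" "tscale (c + d) w = tscale c w + tscale d w"
  "tscale c (tscale d w) = tscale (c * d) w" "tscale 1 w = w" "tscale 0 w = 0" "tscale c 0 = 0" "tscale (-1) w = - w"
  by (simp_all add: tscale_def case_prod_unfold prod_eq_iff vec_eq_iff algebra_simps)

lemma tscale_real: "tscale (of_real r) w = r *\<^sub>R w"
  by (simp add: tscale_def case_prod_unfold prod_eq_iff vec_eq_iff complex_eq_iff)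

lemma tscale_sum: "tscale c (\<Sum>i\<in>S. f i) = (\<Sum>i\<in>S. tscale c (f i))"
  by (induction S rule: infinite_finite_induct) (simp_all add: tscale_simps)

lemma vector_space_tscale: "vector_space tscale"
  by unfold_locales (simp_all add: tscale_simps)

lemma linear_tscale_iff: "Vector_Spaces.linear (*s) tscale \<eta> \<longleftrightarrow> 
   (\<forall>x y. \<eta> (x + y) = \<eta> x + \<eta> y) \<and> (\<forall>c x. \<eta> (c *s x) = tscale c (\<eta> x))"
  for \<eta> :: "complex^'n \<Rightarrow> twisted"
  using vector_space_tscale vec.vector_space_axioms
  unfolding Vector_Spaces.linear_def module_hom_def module_hom_axioms_def module_iff_vector_space by blast

lemma tensor_map_id_linear: 
  "tensor_map F id (w + w') = tensor_map F id w + tensor_map F id w'" "tensor_map F id (tscale c w) = tscale c (tensor_map F id w)"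
  "w \<in> twisted_spinors \<Longrightarrow> tensor_map F id w \<in> twisted_spinors"
proof -
  show "tensor_map F id (w + w') = tensor_map F id w + tensor_map F id w'"
    by (simp add: tensor_map_pair prod_eq_iff vec_eq_iff sum.distrib algebra_simps)
  show "tensor_map F id (tscale c w) = tscale c (tensor_map F id w)"
    by (simp add: tensor_map_pair tscale_def case_prod_unfold prod_eq_iff vec_eq_iff sum_distrib_left algebra_simps)
  show "w \<in> twisted_spinors \<Longrightarrow> tensor_map F id w \<in> twisted_spinors"
    by (auto simp: tensor_map_pair twisted_spinors_iff intro!: spin7_complex_closed spin7_complex_sum)
qed

lemma twisted_spinors_sum: "(\<And>i. i \<in> S \<Longrightarrow> f i \<in> twisted_spinors) \<Longrightarrow> (\<Sum>i\<in>S. f i) \<in> twisted_spinors"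
  by (induction S rule: infinite_finite_induct) (auto intro: twisted_spinors_closed)

context dirac_setting begin

lemma dirac_alt: "dirac 0 I \<rho> \<eta> x = tscale (-1) (\<Sum>a\<in>UNIV. tensor_map (clifford I (I a)) id (\<eta> (drep \<rho> (I a) *v x)))
   + tscale (- (1/2)) (tensor_map (clifford_phi I) id (\<eta> x))"
  using tscale_real[of "-(1/2)"] by (simp add: dirac_def tscale_simps)

text \<open>
  In lowered form a group element acts by substituting its transpose into every argument.
\<close>

lemma c_act:
  assumes g: "g \<in> G2" and w: "w \<in> twisted_spinors"
  defines "T \<equiv> transpose (cmat (vecrep g))"
  shows "twisted_act I g w \<in> twisted_spinors" "c0 (twisted_act I g w) y z = c0 w (T *v y) (T *v z)"
    "c1 i (twisted_act I g w) u y z = c1 i w (T *v u) (T *v y) (T *v z)"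
proof -
  have s: "g \<in> Spin7" using g by (simp add: G2_def)
  have inv: "matrix_inv (cmat g) = cmat (transpose g)"
  proof -
    have e: "cmat g ** cmat (transpose g) = mat 1" "cmat (transpose g) ** cmat g = mat 1"
      by (simp_all only: Spin7_orthogonal[OF s] Spin7_orthogonal'[OF s] cmat_simps(6) cmat_mult[symmetric])
    hence "\<exists>h. cmat g ** h = mat 1 \<and> h ** cmat g = mat 1" by blast
    hence "cmat g ** matrix_inv (cmat g) = mat 1 \<and> matrix_inv (cmat g) ** cmat g = mat 1" unfolding matrix_inv_def by (rule someI_ex)
    hence "matrix_inv (cmat g) ** (cmat g ** cmat (transpose g)) = cmat (transpose g)" by (simp add: matrix_mul_assoc)
    thus ?thesis by (simp add: e)
  qed
  have AdC: "Ad (cmat g) (spinC A) = spinC (cmat (vecrep g) ** A ** T)" for A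
    unfolding Ad_def inv T_def
    by (rule complex_mat_eqI)
       (simp_all add: Re_Im_mult Re_Im_mat Re_Im_spinC covers_conj_spin[OF Spin7_covers[OF s]] flip: cmat_simps)
  have sk: "skew (cmat (vecrep g) ** A ** T)" if "skew A" for A
    using that by (simp add: T_def skew_def matrix_transpose_mul matrix_mul_assoc)
  have Ad: "Ad (cmat g) t \<in> spin7_complex" "vecC (Ad (cmat g) t) = cmat (vecrep g) ** vecC t ** T" if "t \<in> spin7_complex" for t
    using that sk by (auto simp: spin7_complex_eq AdC vecC_spinC)
  have sp: "spinor_act I g (f, v) = (f, \<chi> c. \<Sum>a\<in>UNIV. of_real (dot (vecrep g *v i a) (i c)) * v $ a)" for f v
  proof -
    have "Ad g (I a) = Jm (vecrep g *v i a)" for a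
    proof -
      have "vecrep g ** crossmat (i a) ** transpose (vecrep g) = crossmat (vecrep g *v i a)"
      proof -
        have "cmat (crossmat (vecrep g *v i a)) = cmat (vecrep g ** crossmat (i a) ** transpose (vecrep g))"
          using crossmat_G2[OF g, of "cv (i a)"] by (simp add: cv_simps crossmat_cv cmat_mult cmat_simps)
        thus ?thesis by (simp add: vec_eq_iff)
      qed
      thus ?thesis by (simp add: I Jm_def Ad_spin[OF s])
    qed
    thus ?thesis by (simp add: spinor_act_def I Jm_inner)
  qed
  have f: "fst (twisted_act I g w) = Ad (cmat g) (fst w)"
    by (simp add: twisted_act_def tensor_map_pair sp mscale_simps)
  have sn: "snd (twisted_act I g w) $ c = (\<Sum>a\<in>UNIV. mscale (of_real (dot (vecrep g *v i a) (i c))) (Ad (cmat g) (snd w $ a)))" for c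
    by (simp add: twisted_act_def tensor_map_pair sp mscale_simps axis_def if_distrib[of "\<lambda>x. _ * x"] cong: if_cong)
  have w': "fst w \<in> spin7_complex" "snd w $ a \<in> spin7_complex" for a using w by (auto simp: twisted_spinors_iff)
  show "twisted_act I g w \<in> twisted_spinors"
    unfolding twisted_spinors_iff f sn by (auto intro!: spin7_complex_sum spin7_complex_closed Ad w')
  have TT: "transpose T = cmat (vecrep g)" by (simp add: T_def)
  have dT: "dot y ((cmat (vecrep g) ** A ** T) *v z) = dot (T *v y) (A *v (T *v z))" for A y z
    unfolding dot_transpose TT by (simp add: matrix_vector_mul_assoc matrix_mul_assoc)
  show "c0 (twisted_act I g w) y z = c0 w (T *v y) (T *v z)"
    by (simp add: c0_def f Ad w' dT)
  have dd: "(\<Sum>c\<in>UNIV. dot u (cv (i c)) * of_real (dot (vecrep g *v i a) (i c))) = dot (T *v u) (cv (i a))" for a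
  proof -
    have "dot u (\<Sum>c\<in>UNIV. dot (cv (vecrep g *v i a)) (cv (i c)) *s cv (i c)) = dot u (cmat (vecrep g) *v cv (i a))"
      unfolding complete by (simp add: cv_simps)
    thus ?thesis unfolding dot_transpose TT by (simp add: dot_sum dot_bilinear cv_simps mult.commute)
  qed
  have "c1 i (twisted_act I g w) u y z = (\<Sum>c\<in>UNIV. \<Sum>a\<in>UNIV. dot u (cv (i c)) * of_real (dot (vecrep g *v i a) (i c)) * dot (T *v y) (vecC (snd w $ a) *v (T *v z)))"
    by (simp add: c1_def sn vecC_sum vecC_mscale sum_matrix_vector cmatrix_vector dot_sum dot_bilinear Ad w' dT sum_distrib_left mult.assoc)
  also have "\<dots> = (\<Sum>a\<in>UNIV. \<Sum>c\<in>UNIV. dot u (cv (i c)) * of_real (dot (vecrep g *v i a) (i c)) * dot (T *v y) (vecC (snd w $ a) *v (T *v z)))"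
    by (rule sum.swap)
  also have "\<dots> = c1 i w (T *v u) (T *v y) (T *v z)"
    unfolding sum_distrib_right[symmetric] dd c1_def ..
  finally show "c1 i (twisted_act I g w) u y z = c1 i w (T *v u) (T *v y) (T *v z)" .
qed

lemma (in bilinear_form) orthogonal_invariant:
  assumes "M ** transpose M = mat 1"
  shows "(\<Sum>p\<in>UNIV. inverse (nrm p) * B (M *v nvec p) (M *v nvec (neg p))) = (\<Sum>p\<in>UNIV. inverse (nrm p) * B (nvec p) (nvec (neg p)))"
proof -
  interpret M: bilinear_form "\<lambda>u v. B (M *v u) (M *v v)"
    by unfold_locales (simp_all add: addl addr scl scr cmatrix_vector)
  have "(\<Sum>c\<in>UNIV. 1 * B (M *v axis c 1) (M *v axis c 1)) = (\<Sum>c\<in>UNIV. B (axis c 1) (axis c 1))"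
  proof (rule frame_sum)
    fix c d
    have "(M ** transpose M) $ c $ d = (mat 1 :: complex^7^7) $ c $ d" by (simp add: assms)
    thus "(\<Sum>a\<in>UNIV. 1 * (M *v axis a 1) $ c * (M *v axis a 1) $ d) = (if c = d then 1 else 0)"
      by (simp add: mv_axis matrix_matrix_mult_def transpose_def mat_def)
  qed simp
  thus ?thesis unfolding weight_sum M.weight_sum by simp
qed

lemma RJ_conj:
  assumes g: "g \<in> G2"
  shows "RJ u ** \<rho> g = \<rho> g ** RJ (transpose (cmat (vecrep g)) *v u)"
proof -
  have s: "g \<in> Spin7" using g by (simp add: G2_def)
  define T where "T = transpose (cmat (vecrep g))"
  have u: "u = cmat (vecrep g) *v (T *v u)" 
    by (simp only: T_def matrix_vector_mul_assoc cmat_vecrep_orthogonal[OF s] matrix_vector_mul_lid)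
  have "mscale (2/3) (crossmat u) = cmat (vecrep g) ** mscale (2/3) (crossmat (T *v u)) ** transpose (cmat (vecrep g))"
    by (subst u) (simp add: crossmat_G2[OF g] mscale_mult)
  hence "RJ u = \<rho> g ** RJ (T *v u) ** \<rho> (transpose g)"
    by (simp add: RJ_def crep_conj[OF rep s] skew_crossmatC)
  thus ?thesis by (simp add: T_def rep_transpose[OF rep s] flip: matrix_mul_assoc)
qed

text \<open>
  Conjugating by \<open>g\<close> in G2 replaces the weight basis in the sum by its image under an orthogonal matrix, which does not change the sum.
\<close>

lemma dirac_hom:
  assumes \<eta>: "\<eta> \<in> hom_G2 I \<rho>" shows "dirac 0 I \<rho> \<eta> \<in> hom_G2 I \<rho>"
proof -
  note lin = hom_linear[OF \<eta>]
  have tw: "dirac 0 I \<rho> \<eta> x \<in> twisted_spinors" for x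
    unfolding dirac_alt by (intro twisted_spinors_closed twisted_spinors_sum tensor_map_id_linear lin)
  have l1: "dirac 0 I \<rho> \<eta> (x + y) = dirac 0 I \<rho> \<eta> x + dirac 0 I \<rho> \<eta> y" for x y
    unfolding dirac_alt by (simp add: cmatrix_vector lin tensor_map_id_linear sum.distrib tscale_simps)
  have l2: "dirac 0 I \<rho> \<eta> (c *s x) = tscale c (dirac 0 I \<rho> \<eta> x)" for c x
    unfolding dirac_alt 
    by (simp only: cmatrix_vector lin tensor_map_id_linear tscale_sum[symmetric] tscale_simps(1,3) mult.commute)
  have eq: "dirac 0 I \<rho> \<eta> (\<rho> g *v x) = twisted_act I g (dirac 0 I \<rho> \<eta> x)" if g: "g \<in> G2" for g x
  proof (rule tw_eqI[OF tw c_act(1)[OF g tw]])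
    define T where "T = transpose (cmat (vecrep g))"
    have s: "g \<in> Spin7" using g by (simp add: G2_def)
    have TT: "T ** transpose T = mat 1" by (simp add: T_def cmat_vecrep_orthogonal[OF s])
    have R: "RJ (u + v) *v x = RJ u *v x + RJ v *v x" "RJ (c *s u) *v x = c *s (RJ u *v x)" for u v c
      by (simp_all add: RJ_linear cmatrix_vector)
    have mv: "\<eta> (RJ u *v (\<rho> g *v x)) = twisted_act I g (\<eta> (RJ (T *v u) *v x))" for u
      by (simp add: matrix_vector_mul_assoc RJ_conj[OF g] T_def) (simp add: lin(4)[OF g] flip: matrix_vector_mul_assoc)
    have C: "c0 (twisted_act I g (\<eta> v)) y z = c0 (\<eta> v) (T *v y) (T *v z)" 
      "c1 i (twisted_act I g (\<eta> v)) u y z = c1 i (\<eta> v) (T *v u) (T *v y) (T *v z)" for v u y z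
      unfolding T_def by (rule c_act[OF g lin(3)])+
    have D: "c0 (twisted_act I g (dirac 0 I \<rho> \<eta> x)) y z = c0 (dirac 0 I \<rho> \<eta> x) (T *v y) (T *v z)" 
      "c1 i (twisted_act I g (dirac 0 I \<rho> \<eta> x)) u y z = c1 i (dirac 0 I \<rho> \<eta> x) (T *v u) (T *v y) (T *v z)" for u y z
      unfolding T_def by (rule c_act[OF g tw])+
    have cr: "T *v cross u v = cross (T *v u) (T *v v)" for u v
      using G2_cross_complex[OF G2_transpose[OF g], of u v] by (simp add: T_def vecrep_transpose[OF s] cmat_simps)
    show "c0 (dirac 0 I \<rho> \<eta> (\<rho> g *v x)) y z = c0 (twisted_act I g (dirac 0 I \<rho> \<eta> x)) y z" for y z
    proof -
      interpret B0: bilinear_form "\<lambda>u v. c1 i (\<eta> (RJ u *v x)) v (T *v y) (T *v z)"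
        by unfold_locales (simp_all add: R lin c1_linear)
      show ?thesis unfolding D dirac_c[OF \<eta>] mv C lin(4)[OF g] B0.orthogonal_invariant[OF TT] ..
    qed
    show "c1 i (dirac 0 I \<rho> \<eta> (\<rho> g *v x)) u y z = c1 i (twisted_act I g (dirac 0 I \<rho> \<eta> x)) u y z" for u y z
    proof -
      interpret B1: bilinear_form "\<lambda>v v'. c1 i (\<eta> (RJ v *v x)) (cross (T *v u) v') (T *v y) (T *v z)"
        by unfold_locales (simp_all add: R lin c1_linear cross_bilinear)
      show ?thesis unfolding D dirac_c[OF \<eta>] mv C lin(4)[OF g] cr B1.orthogonal_invariant[OF TT] ..
    qed
  qed
  show ?thesis using tw l1 l2 eq by (auto simp: hom_G2_def linear_tscale_iff)
qed

lemma mexp_g2: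
  assumes L: "skew L" "contract L = 0"
  shows "mexp (t *\<^sub>R spin L) \<in> G2" "vecrep (mexp (t *\<^sub>R spin L)) = mexp (t *\<^sub>R L)"
proof -
  have "spin L \<in> g2" unfolding g2_eq using L by blast
  thus "mexp (t *\<^sub>R spin L) \<in> G2" by (simp add: g2_def lie_algebra_def matrix_exp_mexp)
  hence s: "mexp (t *\<^sub>R spin L) \<in> Spin7" by (simp add: G2_def)
  have "vecrep (mexp (t *\<^sub>R spin L)) *v u = mexp (t *\<^sub>R L) *v u" for u
    using mexp_spin_covers[OF L(1), of t] by (intro vecrep_eqI[OF s]) (simp add: covers_def)
  thus "vecrep (mexp (t *\<^sub>R spin L)) = mexp (t *\<^sub>R L)" by (simp add: matrix_eq)
qed

lemma bounded_linear_complexI: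
  fixes f :: "complex^'m \<Rightarrow> complex"
  assumes "\<And>x y. f (x + y) = f x + f y" "\<And>c x. f (c *s x) = c * f x"
  shows "bounded_linear f"
proof -
  have "r *\<^sub>R x = of_real r *s x" for r and x :: "complex^'m" by (simp add: vec_eq_iff complex_eq_iff)
  hence "linear f" using assms by (intro linearI) (simp_all add: scaleR_conv_of_real)
  thus ?thesis by (simp add: linear_conv_bounded_linear)
qed

text \<open>
  Differentiate the group equivariance along the exponential of \<open>spin L\<close>.
\<close>

lemma real_equivariance:
  assumes \<eta>: "\<eta> \<in> hom_G2 I \<rho>" and L: "skew L" "contract L = 0"
  shows "c0 (\<eta> (drep \<rho> (spin L) *v x)) y z = - c0 (\<eta> x) (cmat L *v y) z - c0 (\<eta> x) y (cmat L *v z)"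
    "c1 i (\<eta> (drep \<rho> (spin L) *v x)) u y z = - c1 i (\<eta> x) (cmat L *v u) y z - c1 i (\<eta> x) u (cmat L *v y) z - c1 i (\<eta> x) u y (cmat L *v z)"
proof -
  note lin = hom_linear[OF \<eta>]
  have X: "spin L \<in> spin7" by (rule spin_in_spin7[OF L(1)])
  define E where "E t = cmat (mexp (t *\<^sub>R (- L)))" for t
  have T: "transpose (cmat (vecrep (mexp (t *\<^sub>R spin L)))) = E t" for t
    unfolding mexp_g2[OF L] E_def transpose_mexp_skew[OF L(1), symmetric] by (rule cmat_simps(7)[symmetric])
  have E0: "E 0 = mat 1" by (simp add: E_def cmat_simps)
  have blc: "bounded_linear (cmat :: real^7^7 \<Rightarrow> _)"
    unfolding linear_conv_bounded_linear[symmetric] by (rule linearI) (simp_all add: vec_eq_iff complex_eq_iff)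
  have dE: "((\<lambda>t. E t *v v) has_vector_derivative - (cmat L *v v)) (at 0)" for v
  proof -
    have "(E has_vector_derivative cmat (- L)) (at 0)" unfolding E_def
      by (rule bounded_linear.has_vector_derivative[OF blc has_derivative_mexp_0])
    from bounded_linear.has_vector_derivative[OF bounded_bilinear.bounded_linear_left[OF bounded_bilinear_matrix_vector_mult, of v] this]
    show ?thesis by (simp add: cmat_simps cmatrix_vector)
  qed
  have dr: "((\<lambda>t. \<rho> (mexp (t *\<^sub>R spin L)) *v x) has_vector_derivative drep \<rho> (spin L) *v x) (at 0)"
    by (rule bounded_linear.has_vector_derivative[OF bounded_bilinear.bounded_linear_left[OF bounded_bilinear_matrix_vector_mult, of x] drep_exp(2)[OF rep X]])
  have dl: "((\<lambda>t. dot k (E t *v v)) has_vector_derivative dot k (- (cmat L *v v))) (at 0)" for k v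
    by (rule bounded_linear.has_vector_derivative[OF bounded_linear_complexI dE]) (simp_all add: dot_bilinear)
  have bil: "((\<lambda>t. dot (E t *v y) (A *v (E t *v z))) has_vector_derivative 
     dot y (A *v (- (cmat L *v z))) + dot (- (cmat L *v y)) (A *v z)) (at 0)" for A y z
  proof -
    have bb: "bounded_bilinear (\<lambda>y z. dot y (A *v z))"
    proof -
      have "r *\<^sub>R x = of_real r *s x" for r and x :: "complex^7" by (simp add: vec_eq_iff complex_eq_iff)
      thus ?thesis unfolding bilinear_conv_bounded_bilinear[symmetric] bilinear_def
        by (auto intro!: linearI simp: dot_bilinear cmatrix_vector scaleR_conv_of_real)
    qed
    from bounded_bilinear.has_vector_derivative[OF bb dE[of y] dE[of z]] show ?thesis by (simp add: E0)
  qed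
  have "((\<lambda>t. c0 (\<eta> (\<rho> (mexp (t *\<^sub>R spin L)) *v x)) y z) has_vector_derivative c0 (\<eta> (drep \<rho> (spin L) *v x)) y z) (at 0)"
    by (rule bounded_linear.has_vector_derivative[OF bounded_linear_complexI dr]) (simp_all add: lin c0_linear)
  moreover have "((\<lambda>t. c0 (\<eta> (\<rho> (mexp (t *\<^sub>R spin L)) *v x)) y z) has_vector_derivative 
     - c0 (\<eta> x) (cmat L *v y) z - c0 (\<eta> x) y (cmat L *v z)) (at 0)"
    unfolding lin(4)[OF mexp_g2(1)[OF L]] c_act(2)[OF mexp_g2(1)[OF L] lin(3)] T
    unfolding c0_def
    using bil[of y "vecC (fst (\<eta> x))" z] by (simp add: cmatrix_vector dot_bilinear minus_diff_commute)
  ultimately show "c0 (\<eta> (drep \<rho> (spin L) *v x)) y z = - c0 (\<eta> x) (cmat L *v y) z - c0 (\<eta> x) y (cmat L *v z)"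
    by (rule vector_derivative_unique_at)
  have "((\<lambda>t. c1 i (\<eta> (\<rho> (mexp (t *\<^sub>R spin L)) *v x)) u y z) has_vector_derivative c1 i (\<eta> (drep \<rho> (spin L) *v x)) u y z) (at 0)"
    by (rule bounded_linear.has_vector_derivative[OF bounded_linear_complexI dr]) (simp_all add: lin c1_linear)
  moreover have "((\<lambda>t. c1 i (\<eta> (\<rho> (mexp (t *\<^sub>R spin L)) *v x)) u y z) has_vector_derivative 
     - c1 i (\<eta> x) (cmat L *v u) y z - c1 i (\<eta> x) u (cmat L *v y) z - c1 i (\<eta> x) u y (cmat L *v z)) (at 0)"
  proof -
    have "((\<lambda>t. \<Sum>a\<in>UNIV. dot (cv (i a)) (E t *v u) * dot (E t *v y) (vecC (snd (\<eta> x) $ a) *v (E t *v z))) has_vector_derivative 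
      (\<Sum>a\<in>UNIV. dot (cv (i a)) (E 0 *v u) * (dot y (vecC (snd (\<eta> x) $ a) *v (- (cmat L *v z))) + dot (- (cmat L *v y)) (vecC (snd (\<eta> x) $ a) *v z))
         + dot (cv (i a)) (- (cmat L *v u)) * dot (E 0 *v y) (vecC (snd (\<eta> x) $ a) *v (E 0 *v z)))) (at 0)"
      by (intro has_vector_derivative_sum has_vector_derivative_mult dl bil)
    moreover have "(\<Sum>a\<in>UNIV. dot (cv (i a)) (E 0 *v u) * (dot y (vecC (snd (\<eta> x) $ a) *v (- (cmat L *v z))) + dot (- (cmat L *v y)) (vecC (snd (\<eta> x) $ a) *v z))
         + dot (cv (i a)) (- (cmat L *v u)) * dot (E 0 *v y) (vecC (snd (\<eta> x) $ a) *v (E 0 *v z)))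
      = - c1 i (\<eta> x) (cmat L *v u) y z - c1 i (\<eta> x) u (cmat L *v y) z - c1 i (\<eta> x) u y (cmat L *v z)"
      unfolding c1_def E0 dot_commute[of _ "cv _"]
      by (simp add: cmatrix_vector dot_bilinear sum.distrib sum_subtractf sum_negf algebra_simps)
    ultimately show ?thesis
      unfolding lin(4)[OF mexp_g2(1)[OF L]] c_act(3)[OF mexp_g2(1)[OF L] lin(3)] T
      unfolding c1_def dot_commute[of _ "cv _"] by simp
  qed
  ultimately show "c1 i (\<eta> (drep \<rho> (spin L) *v x)) u y z = - c1 i (\<eta> x) (cmat L *v u) y z - c1 i (\<eta> x) u (cmat L *v y) z - c1 i (\<eta> x) u y (cmat L *v z)"
    by (rule vector_derivative_unique_at)
qed

text \<open>
  Complex linearity extends the infinitesimal equivariance from g2 to its complexification.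
\<close>

lemma equivariance:
  assumes \<eta>: "\<eta> \<in> hom_G2 I \<rho>" and L: "skew L" "contract L = 0"
  shows "c0 (\<eta> (crep \<rho> L *v x)) y z = - c0 (\<eta> x) (L *v y) z - c0 (\<eta> x) y (L *v z)"
    "c1 i (\<eta> (crep \<rho> L *v x)) u y z = - c1 i (\<eta> x) (L *v u) y z - c1 i (\<eta> x) u (L *v y) z - c1 i (\<eta> x) u y (L *v z)"
proof -
  note lin = hom_linear[OF \<eta>]
  have sk: "skew (Rem L)" "skew (Imm L)" using skew_Re_Im[OF L(1)] .
  have ct: "contract (Rem L) = 0" "contract (Imm L) = 0"
    using L(2) by (simp_all add: vec_eq_7 contract_nth complex_eq_iff)
  have Lv: "L *v v = cmat (Rem L) *v v + \<i> *s (cmat (Imm L) *v v)" for v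
    by (subst complex_matrix_split[of L]) (simp add: cmatrix_vector)
  have R: "crep \<rho> L *v x = drep \<rho> (spin (Rem L)) *v x + \<i> *s (drep \<rho> (spin (Imm L)) *v x)"
    by (simp add: crep_alt cmatrix_vector)
  show "c0 (\<eta> (crep \<rho> L *v x)) y z = - c0 (\<eta> x) (L *v y) z - c0 (\<eta> x) y (L *v z)"
    unfolding R Lv lin c0_linear real_equivariance[OF \<eta> sk(1) ct(1)] real_equivariance[OF \<eta> sk(2) ct(2)]
    by (simp add: algebra_simps)
  show "c1 i (\<eta> (crep \<rho> L *v x)) u y z = - c1 i (\<eta> x) (L *v u) y z - c1 i (\<eta> x) u (L *v y) z - c1 i (\<eta> x) u y (L *v z)"
    unfolding R Lv lin c1_linear real_equivariance[OF \<eta> sk(1) ct(1)] real_equivariance[OF \<eta> sk(2) ct(2)]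
    by (simp add: algebra_simps)
qed

end

section \<open>Generation by a highest weight vector\<close>

lemma hwvD: 
  assumes "hwv R l x" 
  shows "x \<noteq> 0" "height p + height q > 0 \<Longrightarrow> R (wedge (nvec p) (nvec q)) *v x = 0"
    "R (wedge (nvec p) (nvec (neg p))) *v x = (nrm p * wvec l p) *s x"
  using assms by (auto simp: hwv_def)

text \<open>
  The zero weight part of \<open>\<mm>\<close> lies in the torus and acts by a scalar; the other parts agree with \<open>Ymat\<close> up to positive root vectors.
\<close>

lemma hwv_crossmat:
  assumes rep: "spin7_rep \<rho>" and hw: "hwv (crep \<rho>) l x"
  shows "crep \<rho> (crossmat (nvec p)) *v x = (if p = N0 then (- of_real (l $ 1 + l $ 2 + l $ 3)) *s x else crep \<rho> (Ymat p) *v x)"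
  by (cases p)
     (simp_all del: nvec.simps add: crossmat_nvec crep_add[OF rep] crep_mscale[OF rep] skew_add skew_mscale skew_wedge
        cmatrix_vector hwvD(2)[OF hw] hwvD(3)[OF hw, of P1, simplified] hwvD(3)[OF hw, of P2, simplified] hwvD(3)[OF hw, of P3, simplified] 
        vec_eq_iff algebra_simps)

lemma expand_nvec: "u = (\<Sum>p\<in>UNIV. (inverse (nrm p) * dot u (nvec (neg p))) *s nvec p)"
proof -
  have "(\<Sum>p\<in>UNIV. inverse (nrm p) * (nvec p $ c * dot u (nvec (neg p)))) = u $ c" for c
  proof -
    interpret bilinear_form "\<lambda>x y. x $ c * dot u y"
      by unfold_locales (simp_all add: dot_bilinear algebra_simps)
    show ?thesis unfolding weight_sum by (simp add: if_distrib[of "\<lambda>x. x * _"] cong: if_cong)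
  qed
  thus ?thesis by (simp add: vec_eq_iff mult_ac)
qed

lemma crossmat_sum: "crossmat (\<Sum>i\<in>S. f i) = (\<Sum>i\<in>S. crossmat (f i))"
proof -
  have z: "crossmat 0 = 0" by (simp add: crossmat_def vec_eq_iff cross_bilinear)
  show ?thesis by (induction S rule: infinite_finite_induct) (simp_all add: crossmat_add z)
qed

lemma skew_sum: "(\<And>i. i \<in> S \<Longrightarrow> skew (f i)) \<Longrightarrow> skew (\<Sum>i\<in>S. f i :: 'a::ring_1^'n^'n)"
  by (induction S rule: infinite_finite_induct) (simp_all add: subspace_skew skew_add)

lemma crep_sum:
  assumes rep: "spin7_rep \<rho>" and "\<And>i. i \<in> S \<Longrightarrow> skew (f i)"
  shows "crep \<rho> (\<Sum>i\<in>S. f i) = (\<Sum>i\<in>S. crep \<rho> (f i))"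
  using assms(2) by (induction S rule: infinite_finite_induct)
    (simp_all add: crep_zero[OF rep] crep_add[OF rep] skew_sum)

lemma sum_mv: "(\<Sum>i\<in>S. f i) *v x = (\<Sum>i\<in>S. f i *v x)" "A *v (\<Sum>i\<in>S. g i) = (\<Sum>i\<in>S. A *v g i)"
  for x :: "complex^'n" and A :: "complex^'n^'m"
  by (induction S rule: infinite_finite_induct) (simp_all add: cmatrix_vector)

text \<open>
  Words in g2 applied to a vector.
\<close>

inductive_set g2w :: "(real_mat8 \<Rightarrow> complex^'n^'n) \<Rightarrow> complex^'n \<Rightarrow> (complex^'n) set" for \<rho> x where
  base: "x \<in> g2w \<rho> x"
| step: "y \<in> g2w \<rho> x \<Longrightarrow> skew L \<Longrightarrow> contract L = 0 \<Longrightarrow> crep \<rho> L *v y \<in> g2w \<rho> x"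

lemma irreducible_generated:
  assumes irr: "irreducible_spin7_rep \<rho>" and N: "vec.subspace N" and x: "x \<in> N" "x \<noteq> 0"
    and A: "\<And>A y. skew A \<Longrightarrow> y \<in> N \<Longrightarrow> crep \<rho> A *v y \<in> N"
  shows "N = UNIV"
proof -
  have rep: "spin7_rep \<rho>" using irr by (simp add: irreducible_spin7_rep_def)
  have "drep \<rho> X *v y \<in> N" if X: "X \<in> spin7" and y: "y \<in> N" for X y
  proof -
    obtain B where B: "skew B" "X = spin B" using spin7_is_spin[OF X] by blast
    show ?thesis using A[OF skew_cmat[OF B(1)] y] by (simp add: crep_cmat[OF rep] B(2))
  qed
  hence "\<forall>g\<in>Spin7. \<forall>w\<in>N. \<rho> g *v w \<in> N"
    using Spin7_invariant_subspace[OF rep N] by blast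
  hence "N = {0} \<or> N = UNIV" using irr N by (auto simp: irreducible_spin7_rep_def)
  thus ?thesis using x by auto
qed

text \<open>
  The algebra so(7) is the sum of g2 and \<open>\<mm>\<close>, and on the highest weight vector \<open>\<mm>\<close> acts like elements of g2. Moving a general element past a word in g2
  only creates shorter words, so the span of these words is invariant.
\<close>

lemma g2_generates:
  assumes irr: "irreducible_spin7_rep \<rho>" and hw: "hwv (crep \<rho>) l x"
  shows "vec.span (g2w \<rho> x) = UNIV"
proof (rule irreducible_generated[OF irr vec.subspace_span])
  have rep: "spin7_rep \<rho>" using irr by (simp add: irreducible_spin7_rep_def)
  show "x \<in> vec.span (g2w \<rho> x)" by (intro vec.span_base g2w.base)
  show "x \<noteq> 0" by (rule hwvD(1)[OF hw])
  have g: "crep \<rho> L *v y \<in> vec.span (g2w \<rho> x)" if "skew L" "contract L = 0" "y \<in> vec.span (g2w \<rho> x)" for L y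
    using that(3)
  proof (induction rule: vec.span_induct_alt)
    case base show ?case by (simp add: vec.span_zero)
  next
    case (step c y z)
    have "crep \<rho> L *v y \<in> vec.span (g2w \<rho> x)" using g2w.step[OF step(1) that(1,2)] by (rule vec.span_base)
    thus ?case using step by (simp add: cmatrix_vector vec.span_add vec.span_scale)
  qed
  have w: "y \<in> g2w \<rho> x \<Longrightarrow> \<forall>A. skew A \<longrightarrow> crep \<rho> A *v y \<in> vec.span (g2w \<rho> x)" for y
  proof (induction rule: g2w.induct)
    case base
    show ?case
    proof (intro allI impI)
      fix A :: "complex^7^7" assume A: "skew A"
      (* crossmat v is the component of A outside g2; the factor comes from contract_crossmat. *)
      define v where "v = - (1/6) *s contract A"
      define L where "L = A - crossmat v"
      have sL: "skew L" by (simp add: L_def skew_diff A skew_crossmat)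
      have cL: "contract L = 0" by (simp add: L_def contract_linear contract_crossmat v_def vector_smult_assoc)
      have p: "crep \<rho> (crossmat (nvec p)) *v x \<in> vec.span (g2w \<rho> x)" for p
        unfolding hwv_crossmat[OF rep hw]
        using vec.span_base[OF g2w.step[OF g2w.base skew_Ymat contract_Ymat]] vec.span_scale[OF vec.span_base[OF g2w.base]]
        by (cases "p = N0") (simp_all only: refl if_True if_False)
      have "crossmat v = (\<Sum>p\<in>UNIV. mscale (inverse (nrm p) * dot v (nvec (neg p))) (crossmat (nvec p)))"
        by (subst expand_nvec[of v]) (simp add: crossmat_sum vec_eq_iff crossmat_smult)
      hence "crep \<rho> (crossmat v) *v x = (\<Sum>p\<in>UNIV. (inverse (nrm p) * dot v (nvec (neg p))) *s (crep \<rho> (crossmat (nvec p)) *v x))"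
        by (simp add: crep_sum[OF rep] skew_mscale skew_crossmat crep_mscale[OF rep] sum_mv cmatrix_vector)
      hence "crep \<rho> (crossmat v) *v x \<in> vec.span (g2w \<rho> x)"
        using p by (auto intro!: vec.span_sum vec.span_scale)
      moreover have "crep \<rho> L *v x \<in> vec.span (g2w \<rho> x)" by (intro vec.span_base g2w.step g2w.base sL cL)
      moreover have "A = L + crossmat v" by (simp add: L_def)
      ultimately show "crep \<rho> A *v x \<in> vec.span (g2w \<rho> x)"
        by (simp add: crep_add[OF rep] sL skew_crossmat cmatrix_vector vec.span_add)
    qed
  next
    case (step y L)
    show ?case
    proof (intro allI impI)
      fix A :: "complex^7^7" assume A: "skew A"
      have "crep \<rho> A *v (crep \<rho> L *v y) = crep \<rho> L *v (crep \<rho> A *v y) + crep \<rho> (bracket A L) *v y"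
        unfolding crep_bracket[OF rep A step(2)]
        by (simp add: bracket_def matrix_vector_mult_diff_rdistrib matrix_vector_mul_assoc)
      moreover have "crep \<rho> L *v (crep \<rho> A *v y) \<in> vec.span (g2w \<rho> x)" using g[OF step(2,3)] step(4) A by blast
      moreover have "crep \<rho> (bracket A L) *v y \<in> vec.span (g2w \<rho> x)" using step A skew_bracket by blast
      ultimately show "crep \<rho> A *v (crep \<rho> L *v y) \<in> vec.span (g2w \<rho> x)" by (simp add: vec.span_add)
    qed
  qed
  show "crep \<rho> A *v y \<in> vec.span (g2w \<rho> x)" if "skew A" "y \<in> vec.span (g2w \<rho> x)" for A y
    using that(2)
  proof (induction rule: vec.span_induct_alt)
    case base show ?case by (simp add: vec.span_zero)
  next
    case (step c y z)
    thus ?case using w[OF step(1)] that(1) by (simp add: cmatrix_vector vec.span_add vec.span_scale)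
  qed
qed

text \<open>
  An equivariant map is therefore known once its value at the highest weight vector is known. This is why only finitely many numbers have to be
  considered, although the representation has no explicit form.
\<close>

lemma (in dirac_setting) hom_determined:
  assumes irr: "irreducible_spin7_rep \<rho>" and hw: "hwv (crep \<rho>) l x" and \<eta>: "\<eta> \<in> hom_G2 I \<rho>"
    and zero: "\<eta> x = 0"
  shows "\<eta> y = 0"
proof -
  note lin = hom_linear[OF \<eta>]
  have w: "y \<in> g2w \<rho> x \<Longrightarrow> \<eta> y = 0" for y
  proof (induction rule: g2w.induct)
    case (step y L)
    show ?case
      by (rule tw_eqI[OF lin(3) twisted_spinors_closed(3)])
         (simp_all add: equivariance[OF \<eta> step(2,3)] step(4) c0_zero c1_zero)
  qed (rule zero)
  have "y \<in> vec.span (g2w \<rho> x)" unfolding g2_generates[OF irr hw] by simp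
  thus ?thesis
  proof (induction rule: vec.span_induct_alt)
    case base
    have "\<eta> (0 *s 0) = tscale 0 (\<eta> 0)" by (rule lin(2))
    thus ?case by (simp add: tscale_simps)
  next
    case (step c y z)
    thus ?case using w[OF step(1)] by (simp add: lin tscale_simps)
  qed
qed

text \<open>
  The conjugation of so(7, \<open>\<complex>\<close>) with respect to its compact real form.
\<close>

definition conjm :: "complex^'n^'m \<Rightarrow> complex^'n^'m" where "conjm A = map_matrix cnj A"

text \<open>
  Complex conjugation maps \<open>n\<^sub>p\<close> to \<open>n\<^bsub>-p\<^esub>\<close>, except for a sign at the zero weight caused by the factor \<open>\<i>\<close>.
\<close>

fun csgn :: "wt \<Rightarrow> complex" where "csgn N0 = -1" | "csgn _ = 1"

lemma conjm_wedge: "conjm (wedge (nvec p) (nvec q)) = mscale (csgn p * csgn q) (wedge (nvec (neg p)) (nvec (neg q)))"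
proof -
  have "cnj (nvec p $ a) = csgn p * nvec (neg p) $ a" for p a
  proof -
    have "\<forall>a. cnj (nvec p $ a) = csgn p * nvec (neg p) $ a" unfolding all_7 by (cases p) simp_all
    thus ?thesis by blast
  qed
  thus ?thesis by (simp add: conjm_def vec_eq_iff wedge_def algebra_simps)
qed

lemma height_neg: "height (neg p) = - height p" by (cases p) simp_all

lemma height_zero: "height p + height q = 0 \<Longrightarrow> q = neg p" by (cases p; cases q) simp_all

lemma expand_wedge:
  assumes "skew A"
  shows "A = (\<Sum>p\<in>UNIV. \<Sum>q\<in>UNIV. mscale (1/2 * inverse (nrm p) * inverse (nrm q) * dot (nvec (neg p)) (A *v nvec (neg q))) (wedge (nvec p) (nvec q)))"
    (is "A = ?B")
proof -
  have "A *v v = ?B *v v" for v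
  proof -
    define k where "k p q = inverse (nrm p) * inverse (nrm q) * dot (nvec (neg p)) (A *v nvec (neg q))" for p q
    have sk: "k q p = - k p q" for p q using skew_dot[OF assms, of "nvec (neg q)" "nvec (neg p)"] by (simp add: k_def)
    have e1: "A *v v = (\<Sum>p\<in>UNIV. \<Sum>q\<in>UNIV. (k p q * dot v (nvec q)) *s nvec p)"
    proof -
      have "v = (\<Sum>q\<in>UNIV. (inverse (nrm q) * dot v (nvec q)) *s nvec (neg q))"
      proof -
        have "v = (\<Sum>q\<in>UNIV. (inverse (nrm q) * dot v (nvec (neg q))) *s nvec q)" by (rule expand_nvec)
        also have "\<dots> = (\<Sum>q\<in>UNIV. (inverse (nrm q) * dot v (nvec q)) *s nvec (neg q))"
          by (simp only: sum_wt neg.simps nrm.simps) (simp only: add_ac)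
        finally show ?thesis .
      qed
      hence "A *v v = A *v (\<Sum>q\<in>UNIV. (inverse (nrm q) * dot v (nvec q)) *s nvec (neg q))" by simp
      also have "\<dots> = (\<Sum>q\<in>UNIV. (inverse (nrm q) * dot v (nvec q)) *s (A *v nvec (neg q)))" by (simp add: sum_mv cmatrix_vector)
      also have "\<dots> = (\<Sum>q\<in>UNIV. (inverse (nrm q) * dot v (nvec q)) *s (\<Sum>p\<in>UNIV. (inverse (nrm p) * dot (A *v nvec (neg q)) (nvec (neg p))) *s nvec p))"
        using expand_nvec[of "A *v nvec (neg _)"] by simp
      also have "\<dots> = (\<Sum>q\<in>UNIV. \<Sum>p\<in>UNIV. (k p q * dot v (nvec q)) *s nvec p)"
        by (simp add: vec_eq_iff sum_distrib_left k_def dot_commute[of "A *v _"] mult_ac)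
      also have "\<dots> = (\<Sum>p\<in>UNIV. \<Sum>q\<in>UNIV. (k p q * dot v (nvec q)) *s nvec p)" by (rule sum.swap)
      finally show ?thesis .
    qed
    have "?B *v v = (\<Sum>p\<in>UNIV. \<Sum>q\<in>UNIV. (1/2 * k p q) *s (dot (nvec q) v *s nvec p - dot (nvec p) v *s nvec q))"
      by (simp add: sum_mv cmatrix_vector wedge_vector k_def mult_ac)
    also have "\<dots> = (\<Sum>p\<in>UNIV. \<Sum>q\<in>UNIV. (1/2 * k p q * dot v (nvec q)) *s nvec p) - (\<Sum>p\<in>UNIV. \<Sum>q\<in>UNIV. (1/2 * k p q * dot v (nvec p)) *s nvec q)"
      by (simp add: vec_eq_iff sum_subtractf algebra_simps dot_commute[of _ v])
    also have "(\<Sum>p\<in>UNIV. \<Sum>q\<in>UNIV. (1/2 * k p q * dot v (nvec p)) *s nvec q) = (\<Sum>q\<in>UNIV. \<Sum>p\<in>UNIV. (1/2 * k p q * dot v (nvec p)) *s nvec q)"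
      by (rule sum.swap)
    also have "\<dots> = - (\<Sum>p\<in>UNIV. \<Sum>q\<in>UNIV. (1/2 * k p q * dot v (nvec q)) *s nvec p)"
      unfolding sum_negf[symmetric] by (intro sum.cong refl) (subst sk, simp add: vec_eq_iff)
    finally have "?B *v v = (\<Sum>p\<in>UNIV. \<Sum>q\<in>UNIV. (k p q * dot v (nvec q)) *s nvec p)"
      by (simp add: vec_eq_iff flip: sum.distrib)
    thus ?thesis using e1 by simp
  qed
  thus ?thesis unfolding matrix_eq by blast
qed

text \<open>
  The grading element: it acts on \<open>n\<^sub>p\<close> by the height of \<open>p\<close>.
\<close>

definition Hd :: "complex^7^7" where
  "Hd = mscale (3/2) (wedge (nvec P1) (nvec M1)) + mscale 1 (wedge (nvec P2) (nvec M2)) + mscale (1/2) (wedge (nvec P3) (nvec M3))"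

lemma skew_Hd: "skew Hd" by (simp add: Hd_def skew_add skew_mscale skew_wedge)

lemma Hd_nvec: "Hd *v nvec p = of_int (height p) *s nvec p"
  unfolding Hd_def cmatrix_vector wedge_vector dot_nvec
  by (cases p; simp add: vector_smult_assoc del: nvec.simps)

lemma bracket_Hd: "bracket Hd (wedge (nvec p) (nvec q)) = mscale (of_int (height p + height q)) (wedge (nvec p) (nvec q))"
  by (simp add: bracket_wedge skew_Hd Hd_nvec wedge_bilinear mscale_simps)

section \<open>Embedding a representation into a model\<close>

text \<open>
  A product of shifted operators that kills every eigenvector of \<open>H\<close> with eigenvalue \<open>h - 1, ..., h - k\<close> and no eigenvector with eigenvalue \<open>h\<close>.
\<close>

primrec pj :: "complex^'n^'n \<Rightarrow> complex \<Rightarrow> nat \<Rightarrow> complex^'n \<Rightarrow> complex^'n" where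
  "pj H h 0 y = y"
| "pj H h (Suc k) y = H *v pj H h k y - (h - of_nat k - 1) *s pj H h k y"

lemma pj_linear: "pj H h k (y + z) = pj H h k y + pj H h k z" "pj H h k (c *s y) = c *s pj H h k y" "pj H h k 0 = 0"
proof (induction k)
  case (Suc k)
  have e: "H *v (c *s a) - d *s (c *s a) = c *s (H *v a - d *s a)" for c d :: complex and a
    by (simp add: cmatrix_vector vec.scale_right_diff_distrib vector_smult_assoc mult.commute)
  show "pj H h (Suc k) (y + z) = pj H h (Suc k) y + pj H h (Suc k) z"
    by (simp add: Suc cmatrix_vector vec.scale_right_distrib)
  show "pj H h (Suc k) (c *s y) = c *s pj H h (Suc k) y" unfolding pj.simps Suc e ..
  show "pj H h (Suc k) 0 = 0" by (simp add: Suc)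
qed simp_all

lemma pj_eigenvector: "H *v y = e *s y \<Longrightarrow> pj H h k y = (\<Prod>i<k. e - h + of_nat i + 1) *s y"
proof (induction k)
  case (Suc k)
  define c where "c = (\<Prod>i<k. e - h + of_nat i + 1)"
  have "pj H h (Suc k) y = (c * e - (h - of_nat k - 1) * c) *s y"
    using Suc by (simp add: cmatrix_vector vec.scale_left_diff_distrib vector_smult_assoc c_def)
  also have "c * e - (h - of_nat k - 1) * c = c * (e - h + of_nat k + 1)" by (simp add: algebra_simps)
  finally show ?case by (simp add: c_def)
qed simp

lemma lower_eigenvectors:
  fixes H :: "complex^'n^'n"
  assumes "y \<in> vec.span {y. \<exists>j>0. H *v y = (h - of_nat j) *s y}"
  shows "\<exists>J. \<forall>K\<ge>J. pj H h K y = 0"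
  using assms
proof (induction rule: vec.span_induct_alt)
  case base show ?case by (simp add: pj_linear)
next
  case (step c y z)
  from step(1) obtain j where j: "j > 0" "H *v y = (h - of_nat j) *s y" by blast
  from step(2) obtain J where J: "\<And>K. K \<ge> J \<Longrightarrow> pj H h K z = 0" by blast
  have "pj H h K (c *s y + z) = 0" if "K \<ge> max J j" for K
  proof -
    (* The factor with index j - 1 of the product is zero. *)
    have "j - 1 \<in> {..<K}" "(h - of_nat j) - h + of_nat (j - 1) + 1 = (0::complex)" using that j(1) by (auto simp: of_nat_diff)
    hence "(\<Prod>i<K. (h - of_nat j) - h + of_nat i + 1) = 0" by (intro prod_zero bexI[of _ "j - 1"]) auto
    thus ?thesis using that J by (simp add: pj_linear pj_eigenvector[OF j(2)])
  qed
  thus ?case by blast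
qed

lemma eigenvector_independent:
  fixes H :: "complex^'n^'n"
  assumes x: "x \<noteq> 0" "H *v x = h *s x" and c: "c *s x \<in> vec.span {y. \<exists>j>0. H *v y = (h - of_nat j) *s y}"
  shows "c = 0"
proof -
  obtain K where "pj H h K (c *s x) = 0" using lower_eigenvectors[OF c] by blast
  hence "(c * (\<Prod>i<K. of_nat i + 1)) *s x = 0" by (simp add: pj_linear pj_eigenvector[OF x(2)])
  moreover have "(\<Prod>i<K. of_nat i + 1 :: complex) \<noteq> 0"
    unfolding of_nat_Suc[symmetric] add.commute[of _ 1] by (simp add: prod_zero_iff del: of_nat_Suc)
  ultimately show ?thesis using x(1) by (simp add: vec.scale_eq_0_iff)
qed

text \<open>
  The standard Hermitian product, for matrices as vectors of a tensor product.
\<close>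

definition mherm :: "complex^'b^'a \<Rightarrow> complex^'b^'a \<Rightarrow> complex" where
  "mherm M N = (\<Sum>a\<in>UNIV. \<Sum>b\<in>UNIV. cnj (M $ a $ b) * N $ a $ b)"

lemma mherm_linear: "mherm u (v + v') = mherm u v + mherm u v'" "mherm u (mscale c v) = c * mherm u v" "mherm (mscale c u) v = cnj c * mherm u v"
  "mherm (u + u') v = mherm u v + mherm u' v" "mherm u 0 = 0" "mherm 0 v = 0" "mherm u (- v) = - mherm u v" "mherm u (v - v') = mherm u v - mherm u v'"
  by (simp_all add: mherm_def sum.distrib sum_subtractf sum_distrib_left sum_negf algebra_simps)

lemma mherm_self_0: assumes "mherm M M = 0" shows "M = 0"
proof -
  have "mherm M M = of_real (\<Sum>a\<in>UNIV. \<Sum>b\<in>UNIV. (cmod (M $ a $ b))\<^sup>2)"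
    by (simp only: mherm_def of_real_sum complex_norm_square mult.commute)
  with assms have "(\<Sum>a\<in>UNIV. \<Sum>b\<in>UNIV. (cmod (M $ a $ b))\<^sup>2) = 0" by (simp only: of_real_eq_0_iff)
  hence "\<forall>a\<in>UNIV. (\<Sum>b\<in>UNIV. (cmod (M $ a $ b))\<^sup>2) = 0" by (subst (asm) sum_nonneg_eq_0_iff) (auto intro: sum_nonneg)
  hence "\<forall>a\<in>UNIV. \<forall>b\<in>UNIV. (cmod (M $ a $ b))\<^sup>2 = 0" by (simp add: sum_nonneg_eq_0_iff)
  thus "M = 0" by (simp add: vec_eq_iff)
qed

lemma conjm_conjm: "conjm (conjm A) = A" by (simp add: conjm_def vec_eq_iff)

lemma skew_conjm: assumes "skew A" shows "skew (conjm A)"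
proof -
  have "cnj (A $ i $ j) = - cnj (A $ j $ i)" for i j by (subst skewD[OF assms]) (simp only: complex_cnj_minus)
  thus ?thesis unfolding skew_nth conjm_def map_matrix_nth by blast
qed

text \<open>
  A unitary module \<open>act\<close> containing a vector \<open>M0\<close> of the same highest weight as an abstract irreducible representation. The classification by highest weights says that
  the representation is isomorphic to the submodule generated by \<open>M0\<close>; the proof constructs the graph of this isomorphism.
\<close>

locale highest_weight_pair =
  fixes \<rho> :: "real_mat8 \<Rightarrow> complex^'n^'n" and l x0
    and act :: "complex^7^7 \<Rightarrow> complex^'b^'a \<Rightarrow> complex^'b^'a" and M0
  assumes irr: "irreducible_spin7_rep \<rho>" and hw: "hwv (crep \<rho>) l x0"
    and act_linear: "act A (M + N) = act A M + act A N" "act A (mscale c M) = mscale c (act A M)"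
    and act_add: "skew A \<Longrightarrow> skew B \<Longrightarrow> act (A + B) M = act A M + act B M"
    and act_mscale: "skew A \<Longrightarrow> act (mscale c A) M = mscale c (act A M)"
    and act_bracket: "skew A \<Longrightarrow> skew B \<Longrightarrow> act (bracket A B) M = act A (act B M) - act B (act A M)"
    and act_herm: "skew A \<Longrightarrow> mherm (act A M) N = - mherm M (act (conjm A) N)"
    and M0: "M0 \<noteq> 0" "\<And>p q. height p + height q > 0 \<Longrightarrow> act (wedge (nvec p) (nvec q)) M0 = 0"
      "\<And>p. act (wedge (nvec p) (nvec (neg p))) M0 = mscale (nrm p * wvec l p) M0"
begin

lemma rep: "spin7_rep \<rho>" using irr by (simp add: irreducible_spin7_rep_def)

lemma act_zero: "act A 0 = 0" "act 0 M = 0"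
  using act_linear(2)[of A 0 0] act_mscale[OF subspace_skew, of 0 M] by (simp_all add: mscale_simps)

lemma act_sum: "(\<And>i. i \<in> S \<Longrightarrow> skew (f i)) \<Longrightarrow> act (\<Sum>i\<in>S. f i) M = (\<Sum>i\<in>S. act (f i) M)"
  by (induction S rule: infinite_finite_induct) (simp_all add: act_zero act_add skew_sum)

text \<open>
  Simultaneous words in negative root vectors, with the total height by which they lower.
\<close>

inductive wd :: "complex^'n \<Rightarrow> complex^'b^'a \<Rightarrow> nat \<Rightarrow> bool" where
  base: "wd x0 M0 0"
| step: "wd y t j \<Longrightarrow> height p + height q < 0 \<Longrightarrow>
    wd (crep \<rho> (wedge (nvec p) (nvec q)) *v y) (act (wedge (nvec p) (nvec q)) t) (j + nat (- (height p + height q)))"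

text \<open>
  The span of the simultaneous words, a subspace of the direct sum of the two modules.
\<close>

inductive gr :: "complex^'n \<Rightarrow> complex^'b^'a \<Rightarrow> bool" where
  zero: "gr 0 0"
| add: "gr y t \<Longrightarrow> wd y1 t1 j \<Longrightarrow> gr (y + c *s y1) (t + mscale c t1)"

lemma gr_add: assumes "gr y t" "gr y' t'" shows "gr (y + y') (t + t')"
  using assms(2)
proof induction
  case zero thus ?case using assms(1) by simp
next
  case (add y' t' y1 t1 j c)
  from gr.add[OF add(3,2)] show ?case by (simp add: add.assoc)
qed

lemma gr_scale: "gr y t \<Longrightarrow> gr (c *s y) (mscale c t)"
proof (induction rule: gr.induct)
  case zero thus ?case using gr.zero by (simp add: mscale_simps)
next
  case (add y t y1 t1 j d)
  from gr.add[OF add(3,2), of "c * d"] show ?case by (simp add: mscale_simps vec.scale_right_distrib)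
qed

lemma gr_diff: assumes "gr y t" "gr y' t'" shows "gr (y - y') (t - t')"
  using gr_add[OF assms(1) gr_scale[OF assms(2), of "-1"]] by (simp add: mscale_simps vec_eq_iff) 

lemma gr_sum: "(\<And>i. gr (f i) (g i)) \<Longrightarrow> gr (\<Sum>i\<in>S. f i) (\<Sum>i\<in>S. g i)"
  by (induction S rule: infinite_finite_induct) (auto intro: gr.zero gr_add)

lemma gr_word: "wd y t j \<Longrightarrow> gr y t"
  using gr.add[OF gr.zero, of y t j 1] by (simp add: mscale_simps)

lemma gr_lower: "gr y t \<Longrightarrow> height p + height q < 0 \<Longrightarrow> gr (crep \<rho> (wedge (nvec p) (nvec q)) *v y) (act (wedge (nvec p) (nvec q)) t)"
proof (induction rule: gr.induct)
  case zero thus ?case using gr.zero by (simp add: act_zero)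
next
  case (add y t y1 t1 j d)
  from gr.add[OF add(3)[OF add(4)] wd.step[OF add(2,4)], of d] show ?case by (simp add: act_linear cmatrix_vector)
qed

text \<open>
  Invariance of the span. Only the highest weight vectors themselves need the root decomposition: positive root vectors kill them, torus elements act on
  both by the same scalar, and negative ones produce words. For longer words a commutator suffices.
\<close>

lemma gr_act_word: "wd y t j \<Longrightarrow> \<forall>A. skew A \<longrightarrow> gr (crep \<rho> A *v y) (act A t)"
proof (induction rule: wd.induct)
  case base
  show ?case
  proof (intro allI impI)
    fix A :: "complex^7^7" assume A: "skew A"
    define k where "k p q = 1/2 * inverse (nrm p) * inverse (nrm q) * dot (nvec (neg p)) (A *v nvec (neg q))" for p q
    have e: "A = (\<Sum>p\<in>UNIV. \<Sum>q\<in>UNIV. mscale (k p q) (wedge (nvec p) (nvec q)))"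
      unfolding k_def by (rule expand_wedge[OF A])
    have "gr (crep \<rho> (wedge (nvec p) (nvec q)) *v x0) (act (wedge (nvec p) (nvec q)) M0)" for p q
    proof -
      consider "height p + height q > 0" | "height p + height q < 0" | "q = neg p" using height_zero[of p q] by linarith
      thus ?thesis
      proof cases
        case 1 thus ?thesis using hwvD(2)[OF hw 1] M0(2)[OF 1] gr.zero by simp
      next
        case 2 thus ?thesis using gr_word[OF wd.step[OF wd.base 2]] by simp
      next
        case 3 thus ?thesis using hwvD(3)[OF hw] M0(3) gr_scale[OF gr_word[OF wd.base]] by simp
      qed
    qed
    hence "gr (\<Sum>p\<in>UNIV. \<Sum>q\<in>UNIV. k p q *s (crep \<rho> (wedge (nvec p) (nvec q)) *v x0)) (\<Sum>p\<in>UNIV. \<Sum>q\<in>UNIV. mscale (k p q) (act (wedge (nvec p) (nvec q)) M0))"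
      by (intro gr_sum gr_scale)
    moreover have "crep \<rho> A *v x0 = (\<Sum>p\<in>UNIV. \<Sum>q\<in>UNIV. k p q *s (crep \<rho> (wedge (nvec p) (nvec q)) *v x0))"
      by (subst e) (simp add: crep_sum[OF rep] crep_mscale[OF rep] skew_sum skew_mscale skew_wedge sum_mv cmatrix_vector)
    moreover have "act A M0 = (\<Sum>p\<in>UNIV. \<Sum>q\<in>UNIV. mscale (k p q) (act (wedge (nvec p) (nvec q)) M0))"
      by (subst e) (simp add: act_sum act_mscale skew_sum skew_mscale skew_wedge)
    ultimately show "gr (crep \<rho> A *v x0) (act A M0)" by simp
  qed
next
  case (step y t j p q)
  show ?case
  proof (intro allI impI)
    fix A :: "complex^7^7" assume A: "skew A"
    define w where "w = wedge (nvec p) (nvec q)"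
    have w: "skew w" by (simp add: w_def skew_wedge)
    have "crep \<rho> A *v (crep \<rho> w *v y) = crep \<rho> w *v (crep \<rho> A *v y) + crep \<rho> (bracket A w) *v y"
      unfolding crep_bracket[OF rep A w]
      by (simp add: bracket_def matrix_vector_mult_diff_rdistrib matrix_vector_mul_assoc)
    moreover have "act A (act w t) = act w (act A t) + act (bracket A w) t" by (simp add: act_bracket A w)
    moreover have "gr (crep \<rho> w *v (crep \<rho> A *v y)) (act w (act A t))"
      unfolding w_def using gr_lower[OF _ step(2)] step(3) A by blast
    moreover have "gr (crep \<rho> (bracket A w) *v y) (act (bracket A w) t)" using step(3) skew_bracket[OF A w] by blast
    ultimately show "gr (crep \<rho> A *v (crep \<rho> (wedge (nvec p) (nvec q)) *v y)) (act A (act (wedge (nvec p) (nvec q)) t))"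
      by (simp add: gr_add flip: w_def)
  qed
qed

lemma gr_act: "gr y t \<Longrightarrow> skew A \<Longrightarrow> gr (crep \<rho> A *v y) (act A t)"
proof (induction rule: gr.induct)
  case zero thus ?case using gr.zero by (simp add: act_zero)
next
  case (add y t y1 t1 j d)
  have "gr (crep \<rho> A *v y1) (act A t1)" using gr_act_word[OF add(2)] add(4) by blast
  from gr_add[OF add(3)[OF add(4)] gr_scale[OF this, of d]] show ?case by (simp add: act_linear cmatrix_vector)
qed

definition top_height :: complex where "top_height = of_real (3 * l $ 1 + 2 * l $ 2 + l $ 3)"

lemma word_weight: "wd y t j \<Longrightarrow> crep \<rho> Hd *v y = (top_height - of_nat j) *s y"
proof (induction rule: wd.induct)
  case base
  show ?case
    by (simp del: nvec.simps add: Hd_def crep_add[OF rep] crep_mscale[OF rep] skew_add skew_mscale skew_wedge cmatrix_vector top_height_def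
        hwvD(3)[OF hw, of P1, simplified neg.simps] hwvD(3)[OF hw, of P2, simplified neg.simps] hwvD(3)[OF hw, of P3, simplified neg.simps] 
        vec_eq_iff algebra_simps)
next
  case (step y t j p q)
  define w where "w = wedge (nvec p) (nvec q)"
  have w: "skew w" by (simp add: w_def skew_wedge)
  have "crep \<rho> Hd *v (crep \<rho> w *v y) = crep \<rho> w *v (crep \<rho> Hd *v y) + crep \<rho> (bracket Hd w) *v y"
    unfolding crep_bracket[OF rep skew_Hd w]
    by (simp add: bracket_def matrix_vector_mult_diff_rdistrib matrix_vector_mul_assoc)
  also have "\<dots> = (top_height - of_nat j + of_int (height p + height q)) *s (crep \<rho> w *v y)"
    unfolding step(3) w_def bracket_Hd crep_mscale[OF rep skew_wedge] by (simp add: cmatrix_vector vec_eq_iff algebra_simps)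
  also have "top_height - of_nat j + of_int (height p + height q) = top_height - of_nat (j + nat (- (height p + height q)))"
    using step(2) by (simp add: of_nat_nat)
  finally show ?case unfolding w_def .
qed

lemma mherm_act: "skew A \<Longrightarrow> mherm M (act A N) = - mherm (act (conjm A) M) N"
  using act_herm[OF skew_conjm, of A M N] by (simp add: conjm_conjm)

text \<open>
  The adjoint of a negative root vector is a multiple of a positive one, which kills \<open>M0\<close>.
\<close>

lemma word_orthogonal: "wd y t j \<Longrightarrow> (j = 0 \<and> y = x0 \<and> t = M0) \<or> (j > 0 \<and> mherm M0 t = 0)"
proof (induction rule: wd.induct)
  case (step y t j p q)
  have "height (neg p) + height (neg q) > 0" using step(2) by (simp add: height_neg)
  from M0(2)[OF this] have "mherm M0 (act (wedge (nvec p) (nvec q)) t) = 0"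
    by (simp add: mherm_act skew_wedge conjm_wedge act_mscale mscale_simps mherm_linear)
  thus ?case using step(2) by simp
qed simp

text \<open>
  Separation of the component of top height.
\<close>

lemma gr_decompose:
  "gr y t \<Longrightarrow> \<exists>c y' t'. y = c *s x0 + y' \<and> t = mscale c M0 + t' \<and> mherm M0 t' = 0 \<and>
     y' \<in> vec.span {y. \<exists>j>0. crep \<rho> Hd *v y = (top_height - of_nat j) *s y}"
proof (induction rule: gr.induct)
  case zero show ?case by (intro exI[of _ 0]) (simp add: mscale_simps mherm_linear vec.span_zero)
next
  case (add y t y1 t1 j d)
  then obtain c y' t' where IH: "y = c *s x0 + y'" "t = mscale c M0 + t'" "mherm M0 t' = 0"
    "y' \<in> vec.span {y. \<exists>j>0. crep \<rho> Hd *v y = (top_height - of_nat j) *s y}" by blast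
  show ?case
  proof (cases "j = 0")
    case True
    hence "y1 = x0" "t1 = M0" using word_orthogonal[OF add(2)] by auto
    thus ?thesis using IH by (intro exI[of _ "c + d"] exI[of _ y'] exI[of _ t']) (simp add: mscale_simps vec.scale_left_distrib)
  next
    case False
    hence "mherm M0 t1 = 0" using word_orthogonal[OF add(2)] by auto
    moreover have "y1 \<in> vec.span {y. \<exists>j>0. crep \<rho> Hd *v y = (top_height - of_nat j) *s y}"
      using word_weight[OF add(2)] False by (intro vec.span_base) auto
    ultimately show ?thesis using IH by (intro exI[of _ c] exI[of _ "y' + d *s y1"] exI[of _ "t' + mscale d t1"])
       (auto simp: mherm_linear add.assoc intro: vec.span_add vec.span_scale)
  qed
qed

text \<open>
  Eigenvectors of the grading element with different eigenvalues are independent, so a relation in the first module has no component of top height.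
\<close>

lemma gr_zero_orthogonal: assumes "gr 0 t" shows "mherm M0 t = 0"
proof -
  obtain c y' t' where c: "0 = c *s x0 + y'" "t = mscale c M0 + t'" "mherm M0 t' = 0"
    "y' \<in> vec.span {y. \<exists>j>0. crep \<rho> Hd *v y = (top_height - of_nat j) *s y}" using gr_decompose[OF assms] by blast
  have "(- c) *s x0 = y'" using c(1) by (simp add: add_eq_0_iff)
  with c(4) have "(- c) *s x0 \<in> vec.span {y. \<exists>j>0. crep \<rho> Hd *v y = (top_height - of_nat j) *s y}" by simp
  from eigenvector_independent[OF hwvD(1)[OF hw] _ this] word_weight[OF wd.base] have "c = 0" by simp
  thus ?thesis using c by (simp add: mscale_simps)
qed

text \<open>
  The elements \<open>t\<close> with \<open>gr 0 t\<close> form a submodule orthogonal to \<open>M0\<close>. By unitarity it is orthogonal to all words, and it consists of combinations of words, so it is zero.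
  Hence the span is the graph of a map.
\<close>

lemma gr_zero: assumes "gr 0 t" shows "t = 0"
proof -
  have w: "wd y t' j \<Longrightarrow> \<forall>t. gr 0 t \<longrightarrow> mherm t' t = 0" for y t' j
  proof (induction rule: wd.induct)
    case base thus ?case using gr_zero_orthogonal by blast
  next
    case (step y t' j p q)
    have "gr 0 (act (conjm (wedge (nvec p) (nvec q))) t)" if "gr 0 t" for t
      using gr_act[OF that skew_conjm[OF skew_wedge]] by simp
    thus ?case using step(3) by (simp add: act_herm skew_wedge)
  qed
  have "gr y t' \<Longrightarrow> mherm t' t = 0" for y t'
    by (induction rule: gr.induct) (use w assms in \<open>auto simp: mherm_linear\<close>)
  from mherm_self_0[OF this[OF assms]] show ?thesis .
qed

lemma gr_total: "\<exists>t. gr y t"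
proof -
  have "vec.subspace {y. \<exists>t. gr y t}"
    unfolding vec.subspace_def using gr.zero gr_add gr_scale by blast
  from irreducible_generated[OF irr this, of x0] gr_word[OF wd.base] hwvD(1)[OF hw] gr_act
  have "{y. \<exists>t. gr y t} = UNIV" by blast
  thus ?thesis by blast
qed

lemma gr_unique: "gr y t \<Longrightarrow> gr y t' \<Longrightarrow> t = t'"
  using gr_zero[of "t - t'"] gr_diff[of y t y t'] by simp

text \<open>
  The kernel is invariant and does not contain the highest weight vector, so irreducibility makes it trivial.
\<close>

lemma gr_injective: assumes "gr y 0" shows "y = 0"
proof (rule ccontr)
  assume y: "y \<noteq> 0"
  have "vec.subspace {y. gr y 0}"
    unfolding vec.subspace_def using gr.zero gr_add[of _ 0 _ 0] gr_scale[of _ 0] by (auto simp: mscale_simps)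
  moreover have "gr (crep \<rho> A *v z) 0" if "skew A" "gr z 0" for A z
    using gr_act[OF that(2,1)] by (simp add: act_zero)
  ultimately have "{y. gr y 0} = UNIV" using irreducible_generated[OF irr _ _ y] assms by blast
  hence "gr x0 0" by blast
  thus False using gr_unique[OF _ gr_word[OF wd.base]] M0(1) by blast
qed

lemma embedding:
  obtains \<iota> where "\<And>y z. \<iota> (y + z) = \<iota> y + \<iota> z" "\<And>c y. \<iota> (c *s y) = mscale c (\<iota> y)" "\<iota> x0 = M0"
    "\<And>A y. skew A \<Longrightarrow> \<iota> (crep \<rho> A *v y) = act A (\<iota> y)" "\<And>y. \<iota> y = 0 \<Longrightarrow> y = 0"
proof -
  obtain \<iota> where i: "\<And>y. gr y (\<iota> y)" using gr_total by metis
  have u: "gr y t \<Longrightarrow> \<iota> y = t" for y t using gr_unique[OF i] by blast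
  show ?thesis
  proof (rule that[of \<iota>])
    show "\<iota> (y + z) = \<iota> y + \<iota> z" for y z by (intro u gr_add i)
    show "\<iota> (c *s y) = mscale c (\<iota> y)" for c y by (intro u gr_scale i)
    show "\<iota> x0 = M0" by (intro u gr_word[OF wd.base])
    show "\<iota> (crep \<rho> A *v y) = act A (\<iota> y)" if "skew A" for A y by (intro u gr_act i that)
    show "y = 0" if "\<iota> y = 0" for y using i[of y] gr_injective that by simp
  qed
qed

end

section \<open>Tensor products of the vector and spin representations\<close>

text \<open>
  A real orthogonal representation \<open>p\<close> of Spin(7), given together with its derivative \<open>P\<close> on skew 7 by 7 matrices.
\<close>

locale real_rep =
  fixes p :: "real_mat8 \<Rightarrow> real^'a^'a" and P :: "real^7^7 \<Rightarrow> real^'a^'a"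
  assumes mult: "g \<in> Spin7 \<Longrightarrow> h \<in> Spin7 \<Longrightarrow> p (g ** h) = p g ** p h" and one: "p (mat 1) = mat 1"
    and exp: "skew L \<Longrightarrow> p (mexp (spin L)) = mexp (P L)"
    and add: "P (A + B) = P A + P B" and scaleR: "P (r *\<^sub>R A) = r *\<^sub>R P A"
    and skew: "skew L \<Longrightarrow> skew (P L)"
    and bracket: "skew A \<Longrightarrow> skew B \<Longrightarrow> P (bracket A B) = bracket (P A) (P B)"

definition complexify :: "(real^7^7 \<Rightarrow> real^'a^'a) \<Rightarrow> complex^7^7 \<Rightarrow> complex^'a^'a" where
  "complexify P A = cmat (P (Rem A)) + mscale \<i> (cmat (P (Imm A)))"

lemma bracket_0: "bracket X 0 = 0" "bracket 0 X = 0" for X :: "'a::ring_1^'n^'n"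
  by (simp_all add: bracket_def matrix_matrix_mult_def vec_eq_iff)

context real_rep begin

lemma diff: "P (A - B) = P A - P B"
  using add[of "A - B" B] by simp

lemma zero: "P 0 = 0" using scaleR[of 0 0] by simp

lemma minus: "P (- A) = - P A" using diff[of 0 A] by (simp add: zero)

lemma complexify_add: "complexify P (A + B) = complexify P A + complexify P B"
  by (simp add: complexify_def Re_Im_mat add cmat_simps mscale_simps)

lemma complexify_mscale: "complexify P (mscale c A) = mscale c (complexify P A)"
  unfolding complexify_def Re_Im_mat diff add scaleR by (simp add: vec_eq_iff complex_eq_iff algebra_simps)

lemma complexify_cmat: "complexify P (cmat A) = cmat (P A)"
  by (simp add: complexify_def Re_Im_mat zero mscale_simps vec_eq_iff)

lemma complexify_bracket: "skew A \<Longrightarrow> skew B \<Longrightarrow> complexify P (bracket A B) = bracket (complexify P A) (complexify P B)"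
  by (rule complex_mat_eqI)
     (simp_all add: complexify_def Re_Im_bracket Re_Im_mat add diff bracket skew_Re_Im bracket_add_left bracket_add_right bracket_0)

lemma skew_complexify: "skew A \<Longrightarrow> skew (complexify P A)"
  by (simp add: complexify_def skew_add skew_mscale skew_cmat skew skew_Re_Im)

lemma complexify_conjm: "complexify P (conjm A) = conjm (complexify P A)"
proof -
  have c: "Rem (conjm X) = Rem X" "Imm (conjm X) = - Imm X" for X :: "complex^'k^'l" by (simp_all add: conjm_def vec_eq_iff)
  show ?thesis by (rule complex_mat_eqI) (simp_all add: c complexify_def Re_Im_mat minus)
qed

end

lemma mherm_transpose: "mherm (transpose M) (transpose N) = mherm M N"
  unfolding mherm_def transpose_def vec_lambda_beta by (rule sum.swap)

lemma mherm_skew: 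
  "skew B \<Longrightarrow> mherm (B ** M) N = - mherm M (conjm B ** N)" "skew C \<Longrightarrow> mherm (M ** C) N = - mherm M (N ** conjm C)"
proof -
  have 1: "mherm (B ** M) N = - mherm M (conjm B ** N)" if "skew B" for B :: "complex^'c^'c" and M N :: "complex^'d^'c"
  proof -
    have "mherm (B ** M) N = (\<Sum>a\<in>UNIV. \<Sum>b\<in>UNIV. \<Sum>k\<in>UNIV. cnj (B $ a $ k) * cnj (M $ k $ b) * N $ a $ b)"
      by (simp add: mherm_def matrix_matrix_mult_def sum_distrib_right)
    also have "\<dots> = (\<Sum>b\<in>UNIV. \<Sum>a\<in>UNIV. \<Sum>k\<in>UNIV. cnj (B $ a $ k) * cnj (M $ k $ b) * N $ a $ b)" by (rule sum.swap)
    also have "\<dots> = (\<Sum>b\<in>UNIV. \<Sum>k\<in>UNIV. \<Sum>a\<in>UNIV. cnj (B $ a $ k) * cnj (M $ k $ b) * N $ a $ b)" by (intro sum.cong refl sum.swap)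
    also have "\<dots> = (\<Sum>k\<in>UNIV. \<Sum>b\<in>UNIV. \<Sum>a\<in>UNIV. cnj (B $ a $ k) * cnj (M $ k $ b) * N $ a $ b)" by (rule sum.swap)
    also have "\<dots> = (\<Sum>k\<in>UNIV. \<Sum>b\<in>UNIV. \<Sum>a\<in>UNIV. - (cnj (M $ k $ b) * (cnj (B $ k $ a) * N $ a $ b)))"
      by (intro sum.cong refl) (subst skewD[OF that], simp)
    finally show ?thesis
      by (simp add: mherm_def matrix_matrix_mult_def conjm_def sum_distrib_left sum_negf)
  qed
  have 2: "mherm (M ** B) N = - mherm M (N ** conjm B)" if B: "skew B" for B :: "complex^'d^'d" and M N :: "complex^'d^'c"
  proof -
    have neg: "(- X) ** Y = - (X ** Y)" for X :: "complex^'d^'d" and Y :: "complex^'c^'d"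
      by (simp add: vec_eq_iff matrix_matrix_mult_def sum_negf)
    have t: "transpose (M ** B) = - (B ** transpose M)" 
      using B unfolding skew_def by (simp add: matrix_transpose_mul neg)
    have t': "transpose (N ** conjm B) = - (conjm B ** transpose N)"
      using skew_conjm[OF B] unfolding skew_def by (simp add: matrix_transpose_mul neg)
    have m: "mherm (- X) Y = - mherm X Y" for X Y :: "complex^'c^'d" by (simp add: mherm_def sum_negf)
    have "mherm (M ** B) N = mherm (transpose (M ** B)) (transpose N)" by (rule mherm_transpose[symmetric])
    also have "\<dots> = mherm (transpose M) (conjm B ** transpose N)" unfolding t m 1[OF B] by simp
    also have "\<dots> = - mherm (transpose M) (transpose (N ** conjm B))" unfolding t' by (simp add: mherm_linear)
    finally show ?thesis by (simp add: mherm_transpose)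
  qed
  show "skew B \<Longrightarrow> mherm (B ** M) N = - mherm M (conjm B ** N)" by (rule 1)
  show "skew C \<Longrightarrow> mherm (M ** C) N = - mherm M (N ** conjm C)" by (rule 2)
qed

text \<open>
  The tensor product of two real representations, with matrices as its elements: \<open>g\<close> acts by \<open>M \<mapsto> p g ** M ** (q g)\<^sup>T\<close>.
\<close>

locale tensor_rep = L: real_rep p P + R: real_rep q Q
  for p :: "real_mat8 \<Rightarrow> real^'a^'a" and P and q :: "real_mat8 \<Rightarrow> real^'b^'b" and Q
begin

definition tact :: "complex^7^7 \<Rightarrow> complex^'b^'a \<Rightarrow> complex^'b^'a" where
  "tact A M = complexify P A ** M - M ** complexify Q A"

lemma tact_facts:
  "tact A (M + N) = tact A M + tact A N" "tact A (mscale c M) = mscale c (tact A M)"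
  "tact (A + B) M = tact A M + tact B M" "tact (mscale c A) M = mscale c (tact A M)"
  "skew A \<Longrightarrow> skew B \<Longrightarrow> tact (bracket A B) M = tact A (tact B M) - tact B (tact A M)"
  "skew A \<Longrightarrow> mherm (tact A M) N = - mherm M (tact (conjm A) N)"
proof -
  note d = matrix_add_ldistrib matrix_add_rdistrib mscale_mult mscale_simps L.complexify_add R.complexify_add L.complexify_mscale R.complexify_mscale
  have diff: "X ** (Y - Z) = X ** Y - X ** Z" "(Y - Z) ** X' = Y ** X' - Z ** X'" 
    for X :: "complex^'e^'f" and Y Z :: "complex^'g^'e" and X' :: "complex^'h^'g"
    by (simp_all add: vec_eq_iff matrix_matrix_mult_def sum_subtractf algebra_simps)
  show "tact A (M + N) = tact A M + tact A N" "tact A (mscale c M) = mscale c (tact A M)"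
    "tact (A + B) M = tact A M + tact B M" "tact (mscale c A) M = mscale c (tact A M)"
    by (simp_all add: tact_def d)
  show "skew A \<Longrightarrow> skew B \<Longrightarrow> tact (bracket A B) M = tact A (tact B M) - tact B (tact A M)"
    by (simp add: tact_def L.complexify_bracket R.complexify_bracket) (simp add: bracket_def diff matrix_mul_assoc)
  have m: "mherm (X - Y) Z = mherm X Z - mherm Y Z" for X Y Z :: "complex^'b^'a"
    by (simp add: mherm_def sum_subtractf algebra_simps)
  show "skew A \<Longrightarrow> mherm (tact A M) N = - mherm M (tact (conjm A) N)"
    by (simp add: tact_def m mherm_linear mherm_skew L.skew_complexify R.skew_complexify L.complexify_conjm R.complexify_conjm)
qed

lemma cmat_mexp: "cmat (mexp A) = mexp (cmat A)" for A :: "real^'c^'c"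
proof -
  have bl: "bounded_linear (cmat :: real^'c^'c \<Rightarrow> _)"
    unfolding linear_conv_bounded_linear[symmetric] by (rule linearI) (simp_all add: vec_eq_iff complex_eq_iff)
  have "((\<lambda>t. cmat (mexp (t *\<^sub>R A))) has_vector_derivative cmat A ** cmat (mexp (t *\<^sub>R A))) (at t)" for t
    using bounded_linear.has_vector_derivative[OF bl mexp_has_vector_derivative] by (simp add: cmat_mult)
  from linear_ode_unique[OF this, of 1] show ?thesis by (simp add: cmat_simps)
qed

text \<open>
  Along an exponential both sides solve the same linear differential equation, and exponentials generate the group.
\<close>

lemma group_intertwining:
  fixes \<rho> :: "real_mat8 \<Rightarrow> complex^'n^'n"
  assumes rep: "spin7_rep \<rho>" and lin: "\<And>y z. \<iota> (y + z) = \<iota> y + \<iota> z" "\<And>c y. \<iota> (c *s y) = mscale c (\<iota> y)"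
    and int: "\<And>A y. skew A \<Longrightarrow> \<iota> (crep \<rho> A *v y) = tact A (\<iota> y)" and g: "g \<in> Spin7"
  shows "\<iota> (\<rho> g *v y) = cmat (p g) ** \<iota> y ** transpose (cmat (q g))"
proof -
  have "\<forall>y. \<iota> (\<rho> g *v y) = cmat (p g) ** \<iota> y ** transpose (cmat (q g))"
  proof (rule Spin7_exp_induct[OF g])
    show "\<forall>y. \<iota> (\<rho> (mat 1) *v y) = cmat (p (mat 1)) ** \<iota> y ** transpose (cmat (q (mat 1)))"
      by (simp add: rep_one[OF rep] L.one R.one cmat_simps transpose_mat)
    fix X g assume X: "X \<in> spin7" and g: "g \<in> Spin7" and IH: "\<forall>y. \<iota> (\<rho> g *v y) = cmat (p g) ** \<iota> y ** transpose (cmat (q g))"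
    obtain B where B: "skew B" "X = spin B" using spin7_is_spin[OF X] by blast
    have bl: "bounded_linear \<iota>" unfolding linear_conv_bounded_linear[symmetric]
    proof (rule linearI)
      fix r and y :: "complex^'n"
      have "r *\<^sub>R y = of_real r *s y" by (simp add: vec_eq_iff complex_eq_iff)
      thus "\<iota> (r *\<^sub>R y) = r *\<^sub>R \<iota> y" by (simp add: lin mscale_real)
    qed (rule lin)
    have step: "\<iota> (\<rho> (mexp X) *v y) = cmat (p (mexp X)) ** \<iota> y ** transpose (cmat (q (mexp X)))" for y
    proof -
      define D where "D = drep \<rho> X"
      have iD: "\<iota> (D *v z) = cmat (P B) ** \<iota> z - \<iota> z ** cmat (Q B)" for z
        using int[OF skew_cmat[OF B(1)], of z] by (simp add: D_def B(2) crep_cmat[OF rep] tact_def L.complexify_cmat R.complexify_cmat)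
      define E where "E t = mexp (t *\<^sub>R cmat (Q B))" for t
      define Y where "Y t = \<iota> (mexp (t *\<^sub>R D) *v y) ** E t" for t
      have "((\<lambda>t. mexp (t *\<^sub>R D) *v y) has_vector_derivative (D ** mexp (t *\<^sub>R D)) *v y) (at t)" for t
        by (rule bounded_linear.has_vector_derivative[OF bounded_bilinear.bounded_linear_left[OF bounded_bilinear_matrix_vector_mult] mexp_has_vector_derivative])
      from bounded_linear.has_vector_derivative[OF bl this]
      have d: "((\<lambda>t. \<iota> (mexp (t *\<^sub>R D) *v y)) has_vector_derivative \<iota> ((D ** mexp (t *\<^sub>R D)) *v y)) (at t)" for t .
      have "(Y has_vector_derivative cmat (P B) ** Y t) (at t)" for t
      proof -
        have "(Y has_vector_derivative \<iota> (mexp (t *\<^sub>R D) *v y) ** (cmat (Q B) ** E t) + \<iota> ((D ** mexp (t *\<^sub>R D)) *v y) ** E t) (at t)"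
          unfolding Y_def E_def by (intro has_vector_derivative_matrix_mult d mexp_has_vector_derivative)
        moreover have "(X - X') ** Z = X ** Z - X' ** Z" for X X' :: "complex^'b^'a" and Z :: "complex^'b^'b"
          by (simp add: vec_eq_iff matrix_matrix_mult_def sum_subtractf algebra_simps)
        ultimately show ?thesis
          by (simp add: iD Y_def matrix_mul_assoc flip: matrix_vector_mul_assoc)
      qed
      from linear_ode_unique[OF this, of 1] have "\<iota> (mexp D *v y) ** mexp (cmat (Q B)) = mexp (cmat (P B)) ** \<iota> y"
        by (simp add: Y_def E_def)
      hence "(\<iota> (mexp D *v y) ** mexp (cmat (Q B))) ** mexp (- cmat (Q B)) = mexp (cmat (P B)) ** \<iota> y ** mexp (- cmat (Q B))" by simp
      hence "\<iota> (mexp D *v y) = mexp (cmat (P B)) ** \<iota> y ** mexp (- cmat (Q B))"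
        by (simp only: mexp_minus matrix_mul_rid flip: matrix_mul_assoc)
      moreover have "mexp (- cmat (Q B)) = transpose (cmat (q (mexp X)))"
      proof -
        have "transpose (cmat (q (mexp X))) = cmat (transpose (mexp (Q B)))"
          by (simp add: B(2) R.exp[OF B(1)] cmat_simps)
        also have "transpose (mexp (Q B)) = mexp (- Q B)" using transpose_mexp_skew[OF R.skew[OF B(1)], of 1] by simp
        finally show ?thesis by (simp add: cmat_mexp cmat_simps)
      qed
      moreover have "mexp D = \<rho> (mexp X)" using drep_exp(1)[OF rep X, of 1] by (simp add: D_def)
      ultimately show ?thesis by (simp add: B(2) L.exp[OF B(1)] cmat_mexp)
    qed
    show "\<forall>y. \<iota> (\<rho> (mexp X ** g) *v y) = cmat (p (mexp X ** g)) ** \<iota> y ** transpose (cmat (q (mexp X ** g)))"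
    proof
      fix y
      have "\<iota> (\<rho> (mexp X ** g) *v y) = cmat (p (mexp X)) ** (cmat (p g) ** \<iota> y ** transpose (cmat (q g))) ** transpose (cmat (q (mexp X)))"
        using step[of "\<rho> g *v y"] IH by (simp add: rep_mult[OF rep mexp_spin7'[OF X] g] matrix_vector_mul_assoc)
      thus "\<iota> (\<rho> (mexp X ** g) *v y) = cmat (p (mexp X ** g)) ** \<iota> y ** transpose (cmat (q (mexp X ** g)))"
        by (simp add: L.mult[OF mexp_spin7'[OF X] g] R.mult[OF mexp_spin7'[OF X] g] cmat_mult matrix_transpose_mul matrix_mul_assoc)
    qed
  qed
  thus ?thesis by blast
qed

text \<open>
  An injective map that intertwines both the Lie algebra and the group and sends \<open>x\<close> to \<open>M\<close>.
\<close>

definition embeds :: "(real_mat8 \<Rightarrow> complex^'n^'n) \<Rightarrow> complex^'n \<Rightarrow> complex^'b^'a \<Rightarrow> (complex^'n \<Rightarrow> complex^'b^'a) \<Rightarrow> bool" where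
  "embeds \<rho> x M \<iota> \<longleftrightarrow> (\<forall>y z. \<iota> (y + z) = \<iota> y + \<iota> z) \<and> (\<forall>c y. \<iota> (c *s y) = mscale c (\<iota> y)) \<and> \<iota> x = M \<and>
     (\<forall>A y. skew A \<longrightarrow> \<iota> (crep \<rho> A *v y) = tact A (\<iota> y)) \<and> (\<forall>y. \<iota> y = 0 \<longrightarrow> y = 0) \<and>
     (\<forall>g y. g \<in> Spin7 \<longrightarrow> \<iota> (\<rho> g *v y) = cmat (p g) ** \<iota> y ** transpose (cmat (q g)))"

lemma embedsD:
  assumes "embeds \<rho> x M \<iota>"
  shows "\<iota> (y + z) = \<iota> y + \<iota> z" "\<iota> (c *s y) = mscale c (\<iota> y)" "\<iota> x = M"
    "skew A \<Longrightarrow> \<iota> (crep \<rho> A *v y) = tact A (\<iota> y)" "\<iota> y = 0 \<Longrightarrow> y = 0"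
    "g \<in> Spin7 \<Longrightarrow> \<iota> (\<rho> g *v y) = cmat (p g) ** \<iota> y ** transpose (cmat (q g))"
  using assms by (simp_all add: embeds_def)

lemma embedding:
  fixes \<rho> :: "real_mat8 \<Rightarrow> complex^'n^'n"
  assumes irr: "irreducible_spin7_rep \<rho>" and hw: "hwv (crep \<rho>) l x0"
    and M0: "M0 \<noteq> 0" "\<And>p q. height p + height q > 0 \<Longrightarrow> tact (wedge (nvec p) (nvec q)) M0 = 0"
      "\<And>p. tact (wedge (nvec p) (nvec (neg p))) M0 = mscale (nrm p * wvec l p) M0"
  shows "\<exists>\<iota>. embeds \<rho> x0 M0 \<iota>"
proof -
  interpret highest_weight_pair \<rho> l x0 tact M0
    by unfold_locales (simp_all add: irr hw tact_facts M0)
  obtain \<iota> where i: "\<And>y z. \<iota> (y + z) = \<iota> y + \<iota> z" "\<And>c y. \<iota> (c *s y) = mscale c (\<iota> y)" "\<iota> x0 = M0"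
    "\<And>A y. skew A \<Longrightarrow> \<iota> (crep \<rho> A *v y) = tact A (\<iota> y)" "\<And>y. \<iota> y = 0 \<Longrightarrow> y = 0"
    using embedding by blast
  show ?thesis
    using i group_intertwining[OF rep i(1,2,4)] unfolding embeds_def by blast
qed

end

text \<open>
  The vector, spin and trivial representations are the building blocks of the models.
\<close>

interpretation vector_rep: real_rep vecrep "\<lambda>L. L"
proof
  show "vecrep (mat 1) = mat 1" by (rule vecrep_one)
  show "vecrep (g ** h) = vecrep g ** vecrep h" if "g \<in> Spin7" "h \<in> Spin7" for g h by (rule vecrep_mult[OF that])
  fix L :: "real^7^7" assume L: "skew L"
  have s: "mexp (spin L) \<in> Spin7" by (rule mexp_spin7'[OF spin_in_spin7[OF L]])
  have "vecrep (mexp (spin L)) *v u = mexp L *v u" for u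
    using mexp_spin_covers[OF L, of 1] by (intro vecrep_eqI[OF s]) (simp add: covers_def)
  thus "vecrep (mexp (spin L)) = mexp L" by (simp add: matrix_eq)
qed auto

interpretation spin_rep: real_rep "\<lambda>g. g" spin
  by unfold_locales (auto simp: spin_add spin_scaleR spin_bracket skew_def transpose_spin spin_minus)

interpretation trivial_rep: real_rep "\<lambda>g. mat 1 :: real^'a^'a" "\<lambda>L. 0"
  by unfold_locales (auto simp: skew_def transpose_def vec_eq_iff bracket_def)

interpretation vec_triv: tensor_rep vecrep "\<lambda>L. L" "\<lambda>g. mat 1 :: real^1^1" "\<lambda>L. 0" ..
interpretation vec_vec: tensor_rep vecrep "\<lambda>L. L" vecrep "\<lambda>L. L" ..
interpretation vec_spin: tensor_rep vecrep "\<lambda>L. L" "\<lambda>g. g" spin ..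
interpretation triv_spin: tensor_rep "\<lambda>g. mat 1 :: real^1^1" "\<lambda>L. 0" "\<lambda>g. g" spin ..

lemma complexify_simps: "complexify (\<lambda>L. L) A = A" "complexify (\<lambda>L. 0) A = 0" "complexify spin A = spinC A"
  using complex_matrix_split[of A] by (simp_all add: complexify_def spinC_def vec_eq_iff)

definition outer :: "complex^'a \<Rightarrow> complex^'b \<Rightarrow> complex^'b^'a" where "outer u s = (\<chi> a b. u $ a * s $ b)"

lemma outer_mult: "A ** outer u s = outer (A *v u) s" "skew B \<Longrightarrow> outer u s ** B = - outer u (B *v s)"
proof -
  show "A ** outer u s = outer (A *v u) s"
    by (simp add: outer_def vec_eq_iff matrix_matrix_mult_def matrix_vector_mult_def sum_distrib_left sum_distrib_right mult_ac)
  assume B: "skew B"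
  have "(\<Sum>k\<in>UNIV. s $ k * B $ k $ b) = - (\<Sum>k\<in>UNIV. B $ b $ k * s $ k)" for b
    unfolding sum_negf[symmetric] by (intro sum.cong refl) (subst skewD[OF B], simp)
  thus "outer u s ** B = - outer u (B *v s)"
    by (simp add: outer_def vec_eq_iff matrix_matrix_mult_def matrix_vector_mult_def mult.assoc flip: sum_distrib_left)
qed

lemma outer_bilinear: "outer (c *s u) s = mscale c (outer u s)" "outer u (c *s s) = mscale c (outer u s)" "outer 0 s = 0" "outer u 0 = 0"
  "outer u (s + s') = outer u s + outer u s'"
  by (simp_all add: outer_def vec_eq_iff algebra_simps)

section \<open>The spin representation in the weight basis\<close>

lemma pack_scaleR_matrix: "(r *\<^sub>R M) *v x = r *\<^sub>R (M *v x)" for M :: "real^'n^'m"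
  by (simp add: vec_eq_iff matrix_vector_mult_def sum_distrib_left mult.assoc)

lemma vec7_exhaust: obtains x0 x1 x2 x3 x4 x5 x6 where "w = vec7 x0 x1 x2 x3 x4 x5 x6"
  using that[of "w$0" "w$1" "w$2" "w$3" "w$4" "w$5" "w$6"] by (simp add: vec_eq_7)

text \<open>
  In terms of \<open>\<real> \<oplus> \<real>\<^sup>7\<close> the action of spin(7) differs from the vector representation only through the contraction, which vanishes on g2.
\<close>

lemma spin_pack:
  assumes A: "skew A"
  shows "spin A *v pack f w = pack (1/4 * dot (contract A) w) (A *v w + (1/4) *s cross (contract A) w - (f/4) *s contract A)"
proof -
  obtain x0 x1 x2 x3 x4 x5 x6 where w: "w = vec7 x0 x1 x2 x3 x4 x5 x6" by (rule vec7_exhaust)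
  have sm: "(\<Sum>a\<in>S. g a) *v x = (\<Sum>a\<in>S. g a *v x)" for g :: "7 \<Rightarrow> real_mat8" and S x
    by (induction S rule: infinite_finite_induct) (simp_all add: matrix_vector_mult_add_rdistrib)
  have e: "spin A *v pack f w = (- (1/4)) *\<^sub>R (\<Sum>a\<in>UNIV. \<Sum>b\<in>UNIV. A $ a $ b *\<^sub>R (gb a *v (gb b *v pack f w)))"
    by (simp add: spin_def pack_scaleR_matrix sm matrix_vector_mul_assoc del: scaleR_minus_left)
  have sk: "A $ 1 $ 0 = - A $ 0 $ 1" "A $ 2 $ 0 = - A $ 0 $ 2" "A $ 3 $ 0 = - A $ 0 $ 3" "A $ 4 $ 0 = - A $ 0 $ 4" "A $ 5 $ 0 = - A $ 0 $ 5" "A $ 6 $ 0 = - A $ 0 $ 6"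
    "A $ 2 $ 1 = - A $ 1 $ 2" "A $ 3 $ 1 = - A $ 1 $ 3" "A $ 4 $ 1 = - A $ 1 $ 4" "A $ 5 $ 1 = - A $ 1 $ 5" "A $ 6 $ 1 = - A $ 1 $ 6"
    "A $ 3 $ 2 = - A $ 2 $ 3" "A $ 4 $ 2 = - A $ 2 $ 4" "A $ 5 $ 2 = - A $ 2 $ 5" "A $ 6 $ 2 = - A $ 2 $ 6"
    "A $ 4 $ 3 = - A $ 3 $ 4" "A $ 5 $ 3 = - A $ 3 $ 5" "A $ 6 $ 3 = - A $ 3 $ 6"
    "A $ 5 $ 4 = - A $ 4 $ 5" "A $ 6 $ 4 = - A $ 4 $ 6" "A $ 6 $ 5 = - A $ 5 $ 6"
    by (rule skewD[OF A])+
  have dg: "A $ a $ a = 0" for a using skewD[OF A, of a a] by simp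
  have sp: "(\<Sum>a\<in>S. pack (h a) (k a)) = pack (\<Sum>a\<in>S. h a) (\<Sum>a\<in>S. k a)" for h :: "7 \<Rightarrow> real" and k S
    by (simp add: vec8_eq)
  have q: "A $ a $ b *\<^sub>R (gb a *v (gb b *v pack f w)) = 
     pack (A $ a $ b * (- (f * dot (axis a 1) (axis b 1)) - dot (axis a 1) (cross (axis b 1) w)))
          (A $ a $ b *\<^sub>R (f *s cross (axis a 1) (axis b 1) + cross (axis a 1) (cross (axis b 1) w) - dot (axis b 1) w *s axis a 1))" for a b
    by (simp only: gamma_gamma_pack pack_scaleR) simp
  show ?thesis
    unfolding e q sp pack_scaleR pack_eq_iff
  proof
    show "(- (1/4)) *\<^sub>R (\<Sum>a\<in>UNIV. \<Sum>b\<in>UNIV. A $ a $ b * (- (f * dot (axis a 1) (axis b 1)) - dot (axis a 1) (cross (axis b 1) w))) = 1/4 * dot (contract A) w"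
      unfolding w by (simp add: sum_7 cross_nth axis7_nth dot_axis dot_7 contract_nth dg sk algebra_simps)
    show "(- (1/4)) *\<^sub>R (\<Sum>a\<in>UNIV. \<Sum>b\<in>UNIV. A $ a $ b *\<^sub>R (f *s cross (axis a 1) (axis b 1) + cross (axis a 1) (cross (axis b 1) w) - dot (axis b 1) w *s axis a 1))
       = A *v w + (1/4) *s cross (contract A) w - (f/4) *s contract A"
      unfolding w vec_eq_7
      by (simp add: sum_7 cross_nth axis7_nth dot_axis contract_nth matrix_vector_mult_def dg sk) (simp add: field_simps)
  qed
qed

lemma cmat_vector_split:
  "cmat M *v z = (\<chi> x. Complex ((M *v (\<chi> y. Re (z $ y))) $ x) ((M *v (\<chi> y. Im (z $ y))) $ x))"
  by (simp add: vec_eq_iff matrix_vector_mult_def complex_eq_iff)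

lemma spinC_pack:
  assumes A: "skew A"
  shows "spinC A *v pack f w = pack (1/4 * dot (contract A) w) (A *v w + (1/4) *s cross (contract A) w - (f/4) *s contract A)"
proof -
  have p: "(\<chi> y. Re (pack f w $ y)) = pack (Re f) (\<chi> y. Re (w $ y))" "(\<chi> y. Im (pack f w $ y)) = pack (Im f) (\<chi> y. Im (w $ y))"
    by (simp_all add: vec8_eq)
  have cA: "cmat (spin B) *v pack f w = pack (1/4 * dot (contract (cmat B)) w) (cmat B *v w + (1/4) *s cross (contract (cmat B)) w - (f/4) *s contract (cmat B))"
    if "skew B" for B
    unfolding cmat_vector_split[of "spin B"] p spin_pack[OF that]
    by (simp add: vec8_eq all_7 complex_eq_iff dot_7 contract_nth cross_nth matrix_vector_mult_def sum_7)
  define B where "B = cmat (Rem A)"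
  define C where "C = cmat (Imm A)"
  have eA: "A = B + mscale \<i> C" unfolding B_def C_def by (rule complex_matrix_split)
  have "spinC A *v pack f w = cmat (spin (Rem A)) *v pack f w + \<i> *s (cmat (spin (Imm A)) *v pack f w)"
    by (simp add: spinC_def cmatrix_vector)
  also have "\<dots> = pack (1/4 * dot (contract A) w) (A *v w + (1/4) *s cross (contract A) w - (f/4) *s contract A)"
    unfolding cA[OF skew_Re_Im(1)[OF A]] cA[OF skew_Re_Im(2)[OF A]] B_def[symmetric] C_def[symmetric] pack_smult pack_add pack_eq_iff
    unfolding eA by (simp add: contract_linear contract_mscale cross_bilinear dot_bilinear cmatrix_vector vec_eq_iff algebra_simps)
  finally show ?thesis .
qed

text \<open>
  The highest weight spinor: it is annihilated by \<open>gamma\<close> of the three vectors of positive weight.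
\<close>

definition shw :: "complex^(7 option)" where "shw = pack 1 (- nvec N0)"

lemma shw_weight:
  "height p + height q > 0 \<Longrightarrow> spinC (wedge (nvec p) (nvec q)) *v shw = 0"
  "spinC (wedge (nvec p) (nvec (neg p))) *v shw = (if p = N0 then 0 else if height p > 0 then 1 else - 1) *s shw"
proof -
  have z: "(0 :: complex^(7 option)) = pack 0 0" by (simp add: vec8_eq)
  have e: "spinC (wedge u v) *v pack f w = pack (1/2 * dot (cross u v) w) (wedge u v *v w + (1/2) *s cross (cross u v) w - (f/2) *s cross u v)"
    for u v w f by (simp add: spinC_pack[OF skew_wedge] contract_wedge cross_bilinear dot_bilinear vector_smult_assoc)
  show "height p + height q > 0 \<Longrightarrow> spinC (wedge (nvec p) (nvec q)) *v shw = 0"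
    unfolding shw_def z e wedge_vector cross_nvec cross_bilinear dot_bilinear dot_nvec pack_eq_iff
    by (cases p; cases q) (simp_all add: vec_eq_7)
  show "spinC (wedge (nvec p) (nvec (neg p))) *v shw = (if p = N0 then 0 else if height p > 0 then 1 else - 1) *s shw"
    unfolding shw_def e wedge_vector cross_nvec cross_bilinear dot_bilinear dot_nvec pack_smult pack_eq_iff
    by (cases p) (simp_all add: vec_eq_7)
qed

lemma shw_Z: "spinC (Ymat M3) *v (spinC (Ymat M3) *v shw) = 0"
  unfolding shw_def spinC_pack[OF skew_Ymat] contract_Ymat
  by (simp add: dot_bilinear cross_bilinear Ymat_nvec cmatrix_vector vec8_eq del: Ymat.simps nvec.simps)

lemma skew_spinC: "skew A \<Longrightarrow> skew (spinC A)"
  using spin_rep.skew_complexify[of A] by (simp add: complexify_simps)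

section \<open>Explicit G2-equivariant maps\<close>

lemma outer_minus: "outer (- u) s = - outer u s" "outer u (- s) = - outer u s"
  by (simp_all add: outer_def vec_eq_iff)

text \<open>
  The contraction is a sum over an orthonormal frame of cross products, and both are preserved by G2.
\<close>

lemma contract_conj_G2:
  assumes g: "g \<in> G2"
  shows "contract (cmat (vecrep g) ** M ** transpose (cmat (vecrep g))) = cmat (vecrep g) *v contract M"
proof -
  define G where "G = cmat (vecrep g)"
  have gs: "g \<in> Spin7" using g by (simp add: G2_def)
  have GG: "G ** transpose G = mat 1" "transpose G ** G = mat 1" using cmat_vecrep_orthogonal[OF gs] by (simp_all add: G_def)
  have "contract (G ** M ** transpose G) $ c = (G *v contract M) $ c" for c
  proof -
    interpret B: bilinear_form "\<lambda>u v. cross ((G ** M ** transpose G) *v u) v $ c"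
      by unfold_locales (simp_all add: cross_bilinear cmatrix_vector)
    interpret B': bilinear_form "\<lambda>u v. (G *v cross (M *v u) v) $ c"
      by unfold_locales (simp_all add: cross_bilinear cmatrix_vector)
    have "(G ** M ** transpose G) *v (G *v u) = G *v (M *v u)" for u
    proof -
      have "(G ** M ** transpose G) *v (G *v u) = G *v (M *v ((transpose G ** G) *v u))"
        by (simp only: matrix_vector_mul_assoc matrix_mul_assoc)
      thus ?thesis by (simp add: GG)
    qed
    hence e: "cross ((G ** M ** transpose G) *v (G *v u)) (G *v v) $ c = (G *v cross (M *v u) v) $ c" for u v
      by (simp add: G_def G2_cross_complex[OF g])
    have "contract (G ** M ** transpose G) $ c = (\<Sum>b\<in>UNIV. (G *v cross (M *v axis b 1) (axis b 1)) $ c)"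
      unfolding contract_cross B.weight_sum[symmetric] B.orthogonal_invariant[OF GG(1), symmetric] e B'.weight_sum ..
    also have "\<dots> = (G *v (\<Sum>b\<in>UNIV. cross (M *v axis b 1) (axis b 1))) $ c" by (simp add: sum_mv)
    also have "(\<Sum>b\<in>UNIV. cross (M *v axis b 1) (axis b 1)) = contract M" by (simp add: vec_eq_iff contract_cross)
    finally show ?thesis .
  qed
  thus ?thesis by (simp add: vec_eq_iff G_def)
qed

context dirac_setting begin

text \<open>
  An element of the space of equivariant maps is the same as an equivariant family of trilinear forms. Only its vector component is taken nonzero here.
\<close>

lemma theta_hom:
  assumes sk: "\<And>y u. skew (F y u)"
    and lin: "\<And>y z u. F (y + z) u = F y u + F z u" "\<And>c y u. F (c *s y) u = mscale c (F y u)"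
      "\<And>y u v. F y (u + v) = F y u + F y v" "\<And>c y u. F y (c *s u) = mscale c (F y u)"
    and eqv: "\<And>g y u. g \<in> G2 \<Longrightarrow> F (\<rho> g *v y) (cmat (vecrep g) *v u) = cmat (vecrep g) ** F y u ** transpose (cmat (vecrep g))"
  defines "\<eta> \<equiv> \<lambda>y. (0, \<chi> a. spinC (F y (cv (i a))))"
  shows "\<eta> \<in> hom_G2 I \<rho>" "c0 (\<eta> y) p q = 0" "c1 i (\<eta> y) u p q = dot p (F y u *v q)"
proof -
  have tw: "\<eta> y \<in> twisted_spinors" for y
    unfolding \<eta>_def twisted_spinors_iff spin7_complex_eq
    using sk spin7_complex_closed(3) by (auto simp: spin7_complex_eq)
  show C0: "c0 (\<eta> y) p q = 0" for y p q by (simp add: \<eta>_def c0_def vecC_0 cmatrix_vector dot_bilinear)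
  show C1: "c1 i (\<eta> y) u p q = dot p (F y u *v q)" for y u p q
  proof -
    have z: "F y 0 = 0" using lin(4)[of y 0 0] by (simp add: mscale_simps)
    have s: "F y (\<Sum>a\<in>S. f a) = (\<Sum>a\<in>S. F y (f a))" for S :: "7 set" and f
      by (induction S rule: infinite_finite_induct) (simp_all add: lin z)
    have "F y u = (\<Sum>a\<in>UNIV. mscale (dot u (cv (i a))) (F y (cv (i a))))"
      using s[of "\<lambda>a. dot u (cv (i a)) *s cv (i a)" UNIV] by (simp add: complete lin)
    hence "dot p (F y u *v q) = (\<Sum>a\<in>UNIV. dot u (cv (i a)) * dot p (F y (cv (i a)) *v q))"
      by (simp add: sum_mv cmatrix_vector dot_sum dot_bilinear)
    thus ?thesis by (simp add: \<eta>_def c1_def vecC_spinC[OF sk])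
  qed
  have sC: "spinC (A + B) = spinC A + spinC B" "spinC (mscale c A) = mscale c (spinC A)" for A B c
    by (rule spinC_add, rule spinC_mscale)
  have "\<eta> (\<rho> g *v y) = twisted_act I g (\<eta> y)" if g: "g \<in> G2" for g y
  proof (rule tw_eqI[OF tw c_act(1)[OF g tw]])
    define T where "T = transpose (cmat (vecrep g))"
    have gs: "g \<in> Spin7" using g by (simp add: G2_def)
    show "c0 (\<eta> (\<rho> g *v y)) p q = c0 (twisted_act I g (\<eta> y)) p q" for p q
      by (simp add: c_act(2)[OF g tw] C0)
    show "c1 i (\<eta> (\<rho> g *v y)) u p q = c1 i (twisted_act I g (\<eta> y)) u p q" for u p q
    proof -
      have "u = cmat (vecrep g) *v (T *v u)"
        unfolding T_def by (simp only: matrix_vector_mul_assoc cmat_vecrep_orthogonal[OF gs] matrix_vector_mul_lid)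
      hence "F (\<rho> g *v y) u = cmat (vecrep g) ** F y (T *v u) ** T"
        using eqv[OF g, of y "T *v u"] by (simp add: T_def)
      moreover have "dot p ((cmat (vecrep g) ** X ** T) *v q) = dot (T *v p) (X *v (T *v q))" for X
      proof -
        have "dot p ((cmat (vecrep g) ** X ** T) *v q) = dot (cmat (vecrep g) *v (X *v (T *v q))) p"
          by (simp only: dot_commute[of p] matrix_vector_mul_assoc matrix_mul_assoc)
        also have "\<dots> = dot (X *v (T *v q)) (T *v p)" unfolding T_def by (rule dot_transpose)
        also have "\<dots> = dot (T *v p) (X *v (T *v q))" by (rule dot_commute)
        finally show ?thesis .
      qed
      ultimately show ?thesis unfolding c_act(3)[OF g tw] C1 T_def[symmetric] by simp
    qed
  qed
  moreover have "\<eta> (y + z) = \<eta> y + \<eta> z" "\<eta> (c *s y) = tscale c (\<eta> y)" for y z c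
    by (simp_all add: \<eta>_def lin sC tscale_def vec_eq_iff mscale_simps)
  ultimately show "\<eta> \<in> hom_G2 I \<rho>" using tw unfolding hom_G2_def linear_tscale_iff by auto
qed

text \<open>
  The map \<open>\<real>\<^sup>7 \<rightarrow> \<real>\<^sup>7 \<otimes> \<Lambda>\<^sup>2\<close> sending \<open>v\<close> to the family \<open>u \<mapsto> u \<and> v\<close> is equivariant, so any equivariant vector gives an equivariant map.
\<close>

lemma vector_hom:
  assumes lin: "\<And>y z. v (y + z) = v y + v z" "\<And>c y. v (c *s y) = c *s v y"
    and eqv: "\<And>g y. g \<in> G2 \<Longrightarrow> v (\<rho> g *v y) = cmat (vecrep g) *v v y"
  shows "\<exists>\<eta>\<in>hom_G2 I \<rho>. \<forall>y. (\<forall>p q. c0 (\<eta> y) p q = 0) \<and> (\<forall>u p q. c1 i (\<eta> y) u p q = dot p (wedge u (v y) *v q))"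
  using theta_hom[of "\<lambda>y u. wedge u (v y)"]
  by (auto simp: skew_wedge lin wedge_bilinear eqv wedge_conj intro!: bexI)

text \<open>
  Similarly an equivariant 7 by 7 matrix \<open>N\<close> gives the family of skew parts of \<open>N\<close> times a cross product matrix. It is used for highest weights without an
  equivariant vector.
\<close>

lemma matrix_hom:
  assumes lin: "\<And>y z. N (y + z) = N y + N z" "\<And>c y. N (c *s y) = mscale c (N y)"
    and eqv: "\<And>g y. g \<in> G2 \<Longrightarrow> N (\<rho> g *v y) = cmat (vecrep g) ** N y ** transpose (cmat (vecrep g))"
  shows "\<exists>\<eta>\<in>hom_G2 I \<rho>. \<forall>y. (\<forall>p q. c0 (\<eta> y) p q = 0) \<and>
     (\<forall>u p q. c1 i (\<eta> y) u p q = dot p ((N y ** crossmat u + crossmat u ** transpose (N y)) *v q))"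
proof -
  define F where "F y u = N y ** crossmat u + crossmat u ** transpose (N y)" for y u
  have sk: "skew (F y u)" for y u
  proof -
    have n: "(- X) ** Y = - (X ** Y)" "Y ** (- X) = - (Y ** X)" for X Y :: "complex^7^7"
      by (simp_all add: vec_eq_iff matrix_matrix_mult_def sum_negf)
    have "transpose (crossmat u) = - crossmat u" using skew_crossmat[of u] by (simp add: skew_def)
    moreover have "transpose (X + Y) = transpose X + transpose Y" for X Y :: "complex^7^7" by (simp add: transpose_def vec_eq_iff)
    ultimately show ?thesis by (simp add: F_def skew_def matrix_transpose_mul n)
  qed
  have t: "transpose (X + Y) = transpose X + transpose Y" "transpose (mscale c X) = mscale c (transpose X)" for X Y :: "complex^7^7" and c
    by (simp_all add: transpose_def vec_eq_iff)
  have e: "F (\<rho> g *v y) (cmat (vecrep g) *v u) = cmat (vecrep g) ** F y u ** transpose (cmat (vecrep g))" if g: "g \<in> G2" for g y u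
  proof -
    define G where "G = cmat (vecrep g)"
    have gs: "g \<in> Spin7" using g by (simp add: G2_def)
    have c: "transpose G ** (G ** X) = X" for X :: "complex^7^7"
      unfolding G_def by (simp only: matrix_mul_assoc cmat_vecrep_orthogonal[OF gs] matrix_mul_lid)
    show ?thesis unfolding F_def eqv[OF g] crossmat_G2[OF g]
      unfolding G_def[symmetric]
      by (simp add: matrix_transpose_mul matrix_add_ldistrib matrix_add_rdistrib c flip: matrix_mul_assoc)
  qed
  have "(\<lambda>y. (0, \<chi> a. spinC (F y (cv (i a))))) \<in> hom_G2 I \<rho> \<and> (\<forall>y. (\<forall>p q. c0 (0, \<chi> a. spinC (F y (cv (i a)))) p q = 0) \<and>
     (\<forall>u p q. c1 i (0, \<chi> a. spinC (F y (cv (i a)))) u p q = dot p (F y u *v q)))"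
  proof -
    have cs: "crossmat (c *s u) = mscale c (crossmat u)" for c u by (simp add: vec_eq_iff crossmat_smult)
    have "F (y + z) u = F y u + F z u" "F (c *s y) u = mscale c (F y u)" "F y (u + v) = F y u + F y v" "F y (c *s u) = mscale c (F y u)" for y z u v c
      by (simp_all add: F_def lin t crossmat_add cs mscale_mult mscale_simps matrix_add_ldistrib matrix_add_rdistrib)
    from theta_hom[of F, OF sk this e] show ?thesis by blast
  qed
  thus ?thesis by (intro bexI[where x = "\<lambda>y. (0, \<chi> a. spinC (F y (cv (i a))))"]) (auto simp: F_def)
qed

abbreviation theta_vector :: "(complex^'n \<Rightarrow> twisted) \<Rightarrow> complex^'n \<Rightarrow> complex^7 \<Rightarrow> bool" where
  "theta_vector \<eta> x v \<equiv> \<eta> \<in> hom_G2 I \<rho> \<and> (\<forall>p q. c0 (\<eta> x) p q = 0) \<and> (\<forall>u p q. c1 i (\<eta> x) u p q = dot p (wedge u v *v q))"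

abbreviation theta_matrix :: "(complex^'n \<Rightarrow> twisted) \<Rightarrow> complex^'n \<Rightarrow> complex^7^7 \<Rightarrow> bool" where
  "theta_matrix \<eta> x N \<equiv> \<eta> \<in> hom_G2 I \<rho> \<and> (\<forall>p q. c0 (\<eta> x) p q = 0) \<and>
     (\<forall>u p q. c1 i (\<eta> x) u p q = dot p ((N ** crossmat u + crossmat u ** transpose N) *v q))"

lemma G2_column: "g \<in> G2 \<Longrightarrow> transpose (cmat g) *v axis None 1 = axis None 1"
proof -
  assume "g \<in> G2"
  from G2_transpose[OF this] have e: "transpose g *v axis None 1 = axis None 1" by (simp add: G2_def)
  have "transpose (cmat g) *v axis None 1 = cmat (transpose g) *v (\<chi> x. of_real (axis None 1 $ x))"
    by (simp add: cmat_simps axis_def if_distrib[of of_real] vec_eq_iff cong: if_cong)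
  also have "\<dots> = (\<chi> x. of_real ((transpose g *v axis None 1) $ x))"
    by (simp add: vec_eq_iff matrix_vector_mult_def)
  also have "\<dots> = axis None 1" unfolding e by (simp add: axis_def vec_eq_iff)
  finally show ?thesis .
qed

lemma G2_spinor: "g \<in> G2 \<Longrightarrow> cmat g *v pack f w = pack f (cmat (vecrep g) *v w)"
proof -
  assume g: "g \<in> G2"
  have p: "(\<chi> y. Re (pack f w $ y)) = pack (Re f) (\<chi> y. Re (w $ y))" "(\<chi> y. Im (pack f w $ y)) = pack (Im f) (\<chi> y. Im (w $ y))"
    by (simp_all add: vec8_eq)
  show ?thesis unfolding cmat_vector_split p vecrep_G2_cross(2)[OF g] by (simp add: vec8_eq)
qed

lemma outer_nonzero: "u \<noteq> 0 \<Longrightarrow> s \<noteq> 0 \<Longrightarrow> outer u s \<noteq> 0"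
  by (auto simp: outer_def vec_eq_iff)

lemma nvec_nonzero: "nvec p \<noteq> 0" by (cases p) (simp_all add: vec_eq_7)

lemma shw_nonzero: "shw \<noteq> 0" by (simp add: shw_def vec8_eq)

lemma wedge_nvec_vector: "wedge (nvec p) (nvec q) *v nvec r =
    (if r = neg q then nrm q else 0) *s nvec p - (if r = neg p then nrm p else 0) *s nvec q"
  unfolding wedge_vector dot_nvec ..

context
  fixes l x assumes irr: "irreducible_spin7_rep \<rho>" and hw: "hwv (crep \<rho>) l x"
begin

text \<open>
  The model is the vector representation itself.
\<close>

lemma model_100:
  assumes l: "l $ 1 = 1" "l $ 2 = 0" "l $ 3 = 0"
  shows "crep \<rho> (Ymat M3) *v x = 0" "\<exists>\<eta>. theta_vector \<eta> x (nvec P1)"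
proof -
  define one :: "complex^1" where "one = (\<chi> _. 1)"
  have t: "vec_triv.tact A (outer u one) = outer (A *v u) one" for A u
    by (simp add: vec_triv.tact_def complexify_simps outer_mult)
  have "\<exists>\<iota>. vec_triv.embeds \<rho> x (outer (nvec P1) one) \<iota>"
  proof (rule vec_triv.embedding[OF irr hw])
    show "outer (nvec P1) one \<noteq> 0" by (rule outer_nonzero[OF nvec_nonzero]) (simp add: one_def vec_eq_iff)
    show "vec_triv.tact (wedge (nvec p) (nvec q)) (outer (nvec P1) one) = 0" if "height p + height q > 0" for p q
      using that unfolding t wedge_nvec_vector by (cases p; cases q; simp add: outer_bilinear del: nvec.simps)
    show "vec_triv.tact (wedge (nvec p) (nvec (neg p))) (outer (nvec P1) one) = mscale (nrm p * wvec l p) (outer (nvec P1) one)" for p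
      unfolding t wedge_nvec_vector by (cases p; simp add: l outer_bilinear outer_minus mscale_simps del: nvec.simps)
  qed
  then obtain \<iota> where "vec_triv.embeds \<rho> x (outer (nvec P1) one) \<iota>" by blast
  note \<iota> = vec_triv.embedsD[OF this]
  show "crep \<rho> (Ymat M3) *v x = 0"
    by (rule \<iota>(5)) (simp add: \<iota>(3,4) skew_Ymat t Ymat_nvec outer_bilinear del: Ymat.simps nvec.simps)
  have "\<exists>\<eta>\<in>hom_G2 I \<rho>. \<forall>y. (\<forall>p q. c0 (\<eta> y) p q = 0) \<and> (\<forall>u p q. c1 i (\<eta> y) u p q = dot p (wedge u (\<iota> y *v one) *v q))"
  proof (rule vector_hom)
    fix g y assume "g \<in> G2"
    thus "\<iota> (\<rho> g *v y) *v one = cmat (vecrep g) *v (\<iota> y *v one)"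
      by (simp add: G2_def \<iota>(6) cmat_simps transpose_mat matrix_vector_mul_assoc)
  qed (simp_all add: \<iota> cmatrix_vector)
  moreover have "\<iota> x *v one = nvec P1"
    unfolding \<iota>(3) by (simp add: outer_def one_def matrix_vector_mult_def vec_eq_iff del: nvec.simps)
  ultimately show "\<exists>\<eta>. theta_vector \<eta> x (nvec P1)" by metis
qed

text \<open>
  The model is the spin representation; restricted to G2 it splits as \<open>\<real> \<oplus> \<real>\<^sup>7\<close>, and the vector is the second component.
\<close>

lemma model_001:
  assumes l: "l $ 1 = 1/2" "l $ 2 = 1/2" "l $ 3 = 1/2"
  shows "crep \<rho> (Ymat M3) *v (crep \<rho> (Ymat M3) *v x) = 0" "\<exists>\<eta>. theta_vector \<eta> x (- nvec N0)"
proof -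
  define one :: "complex^1" where "one = (\<chi> _. 1)"
  have t: "triv_spin.tact A (outer one s) = outer one (spinC A *v s)" if "skew A" for A s
    by (simp add: triv_spin.tact_def complexify_simps outer_mult skew_spinC[OF that] outer_bilinear)
  have "\<exists>\<iota>. triv_spin.embeds \<rho> x (outer one shw) \<iota>"
  proof (rule triv_spin.embedding[OF irr hw])
    show "outer one shw \<noteq> 0" by (rule outer_nonzero[OF _ shw_nonzero]) (simp add: one_def vec_eq_iff)
    show "triv_spin.tact (wedge (nvec p) (nvec q)) (outer one shw) = 0" if "height p + height q > 0" for p q
      using shw_weight(1)[OF that] by (simp add: t skew_wedge outer_bilinear)
    show "triv_spin.tact (wedge (nvec p) (nvec (neg p))) (outer one shw) = mscale (nrm p * wvec l p) (outer one shw)" for p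
      unfolding t[OF skew_wedge] shw_weight(2) by (cases p; simp add: l outer_bilinear outer_minus mscale_simps del: nvec.simps)
  qed
  then obtain \<iota> where "triv_spin.embeds \<rho> x (outer one shw) \<iota>" by blast
  note \<iota> = triv_spin.embedsD[OF this]
  show "crep \<rho> (Ymat M3) *v (crep \<rho> (Ymat M3) *v x) = 0"
    by (rule \<iota>(5)) (simp add: \<iota>(3,4) skew_Ymat t shw_Z outer_bilinear del: Ymat.simps nvec.simps)
  define v where "v y = (\<chi> a. \<iota> y $ 1 $ Some a)" for y
  have "\<exists>\<eta>\<in>hom_G2 I \<rho>. \<forall>y. (\<forall>p q. c0 (\<eta> y) p q = 0) \<and> (\<forall>u p q. c1 i (\<eta> y) u p q = dot p (wedge u (v y) *v q))"
  proof (rule vector_hom)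
    fix g y assume g: "g \<in> G2"
    hence gs: "g \<in> Spin7" by (simp add: G2_def)
    have "\<iota> (\<rho> g *v y) $ 1 = cmat g *v (\<iota> y $ 1)"
      by (simp add: \<iota>(6)[OF gs] cmat_simps) (simp add: vec_eq_iff matrix_matrix_mult_def transpose_def matrix_vector_mult_def mult.commute)
    also have "\<iota> y $ 1 = pack (\<iota> y $ 1 $ None) (v y)" by (simp add: v_def vec8_eq)
    finally show "v (\<rho> g *v y) = cmat (vecrep g) *v v y"
      unfolding G2_spinor[OF g] by (simp add: v_def vec_eq_iff)
  qed (simp_all add: v_def \<iota> vec_eq_iff)
  moreover have "v x = - nvec N0"
    unfolding v_def \<iota>(3) by (simp add: outer_def one_def shw_def vec_eq_iff del: nvec.simps)
  ultimately show "\<exists>\<eta>. theta_vector \<eta> x (- nvec N0)" by metis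
qed

text \<open>
  The model is generated by \<open>n\<^sub>1 \<otimes> s\<close> in the product of the vector and spin representations, with \<open>s\<close> the highest weight spinor. Contraction with the G2-invariant spinor gives
  the vector. The element \<open>Ymat M3\<close> acts nilpotently of order two because the third Dynkin label is 1.
\<close>

lemma model_101:
  assumes l: "l $ 1 = 3/2" "l $ 2 = 1/2" "l $ 3 = 1/2"
  shows "crep \<rho> (Ymat M3) *v (crep \<rho> (Ymat M3) *v x) = 0" "\<exists>\<eta>. theta_vector \<eta> x (nvec P1)"
proof -
  have t: "vec_spin.tact A (outer u s) = outer (A *v u) s + outer u (spinC A *v s)" if "skew A" for A u s
    by (simp add: vec_spin.tact_def complexify_simps outer_mult skew_spinC[OF that])
  have "\<exists>\<iota>. vec_spin.embeds \<rho> x (outer (nvec P1) shw) \<iota>"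
  proof (rule vec_spin.embedding[OF irr hw])
    show "outer (nvec P1) shw \<noteq> 0" by (rule outer_nonzero[OF nvec_nonzero shw_nonzero])
    show "vec_spin.tact (wedge (nvec p) (nvec q)) (outer (nvec P1) shw) = 0" if "height p + height q > 0" for p q
      using that unfolding t[OF skew_wedge] shw_weight(1)[OF that] wedge_nvec_vector
      by (cases p; cases q; simp add: outer_bilinear del: nvec.simps)
    show "vec_spin.tact (wedge (nvec p) (nvec (neg p))) (outer (nvec P1) shw) = mscale (nrm p * wvec l p) (outer (nvec P1) shw)" for p
      unfolding t[OF skew_wedge] shw_weight(2) wedge_nvec_vector
      by (cases p; simp add: l outer_bilinear outer_minus vec_eq_iff algebra_simps del: nvec.simps)
  qed
  then obtain \<iota> where "vec_spin.embeds \<rho> x (outer (nvec P1) shw) \<iota>" by blast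
  note \<iota> = vec_spin.embedsD[OF this]
  show "crep \<rho> (Ymat M3) *v (crep \<rho> (Ymat M3) *v x) = 0"
    by (rule \<iota>(5)) (simp add: \<iota>(3,4) skew_Ymat t shw_Z Ymat_nvec outer_bilinear del: Ymat.simps nvec.simps)
  have "\<exists>\<eta>\<in>hom_G2 I \<rho>. \<forall>y. (\<forall>p q. c0 (\<eta> y) p q = 0) \<and> (\<forall>u p q. c1 i (\<eta> y) u p q = dot p (wedge u (\<iota> y *v axis None 1) *v q))"
  proof (rule vector_hom)
    fix g y assume g: "g \<in> G2"
    hence gs: "g \<in> Spin7" by (simp add: G2_def)
    have "\<iota> (\<rho> g *v y) *v axis None 1 = cmat (vecrep g) *v (\<iota> y *v (transpose (cmat g) *v axis None 1))"
      by (simp only: \<iota>(6)[OF gs] matrix_vector_mul_assoc matrix_mul_assoc)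
    thus "\<iota> (\<rho> g *v y) *v axis None 1 = cmat (vecrep g) *v (\<iota> y *v axis None 1)" unfolding G2_column[OF g] .
  qed (simp_all add: \<iota> cmatrix_vector)
  moreover have "\<iota> x *v axis None 1 = nvec P1"
    unfolding \<iota>(3) by (simp add: outer_def shw_def vec_eq_iff mv_axis del: nvec.simps)
  ultimately show "\<exists>\<eta>. theta_vector \<eta> x (nvec P1)" by metis
qed

lemma vec_vec_wedge: "skew A \<Longrightarrow> vec_vec.tact A (wedge u v) = wedge (A *v u) v + wedge u (A *v v)"
  by (simp add: vec_vec.tact_def complexify_simps bracket_wedge[symmetric] bracket_def)

text \<open>
  The adjoint representation, as skew matrices; the contraction gives the vector.
\<close>

lemma model_010:
  assumes l: "l $ 1 = 1" "l $ 2 = 1" "l $ 3 = 0"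
  shows "crep \<rho> (Ymat M3) *v x = 0" "\<exists>\<eta>. theta_vector \<eta> x (2 *s cross (nvec P1) (nvec P2))"
proof -
  have "\<exists>\<iota>. vec_vec.embeds \<rho> x (wedge (nvec P1) (nvec P2)) \<iota>"
  proof (rule vec_vec.embedding[OF irr hw])
    have "wedge (nvec P1) (nvec P2) $ 1 $ 2 \<noteq> 0" by (simp add: wedge_def)
    thus "wedge (nvec P1) (nvec P2) \<noteq> 0" by force
    show "vec_vec.tact (wedge (nvec p) (nvec q)) (wedge (nvec P1) (nvec P2)) = 0" if "height p + height q > 0" for p q
      using that unfolding vec_vec_wedge[OF skew_wedge] wedge_nvec_vector
      by (cases p; cases q; simp add: wedge_bilinear wedge_self mscale_simps del: nvec.simps)
    show "vec_vec.tact (wedge (nvec p) (nvec (neg p))) (wedge (nvec P1) (nvec P2)) = mscale (nrm p * wvec l p) (wedge (nvec P1) (nvec P2))" for p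
      unfolding vec_vec_wedge[OF skew_wedge] wedge_nvec_vector
      by (cases p; simp add: l wedge_bilinear wedge_self mscale_simps del: nvec.simps)
  qed
  then obtain \<iota> where "vec_vec.embeds \<rho> x (wedge (nvec P1) (nvec P2)) \<iota>" by blast
  note \<iota> = vec_vec.embedsD[OF this]
  show "crep \<rho> (Ymat M3) *v x = 0"
    by (rule \<iota>(5)) (simp add: \<iota>(3,4) skew_Ymat vec_vec_wedge Ymat_nvec wedge_bilinear del: Ymat.simps nvec.simps)
  have "\<exists>\<eta>\<in>hom_G2 I \<rho>. \<forall>y. (\<forall>p q. c0 (\<eta> y) p q = 0) \<and> (\<forall>u p q. c1 i (\<eta> y) u p q = dot p (wedge u (contract (\<iota> y)) *v q))"
  proof (rule vector_hom)
    fix g y assume g: "g \<in> G2"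
    show "contract (\<iota> (\<rho> g *v y)) = cmat (vecrep g) *v contract (\<iota> y)"
      using g contract_conj_G2[OF g, of "\<iota> y"] by (simp add: G2_def \<iota>(6))
  qed (simp_all add: \<iota> contract_linear contract_mscale)
  moreover have "contract (\<iota> x) = 2 *s cross (nvec P1) (nvec P2)" unfolding \<iota>(3) by (rule contract_wedge)
  ultimately show "\<exists>\<eta>. theta_vector \<eta> x (2 *s cross (nvec P1) (nvec P2))" by metis
qed

text \<open>
  The trivial representation is generated by the identity matrix.
\<close>

lemma model_000:
  assumes l: "l $ 1 = 0" "l $ 2 = 0" "l $ 3 = 0"
  shows "crep \<rho> (Ymat M3) *v x = 0" "\<exists>\<eta>. theta_matrix \<eta> x (mat 1)"
proof -
  have t: "vec_vec.tact A (mat 1) = 0" for A by (simp add: vec_vec.tact_def complexify_simps)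
  have w: "wvec l p = 0" for p by (cases p) (simp_all add: l)
  have "\<exists>\<iota>. vec_vec.embeds \<rho> x (mat 1) \<iota>"
  proof (rule vec_vec.embedding[OF irr hw])
    have "(mat 1 :: complex^7^7) $ 0 $ 0 = 1" by (simp add: mat_def)
    thus "(mat 1 :: complex^7^7) \<noteq> 0" by force
  qed (auto simp: t w mscale_simps)
  then obtain \<iota> where "vec_vec.embeds \<rho> x (mat 1) \<iota>" by blast
  note \<iota> = vec_vec.embedsD[OF this]
  show "crep \<rho> (Ymat M3) *v x = 0" by (rule \<iota>(5)) (simp add: \<iota>(3,4) skew_Ymat t del: Ymat.simps nvec.simps)
  have "\<exists>\<eta>\<in>hom_G2 I \<rho>. \<forall>y. (\<forall>p q. c0 (\<eta> y) p q = 0) \<and>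
     (\<forall>u p q. c1 i (\<eta> y) u p q = dot p ((\<iota> y ** crossmat u + crossmat u ** transpose (\<iota> y)) *v q))"
    by (rule matrix_hom) (simp_all add: \<iota> G2_def)
  thus "\<exists>\<eta>. theta_matrix \<eta> x (mat 1)" by (metis \<iota>(3))
qed

text \<open>
  The symmetric square of the vector representation is generated by \<open>n\<^sub>1 \<otimes> n\<^sub>1\<close>.
\<close>

lemma model_200:
  assumes l: "l $ 1 = 2" "l $ 2 = 0" "l $ 3 = 0"
  shows "crep \<rho> (Ymat M3) *v x = 0" "\<exists>\<eta>. theta_matrix \<eta> x (outer (nvec P1) (nvec P1))"
proof -
  have t: "vec_vec.tact A (outer u s) = outer (A *v u) s + outer u (A *v s)" if "skew A" for A u s
    by (simp add: vec_vec.tact_def complexify_simps outer_mult that)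
  have "\<exists>\<iota>. vec_vec.embeds \<rho> x (outer (nvec P1) (nvec P1)) \<iota>"
  proof (rule vec_vec.embedding[OF irr hw])
    show "outer (nvec P1) (nvec P1) \<noteq> 0" by (rule outer_nonzero[OF nvec_nonzero nvec_nonzero])
    show "vec_vec.tact (wedge (nvec p) (nvec q)) (outer (nvec P1) (nvec P1)) = 0" if "height p + height q > 0" for p q
      using that unfolding t[OF skew_wedge] wedge_nvec_vector
      by (cases p; cases q; simp add: outer_bilinear del: nvec.simps)
    show "vec_vec.tact (wedge (nvec p) (nvec (neg p))) (outer (nvec P1) (nvec P1)) = mscale (nrm p * wvec l p) (outer (nvec P1) (nvec P1))" for p
      unfolding t[OF skew_wedge] wedge_nvec_vector
      by (cases p; simp add: l outer_bilinear outer_minus vec_eq_iff algebra_simps del: nvec.simps)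
  qed
  then obtain \<iota> where "vec_vec.embeds \<rho> x (outer (nvec P1) (nvec P1)) \<iota>" by blast
  note \<iota> = vec_vec.embedsD[OF this]
  show "crep \<rho> (Ymat M3) *v x = 0"
    by (rule \<iota>(5)) (simp add: \<iota>(3,4) skew_Ymat t Ymat_nvec outer_bilinear del: Ymat.simps nvec.simps)
  have "\<exists>\<eta>\<in>hom_G2 I \<rho>. \<forall>y. (\<forall>p q. c0 (\<eta> y) p q = 0) \<and>
     (\<forall>u p q. c1 i (\<eta> y) u p q = dot p ((\<iota> y ** crossmat u + crossmat u ** transpose (\<iota> y)) *v q))"
    by (rule matrix_hom) (simp_all add: \<iota> G2_def)
  thus "\<exists>\<eta>. theta_matrix \<eta> x (outer (nvec P1) (nvec P1))" by (metis \<iota>(3))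
qed

end

end

section \<open>Reduction to finite arrays\<close>

text \<open>
  The derivation action on arrays of the operator sending \<open>n\<^sub>p\<close> to \<open>c p n\<^bsub>t p\<^esub>\<close>; \<open>lie0\<close> is for the function component and \<open>lie1\<close> for the vector component.
\<close>

definition lie0 :: "(wt \<Rightarrow> complex) \<Rightarrow> (wt \<Rightarrow> wt) \<Rightarrow> (wt \<Rightarrow> wt \<Rightarrow> complex) \<Rightarrow> wt \<Rightarrow> wt \<Rightarrow> complex" where
  "lie0 c t W p q = c p * W (t p) q + c q * W p (t q)"

definition lie1 :: "(wt \<Rightarrow> complex) \<Rightarrow> (wt \<Rightarrow> wt) \<Rightarrow> (wt \<Rightarrow> wt \<Rightarrow> wt \<Rightarrow> complex) \<Rightarrow> wt \<Rightarrow> wt \<Rightarrow> wt \<Rightarrow> complex" where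
  "lie1 c t W r p q = c r * W (t r) p q + c p * W r (t p) q + c q * W r p (t q)"

text \<open>
  The effect of \<open>n\<^sub>s\<close>, as an element of \<open>\<mm>\<close>, on an array at a highest weight vector. For the zero weight it is the scalar computed from \<open>h\<close>, the sum of the
  three coordinates of the highest weight.
\<close>

definition jact0 :: "complex \<Rightarrow> (wt \<Rightarrow> wt \<Rightarrow> complex) \<Rightarrow> wt \<Rightarrow> wt \<Rightarrow> wt \<Rightarrow> complex" where
  "jact0 h W s p q = - (2/3) * (if s = N0 then h * W p q else lie0 (ymc s) (ymt s) W p q)"

definition jact1 :: "complex \<Rightarrow> (wt \<Rightarrow> wt \<Rightarrow> wt \<Rightarrow> complex) \<Rightarrow> wt \<Rightarrow> wt \<Rightarrow> wt \<Rightarrow> wt \<Rightarrow> complex" where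
  "jact1 h W s r p q = - (2/3) * (if s = N0 then h * W r p q else lie1 (ymc s) (ymt s) W r p q)"

text \<open>
  The Dirac operator on arrays: \<open>D0\<close> is its function component and \<open>D1\<close> its vector component.
\<close>

definition D0 :: "complex \<Rightarrow> (wt \<Rightarrow> wt \<Rightarrow> complex) \<Rightarrow> (wt \<Rightarrow> wt \<Rightarrow> wt \<Rightarrow> complex) \<Rightarrow> wt \<Rightarrow> wt \<Rightarrow> complex" where
  "D0 h W0 W1 p q = - (\<Sum>s\<in>UNIV. inverse (nrm s) * jact1 h W1 s (neg s) p q) - 7/2 * W0 p q"

definition D1 :: "complex \<Rightarrow> (wt \<Rightarrow> wt \<Rightarrow> complex) \<Rightarrow> (wt \<Rightarrow> wt \<Rightarrow> wt \<Rightarrow> complex) \<Rightarrow> wt \<Rightarrow> wt \<Rightarrow> wt \<Rightarrow> complex" where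
  "D1 h W0 W1 r p q = jact0 h W0 r p q + (\<Sum>s\<in>UNIV. inverse (nrm s) * (crc r (neg s) * jact1 h W1 s (crt r (neg s)) p q)) + 1/2 * W1 r p q"

text \<open>
  The linear conditions satisfied by the components, at a highest weight vector, of an equivariant map: antisymmetry in the last two indices, the weights \<open>-a\<close> and \<open>-b\<close>
  under the Cartan subalgebra of su(3), and annihilation by its raising operators.
\<close>

locale weight_array =
  fixes W0 :: "wt \<Rightarrow> wt \<Rightarrow> complex" and W1 :: "wt \<Rightarrow> wt \<Rightarrow> wt \<Rightarrow> complex" and a b :: complex
  assumes skew0: "W0 q p = - W0 p q" and skew1: "W1 r q p = - W1 r p q"
    and H0: "(h12 p + h12 q + a) * W0 p q = 0" "(h23 p + h23 q + b) * W0 p q = 0"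
    and H1: "(h12 r + h12 p + h12 q + a) * W1 r p q = 0" "(h23 r + h23 p + h23 q + b) * W1 r p q = 0"
    and E12_0: "lie0 e12c e12t W0 p q = 0" and E23_0: "lie0 e23c e23t W0 p q = 0"
    and E12_1: "lie1 e12c e12t W1 r p q = 0" and E23_1: "lie1 e23c e23t W1 r p q = 0"
begin

lemma diagonal: "W0 p p = 0" "W1 r p p = 0"
  using skew0[of p p] skew1[of r p p] by simp_all

lemmas sk = diagonal
  skew0[of P1 N0] skew1[of _ P1 N0]
  skew0[of P2 N0] skew1[of _ P2 N0]
  skew0[of P3 N0] skew1[of _ P3 N0]
  skew0[of M1 N0] skew1[of _ M1 N0]
  skew0[of M2 N0] skew1[of _ M2 N0]
  skew0[of M3 N0] skew1[of _ M3 N0]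
  skew0[of P2 P1] skew1[of _ P2 P1]
  skew0[of P3 P1] skew1[of _ P3 P1]
  skew0[of M1 P1] skew1[of _ M1 P1]
  skew0[of M2 P1] skew1[of _ M2 P1]
  skew0[of M3 P1] skew1[of _ M3 P1]
  skew0[of P3 P2] skew1[of _ P3 P2]
  skew0[of M1 P2] skew1[of _ M1 P2]
  skew0[of M2 P2] skew1[of _ M2 P2]
  skew0[of M3 P2] skew1[of _ M3 P2]
  skew0[of M1 P3] skew1[of _ M1 P3]
  skew0[of M2 P3] skew1[of _ M2 P3]
  skew0[of M3 P3] skew1[of _ M3 P3]
  skew0[of M2 M1] skew1[of _ M2 M1]
  skew0[of M3 M1] skew1[of _ M3 M1]
  skew0[of M3 M2] skew1[of _ M3 M2]

end

context dirac_setting begin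

definition A0 :: "complex^'n \<Rightarrow> (complex^'n \<Rightarrow> twisted) \<Rightarrow> wt \<Rightarrow> wt \<Rightarrow> complex" where
  "A0 x \<eta> p q = c0 (\<eta> x) (nvec p) (nvec q)"

definition A1 :: "complex^'n \<Rightarrow> (complex^'n \<Rightarrow> twisted) \<Rightarrow> wt \<Rightarrow> wt \<Rightarrow> wt \<Rightarrow> complex" where
  "A1 x \<eta> r p q = c1 i (\<eta> x) (nvec r) (nvec p) (nvec q)"

lemma array_linear: 
  "A0 x (\<lambda>y. \<eta> y + tscale k (\<zeta> y)) p q = A0 x \<eta> p q + k * A0 x \<zeta> p q"
  "A1 x (\<lambda>y. \<eta> y + tscale k (\<zeta> y)) r p q = A1 x \<eta> r p q + k * A1 x \<zeta> r p q"
  by (simp_all add: A0_def A1_def c0_linear c1_linear)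

lemma array_equivariance:
  assumes \<eta>: "\<eta> \<in> hom_G2 I \<rho>" and L: "skew L" "contract L = 0" and ct: "\<And>r. L *v nvec r = c r *s nvec (t r)"
  shows "A0 (crep \<rho> L *v x) \<eta> p q = - lie0 c t (A0 x \<eta>) p q"
    "A1 (crep \<rho> L *v x) \<eta> r p q = - lie1 c t (A1 x \<eta>) r p q"
proof -
  note lin = hom_linear(3)[OF \<eta>]
  have sc0: "c0 w (k *s y) z = k * c0 w y z" "c0 w y (k *s z) = k * c0 w y z" for w k y z
    by (simp_all add: c0_def dot_bilinear cmatrix_vector)
  have sc1: "c1 i w (k *s u) y z = k * c1 i w u y z" "c1 i w u (k *s y) z = k * c1 i w u y z" "c1 i w u y (k *s z) = k * c1 i w u y z" for w k u y z
    by (simp_all add: c1_def dot_bilinear cmatrix_vector sum_distrib_left mult_ac)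
  show "A0 (crep \<rho> L *v x) \<eta> p q = - lie0 c t (A0 x \<eta>) p q"
    "A1 (crep \<rho> L *v x) \<eta> r p q = - lie1 c t (A1 x \<eta>) r p q"
    by (simp_all add: A0_def A1_def equivariance[OF \<eta> L] ct sc0 sc1 lie0_def lie1_def)
qed

lemma array_scale:
  assumes \<eta>: "\<eta> \<in> hom_G2 I \<rho>"
  shows "A0 (k *s x) \<eta> p q = k * A0 x \<eta> p q" "A1 (k *s x) \<eta> r p q = k * A1 x \<eta> r p q"
    "A0 0 \<eta> p q = 0" "A1 0 \<eta> r p q = 0"
proof -
  show s: "A0 (k *s x) \<eta> p q = k * A0 x \<eta> p q" "A1 (k *s x) \<eta> r p q = k * A1 x \<eta> r p q" for k x
    by (simp_all add: A0_def A1_def hom_linear[OF \<eta>] c0_linear c1_linear)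
  show "A0 0 \<eta> p q = 0" "A1 0 \<eta> r p q = 0" using s[of 0 0] by simp_all
qed

context
  fixes l x assumes irr: "irreducible_spin7_rep \<rho>" and hw: "hwv (crep \<rho>) l x"
begin

text \<open>
  Each condition is an element of g2 acting on the highest weight vector in a known way, moved to the values by equivariance.
\<close>

lemma highest_weight_array:
  assumes \<eta>: "\<eta> \<in> hom_G2 I \<rho>"
  shows "weight_array (A0 x \<eta>) (A1 x \<eta>) (of_real (l $ 1 - l $ 2)) (of_real (l $ 2 - l $ 3))"
proof -
  have e: "crep \<rho> gE12 *v x = 0" "crep \<rho> gE23 *v x = 0"
    unfolding gE12_def gE23_def by (rule hwvD(2)[OF hw], simp)+
  have dif: "crep \<rho> (mscale (1/2) (wedge (nvec p) (nvec (neg p))) - mscale (1/2) (wedge (nvec q) (nvec (neg q)))) *v x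
     = (1/2 * (nrm p * wvec l p) - 1/2 * (nrm q * wvec l q)) *s x" for p q
    by (simp add: crep_diff[OF rep] crep_mscale[OF rep] skew_mscale skew_wedge matrix_vector_mult_diff_rdistrib cmatrix_vector
        hwvD(3)[OF hw] vector_smult_assoc vec.scale_left_diff_distrib)
  have h: "crep \<rho> gH12 *v x = of_real (l $ 1 - l $ 2) *s x" "crep \<rho> gH23 *v x = of_real (l $ 2 - l $ 3) *s x"
    using dif[of P1 P2] dif[of P2 P3] by (simp_all add: gH12_def gH23_def del: nvec.simps)
  note ae = array_equivariance[OF \<eta> skew_g(1) contract_g(1) g_nvec(1), of x, unfolded e array_scale(3,4)[OF \<eta>]]
    array_equivariance[OF \<eta> skew_g(2) contract_g(2) g_nvec(2), of x, unfolded e array_scale(3,4)[OF \<eta>]]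
    array_equivariance[OF \<eta> skew_g(3) contract_g(3) g_nvec(3), of x, unfolded h array_scale(1,2)[OF \<eta>]]
    array_equivariance[OF \<eta> skew_g(4) contract_g(4) g_nvec(4), of x, unfolded h array_scale(1,2)[OF \<eta>]]
  show ?thesis
  proof
    note lin = hom_linear(3)[OF \<eta>]
    show "A0 x \<eta> q p = - A0 x \<eta> p q" "A1 x \<eta> r q p = - A1 x \<eta> r p q" for r p q
      unfolding A0_def A1_def by (rule c_skew[OF lin])+
    show "lie0 e12c e12t (A0 x \<eta>) p q = 0" "lie0 e23c e23t (A0 x \<eta>) p q = 0" 
      "lie1 e12c e12t (A1 x \<eta>) r p q = 0" "lie1 e23c e23t (A1 x \<eta>) r p q = 0" for r p q
      using ae(1)[of p q] ae(2)[of r p q] ae(3)[of p q] ae(4)[of r p q] by simp_all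
    show "(h12 p + h12 q + of_real (l $ 1 - l $ 2)) * A0 x \<eta> p q = 0" for p q
      using ae(5)[of p q] by (simp only: lie0_def distrib_right) simp
    show "(h23 p + h23 q + of_real (l $ 2 - l $ 3)) * A0 x \<eta> p q = 0" for p q
      using ae(7)[of p q] by (simp only: lie0_def distrib_right) simp
    show "(h12 r + h12 p + h12 q + of_real (l $ 1 - l $ 2)) * A1 x \<eta> r p q = 0" for r p q
      using ae(6)[of r p q] by (simp only: lie1_def distrib_right) simp
    show "(h23 r + h23 p + h23 q + of_real (l $ 2 - l $ 3)) * A1 x \<eta> r p q = 0" for r p q
      using ae(8)[of r p q] by (simp only: lie1_def distrib_right) simp
  qed
qed

lemma dirac_array:
  assumes \<eta>: "\<eta> \<in> hom_G2 I \<rho>"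
  defines "h \<equiv> of_real (l $ 1 + l $ 2 + l $ 3)"
  shows "A0 x (dirac 0 I \<rho> \<eta>) = D0 h (A0 x \<eta>) (A1 x \<eta>)" "A1 x (dirac 0 I \<rho> \<eta>) = D1 h (A0 x \<eta>) (A1 x \<eta>)"
proof -
  have RJx: "RJ (nvec s) *v x = (if s = N0 then (- (2/3) * h) *s x else (2/3) *s (crep \<rho> (Ymat s) *v x))" for s
    unfolding RJ_def crep_mscale[OF rep skew_crossmat] cmatrix_vector hwv_crossmat[OF rep hw]
    by (simp add: h_def vector_smult_assoc del: of_real_add)
  have j0: "c0 (\<eta> (RJ (nvec s) *v x)) (nvec p) (nvec q) = jact0 h (A0 x \<eta>) s p q" for s p q
    using array_equivariance(1)[OF \<eta> skew_Ymat contract_Ymat Ymat_nvec, of s x p q]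
    unfolding A0_def[of _ \<eta>, symmetric] RJx jact0_def
    by (cases "s = N0") (simp_all only: refl if_True if_False array_scale[OF \<eta>], simp_all)
  have j1: "c1 i (\<eta> (RJ (nvec s) *v x)) (nvec r) (nvec p) (nvec q) = jact1 h (A1 x \<eta>) s r p q" for s r p q
    using array_equivariance(2)[OF \<eta> skew_Ymat contract_Ymat Ymat_nvec, of s x r p q]
    unfolding A1_def[of _ \<eta>, symmetric] RJx jact1_def
    by (cases "s = N0") (simp_all only: refl if_True if_False array_scale[OF \<eta>], simp_all)
  have sc: "c1 i w (k *s u) y z = k * c1 i w u y z" for w k u y z
    by (simp add: c1_def dot_bilinear sum_distrib_left mult_ac)
  show "A0 x (dirac 0 I \<rho> \<eta>) = D0 h (A0 x \<eta>) (A1 x \<eta>)"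
    by (intro ext) (simp only: A0_def[of x "dirac 0 I \<rho> \<eta>"] dirac_c[OF \<eta>] D0_def j1, simp only: A0_def)
  show "A1 x (dirac 0 I \<rho> \<eta>) = D1 h (A0 x \<eta>) (A1 x \<eta>)"
    by (intro ext) (simp only: A1_def[of x "dirac 0 I \<rho> \<eta>"] dirac_c[OF \<eta>] D1_def j0 j1 cross_nvec sc, simp only: A1_def)
qed

text \<open>
  The element \<open>Ymat M3\<close> acts on the highest weight vector like the negative simple root vector of the short root, whose power of exponent \<open>c + 1\<close> is zero for
  the third Dynkin label \<open>c\<close>. For \<open>c \<le> 1\<close> this is the remaining condition that cuts out the true space of equivariant maps.
\<close>

lemma lowering_array:
  assumes \<eta>: "\<eta> \<in> hom_G2 I \<rho>"
  shows "crep \<rho> (Ymat M3) *v x = 0 \<Longrightarrow> lie0 (ymc M3) (ymt M3) (A0 x \<eta>) p q = 0"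
    "crep \<rho> (Ymat M3) *v x = 0 \<Longrightarrow> lie1 (ymc M3) (ymt M3) (A1 x \<eta>) r p q = 0"
    "crep \<rho> (Ymat M3) *v (crep \<rho> (Ymat M3) *v x) = 0 \<Longrightarrow> lie0 (ymc M3) (ymt M3) (lie0 (ymc M3) (ymt M3) (A0 x \<eta>)) p q = 0"
    "crep \<rho> (Ymat M3) *v (crep \<rho> (Ymat M3) *v x) = 0 \<Longrightarrow> lie1 (ymc M3) (ymt M3) (lie1 (ymc M3) (ymt M3) (A1 x \<eta>)) r p q = 0"
proof -
  define Z where "Z = crep \<rho> (Ymat M3)"
  note e = array_equivariance[OF \<eta> skew_Ymat contract_Ymat Ymat_nvec, of M3, folded Z_def]
  have f: "A0 (Z *v y) \<eta> = (\<lambda>p q. - lie0 (ymc M3) (ymt M3) (A0 y \<eta>) p q)" "A1 (Z *v y) \<eta> = (\<lambda>r p q. - lie1 (ymc M3) (ymt M3) (A1 y \<eta>) r p q)" for y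
    by (intro ext e)+
  have n: "lie0 c t (\<lambda>p q. - W p q) p q = - lie0 c t W p q" "lie1 c t (\<lambda>r p q. - V r p q) r p q = - lie1 c t V r p q" for c t W V r p q
    by (simp_all add: lie0_def lie1_def)
  show "crep \<rho> (Ymat M3) *v x = 0 \<Longrightarrow> lie0 (ymc M3) (ymt M3) (A0 x \<eta>) p q = 0"
    "crep \<rho> (Ymat M3) *v x = 0 \<Longrightarrow> lie1 (ymc M3) (ymt M3) (A1 x \<eta>) r p q = 0"
    using e[of x] unfolding Z_def[symmetric] by (metis array_scale(3,4)[OF \<eta>] neg_equal_0_iff_equal)+
  assume "crep \<rho> (Ymat M3) *v (crep \<rho> (Ymat M3) *v x) = 0"
  hence z: "Z *v (Z *v x) = 0" by (simp add: Z_def)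
  show "lie0 (ymc M3) (ymt M3) (lie0 (ymc M3) (ymt M3) (A0 x \<eta>)) p q = 0" 
    using e(1)[of "Z *v x" p q] unfolding z array_scale(3)[OF \<eta>] f n by simp
  show "lie1 (ymc M3) (ymt M3) (lie1 (ymc M3) (ymt M3) (A1 x \<eta>)) r p q = 0"
    using e(2)[of "Z *v x" r p q] unfolding z array_scale(4)[OF \<eta>] f n by simp
qed

lemma array_determines:
  assumes \<eta>: "\<eta> \<in> hom_G2 I \<rho>" and z: "\<And>p q. A0 x \<eta> p q = 0" "\<And>r p q. A1 x \<eta> r p q = 0"
  shows "\<eta> y = 0"
proof (rule hom_determined[OF irr hw \<eta>], rule tw_eqI[OF hom_linear(3)[OF \<eta>] twisted_spinors_closed(3)])
  have nz: "\<forall>p. F (nvec p) = 0 \<Longrightarrow> (\<And>v v'. F (v + v') = F v + F v') \<Longrightarrow> (\<And>c v. F (c *s v) = c * F v) \<Longrightarrow> F v = 0" for F :: "complex^7 \<Rightarrow> complex" and v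
  proof -
    assume F: "\<forall>p. F (nvec p) = 0" "\<And>v v'. F (v + v') = F v + F v'" "\<And>c v. F (c *s v) = c * F v"
    have "F 0 = 0" using F(3)[of 0 0] by simp
    hence "F (\<Sum>p\<in>S. g p) = (\<Sum>p\<in>S. F (g p))" for S :: "wt set" and g
      by (induction S rule: infinite_finite_induct) (simp_all add: F(2))
    thus "F v = 0" using F(1) by (subst expand_nvec) (simp add: F(3))
  qed
  have b0: "c0 w (y + y') z = c0 w y z + c0 w y' z" "c0 w (k *s y) z = k * c0 w y z" 
    "c0 w y (z + z') = c0 w y z + c0 w y z'" "c0 w y (k *s z) = k * c0 w y z" for w k y y' z z'
    by (simp_all add: c0_def dot_bilinear cmatrix_vector)
  have b1: "c1 i w (u + u') y z = c1 i w u y z + c1 i w u' y z" "c1 i w (k *s u) y z = k * c1 i w u y z"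
    "c1 i w u (y + y') z = c1 i w u y z + c1 i w u y' z" "c1 i w u (k *s y) z = k * c1 i w u y z"
    "c1 i w u y (z + z') = c1 i w u y z + c1 i w u y z'" "c1 i w u y (k *s z) = k * c1 i w u y z" for w k u u' y y' z z'
    by (simp_all add: c1_def dot_bilinear cmatrix_vector sum_distrib_left sum.distrib algebra_simps)
  have "c0 (\<eta> x) y (nvec q) = 0" for y q
    by (rule nz) (use z(1) in \<open>simp_all add: A0_def b0\<close>)
  hence "c0 (\<eta> x) y z = 0" for y z by (intro nz[of "\<lambda>z. c0 (\<eta> x) y z"]) (simp_all add: b0)
  thus "c0 (\<eta> x) y z = c0 0 y z" for y z by (simp add: c0_zero)
  have "c1 i (\<eta> x) u (nvec p) (nvec q) = 0" for u p q
    by (rule nz) (use z(2) in \<open>simp_all add: A1_def b1\<close>)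
  hence "c1 i (\<eta> x) u y (nvec q) = 0" for u y q by (intro nz[of "\<lambda>y. c1 i (\<eta> x) u y (nvec q)"]) (simp_all add: b1)
  hence "c1 i (\<eta> x) u y z = 0" for u y z by (intro nz[of "\<lambda>z. c1 i (\<eta> x) u y z"]) (simp_all add: b1)
  thus "c1 i (\<eta> x) u y z = c1 i 0 u y z" for u y z by (simp add: c1_zero)
qed

end

lemma hom_combination:
  assumes "\<eta> \<in> hom_G2 I \<rho>" "\<zeta> \<in> hom_G2 I \<rho>"
  shows "(\<lambda>x. \<eta> x + tscale k (\<zeta> x)) \<in> hom_G2 I \<rho>"
proof -
  note l = hom_linear[OF assms(1)] hom_linear[OF assms(2)]
  have "\<eta> (\<rho> g *v x) + tscale k (\<zeta> (\<rho> g *v x)) = twisted_act I g (\<eta> x + tscale k (\<zeta> x))" if g: "g \<in> G2" for g x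
    by (rule tw_eqI) (simp_all add: l g c_act twisted_spinors_closed c0_linear c1_linear)
  thus ?thesis
    unfolding hom_G2_def linear_tscale_iff using l
    by (auto simp: tscale_simps twisted_spinors_closed mult.commute)
qed

text \<open>
  Linear functionals that are eigenvectors of the transpose of \<open>D\<close> and jointly separate points diagonalise \<open>D\<close>, as soon as each of their eigenvalues occurs. It occurs
  when the functional is nonzero on some \<open>\<theta>\<close>: the product of \<open>D - \<nu>\<close> over the other eigenvalues projects \<open>\<theta>\<close> to an eigenvector.
\<close>

lemma spectrum:
  fixes ps :: "(complex \<times> ((complex^'n \<Rightarrow> twisted) \<Rightarrow> complex)) list"
  assumes lin: "\<And>\<mu> L \<eta> \<zeta> k. (\<mu>, L) \<in> set ps \<Longrightarrow> L (\<lambda>x. \<eta> x + tscale k (\<zeta> x)) = L \<eta> + k * L \<zeta>"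
    and eig: "\<And>\<mu> L \<eta>. (\<mu>, L) \<in> set ps \<Longrightarrow> \<eta> \<in> hom_G2 I \<rho> \<Longrightarrow> L (dirac 0 I \<rho> \<eta>) = \<mu> * L \<eta>"
    and inj: "\<And>\<eta> x. \<eta> \<in> hom_G2 I \<rho> \<Longrightarrow> \<forall>(\<mu>, L)\<in>set ps. L \<eta> = 0 \<Longrightarrow> \<eta> x = 0"
    and ex: "\<theta> \<in> hom_G2 I \<rho>" "\<And>\<mu> L. (\<mu>, L) \<in> set ps \<Longrightarrow> L \<theta> \<noteq> 0"
  shows "dirac_eigenvalues 0 I \<rho> = fst ` set ps"
proof
  show "dirac_eigenvalues 0 I \<rho> \<subseteq> fst ` set ps"
  proof
    fix \<nu> assume "\<nu> \<in> dirac_eigenvalues 0 I \<rho>"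
    then obtain \<eta> x where \<eta>: "\<eta> \<in> hom_G2 I \<rho>" "\<eta> x \<noteq> 0" "\<And>x. dirac 0 I \<rho> \<eta> x = tscale \<nu> (\<eta> x)"
      unfolding dirac_eigenvalues_def by blast
    from inj[OF \<eta>(1), of x] \<eta>(2) obtain \<mu> L where L: "(\<mu>, L) \<in> set ps" "L \<eta> \<noteq> 0" by blast
    have "dirac 0 I \<rho> \<eta> = (\<lambda>x. \<eta> x + tscale (\<nu> - 1) (\<eta> x))"
    proof
      fix x
      have "\<eta> x + tscale (\<nu> - 1) (\<eta> x) = tscale 1 (\<eta> x) + tscale (\<nu> - 1) (\<eta> x)" by (simp only: tscale_simps)
      also have "\<dots> = tscale \<nu> (\<eta> x)" by (simp flip: tscale_simps(2))
      finally show "dirac 0 I \<rho> \<eta> x = \<eta> x + tscale (\<nu> - 1) (\<eta> x)" by (simp add: \<eta>(3))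
    qed
    hence "L (dirac 0 I \<rho> \<eta>) = \<nu> * L \<eta>" by (simp add: lin[OF L(1)] algebra_simps)
    hence "\<nu> = \<mu>" using eig[OF L(1) \<eta>(1)] L(2) by simp
    thus "\<nu> \<in> fst ` set ps" using L(1) by force
  qed
  show "fst ` set ps \<subseteq> dirac_eigenvalues 0 I \<rho>"
  proof
    fix \<mu> assume "\<mu> \<in> fst ` set ps"
    then obtain M where M: "(\<mu>, M) \<in> set ps" by auto
    (* \<zeta> is the product of the operators D - \<nu> over the entries \<nu> of N, applied to \<theta>. *)
    have "\<exists>\<zeta>\<in>hom_G2 I \<rho>. \<forall>(\<kappa>, L)\<in>set ps. L \<zeta> = (\<Prod>\<nu>\<leftarrow>N. \<kappa> - \<nu>) * L \<theta>" for N
    proof (induction N)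
      case Nil show ?case using ex(1) by auto
    next
      case (Cons \<nu> N)
      then obtain \<zeta> where \<zeta>: "\<zeta> \<in> hom_G2 I \<rho>" "\<And>\<kappa> L. (\<kappa>, L) \<in> set ps \<Longrightarrow> L \<zeta> = (\<Prod>\<nu>\<leftarrow>N. \<kappa> - \<nu>) * L \<theta>" by blast
      show ?case
      proof (intro bexI ballI)
        show "(\<lambda>x. dirac 0 I \<rho> \<zeta> x + tscale (- \<nu>) (\<zeta> x)) \<in> hom_G2 I \<rho>" by (intro hom_combination dirac_hom \<zeta>)
        show "case p of (\<kappa>, L) \<Rightarrow> L (\<lambda>x. dirac 0 I \<rho> \<zeta> x + tscale (- \<nu>) (\<zeta> x)) = (\<Prod>\<nu>\<leftarrow>\<nu> # N. \<kappa> - \<nu>) * L \<theta>" if pp: "p \<in> set ps" for p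
        proof -
          obtain \<kappa> L where p: "p = (\<kappa>, L)" by force
          note L = pp[unfolded p]
          show ?thesis unfolding p prod.case lin[OF L] eig[OF L \<zeta>(1)] \<zeta>(2)[OF L] by (simp add: algebra_simps)
        qed
      qed
    qed
    from this[of "filter (\<lambda>\<nu>. \<nu> \<noteq> \<mu>) (map fst ps)"] obtain \<zeta> where \<zeta>: "\<zeta> \<in> hom_G2 I \<rho>"
      "\<And>\<kappa> L. (\<kappa>, L) \<in> set ps \<Longrightarrow> L \<zeta> = (\<Prod>\<nu>\<leftarrow>filter (\<lambda>\<nu>. \<nu> \<noteq> \<mu>) (map fst ps). \<kappa> - \<nu>) * L \<theta>" by blast
    have z: "L \<zeta> = 0" if "(\<kappa>, L) \<in> set ps" "\<kappa> \<noteq> \<mu>" for \<kappa> L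
    proof -
      have "\<kappa> \<in> set (filter (\<lambda>\<nu>. \<nu> \<noteq> \<mu>) (map fst ps))" using that by force
      hence "(\<Prod>\<nu>\<leftarrow>filter (\<lambda>\<nu>. \<nu> \<noteq> \<mu>) (map fst ps). \<kappa> - \<nu>) = 0" by (simp add: prod_list_zero_iff image_iff)
      thus ?thesis using \<zeta>(2)[OF that(1)] by simp
    qed
    define \<xi> where "\<xi> x = dirac 0 I \<rho> \<zeta> x + tscale (- \<mu>) (\<zeta> x)" for x
    have "\<xi> \<in> hom_G2 I \<rho>" unfolding \<xi>_def by (intro hom_combination dirac_hom \<zeta>)
    moreover have "\<forall>(\<kappa>, L)\<in>set ps. L \<xi> = 0"
    proof (clarify)
      fix \<kappa> L assume L: "(\<kappa>, L) \<in> set ps"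
      have "L \<xi> = (\<kappa> - \<mu>) * L \<zeta>" unfolding \<xi>_def lin[OF L] eig[OF L \<zeta>(1)] by (simp add: algebra_simps)
      thus "L \<xi> = 0" using z[OF L] by auto
    qed
    ultimately have xi0: "\<xi> x = 0" for x by (rule inj)
    have d: "dirac 0 I \<rho> \<zeta> x = tscale \<mu> (\<zeta> x)" for x
    proof -
      have "dirac 0 I \<rho> \<zeta> x + tscale (- \<mu>) (\<zeta> x) + tscale \<mu> (\<zeta> x) = tscale \<mu> (\<zeta> x)"
        using xi0[of x] by (simp only: \<xi>_def add_0)
      moreover have "tscale (- \<mu>) (\<zeta> x) + tscale \<mu> (\<zeta> x) = 0"
        unfolding tscale_simps(2)[symmetric] by (simp add: tscale_simps)
      ultimately show ?thesis by (simp only: add.assoc add_0_right)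
    qed
    have "M \<zeta> \<noteq> 0"
    proof -
      have "(\<Prod>\<nu>\<leftarrow>filter (\<lambda>\<nu>. \<nu> \<noteq> \<mu>) (map fst ps). \<mu> - \<nu>) \<noteq> 0" by (auto simp: prod_list_zero_iff)
      thus ?thesis using \<zeta>(2)[OF M] ex(2)[OF M] by simp
    qed
    moreover have "M (\<lambda>x. 0) = 0" using lin[OF M, of "\<lambda>x. 0" "-1" "\<lambda>x. 0"] by (simp add: tscale_simps)
    ultimately have "\<zeta> \<noteq> (\<lambda>x. 0)" by metis
    hence "\<exists>x. \<zeta> x \<noteq> 0" by blast
    thus "\<mu> \<in> dirac_eigenvalues 0 I \<rho>" unfolding dirac_eigenvalues_def using \<zeta>(1) d by blast
  qed
qed

end

section \<open>The Dirac operator on the six solution spaces\<close>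

type_synonym functional = "(wt \<Rightarrow> wt \<Rightarrow> complex) \<Rightarrow> (wt \<Rightarrow> wt \<Rightarrow> wt \<Rightarrow> complex) \<Rightarrow> complex"

abbreviation "lower0 \<equiv> lie0 (ymc M3) (ymt M3)"
abbreviation "lower1 \<equiv> lie1 (ymc M3) (ymt M3)"

lemmas (in weight_array) dirac_simps = D0_def D1_def sum_wt jact0_def jact1_def lie0_def lie1_def sk

text \<open>
  The zero weight conditions, the raising operators and the lowering operator leave a line of arrays, on which \<open>D\<close> is the scalar 1/2. The equations used are the instances of these conditions that
  involve the fewest entries. In the following cases the same elimination expresses all entries through a few free ones; the functionals
  \<open>block...\<close> are eigenvectors of the transpose of the matrix of \<open>D\<close> on the free entries, or, where a name with a prime follows, the first two iterates of a vector annihilated by an irreducible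
  quadratic factor of its characteristic polynomial.
\<close>

abbreviation block1_000 :: functional where
  "block1_000 W0 W1 \<equiv> W1 M3 M1 M2"

context weight_array begin

lemma entries_000:
  assumes Z: "\<And>p q. lower0 W0 p q = 0" "\<And>r p q. lower1 W1 r p q = 0"
  notes [simp] = lie0_def lie1_def sk
  notes equations = Z(1)[of N0 P3, simplified] Z(1)[of M1 M2, simplified] Z(2)[of N0 N0 P3, simplified]
    Z(2)[of P1 P3 M1, simplified] Z(2)[of P2 P3 M2, simplified] Z(2)[of P3 P1 M1, simplified]
    Z(2)[of P3 P2 M2, simplified] Z(2)[of M1 P1 P3, simplified] Z(2)[of M2 P2 P3, simplified]
    E12_0[of P2 M1, simplified] E23_1[of N0 P3 M2, simplified] E12_1[of P2 N0 M1, simplified]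
    E23_1[of P3 N0 M2, simplified] E23_1[of P3 P1 P3, simplified] E12_1[of M1 M1 M3, simplified]
    E23_1[of M2 M1 M2, simplified] Z(2)[of N0 M1 M2, simplified]
  shows "W0 P1 M1 = 0"
    "W0 P2 M2 = 0"
    "W0 P3 M3 = 0"
    "W1 N0 P1 M1 = - (1/2) * W1 M3 M1 M2"
    "W1 N0 P2 M2 = - (1/2) * W1 M3 M1 M2"
    "W1 N0 P3 M3 = - (1/2) * W1 M3 M1 M2"
    "W1 P1 N0 M1 = 1/2 * W1 M3 M1 M2"
    "W1 P1 P2 P3 = W1 M3 M1 M2"
    "W1 P2 N0 M2 = 1/2 * W1 M3 M1 M2"
    "W1 P2 P1 P3 = - (W1 M3 M1 M2)"
    "W1 P3 N0 M3 = 1/2 * W1 M3 M1 M2"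
    "W1 P3 P1 P2 = W1 M3 M1 M2"
    "W1 M1 N0 P1 = - (1/2) * W1 M3 M1 M2"
    "W1 M1 M2 M3 = W1 M3 M1 M2"
    "W1 M2 N0 P2 = - (1/2) * W1 M3 M1 M2"
    "W1 M2 M1 M3 = - (W1 M3 M1 M2)"
    "W1 M3 N0 P3 = - (1/2) * W1 M3 M1 M2"
  using equations[THEN right_minus_eq[THEN iffD2]] by algebra+

lemma dirac_000:
  assumes Z: "\<And>p q. lower0 W0 p q = 0" "\<And>r p q. lower1 W1 r p q = 0"
  shows "D1 (0) W0 W1 M3 M1 M2 = 1/2 * W1 M3 M1 M2"
  by (simp add: dirac_simps entries_000[OF Z]; (simp add: field_simps)?)+

lemma blocks_000:
  assumes Z: "\<And>p q. lower0 W0 p q = 0" "\<And>r p q. lower1 W1 r p q = 0"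
  shows "block1_000 (D0 (0) W0 W1) (D1 (0) W0 W1) = (1/2) * block1_000 W0 W1"
  unfolding dirac_000[OF Z] by (simp_all add: field_simps)

text \<open>
  The weight conditions remove all entries of a different weight, and the remaining ones are combinations of the free entries.
\<close>

lemma zero_000:
  assumes weights: "a = 0" "b = 0"
    and Z: "\<And>p q. lower0 W0 p q = 0" "\<And>r p q. lower1 W1 r p q = 0"
    and z: "block1_000 W0 W1 = 0"
  shows "W0 p q = 0" "W1 r p q = 0"
proof -
  have f0: "W1 M3 M1 M2 = 0" using z by simp
  note zero = entries_000[OF Z, unfolded f0, simplified] f0
  show "W0 p q = 0"
    using H0[of p q] unfolding weights by (cases p; cases q; simp add: sk zero)
  show "W1 r p q = 0"
    using H1[of r p q] unfolding weights by (cases r; cases p; cases q; simp add: sk zero)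
qed

end

text \<open>
  The solution space has dimension 3 and the characteristic polynomial of \<open>D\<close> is \<open>(T\<^sup>2 + T - 137/12) (T + 3/2)\<close>.
\<close>

abbreviation block1_100 :: functional where
  "block1_100 W0 W1 \<equiv> W0 P2 P3"
abbreviation block1_100' :: functional where
  "block1_100' W0 W1 \<equiv> - (7/2) * W0 P2 P3 + 4 * W1 M1 P3 M3 + 4/3 * W1 M3 P3 M1"
abbreviation block2_100 :: functional where
  "block2_100 W0 W1 \<equiv> W1 M3 P3 M1"

context weight_array begin

lemma entries_100:
  assumes Z: "\<And>p q. lower0 W0 p q = 0" "\<And>r p q. lower1 W1 r p q = 0"
  notes [simp] = lie0_def lie1_def sk
  notes equations = Z(2)[of M1 N0 P3, simplified] Z(1)[of P3 M1, simplified] E23_1[of P3 N0 P3, simplified]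
    Z(2)[of P3 P2 P3, simplified] E23_1[of P3 M1 M2, simplified] E23_1[of M1 P3 M2, simplified]
    E23_1[of M2 P3 M1, simplified] Z(2)[of M1 M1 M2, simplified] Z(2)[of N0 P3 M1, simplified]
    Z(2)[of P3 N0 M1, simplified]
  shows "W0 N0 M1 = 1/2 * W0 P2 P3"
    "W1 N0 N0 M1 = - (1/2) * W1 M1 P3 M3 - 1/2 * W1 M3 P3 M1"
    "W1 N0 P2 P3 = - (W1 M1 P3 M3)"
    "W1 P2 N0 P3 = W1 M1 P3 M3"
    "W1 P2 M1 M2 = - (2) * W1 M1 P3 M3 - W1 M3 P3 M1"
    "W1 P3 N0 P2 = - (W1 M1 P3 M3)"
    "W1 P3 M1 M3 = - (2) * W1 M1 P3 M3 - W1 M3 P3 M1"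
    "W1 M1 P1 M1 = W1 M1 P3 M3 + W1 M3 P3 M1"
    "W1 M1 P2 M2 = W1 M1 P3 M3"
    "W1 M2 P2 M1 = W1 M3 P3 M1"
  using equations[THEN right_minus_eq[THEN iffD2]] by algebra+

lemma dirac_100:
  assumes Z: "\<And>p q. lower0 W0 p q = 0" "\<And>r p q. lower1 W1 r p q = 0"
  shows "D0 (1) W0 W1 P2 P3 = - (7/2) * W0 P2 P3 + 4 * W1 M1 P3 M3 + 4/3 * W1 M3 P3 M1"
    "D1 (1) W0 W1 M1 P3 M3 = 2/3 * W0 P2 P3 + 5/2 * W1 M1 P3 M3 + 4/3 * W1 M3 P3 M1"
    "D1 (1) W0 W1 M3 P3 M1 = - (3/2) * W1 M3 P3 M1"
  by (simp add: dirac_simps entries_100[OF Z]; (simp add: field_simps)?)+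

lemma blocks_100:
  assumes Z: "\<And>p q. lower0 W0 p q = 0" "\<And>r p q. lower1 W1 r p q = 0"
  shows "block1_100 (D0 (1) W0 W1) (D1 (1) W0 W1) = block1_100' W0 W1"
    "block1_100' (D0 (1) W0 W1) (D1 (1) W0 W1) = - (1) * block1_100' W0 W1 - (- (137/12)) * block1_100 W0 W1"
    "block2_100 (D0 (1) W0 W1) (D1 (1) W0 W1) = - (3/2) * block2_100 W0 W1"
  unfolding dirac_100[OF Z] by (simp_all add: field_simps)

lemma zero_100:
  assumes weights: "a = 1" "b = 0"
    and Z: "\<And>p q. lower0 W0 p q = 0" "\<And>r p q. lower1 W1 r p q = 0"
    and z: "block1_100 W0 W1 = 0" "block1_100' W0 W1 = 0" "block2_100 W0 W1 = 0"
  shows "W0 p q = 0" "W1 r p q = 0"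
proof -
  have f0: "W0 P2 P3 = 0" using z(1) by simp
  have f1: "W1 M1 P3 M3 = 0" using z by algebra
  have f2: "W1 M3 P3 M1 = 0" using z(3) by simp
  note zero = entries_100[OF Z, unfolded f0 f1 f2, simplified] f0 f1 f2
  show "W0 p q = 0"
    using H0[of p q] unfolding weights by (cases p; cases q; simp add: sk zero)
  show "W1 r p q = 0"
    using H1[of r p q] unfolding weights by (cases r; cases p; cases q; simp add: sk zero)
qed

end

text \<open>
  The solution space has dimension 4 and the characteristic polynomial of \<open>D\<close> is \<open>(T\<^sup>2 + T - 125/12) (T + 5/2) (T - 3/2)\<close>.
\<close>

abbreviation block1_001 :: functional where
  "block1_001 W0 W1 \<equiv> W0 P3 M3"
abbreviation block1_001' :: functional where
  "block1_001' W0 W1 \<equiv> - (7/2) * W0 P3 M3 + 3/4 * W1 P3 P1 P2 + 2/3 * W1 M3 N0 P3 + 1/12 * W1 M3 M1 M2"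
abbreviation block2_001 :: functional where
  "block2_001 W0 W1 \<equiv> W1 P3 P1 P2 + 2 * W1 M3 N0 P3 - W1 M3 M1 M2"
abbreviation block3_001 :: functional where
  "block3_001 W0 W1 \<equiv> 2 * W1 M3 N0 P3 + W1 M3 M1 M2"

context weight_array begin

lemma entries_001:
  assumes Z: "\<And>p q. lower0 (lower0 W0) p q = 0" "\<And>r p q. lower1 (lower1 W1) r p q = 0"
  notes [simp] = lie0_def lie1_def sk
  notes equations = E12_0[of P2 M1, simplified] E23_0[of P3 M2, simplified] E12_1[of N0 P2 M1, simplified]
    E23_1[of N0 P3 M2, simplified] E12_1[of P2 N0 M1, simplified] E12_1[of P2 P2 P3, simplified]
    E23_1[of P3 N0 M2, simplified] E23_1[of P3 P1 P3, simplified] E12_1[of M1 N0 P2, simplified]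
    E12_1[of M1 M1 M3, simplified] E23_1[of M2 N0 P3, simplified] E23_1[of M2 M1 M2, simplified]
    Z(2)[of P3 N0 P3, simplified] Z(2)[of P3 M1 M2, simplified]
  shows "W0 P1 M1 = W0 P3 M3"
    "W0 P2 M2 = W0 P3 M3"
    "W1 N0 P1 M1 = - (1/4) * W1 P3 P1 P2 - 1/4 * W1 M3 M1 M2"
    "W1 N0 P2 M2 = - (1/4) * W1 P3 P1 P2 - 1/4 * W1 M3 M1 M2"
    "W1 N0 P3 M3 = - (1/4) * W1 P3 P1 P2 - 1/4 * W1 M3 M1 M2"
    "W1 P1 N0 M1 = 1/2 * W1 P3 P1 P2 + W1 M3 N0 P3 + 1/2 * W1 M3 M1 M2"
    "W1 P1 P2 P3 = W1 P3 P1 P2"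
    "W1 P2 N0 M2 = 1/2 * W1 P3 P1 P2 + W1 M3 N0 P3 + 1/2 * W1 M3 M1 M2"
    "W1 P2 P1 P3 = - (W1 P3 P1 P2)"
    "W1 P3 N0 M3 = 1/2 * W1 P3 P1 P2 + W1 M3 N0 P3 + 1/2 * W1 M3 M1 M2"
    "W1 M1 N0 P1 = W1 M3 N0 P3"
    "W1 M1 M2 M3 = W1 M3 M1 M2"
    "W1 M2 N0 P2 = W1 M3 N0 P3"
    "W1 M2 M1 M3 = - (W1 M3 M1 M2)"
  using equations[THEN right_minus_eq[THEN iffD2]] by algebra+

lemma dirac_001:
  assumes Z: "\<And>p q. lower0 (lower0 W0) p q = 0" "\<And>r p q. lower1 (lower1 W1) r p q = 0"
  shows "D0 (3/2) W0 W1 P3 M3 = - (7/2) * W0 P3 M3 + 3/4 * W1 P3 P1 P2 + 2/3 * W1 M3 N0 P3 + 1/12 * W1 M3 M1 M2"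
    "D1 (3/2) W0 W1 P3 P1 P2 = 8/3 * W0 P3 M3 + 7/2 * W1 P3 P1 P2 + 8/3 * W1 M3 N0 P3 - 2/3 * W1 M3 M1 M2"
    "D1 (3/2) W0 W1 M3 N0 P3 = - (2/3) * W0 P3 M3 - 3/2 * W1 P3 P1 P2 - 7/6 * W1 M3 N0 P3 + 7/6 * W1 M3 M1 M2"
    "D1 (3/2) W0 W1 M3 M1 M2 = 4/3 * W0 P3 M3 + 3 * W1 P3 P1 P2 + 16/3 * W1 M3 N0 P3 - 5/6 * W1 M3 M1 M2"
  by (simp add: dirac_simps entries_001[OF Z]; (simp add: field_simps)?)+

lemma blocks_001:
  assumes Z: "\<And>p q. lower0 (lower0 W0) p q = 0" "\<And>r p q. lower1 (lower1 W1) r p q = 0"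
  shows "block1_001 (D0 (3/2) W0 W1) (D1 (3/2) W0 W1) = block1_001' W0 W1"
    "block1_001' (D0 (3/2) W0 W1) (D1 (3/2) W0 W1) = - (1) * block1_001' W0 W1 - (- (125/12)) * block1_001 W0 W1"
    "block2_001 (D0 (3/2) W0 W1) (D1 (3/2) W0 W1) = - (5/2) * block2_001 W0 W1"
    "block3_001 (D0 (3/2) W0 W1) (D1 (3/2) W0 W1) = (3/2) * block3_001 W0 W1"
  unfolding dirac_001[OF Z] by (simp_all add: field_simps)

lemma zero_001:
  assumes weights: "a = 0" "b = 0"
    and Z: "\<And>p q. lower0 (lower0 W0) p q = 0" "\<And>r p q. lower1 (lower1 W1) r p q = 0"
    and z: "block1_001 W0 W1 = 0" "block1_001' W0 W1 = 0" "block2_001 W0 W1 = 0" "block3_001 W0 W1 = 0"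
  shows "W0 p q = 0" "W1 r p q = 0"
proof -
  have f0: "W0 P3 M3 = 0" using z(1) by simp
  have f1: "W1 P3 P1 P2 = 0" using z by algebra
  have f2: "W1 M3 N0 P3 = 0" using z by algebra
  have f3: "W1 M3 M1 M2 = 0" using z by algebra
  note zero = entries_001[OF Z, unfolded f0 f1 f2 f3, simplified] f0 f1 f2 f3
  show "W0 p q = 0"
    using H0[of p q] unfolding weights by (cases p; cases q; simp add: sk zero)
  show "W1 r p q = 0"
    using H1[of r p q] unfolding weights by (cases r; cases p; cases q; simp add: sk zero)
qed

end

text \<open>
  The solution space has dimension 5 and the characteristic polynomial of \<open>D\<close> is \<open>(T\<^sup>2 + T - 67/4) (T\<^sup>2 + T - 137/12) (T + 7/2)\<close>.
\<close>

abbreviation block1_010 :: functional where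
  "block1_010 W0 W1 \<equiv> W0 N0 P3 - W0 M1 M2"
abbreviation block1_010' :: functional where
  "block1_010' W0 W1 \<equiv> - (7/2) * W0 N0 P3 + 7/2 * W0 M1 M2 - 10 * W1 P3 P3 M3 + 12 * W1 M2 N0 M1 - 8 * W1 M2 P2 P3"
abbreviation block2_010 :: functional where
  "block2_010 W0 W1 \<equiv> 2 * W0 N0 P3 + W0 M1 M2"
abbreviation block2_010' :: functional where
  "block2_010' W0 W1 \<equiv> - (7) * W0 N0 P3 - 7/2 * W0 M1 M2 - 4 * W1 M2 N0 M1 + 2 * W1 M2 P2 P3"
abbreviation block3_010 :: functional where
  "block3_010 W0 W1 \<equiv> W1 P3 P3 M3 + 2 * W1 M2 P2 P3"

context weight_array begin

lemma entries_010:
  assumes Z: "\<And>p q. lower0 W0 p q = 0" "\<And>r p q. lower1 W1 r p q = 0"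
  notes [simp] = lie0_def lie1_def sk
  notes equations = Z(2)[of P3 N0 P3, simplified] E12_1[of P2 P3 M1, simplified] E12_1[of P3 P2 M1, simplified]
    E12_1[of M1 N0 M1, simplified] E12_1[of M1 P2 P3, simplified] Z(2)[of P3 M1 M2, simplified]
    Z(2)[of M1 P3 M2, simplified] E23_1[of P3 P3 M2, simplified]
  shows "W1 N0 N0 P3 = 1/2 * W1 P3 P3 M3"
    "W1 N0 M1 M2 = - (W1 P3 P3 M3) + 2 * W1 M2 N0 M1 - W1 M2 P2 P3"
    "W1 P1 P3 M1 = 2 * W1 M2 N0 M1 - W1 M2 P2 P3"
    "W1 P2 P3 M2 = 2 * W1 M2 N0 M1 - W1 M2 P2 P3"
    "W1 P3 P1 M1 = W1 P3 P3 M3 - 2 * W1 M2 N0 M1 + W1 M2 P2 P3"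
    "W1 P3 P2 M2 = W1 P3 P3 M3 - 2 * W1 M2 N0 M1 + W1 M2 P2 P3"
    "W1 M1 N0 M2 = - (W1 M2 N0 M1)"
    "W1 M1 P1 P3 = W1 M2 P2 P3"
  using equations[THEN right_minus_eq[THEN iffD2]] by algebra+

lemma dirac_010:
  assumes Z: "\<And>p q. lower0 W0 p q = 0" "\<And>r p q. lower1 W1 r p q = 0"
  shows "D0 (2) W0 W1 N0 P3 = - (7/2) * W0 N0 P3 - 10/3 * W1 P3 P3 M3 + 8/3 * W1 M2 N0 M1 - 2 * W1 M2 P2 P3"
    "D0 (2) W0 W1 M1 M2 = - (7/2) * W0 M1 M2 + 20/3 * W1 P3 P3 M3 - 28/3 * W1 M2 N0 M1 + 6 * W1 M2 P2 P3"
    "D1 (2) W0 W1 P3 P3 M3 = - (8/3) * W0 N0 P3 + 19/6 * W1 P3 P3 M3 + 4/3 * W1 M2 P2 P3"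
    "D1 (2) W0 W1 M2 N0 M1 = - (2/3) * W0 N0 P3 - 2/3 * W0 M1 M2 - 5/3 * W1 P3 P3 M3 + 5/2 * W1 M2 N0 M1 - 10/3 * W1 M2 P2 P3"
    "D1 (2) W0 W1 M2 P2 P3 = 4/3 * W0 N0 P3 - 10/3 * W1 P3 P3 M3 - 25/6 * W1 M2 P2 P3"
  by (simp add: dirac_simps entries_010[OF Z]; (simp add: field_simps)?)+

lemma blocks_010:
  assumes Z: "\<And>p q. lower0 W0 p q = 0" "\<And>r p q. lower1 W1 r p q = 0"
  shows "block1_010 (D0 (2) W0 W1) (D1 (2) W0 W1) = block1_010' W0 W1"
    "block1_010' (D0 (2) W0 W1) (D1 (2) W0 W1) = - (1) * block1_010' W0 W1 - (- (67/4)) * block1_010 W0 W1"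
    "block2_010 (D0 (2) W0 W1) (D1 (2) W0 W1) = block2_010' W0 W1"
    "block2_010' (D0 (2) W0 W1) (D1 (2) W0 W1) = - (1) * block2_010' W0 W1 - (- (137/12)) * block2_010 W0 W1"
    "block3_010 (D0 (2) W0 W1) (D1 (2) W0 W1) = - (7/2) * block3_010 W0 W1"
  unfolding dirac_010[OF Z] by (simp_all add: field_simps)

lemma zero_010:
  assumes weights: "a = 0" "b = 1"
    and Z: "\<And>p q. lower0 W0 p q = 0" "\<And>r p q. lower1 W1 r p q = 0"
    and z: "block1_010 W0 W1 = 0" "block1_010' W0 W1 = 0" "block2_010 W0 W1 = 0" "block2_010' W0 W1 = 0" "block3_010 W0 W1 = 0"
  shows "W0 p q = 0" "W1 r p q = 0"
proof -
  have f0: "W0 N0 P3 = 0" using z by algebra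
  have f1: "W0 M1 M2 = 0" using z by algebra
  have f2: "W1 P3 P3 M3 = 0" using z by algebra
  have f3: "W1 M2 N0 M1 = 0" using z by algebra
  have f4: "W1 M2 P2 P3 = 0" using z by algebra
  note zero = entries_010[OF Z, unfolded f0 f1 f2 f3 f4, simplified] f0 f1 f2 f3 f4
  show "W0 p q = 0"
    using H0[of p q] unfolding weights by (cases p; cases q; simp add: sk zero)
  show "W1 r p q = 0"
    using H1[of r p q] unfolding weights by (cases r; cases p; cases q; simp add: sk zero)
qed

end

text \<open>
  The solution space has dimension 2 and the characteristic polynomial of \<open>D\<close> is \<open>(T + 25/6) (T - 23/6)\<close>.
\<close>

abbreviation block1_200 :: functional where
  "block1_200 W0 W1 \<equiv> W1 M1 N0 M1 + W1 M1 P2 P3"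
abbreviation block2_200 :: functional where
  "block2_200 W0 W1 \<equiv> 2 * W1 M1 N0 M1 - W1 M1 P2 P3"

context weight_array begin

lemma entries_200:
  assumes Z: "\<And>p q. lower0 W0 p q = 0" "\<And>r p q. lower1 W1 r p q = 0"
  notes [simp] = lie0_def lie1_def sk
  notes equations = E23_1[of P3 P3 M1, simplified] Z(2)[of M1 P3 M1, simplified]
  shows "W1 P2 P3 M1 = - (2) * W1 M1 N0 M1 + W1 M1 P2 P3"
    "W1 P3 P2 M1 = 2 * W1 M1 N0 M1 - W1 M1 P2 P3"
  using equations[THEN right_minus_eq[THEN iffD2]] by algebra+

lemma dirac_200:
  assumes Z: "\<And>p q. lower0 W0 p q = 0" "\<And>r p q. lower1 W1 r p q = 0"
  shows "D1 (2) W0 W1 M1 N0 M1 = 7/6 * W1 M1 N0 M1 - 8/3 * W1 M1 P2 P3"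
    "D1 (2) W0 W1 M1 P2 P3 = - (16/3) * W1 M1 N0 M1 - 3/2 * W1 M1 P2 P3"
  by (simp add: dirac_simps entries_200[OF Z]; (simp add: field_simps)?)+

lemma blocks_200:
  assumes Z: "\<And>p q. lower0 W0 p q = 0" "\<And>r p q. lower1 W1 r p q = 0"
  shows "block1_200 (D0 (2) W0 W1) (D1 (2) W0 W1) = - (25/6) * block1_200 W0 W1"
    "block2_200 (D0 (2) W0 W1) (D1 (2) W0 W1) = (23/6) * block2_200 W0 W1"
  unfolding dirac_200[OF Z] by (simp_all add: field_simps)

lemma zero_200:
  assumes weights: "a = 2" "b = 0"
    and Z: "\<And>p q. lower0 W0 p q = 0" "\<And>r p q. lower1 W1 r p q = 0"
    and z: "block1_200 W0 W1 = 0" "block2_200 W0 W1 = 0"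
  shows "W0 p q = 0" "W1 r p q = 0"
proof -
  have f0: "W1 M1 N0 M1 = 0" using z by algebra
  have f1: "W1 M1 P2 P3 = 0" using z by algebra
  note zero = entries_200[OF Z, unfolded f0 f1, simplified] f0 f1
  show "W0 p q = 0"
    using H0[of p q] unfolding weights by (cases p; cases q; simp add: sk zero)
  show "W1 r p q = 0"
    using H1[of r p q] unfolding weights by (cases r; cases p; cases q; simp add: sk zero)
qed

end

text \<open>
  The solution space has dimension 7 and the characteristic polynomial of \<open>D\<close> is
  \<open>(T\<^sup>2 + T - 79/4) (T\<^sup>2 + T - 173/12) (T\<^sup>2 - T/3 - 197/12) (T + 19/6)\<close>.
\<close>

abbreviation block1_101 :: functional where
  "block1_101 W0 W1 \<equiv> W0 N0 M1 + W0 P2 P3"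
abbreviation block1_101' :: functional where
  "block1_101' W0 W1 \<equiv> - (7/2) * W0 N0 M1 - 7/2 * W0 P2 P3 - 23/2 * W1 N0 P2 P3 + 9/2 * W1 P3 N0 P2 - 5/4 * W1 P3 M1 M3 - 2 * W1 M1 P3 M3 + 5/4 * W1 M3 P3 M1"
abbreviation block2_101 :: functional where
  "block2_101 W0 W1 \<equiv> 2 * W0 N0 M1 - W0 P2 P3"
abbreviation block2_101' :: functional where
  "block2_101' W0 W1 \<equiv> - (7) * W0 N0 M1 + 7/2 * W0 P2 P3 + 5 * W1 P3 N0 P2 - 5/2 * W1 P3 M1 M3 - 3/2 * W1 M3 P3 M1"
abbreviation block3_101 :: functional where
  "block3_101 W0 W1 \<equiv> 2 * W1 N0 P2 P3 + W1 P3 M1 M3 + 7 * W1 M1 P3 M3 + 2 * W1 M3 P3 M1"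
abbreviation block3_101' :: functional where
  "block3_101' W0 W1 \<equiv> - (W1 N0 P2 P3) - 8 * W1 P3 N0 P2 - 17/2 * W1 P3 M1 M3 - 55/2 * W1 M1 P3 M3 - 9 * W1 M3 P3 M1"
abbreviation block4_101 :: functional where
  "block4_101 W0 W1 \<equiv> 2 * W1 P3 N0 P2 - W1 P3 M1 M3 - 4 * W1 M3 P3 M1"

context weight_array begin

lemma entries_101:
  assumes Z: "\<And>p q. lower0 (lower0 W0) p q = 0" "\<And>r p q. lower1 (lower1 W1) r p q = 0"
  notes [simp] = lie0_def lie1_def sk
  notes equations = E23_1[of P3 N0 P3, simplified] E23_1[of P3 M1 M2, simplified] E23_1[of M1 P3 M2, simplified]
    E23_1[of M2 P3 M1, simplified] E12_1[of M1 P2 M1, simplified] Z(2)[of P3 P3 M1, simplified]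
  shows "W1 N0 N0 M1 = 1/2 * W1 N0 P2 P3 - 1/2 * W1 P3 N0 P2 + 1/4 * W1 P3 M1 M3 - 1/4 * W1 M3 P3 M1"
    "W1 P2 N0 P3 = - (W1 P3 N0 P2)"
    "W1 P2 M1 M2 = W1 P3 M1 M3"
    "W1 M1 P1 M1 = W1 M1 P3 M3 + W1 M3 P3 M1"
    "W1 M1 P2 M2 = W1 M1 P3 M3"
    "W1 M2 P2 M1 = W1 M3 P3 M1"
  using equations[THEN right_minus_eq[THEN iffD2]] by algebra+

lemma dirac_101:
  assumes Z: "\<And>p q. lower0 (lower0 W0) p q = 0" "\<And>r p q. lower1 (lower1 W1) r p q = 0"
  shows "D0 (5/2) W0 W1 N0 M1 = - (7/2) * W0 N0 M1 - 23/6 * W1 N0 P2 P3 + 19/6 * W1 P3 N0 P2 - 5/4 * W1 P3 M1 M3 - 2/3 * W1 M1 P3 M3 - 1/12 * W1 M3 P3 M1"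
    "D0 (5/2) W0 W1 P2 P3 = - (7/2) * W0 P2 P3 - 23/3 * W1 N0 P2 P3 + 4/3 * W1 P3 N0 P2 - 4/3 * W1 M1 P3 M3 + 4/3 * W1 M3 P3 M1"
    "D1 (5/2) W0 W1 N0 P2 P3 = - (5/3) * W0 P2 P3 + 5/2 * W1 N0 P2 P3 + 4/3 * W1 P3 N0 P2 + 4/3 * W1 M1 P3 M3 - 4/3 * W1 M3 P3 M1"
    "D1 (5/2) W0 W1 P3 N0 P2 = 4/3 * W0 N0 M1 - 4/3 * W0 P2 P3 - 2/3 * W1 N0 P2 P3 + 25/6 * W1 P3 N0 P2 + 1/3 * W1 P3 M1 M3 + 2/3 * W1 M1 P3 M3 - W1 M3 P3 M1"
    "D1 (5/2) W0 W1 P3 M1 M3 = - (8/3) * W0 N0 M1 - 4/3 * W1 N0 P2 P3 + 4/3 * W1 P3 N0 P2 + 25/6 * W1 P3 M1 M3 + 4/3 * W1 M1 P3 M3 + 2 * W1 M3 P3 M1"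
    "D1 (5/2) W0 W1 M1 P3 M3 = 2/3 * W0 P2 P3 - 2/3 * W1 N0 P2 P3 - 8/3 * W1 P3 N0 P2 - 4/3 * W1 P3 M1 M3 - 9/2 * W1 M1 P3 M3"
    "D1 (5/2) W0 W1 M3 P3 M1 = 4/3 * W0 N0 M1 - 2/3 * W0 P2 P3 + 10/3 * W1 P3 N0 P2 - 5/3 * W1 P3 M1 M3 - 25/6 * W1 M3 P3 M1"
  by (simp add: dirac_simps entries_101[OF Z]; (simp add: field_simps)?)+

lemma blocks_101:
  assumes Z: "\<And>p q. lower0 (lower0 W0) p q = 0" "\<And>r p q. lower1 (lower1 W1) r p q = 0"
  shows "block1_101 (D0 (5/2) W0 W1) (D1 (5/2) W0 W1) = block1_101' W0 W1"
    "block1_101' (D0 (5/2) W0 W1) (D1 (5/2) W0 W1) = - (1) * block1_101' W0 W1 - (- (79/4)) * block1_101 W0 W1"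
    "block2_101 (D0 (5/2) W0 W1) (D1 (5/2) W0 W1) = block2_101' W0 W1"
    "block2_101' (D0 (5/2) W0 W1) (D1 (5/2) W0 W1) = - (1) * block2_101' W0 W1 - (- (173/12)) * block2_101 W0 W1"
    "block3_101 (D0 (5/2) W0 W1) (D1 (5/2) W0 W1) = block3_101' W0 W1"
    "block3_101' (D0 (5/2) W0 W1) (D1 (5/2) W0 W1) = (1/3) * block3_101' W0 W1 - (- (197/12)) * block3_101 W0 W1"
    "block4_101 (D0 (5/2) W0 W1) (D1 (5/2) W0 W1) = - (19/6) * block4_101 W0 W1"
  unfolding dirac_101[OF Z] by (simp_all add: field_simps)

lemma zero_101:
  assumes weights: "a = 1" "b = 0"
    and Z: "\<And>p q. lower0 (lower0 W0) p q = 0" "\<And>r p q. lower1 (lower1 W1) r p q = 0"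
    and z: "block1_101 W0 W1 = 0" "block1_101' W0 W1 = 0" "block2_101 W0 W1 = 0" "block2_101' W0 W1 = 0" "block3_101 W0 W1 = 0" "block3_101' W0 W1 = 0" "block4_101 W0 W1 = 0"
  shows "W0 p q = 0" "W1 r p q = 0"
proof -
  have f0: "W0 N0 M1 = 0" using z by algebra
  have f1: "W0 P2 P3 = 0" using z by algebra
  have f2: "W1 N0 P2 P3 = 0" using z by algebra
  have f3: "W1 P3 N0 P2 = 0" using z by algebra
  have f4: "W1 P3 M1 M3 = 0" using z by algebra
  have f5: "W1 M1 P3 M3 = 0" using z by algebra
  have f6: "W1 M3 P3 M1 = 0" using z by algebra
  note zero = entries_101[OF Z, unfolded f0 f1 f2 f3 f4 f5 f6, simplified] f0 f1 f2 f3 f4 f5 f6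
  show "W0 p q = 0"
    using H0[of p q] unfolding weights by (cases p; cases q; simp add: sk zero)
  show "W1 r p q = 0"
    using H1[of r p q] unfolding weights by (cases r; cases p; cases q; simp add: sk zero)
qed

end

section \<open>The spectra\<close>

lemma outer_vector: "outer u s *v z = dot s z *s u" for u s z :: "complex^7"
  by (simp add: outer_def dot_def matrix_vector_mult_def vec_eq_iff sum_distrib_left sum_distrib_right mult_ac)

lemma transpose_outer: "transpose (outer u s) = outer s u"
  by (simp add: outer_def transpose_def vec_eq_iff mult.commute)

text \<open>
  Linearity in the combined array, in the only form that is needed below.
\<close>

definition array_functional :: "functional \<Rightarrow> bool" where
  "array_functional P \<longleftrightarrow> (\<forall>W0 W1 V0 V1 k. P (\<lambda>p q. W0 p q + k * V0 p q) (\<lambda>r p q. W1 r p q + k * V1 r p q) = P W0 W1 + k * P V0 V1)"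

context dirac_setting begin

context
  fixes l x assumes irr: "irreducible_spin7_rep \<rho>" and hw: "hwv (crep \<rho>) l x"
begin

text \<open>
  The value of a functional on the array of an equivariant map at the highest weight vector.
\<close>

abbreviation val :: "functional \<Rightarrow> (complex^'n \<Rightarrow> twisted) \<Rightarrow> complex" where
  "val P \<eta> \<equiv> P (A0 x \<eta>) (A1 x \<eta>)"

text \<open>
  Rational functionals \<open>P\<close>, \<open>Q\<close> with \<open>P (D \<eta>) = Q \<eta>\<close> and \<open>Q (D \<eta>) = (\<mu> + \<nu>) Q \<eta> - \<mu> \<nu> P \<eta>\<close> encode a pair of conjugate irrational eigenvalues: the combination \<open>Q - \<nu> P\<close> has
  eigenvalue \<open>\<mu>\<close> and \<open>Q - \<mu> P\<close> has eigenvalue \<open>\<nu>\<close>. The product of the two combinations at \<open>\<theta>\<close> is the quadratic expression that has to be nonzero.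
\<close>

lemma block_spectrum:
  fixes qs :: "(real \<times> real \<times> functional \<times> functional) list" and ls :: "(real \<times> functional) list"
  assumes qs: "\<forall>(\<mu>, \<nu>, P, Q)\<in>set qs. array_functional P \<and> array_functional Q \<and> \<mu> \<noteq> \<nu>"
    and ls: "\<forall>(\<mu>, P)\<in>set ls. array_functional P"
    and qeig: "\<And>\<eta>. \<eta> \<in> hom_G2 I \<rho> \<Longrightarrow> \<forall>(\<mu>, \<nu>, P, Q)\<in>set qs.
      val P (dirac 0 I \<rho> \<eta>) = val Q \<eta> \<and>
      val Q (dirac 0 I \<rho> \<eta>) = of_real (\<mu> + \<nu>) * val Q \<eta> - of_real (\<mu> * \<nu>) * val P \<eta>"
    and leig: "\<And>\<eta>. \<eta> \<in> hom_G2 I \<rho> \<Longrightarrow> \<forall>(\<mu>, P)\<in>set ls.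
      val P (dirac 0 I \<rho> \<eta>) = of_real \<mu> * val P \<eta>"
    and inj: "\<And>\<eta>. \<eta> \<in> hom_G2 I \<rho> \<Longrightarrow> \<forall>(\<mu>, \<nu>, P, Q)\<in>set qs. val P \<eta> = 0 \<and> val Q \<eta> = 0 \<Longrightarrow>
        \<forall>(\<mu>, P)\<in>set ls. val P \<eta> = 0 \<Longrightarrow> (\<forall>p q. A0 x \<eta> p q = 0) \<and> (\<forall>r p q. A1 x \<eta> r p q = 0)"
    and \<theta>: "\<theta> \<in> hom_G2 I \<rho>"
    and qnz: "\<forall>(\<mu>, \<nu>, P, Q)\<in>set qs. (val Q \<theta>)\<^sup>2 - of_real (\<mu> + \<nu>) * val Q \<theta> * val P \<theta>
       + of_real (\<mu> * \<nu>) * (val P \<theta>)\<^sup>2 \<noteq> 0"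
    and lnz: "\<forall>(\<mu>, P)\<in>set ls. val P \<theta> \<noteq> 0"
  shows "dirac_eigenvalues 0 I \<rho> = complex_of_real ` (fst ` set ls \<union> (\<Union>(\<mu>, \<nu>, P, Q)\<in>set qs. {\<mu>, \<nu>}))"
proof -
  define split where "split = (\<lambda>(\<mu>, \<nu>, P, Q). [(complex_of_real \<mu>, \<lambda>\<eta>. val Q \<eta> - of_real \<nu> * val P \<eta>),
    (complex_of_real \<nu>, \<lambda>\<eta>. val Q \<eta> - of_real \<mu> * val P \<eta>)])"
  define ps where "ps = map (\<lambda>(\<mu>, P). (complex_of_real \<mu>, val P)) ls @ concat (map split qs)"
  have val_linear: "val P (\<lambda>x. \<eta> x + tscale k (\<zeta> x)) = val P \<eta> + k * val P \<zeta>" if "array_functional P" for P \<eta> \<zeta> k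
  proof -
    have a: "A0 x (\<lambda>y. \<eta> y + tscale k (\<zeta> y)) = (\<lambda>p q. A0 x \<eta> p q + k * A0 x \<zeta> p q)" "A1 x (\<lambda>y. \<eta> y + tscale k (\<zeta> y)) = (\<lambda>r p q. A1 x \<eta> r p q + k * A1 x \<zeta> r p q)"
      by (intro ext array_linear)+
    show ?thesis using that unfolding a array_functional_def by blast
  qed
  have cases: thesis if L: "(\<kappa>, L) \<in> set ps"
    and 1: "\<And>\<mu> P. (\<mu>, P) \<in> set ls \<Longrightarrow> \<kappa> = of_real \<mu> \<Longrightarrow> L = val P \<Longrightarrow> thesis"
    and 2: "\<And>\<mu> \<nu> P Q. (\<mu>, \<nu>, P, Q) \<in> set qs \<or> (\<nu>, \<mu>, P, Q) \<in> set qs \<Longrightarrow> \<kappa> = of_real \<mu> \<Longrightarrow> L = (\<lambda>\<eta>. val Q \<eta> - of_real \<nu> * val P \<eta>) \<Longrightarrow> thesis" for \<kappa> L thesis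
    using L unfolding ps_def split_def by (auto intro: 1 2)
  have q': "array_functional P" "array_functional Q" 
    "\<eta> \<in> hom_G2 I \<rho> \<Longrightarrow> val P (dirac 0 I \<rho> \<eta>) = val Q \<eta>" 
    "\<eta> \<in> hom_G2 I \<rho> \<Longrightarrow> val Q (dirac 0 I \<rho> \<eta>) = of_real (\<mu> + \<nu>) * val Q \<eta> - of_real (\<mu> * \<nu>) * val P \<eta>"
    "(val Q \<theta>)\<^sup>2 - of_real (\<mu> + \<nu>) * val Q \<theta> * val P \<theta> + of_real (\<mu> * \<nu>) * (val P \<theta>)\<^sup>2 \<noteq> 0"
    if "(\<mu>, \<nu>, P, Q) \<in> set qs" for \<mu> \<nu> P Q \<eta>
    using bspec[OF qs that] bspec[OF qeig that, of \<eta>] bspec[OF qnz that] unfolding prod.case by blast+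
  have q: "array_functional P" "array_functional Q" 
    "\<eta> \<in> hom_G2 I \<rho> \<Longrightarrow> val P (dirac 0 I \<rho> \<eta>) = val Q \<eta>" 
    "\<eta> \<in> hom_G2 I \<rho> \<Longrightarrow> val Q (dirac 0 I \<rho> \<eta>) = of_real (\<mu> + \<nu>) * val Q \<eta> - of_real (\<mu> * \<nu>) * val P \<eta>"
    "(val Q \<theta>)\<^sup>2 - of_real (\<mu> + \<nu>) * val Q \<theta> * val P \<theta> + of_real (\<mu> * \<nu>) * (val P \<theta>)\<^sup>2 \<noteq> 0"
    if "(\<mu>, \<nu>, P, Q) \<in> set qs \<or> (\<nu>, \<mu>, P, Q) \<in> set qs" for \<mu> \<nu> P Q \<eta>
    using that q'[of \<mu> \<nu> P Q] q'[of \<nu> \<mu> P Q] unfolding add.commute[of \<nu> \<mu>] mult.commute[of \<nu> \<mu>] by blast+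
  have "dirac_eigenvalues 0 I \<rho> = fst ` set ps"
  proof (rule spectrum[OF _ _ _ \<theta>])
    fix \<kappa> L assume L: "(\<kappa>, L) \<in> set ps"
    show "L (\<lambda>x. \<eta> x + tscale k (\<zeta> x)) = L \<eta> + k * L \<zeta>" for \<eta> \<zeta> k
    proof (rule cases[OF L])
      fix \<mu> P assume "(\<mu>, P) \<in> set ls" "L = val P"
      thus ?thesis using ls val_linear by blast
    next
      fix \<mu> \<nu> P Q assume "(\<mu>, \<nu>, P, Q) \<in> set qs \<or> (\<nu>, \<mu>, P, Q) \<in> set qs" "L = (\<lambda>\<eta>. val Q \<eta> - of_real \<nu> * val P \<eta>)"
      thus ?thesis by (simp add: val_linear q algebra_simps)
    qed
    show "L (dirac 0 I \<rho> \<eta>) = \<kappa> * L \<eta>" if \<eta>: "\<eta> \<in> hom_G2 I \<rho>" for \<eta>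
    proof (rule cases[OF L])
      fix \<mu> P assume "(\<mu>, P) \<in> set ls" "L = val P" "\<kappa> = of_real \<mu>"
      thus ?thesis using bspec[OF leig[OF \<eta>]] by auto
    next
      fix \<mu> \<nu> P Q assume "(\<mu>, \<nu>, P, Q) \<in> set qs \<or> (\<nu>, \<mu>, P, Q) \<in> set qs" "L = (\<lambda>\<eta>. val Q \<eta> - of_real \<nu> * val P \<eta>)" "\<kappa> = of_real \<mu>"
      thus ?thesis by (simp add: q(3,4)[OF _ \<eta>] algebra_simps)
    qed
    show "L \<theta> \<noteq> 0"
    proof (rule cases[OF L])
      fix \<mu> P assume "(\<mu>, P) \<in> set ls" "L = val P"
      thus ?thesis using bspec[OF lnz] by auto
    next
      fix \<mu> \<nu> P Q assume *: "(\<mu>, \<nu>, P, Q) \<in> set qs \<or> (\<nu>, \<mu>, P, Q) \<in> set qs" and L: "L = (\<lambda>\<eta>. val Q \<eta> - of_real \<nu> * val P \<eta>)"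
      have "(val Q \<theta>)\<^sup>2 - of_real (\<mu> + \<nu>) * val Q \<theta> * val P \<theta> + of_real (\<mu> * \<nu>) * (val P \<theta>)\<^sup>2 = (val Q \<theta> - of_real \<nu> * val P \<theta>) * (val Q \<theta> - of_real \<mu> * val P \<theta>)"
        by (simp add: power2_eq_square algebra_simps)
      thus ?thesis using q(5)[OF *] by (auto simp: L)
    qed
  next
    fix \<eta> y assume \<eta>: "\<eta> \<in> hom_G2 I \<rho>" and zero: "\<forall>(\<mu>, L)\<in>set ps. L \<eta> = 0"
    have "\<forall>(\<mu>, P)\<in>set ls. val P \<eta> = 0" 
    proof (clarify)
      fix \<mu> P assume "(\<mu>, P) \<in> set ls"
      hence "(of_real \<mu>, val P) \<in> set ps" by (force simp: ps_def)
      thus "val P \<eta> = 0" using zero by auto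
    qed
    moreover have "\<forall>(\<mu>, \<nu>, P, Q)\<in>set qs. val P \<eta> = 0 \<and> val Q \<eta> = 0"
    proof (clarify)
      fix \<mu> \<nu> P Q assume m: "(\<mu>, \<nu>, P, Q) \<in> set qs"
      hence s: "set (split (\<mu>, \<nu>, P, Q)) \<subseteq> set ps" by (auto simp: ps_def)
      have "val Q \<eta> - of_real \<nu> * val P \<eta> = 0" "val Q \<eta> - of_real \<mu> * val P \<eta> = 0"
        using zero s unfolding split_def by auto
      moreover from this have "(of_real \<mu> - of_real \<nu>) * val P \<eta> = 0" by algebra
      moreover have "\<mu> \<noteq> \<nu>" using m qs by blast
      ultimately show "val P \<eta> = 0 \<and> val Q \<eta> = 0" by auto
    qed
    ultimately show "\<eta> y = 0" using array_determines[OF irr hw \<eta>] inj[OF \<eta>] by blast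
  qed
  moreover have "fst ` set ps = complex_of_real ` (fst ` set ls \<union> (\<Union>(\<mu>, \<nu>, P, Q)\<in>set qs. {\<mu>, \<nu>}))"
    unfolding ps_def split_def by (auto simp: image_iff) force+
  ultimately show ?thesis by simp
qed

text \<open>
  The map \<open>\<theta>\<close> obtained from the model has nonzero components in all eigenspaces: no functional vanishes on it.
\<close>

lemma eigenvalues_000:
  assumes l: "l $ 1 = 0" "l $ 2 = 0" "l $ 3 = 0"
  shows "dirac_eigenvalues 0 I \<rho> = complex_of_real `
    {1 / 2}"
proof -
  obtain \<theta> where \<theta>: "theta_matrix \<theta> x (mat 1)" using model_000(2)[OF irr hw l] by blast
  have w: "complex_of_real (l $ 1 - l $ 2) = 0" "complex_of_real (l $ 2 - l $ 3) = 0" "complex_of_real (l $ 1 + l $ 2 + l $ 3) = 0"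
    by (simp_all add: l)
  note Z = lowering_array(1,2)[OF irr hw _ model_000(1)[OF irr hw l]]
  note b = weight_array.blocks_000[OF highest_weight_array[OF irr hw] Z(1) Z(2)]
  note b0 = weight_array.zero_000[OF highest_weight_array[OF irr hw] w(1,2) Z(1) Z(2)]
  have c: "c1 i (\<theta> x) u p q = dot p ((mat 1) *v cross u q) + dot p (cross u (transpose (mat 1) *v q))" for u p q
    using \<theta> by (simp only: cmatrix_vector dot_bilinear crossmat_vector flip: matrix_vector_mul_assoc)
  have v: "val block1_000 \<theta> = - 8"
    by (simp_all add: A1_def c outer_vector transpose_outer transpose_mat dot_bilinear cross_bilinear dot_nvec cross_nvec del: nvec.simps)
  define qs :: "(real \<times> real \<times> functional \<times> functional) list" where "qs = []"
  define ls :: "(real \<times> functional) list" where "ls = [(1 / 2, block1_000)]"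
  have "dirac_eigenvalues 0 I \<rho> = complex_of_real ` (fst ` set ls \<union> (\<Union>(\<mu>, \<nu>, P, Q)\<in>set qs. {\<mu>, \<nu>}))"
  proof (rule block_spectrum[where \<theta> = \<theta>], goal_cases)
    case 1 show ?case by (simp add: qs_def array_functional_def field_simps)
  next
    case 2 show ?case by (simp add: ls_def array_functional_def field_simps)
  next
    case (3 \<eta>)
    show ?case by (simp add: qs_def)
  next
    case (4 \<eta>)
    show ?case unfolding ls_def list.set ball_simps prod.case dirac_array[OF irr hw 4, unfolded w(3)]
      using b(1)[OF 4 4 4] by simp
  next
    case (5 \<eta>)
    hence z: "val block1_000 \<eta> = 0"
      unfolding qs_def ls_def list.set ball_simps prod.case by blast+
    show ?case using b0[OF 5(1) 5(1) 5(1) z] by blast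
  next
    case 6 show ?case using \<theta> by blast
  next
    case 7 show ?case
      by (simp add: qs_def)
  next
    case 8 show ?case unfolding ls_def list.set ball_simps prod.case v(1) by simp
  qed
  thus ?thesis by (simp add: qs_def ls_def insert_commute)
qed

lemma eigenvalues_100:
  assumes l: "l $ 1 = 1" "l $ 2 = 0" "l $ 3 = 0"
  shows "dirac_eigenvalues 0 I \<rho> = complex_of_real `
    {(-3 + 2 * sqrt 105) / 6, (-3 - 2 * sqrt 105) / 6, - (3 / 2)}"
proof -
  obtain \<theta> where \<theta>: "theta_vector \<theta> x (nvec P1)" using model_100(2)[OF irr hw l] by blast
  have w: "complex_of_real (l $ 1 - l $ 2) = 1" "complex_of_real (l $ 2 - l $ 3) = 0" "complex_of_real (l $ 1 + l $ 2 + l $ 3) = 1"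
    by (simp_all add: l)
  note Z = lowering_array(1,2)[OF irr hw _ model_100(1)[OF irr hw l]]
  note b = weight_array.blocks_100[OF highest_weight_array[OF irr hw] Z(1) Z(2)]
  note b0 = weight_array.zero_100[OF highest_weight_array[OF irr hw] w(1,2) Z(1) Z(2)]
  have v: "val block1_100 \<theta> = 0"
    "val block1_100' \<theta> = 16/3"
    "val block2_100 \<theta> = 4"
    using \<theta> by (simp_all add: A0_def A1_def wedge_vector dot_bilinear dot_nvec cross_nvec del: nvec.simps)
  define qs :: "(real \<times> real \<times> functional \<times> functional) list" where "qs = [((-3 + 2 * sqrt 105) / 6, (-3 - 2 * sqrt 105) / 6, block1_100, block1_100')]"
  define ls :: "(real \<times> functional) list" where "ls = [(- (3 / 2), block2_100)]"
  have "dirac_eigenvalues 0 I \<rho> = complex_of_real ` (fst ` set ls \<union> (\<Union>(\<mu>, \<nu>, P, Q)\<in>set qs. {\<mu>, \<nu>}))"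
  proof (rule block_spectrum[where \<theta> = \<theta>], goal_cases)
    case 1 show ?case by (simp add: qs_def array_functional_def field_simps)
  next
    case 2 show ?case by (simp add: ls_def array_functional_def field_simps)
  next
    case (3 \<eta>)
    have vieta: "((-3 + 2 * sqrt 105) / 6) + ((-3 - 2 * sqrt 105) / 6) = - (1)" "((-3 + 2 * sqrt 105) / 6) * (((-3 - 2 * sqrt 105) / 6)) = - (137/12)"
      by (simp_all add: field_simps)
    show ?case unfolding qs_def list.set ball_simps prod.case dirac_array[OF irr hw 3, unfolded w(3)] vieta
      using b(1,2)[OF 3 3 3] by simp
  next
    case (4 \<eta>)
    show ?case unfolding ls_def list.set ball_simps prod.case dirac_array[OF irr hw 4, unfolded w(3)]
      using b(3)[OF 4 4 4] by simp
  next
    case (5 \<eta>)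
    hence z: "val block1_100 \<eta> = 0" "val block1_100' \<eta> = 0" "val block2_100 \<eta> = 0"
      unfolding qs_def ls_def list.set ball_simps prod.case by blast+
    show ?case using b0[OF 5(1) 5(1) 5(1) z] by blast
  next
    case 6 show ?case using \<theta> by blast
  next
    case 7 show ?case
      unfolding qs_def list.set ball_simps prod.case v(2)
      unfolding v(1) by (simp add: complex_eq_iff field_simps)
  next
    case 8 show ?case unfolding ls_def list.set ball_simps prod.case v(3) by simp
  qed
  thus ?thesis by (simp add: qs_def ls_def insert_commute)
qed

lemma eigenvalues_001:
  assumes l: "l $ 1 = 1/2" "l $ 2 = 1/2" "l $ 3 = 1/2"
  shows "dirac_eigenvalues 0 I \<rho> = complex_of_real `
    {(-3 - 8 * sqrt 6) / 6, (-3 + 8 * sqrt 6) / 6, - (5 / 2), 3 / 2}"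
proof -
  obtain \<theta> where \<theta>: "theta_vector \<theta> x (- nvec N0)" using model_001(2)[OF irr hw l] by blast
  have w: "complex_of_real (l $ 1 - l $ 2) = 0" "complex_of_real (l $ 2 - l $ 3) = 0" "complex_of_real (l $ 1 + l $ 2 + l $ 3) = 3/2"
    by (simp_all add: l)
  note Z = lowering_array(3,4)[OF irr hw _ model_001(1)[OF irr hw l]]
  note b = weight_array.blocks_001[OF highest_weight_array[OF irr hw] Z(1) Z(2)]
  note b0 = weight_array.zero_001[OF highest_weight_array[OF irr hw] w(1,2) Z(1) Z(2)]
  have v: "val block1_001 \<theta> = 0"
    "val block1_001' \<theta> = - 4/3"
    "val block2_001 \<theta> = - 4"
    "val block3_001 \<theta> = - 4"
    using \<theta> by (simp_all add: A0_def A1_def wedge_vector dot_bilinear dot_nvec cross_nvec del: nvec.simps)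
  define qs :: "(real \<times> real \<times> functional \<times> functional) list" where "qs = [((-3 + 8 * sqrt 6) / 6, (-3 - 8 * sqrt 6) / 6, block1_001, block1_001')]"
  define ls :: "(real \<times> functional) list" where "ls = [(- (5 / 2), block2_001), (3 / 2, block3_001)]"
  have "dirac_eigenvalues 0 I \<rho> = complex_of_real ` (fst ` set ls \<union> (\<Union>(\<mu>, \<nu>, P, Q)\<in>set qs. {\<mu>, \<nu>}))"
  proof (rule block_spectrum[where \<theta> = \<theta>], goal_cases)
    case 1 show ?case by (simp add: qs_def array_functional_def field_simps)
  next
    case 2 show ?case by (simp add: ls_def array_functional_def field_simps)
  next
    case (3 \<eta>)
    have vieta: "((-3 + 8 * sqrt 6) / 6) + ((-3 - 8 * sqrt 6) / 6) = - (1)" "((-3 + 8 * sqrt 6) / 6) * (((-3 - 8 * sqrt 6) / 6)) = - (125/12)"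
      by (simp_all add: field_simps)
    show ?case unfolding qs_def list.set ball_simps prod.case dirac_array[OF irr hw 3, unfolded w(3)] vieta
      using b(1,2)[OF 3 3 3] by simp
  next
    case (4 \<eta>)
    show ?case unfolding ls_def list.set ball_simps prod.case dirac_array[OF irr hw 4, unfolded w(3)]
      using b(3,4)[OF 4 4 4] by simp
  next
    case (5 \<eta>)
    hence z: "val block1_001 \<eta> = 0" "val block1_001' \<eta> = 0" "val block2_001 \<eta> = 0" "val block3_001 \<eta> = 0"
      unfolding qs_def ls_def list.set ball_simps prod.case by blast+
    show ?case using b0[OF 5(1) 5(1) 5(1) z] by blast
  next
    case 6 show ?case using \<theta> by blast
  next
    case 7 show ?case
      unfolding qs_def list.set ball_simps prod.case v(2)
      unfolding v(1) by (simp add: complex_eq_iff field_simps)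
  next
    case 8 show ?case unfolding ls_def list.set ball_simps prod.case v(3) v(4) by simp
  qed
  thus ?thesis by (simp add: qs_def ls_def insert_commute)
qed

lemma eigenvalues_010:
  assumes l: "l $ 1 = 1" "l $ 2 = 1" "l $ 3 = 0"
  shows "dirac_eigenvalues 0 I \<rho> = complex_of_real `
    {(-1 - 2 * sqrt 17) / 2, (-3 - 2 * sqrt 105) / 6, (-1 + 2 * sqrt 17) / 2, - (7 / 2), (-3 + 2 * sqrt 105) / 6}"
proof -
  obtain \<theta> where \<theta>: "theta_vector \<theta> x (2 *s cross (nvec P1) (nvec P2))" using model_010(2)[OF irr hw l] by blast
  have w: "complex_of_real (l $ 1 - l $ 2) = 0" "complex_of_real (l $ 2 - l $ 3) = 1" "complex_of_real (l $ 1 + l $ 2 + l $ 3) = 2"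
    by (simp_all add: l)
  note Z = lowering_array(1,2)[OF irr hw _ model_010(1)[OF irr hw l]]
  note b = weight_array.blocks_010[OF highest_weight_array[OF irr hw] Z(1) Z(2)]
  note b0 = weight_array.zero_010[OF highest_weight_array[OF irr hw] w(1,2) Z(1) Z(2)]
  have v: "val block1_010 \<theta> = 0"
    "val block1_010' \<theta> = 32"
    "val block2_010 \<theta> = 0"
    "val block2_010' \<theta> = 32"
    "val block3_010 \<theta> = 16"
    using \<theta> by (simp_all add: A0_def A1_def wedge_vector dot_bilinear dot_nvec cross_nvec del: nvec.simps)
  define qs :: "(real \<times> real \<times> functional \<times> functional) list" where "qs = [((-1 + 2 * sqrt 17) / 2, (-1 - 2 * sqrt 17) / 2, block1_010, block1_010'), ((-3 + 2 * sqrt 105) / 6, (-3 - 2 * sqrt 105) / 6, block2_010, block2_010')]"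
  define ls :: "(real \<times> functional) list" where "ls = [(- (7 / 2), block3_010)]"
  have "dirac_eigenvalues 0 I \<rho> = complex_of_real ` (fst ` set ls \<union> (\<Union>(\<mu>, \<nu>, P, Q)\<in>set qs. {\<mu>, \<nu>}))"
  proof (rule block_spectrum[where \<theta> = \<theta>], goal_cases)
    case 1 show ?case by (simp add: qs_def array_functional_def field_simps)
  next
    case 2 show ?case by (simp add: ls_def array_functional_def field_simps)
  next
    case (3 \<eta>)
    have vieta: "((-1 + 2 * sqrt 17) / 2) + ((-1 - 2 * sqrt 17) / 2) = - (1)" "((-1 + 2 * sqrt 17) / 2) * (((-1 - 2 * sqrt 17) / 2)) = - (67/4)"
      "((-3 + 2 * sqrt 105) / 6) + ((-3 - 2 * sqrt 105) / 6) = - (1)" "((-3 + 2 * sqrt 105) / 6) * (((-3 - 2 * sqrt 105) / 6)) = - (137/12)"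
      by (simp_all add: field_simps)
    show ?case unfolding qs_def list.set ball_simps prod.case dirac_array[OF irr hw 3, unfolded w(3)] vieta
      using b(1,2,3,4)[OF 3 3 3] by simp
  next
    case (4 \<eta>)
    show ?case unfolding ls_def list.set ball_simps prod.case dirac_array[OF irr hw 4, unfolded w(3)]
      using b(5)[OF 4 4 4] by simp
  next
    case (5 \<eta>)
    hence z: "val block1_010 \<eta> = 0" "val block1_010' \<eta> = 0" "val block2_010 \<eta> = 0" "val block2_010' \<eta> = 0" "val block3_010 \<eta> = 0"
      unfolding qs_def ls_def list.set ball_simps prod.case by blast+
    show ?case using b0[OF 5(1) 5(1) 5(1) z] by blast
  next
    case 6 show ?case using \<theta> by blast
  next
    case 7 show ?case
      unfolding qs_def list.set ball_simps prod.case v(2) v(4)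
      unfolding v(1) v(3) by (simp add: complex_eq_iff field_simps)
  next
    case 8 show ?case unfolding ls_def list.set ball_simps prod.case v(5) by simp
  qed
  thus ?thesis by (simp add: qs_def ls_def insert_commute)
qed

lemma eigenvalues_200:
  assumes l: "l $ 1 = 2" "l $ 2 = 0" "l $ 3 = 0"
  shows "dirac_eigenvalues 0 I \<rho> = complex_of_real `
    {- (25 / 6), 23 / 6}"
proof -
  obtain \<theta> where \<theta>: "theta_matrix \<theta> x (outer (nvec P1) (nvec P1))" using model_200(2)[OF irr hw l] by blast
  have w: "complex_of_real (l $ 1 - l $ 2) = 2" "complex_of_real (l $ 2 - l $ 3) = 0" "complex_of_real (l $ 1 + l $ 2 + l $ 3) = 2"
    by (simp_all add: l)
  note Z = lowering_array(1,2)[OF irr hw _ model_200(1)[OF irr hw l]]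
  note b = weight_array.blocks_200[OF highest_weight_array[OF irr hw] Z(1) Z(2)]
  note b0 = weight_array.zero_200[OF highest_weight_array[OF irr hw] w(1,2) Z(1) Z(2)]
  have c: "c1 i (\<theta> x) u p q = dot p ((outer (nvec P1) (nvec P1)) *v cross u q) + dot p (cross u (transpose (outer (nvec P1) (nvec P1)) *v q))" for u p q
    using \<theta> by (simp only: cmatrix_vector dot_bilinear crossmat_vector flip: matrix_vector_mul_assoc)
  have v: "val block1_200 \<theta> = 4"
    "val block2_200 \<theta> = 8"
    by (simp_all add: A1_def c outer_vector transpose_outer transpose_mat dot_bilinear cross_bilinear dot_nvec cross_nvec del: nvec.simps)
  define qs :: "(real \<times> real \<times> functional \<times> functional) list" where "qs = []"
  define ls :: "(real \<times> functional) list" where "ls = [(- (25 / 6), block1_200), (23 / 6, block2_200)]"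
  have "dirac_eigenvalues 0 I \<rho> = complex_of_real ` (fst ` set ls \<union> (\<Union>(\<mu>, \<nu>, P, Q)\<in>set qs. {\<mu>, \<nu>}))"
  proof (rule block_spectrum[where \<theta> = \<theta>], goal_cases)
    case 1 show ?case by (simp add: qs_def array_functional_def field_simps)
  next
    case 2 show ?case by (simp add: ls_def array_functional_def field_simps)
  next
    case (3 \<eta>)
    show ?case by (simp add: qs_def)
  next
    case (4 \<eta>)
    show ?case unfolding ls_def list.set ball_simps prod.case dirac_array[OF irr hw 4, unfolded w(3)]
      using b(1,2)[OF 4 4 4] by simp
  next
    case (5 \<eta>)
    hence z: "val block1_200 \<eta> = 0" "val block2_200 \<eta> = 0"
      unfolding qs_def ls_def list.set ball_simps prod.case by blast+
    show ?case using b0[OF 5(1) 5(1) 5(1) z] by blast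
  next
    case 6 show ?case using \<theta> by blast
  next
    case 7 show ?case
      by (simp add: qs_def)
  next
    case 8 show ?case unfolding ls_def list.set ball_simps prod.case v(1) v(2) by simp
  qed
  thus ?thesis by (simp add: qs_def ls_def insert_commute)
qed

lemma eigenvalues_101:
  assumes l: "l $ 1 = 3/2" "l $ 2 = 1/2" "l $ 3 = 1/2"
  shows "dirac_eigenvalues 0 I \<rho> = complex_of_real `
    {(-1 - 4 * sqrt 5) / 2, (-3 - 4 * sqrt 33) / 6, (1 + 4 * sqrt 37) / 6, (-1 + 4 * sqrt 5) / 2, (1 - 4 * sqrt 37) / 6, (-3 + 4 * sqrt 33) / 6, - (19 / 6)}"
proof -
  obtain \<theta> where \<theta>: "theta_vector \<theta> x (nvec P1)" using model_101(2)[OF irr hw l] by blast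
  have w: "complex_of_real (l $ 1 - l $ 2) = 1" "complex_of_real (l $ 2 - l $ 3) = 0" "complex_of_real (l $ 1 + l $ 2 + l $ 3) = 5/2"
    by (simp_all add: l)
  note Z = lowering_array(3,4)[OF irr hw _ model_101(1)[OF irr hw l]]
  note b = weight_array.blocks_101[OF highest_weight_array[OF irr hw] Z(1) Z(2)]
  note b0 = weight_array.zero_101[OF highest_weight_array[OF irr hw] w(1,2) Z(1) Z(2)]
  have v: "val block1_101 \<theta> = 0"
    "val block1_101' \<theta> = 10"
    "val block2_101 \<theta> = 0"
    "val block2_101' \<theta> = 4"
    "val block3_101 \<theta> = 4"
    "val block3_101' \<theta> = - 2"
    "val block4_101 \<theta> = - 12"
    using \<theta> by (simp_all add: A0_def A1_def wedge_vector dot_bilinear dot_nvec cross_nvec del: nvec.simps)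
  define qs :: "(real \<times> real \<times> functional \<times> functional) list" where "qs = [((-1 + 4 * sqrt 5) / 2, (-1 - 4 * sqrt 5) / 2, block1_101, block1_101'), ((-3 + 4 * sqrt 33) / 6, (-3 - 4 * sqrt 33) / 6, block2_101, block2_101'), ((1 + 4 * sqrt 37) / 6, (1 - 4 * sqrt 37) / 6, block3_101, block3_101')]"
  define ls :: "(real \<times> functional) list" where "ls = [(- (19 / 6), block4_101)]"
  have "dirac_eigenvalues 0 I \<rho> = complex_of_real ` (fst ` set ls \<union> (\<Union>(\<mu>, \<nu>, P, Q)\<in>set qs. {\<mu>, \<nu>}))"
  proof (rule block_spectrum[where \<theta> = \<theta>], goal_cases)
    case 1 show ?case by (simp add: qs_def array_functional_def field_simps)
  next
    case 2 show ?case by (simp add: ls_def array_functional_def field_simps)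
  next
    case (3 \<eta>)
    have vieta: "((-1 + 4 * sqrt 5) / 2) + ((-1 - 4 * sqrt 5) / 2) = - (1)" "((-1 + 4 * sqrt 5) / 2) * (((-1 - 4 * sqrt 5) / 2)) = - (79/4)"
      "((-3 + 4 * sqrt 33) / 6) + ((-3 - 4 * sqrt 33) / 6) = - (1)" "((-3 + 4 * sqrt 33) / 6) * (((-3 - 4 * sqrt 33) / 6)) = - (173/12)"
      "((1 + 4 * sqrt 37) / 6) + ((1 - 4 * sqrt 37) / 6) = (1/3)" "((1 + 4 * sqrt 37) / 6) * (((1 - 4 * sqrt 37) / 6)) = - (197/12)"
      by (simp_all add: field_simps)
    show ?case unfolding qs_def list.set ball_simps prod.case dirac_array[OF irr hw 3, unfolded w(3)] vieta
      using b(1,2,3,4,5,6)[OF 3 3 3] by simp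
  next
    case (4 \<eta>)
    show ?case unfolding ls_def list.set ball_simps prod.case dirac_array[OF irr hw 4, unfolded w(3)]
      using b(7)[OF 4 4 4] by simp
  next
    case (5 \<eta>)
    hence z: "val block1_101 \<eta> = 0" "val block1_101' \<eta> = 0" "val block2_101 \<eta> = 0" "val block2_101' \<eta> = 0" "val block3_101 \<eta> = 0" "val block3_101' \<eta> = 0" "val block4_101 \<eta> = 0"
      unfolding qs_def ls_def list.set ball_simps prod.case by blast+
    show ?case using b0[OF 5(1) 5(1) 5(1) z] by blast
  next
    case 6 show ?case using \<theta> by blast
  next
    case 7 show ?case
      unfolding qs_def list.set ball_simps prod.case v(2) v(4) v(6)
      unfolding v(1) v(3) v(5) by (simp add: complex_eq_iff field_simps)
  next
    case 8 show ?case unfolding ls_def list.set ball_simps prod.case v(7) by simp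
  qed
  thus ?thesis by (simp add: qs_def ls_def insert_commute)
qed

end

end

theorem theorem4p5:
  fixes \<rho> :: "real_mat8 \<Rightarrow> complex^'n^'n" and I :: "7 \<Rightarrow> real_mat8"
  assumes "irreducible_spin7_rep \<rho>"
    and "orthonormal_basis_m I"
  shows
    "(has_highest_weight \<rho> (0, 0, 0) \<longrightarrow>
        dirac_eigenvalues 0 I \<rho> = complex_of_real ` {1 / 2})
   \<and> (has_highest_weight \<rho> (1, 0, 0) \<longrightarrow>
        dirac_eigenvalues 0 I \<rho> = complex_of_real `
          {(-3 + 2 * sqrt 105) / 6, (-3 - 2 * sqrt 105) / 6, - (3 / 2)})
   \<and> (has_highest_weight \<rho> (0, 0, 1) \<longrightarrow>
        dirac_eigenvalues 0 I \<rho> = complex_of_real `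
          {(-3 - 8 * sqrt 6) / 6, (-3 + 8 * sqrt 6) / 6, - (5 / 2), 3 / 2})
   \<and> (has_highest_weight \<rho> (0, 1, 0) \<longrightarrow>
        dirac_eigenvalues 0 I \<rho> = complex_of_real `
          {(-1 - 2 * sqrt 17) / 2, (-3 - 2 * sqrt 105) / 6, (-1 + 2 * sqrt 17) / 2,
           - (7 / 2), (-3 + 2 * sqrt 105) / 6})
   \<and> (has_highest_weight \<rho> (2, 0, 0) \<longrightarrow>
        dirac_eigenvalues 0 I \<rho> = complex_of_real ` {- (25 / 6), 23 / 6})
   \<and> (has_highest_weight \<rho> (1, 0, 1) \<longrightarrow>
        dirac_eigenvalues 0 I \<rho> = complex_of_real `
          {(-1 - 4 * sqrt 5) / 2, (-3 - 4 * sqrt 33) / 6, (1 + 4 * sqrt 37) / 6,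
           (-1 + 4 * sqrt 5) / 2, (1 - 4 * sqrt 37) / 6, (-3 + 4 * sqrt 33) / 6, - (19 / 6)})"
proof -
  have rep: "spin7_rep \<rho>" using assms(1) by (simp add: irreducible_spin7_rep_def)
  obtain i where i: "\<And>a. I a = Jm (i a)" "\<And>a b. dot (i a) (i b) = (if a = b then 1 else 0)"
    using orthonormal_basis_m_vectors[OF assms(2)] by blast
  interpret dirac_setting \<rho> I i by unfold_locales (simp_all add: rep i)
  note aligned = highest_weight_aligned[OF rep]
  show ?thesis
    using eigenvalues_000[OF assms(1)] eigenvalues_100[OF assms(1)] eigenvalues_001[OF assms(1)]
      eigenvalues_010[OF assms(1)] eigenvalues_200[OF assms(1)] eigenvalues_101[OF assms(1)]
    apply (intro conjI impI)
    subgoal using aligned[of 0 0 0] by (auto simp: vector_3)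
    subgoal using aligned[of 1 0 0] by (auto simp: vector_3)
    subgoal using aligned[of 0 0 1] by (auto simp: vector_3)
    subgoal using aligned[of 0 1 0] by (auto simp: vector_3)
    subgoal using aligned[of 2 0 0] by (auto simp: vector_3)
    subgoal using aligned[of 1 0 1] by (auto simp: vector_3)
    done
qed

end
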